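(* There is an absolute constant $c>0$ such that for every $n\in\mathbb{N}$, if $A$ is drawn uniformly at random from the set of all $n\times n$ symmetric matrices with entries in $\{-1,1\}$, then \[\mathbb{P}(\det(A)=0)\le e^{-cn}.\] *)

theory Defs
  imports Complex_Main "Jordan_Normal_Form.Determinant"
begin

definition sym_sign_mats :: "nat \<Rightarrow> int mat set" where
  "sym_sign_mats n = {A \<in> carrier_mat n n.
      (\<forall>i<n. \<forall>j<n. A $$ (i, j) \<in> {-1, 1}) \<and> transpose_mat A = A}"

definition prob_singular :: "nat \<Rightarrow> real" where
  "prob_singular n = real (card {A \<in> sym_sign_mats n. det A = 0}) / real (card (sym_sign_mats n))"

end

theory Submission
  imports Defs "HOL-Library.FuncSet"
begin

text \<open>A vector \<open>v\<close> is structured if \<open>\<Sum> r\<^sub>j v\<^sub>j\<close> takes some value with probability at least \<open>e\<^sup>-\<^sup>c\<^sup>n\<close> for random signs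
  \<open>r\<close>. If all kernel vectors of a symmetric sign matrix are unstructured, then singularity is exponentially unlikely: in
  corank at least two reveal the rows outside a principal minor with one-dimensional kernel, in corank one decouple the
  last column by Cauchy--Schwarz. Structured solutions \<open>v\<close> of \<open>A v = w\<close> are excluded by a union bound. Round \<open>2\<^sup>j v\<close> to
  integer vectors \<open>u\<close> for which \<open>A u\<close> stays close to the line of \<open>w\<close>. The Fourier average \<open>fM u\<close> over a lazy
  off-diagonal block of \<open>A\<close> bounds the small-ball probability of \<open>A u\<close>, and structure makes it eventually larger than
  \<open>(L/2\<^sup>j)\<^sup>n\<close>. Just before the first such scale the small-ball probability is still at most \<open>(C L/2\<^sup>j)\<^sup>n\<close>, whereas only
  \<open>(C 2\<^sup>j/L\<^sup>2)\<^sup>n\<close> vectors \<open>u\<close> have large \<open>fM u\<close>, so that the union bound wins for large \<open>L\<close>. That count is a second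
  moment over an integer box, in which the randomness is inverted: the box is random and the pair of lazy blocks is
  fixed. Pairs of blocks with \<open>k\<close> almost singular directions lose a factor \<open>N\<^sup>k\<close> in the number of boxed
  vectors, but they have probability \<open>e\<^sup>-\<^sup>c\<^sup>n\<^sup>k\<close>. This is a discrete version of the argument of Campos, Jenssen,
  Michelen and Sahasrabudhe, with Fejer kernels in place of Gaussians.\<close>

section \<open>Averages and orthonormal systems\<close>

text \<open>Symmetry ties rows to columns, so the entries are never treated as jointly free: two
  index sets \<open>D\<close> and \<open>E\<close> are fixed, everything outside the
  \<open>D\<close>-\<open>E\<close> block is conditioned on, and the block alone supplies
  randomness. The size of \<open>D\<close>, about n/2^36, balances two costs. A net for k directions
  on two copies of \<open>D\<close> has up to e^(36 |D| k) elements, which must be paid from a gain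
  of e^(-\<open>del0\<close> n k / 4) with \<open>del0\<close> = 2^-26; yet \<open>D\<close> has to
  be a fixed proportion of n, since the lattice-like restrictions to \<open>D\<close> are
  outnumbered only by a factor s^|D|. All counts are allowed to lose e^(O(n)). This is recovered
  from L alone, so the constant C of the count must be fixed before L; only the exponential rate and
  the initial dimension may depend on L. Kernels with finitely many frequencies turn every
  expectation into a finite average and every exchange of integrals into \<open>avg_swap\<close>.
  The price is periodicity: the parameter T has to exceed all linear forms that are
  evaluated.\<close>

definition avg :: "'a set => ('a => 'b::field_char_0) => 'b" where
  "avg S f = (\<Sum>x\<in>S. f x) / of_nat (card S)"

abbreviation Pr :: "'a set => ('a => bool) => real" where
  "Pr S P \<equiv> avg S (\<lambda>x. of_bool (P x))"

lemma avg_cong: "S = T ==> (\<And>x. x \<in> T ==> f x = g x) ==> avg S f = avg T g"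
  by (simp add: avg_def cong: sum.cong)

lemma avg_const [simp]: "finite S ==> S \<noteq> {} ==> avg S (\<lambda>_. c) = c"
  by (simp add: avg_def)

lemma avg_add: "avg S (\<lambda>x. f x + g x) = avg S f + avg S g"
  by (simp add: avg_def sum.distrib add_divide_distrib)

lemma avg_diff: "avg S (\<lambda>x. f x - g x) = avg S f - avg S g"
  by (simp add: avg_def sum_subtractf diff_divide_distrib)

lemma avg_cmult: "avg S (\<lambda>x. c * f x) = c * avg S f"
  by (simp add: avg_def sum_distrib_left[symmetric])

lemma avg_multc: "avg S (\<lambda>x. f x * c) = avg S f * c"
  by (simp add: avg_def sum_distrib_right[symmetric])

lemma avg_sum: "avg S (\<lambda>x. \<Sum>i\<in>I. f i x) = (\<Sum>i\<in>I. avg S (f i))"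
  unfolding avg_def by (subst sum.swap) (simp add: sum_divide_distrib)

lemma avg_swap: "avg S (\<lambda>x. avg T (\<lambda>y. f x y)) = avg T (\<lambda>y. avg S (\<lambda>x. f x y))"
  unfolding avg_def sum_divide_distrib[symmetric] by (subst sum.swap) simp

lemma avg_prod2: "avg S f * avg T g = avg S (\<lambda>x. avg T (\<lambda>y. f x * g y))"
  by (simp add: avg_cmult avg_multc)

lemma avg_nonneg: "(\<And>x. x \<in> S ==> 0 \<le> f x) ==> 0 \<le> avg S (f :: _ => real)"
  by (simp add: avg_def sum_nonneg)

lemma avg_mono: "(\<And>x. x \<in> S ==> f x \<le> g x) ==> avg S f \<le> avg S (g :: _ => real)"
  by (simp add: avg_def sum_mono divide_right_mono)

lemma avg_le: "finite S ==> S \<noteq> {} ==> (\<And>x. x \<in> S ==> f x \<le> c) ==> avg S f \<le> (c::real)"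
  using avg_mono[of S f "\<lambda>_. c"] by simp

text \<open>An average over an empty or infinite set is 0 by the conventions for sums, cardinalities
  and division; the hypothesis \<open>0 \<le> c\<close> stands in for finiteness and
  nonemptiness.\<close>

lemma avg_le0: "(\<And>x. x \<in> S ==> f x \<le> c) ==> 0 \<le> c ==> avg S f \<le> (c::real)"
proof (cases "finite S \<and> S \<noteq> {}")
  case False
  assume "0 \<le> c"
  with False show ?thesis by (auto simp: avg_def)
qed (auto intro: avg_le)

lemma avg_ge: "finite S ==> S \<noteq> {} ==> (\<And>x. x \<in> S ==> c \<le> f x) ==> (c::real) \<le> avg S f"
  using avg_mono[of S "\<lambda>_. c" f] by simp

lemma avg_ex_ge:
  assumes "finite S" "S \<noteq> {}" "(c::real) \<le> avg S f"
  shows "\<exists>x\<in>S. c \<le> f x"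
proof (rule ccontr)
  assume "\<not> ?thesis"
  then have "\<And>x. x \<in> S ==> f x < c" by force
  then have "sum f S < (\<Sum>x\<in>S. c)" using assms by (intro sum_strict_mono) auto
  then show False using assms by (simp add: avg_def field_simps card_gt_0_iff)
qed

lemma norm_avg_le: "norm (avg S f) \<le> avg S (\<lambda>x. norm (f x :: 'b::{real_normed_field,field_char_0}))"
  by (simp add: avg_def norm_divide divide_right_mono norm_sum)

lemma of_real_avg: "of_real (avg S f) = avg S (\<lambda>x. of_real (f x) :: 'b::{real_div_algebra,field_char_0})"
  by (simp add: avg_def)

lemma Re_avg: "Re (avg S f) = avg S (\<lambda>x. Re (f x))"
  by (simp add: avg_def)

lemma avg_of_bool: "finite S ==> Pr S P = (of_nat (card {x\<in>S. P x}) / of_nat (card S) :: real)"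
proof -
  assume "finite S"
  then have "(\<Sum>x\<in>S. of_bool (P x)) = (\<Sum>x\<in>{x\<in>S. P x}. (1::real))" using \<open>finite S\<close> by (subst sum.inter_filter) (auto simp: of_bool_def)
  then show ?thesis by (simp add: avg_def)
qed

lemma avg_square_le:
  fixes f :: "_ => real"
  assumes "finite S"
  shows "(avg S f)\<^sup>2 \<le> avg S (\<lambda>x. (f x)\<^sup>2)"
proof (cases "S = {}")
  case False
  have "0 \<le> avg S (\<lambda>x. (f x - avg S f)\<^sup>2)" by (rule avg_nonneg) simp
  also have "... = avg S (\<lambda>x. (f x)\<^sup>2 - 2 * avg S f * f x + (avg S f)\<^sup>2)" by (rule avg_cong) (auto simp: power2_eq_square algebra_simps)
  also have "... = avg S (\<lambda>x. (f x)\<^sup>2) - (avg S f)\<^sup>2" using assms False by (simp add: avg_add avg_diff avg_cmult power2_eq_square)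
  finally show ?thesis by simp
qed (simp add: avg_def)

lemma avg_reindex: "bij_betw T S S' ==> avg S (\<lambda>x. G (T x)) = avg S' G"
  unfolding avg_def using bij_betw_same_card sum.reindex_bij_betw by metis

lemma avg_PiE_prod:
  assumes "finite I" "\<And>i. i \<in> I ==> finite (F i)"
  shows "avg (PiE I F) (\<lambda>f. \<Prod>i\<in>I. g i (f i)) = (\<Prod>i\<in>I. avg (F i) (g i))"
  using assms by (simp add: avg_def prod_sum_PiE card_PiE prod_dividef)

section \<open>Random signs and resampling\<close>

abbreviation pm1 :: "real set" where "pm1 \<equiv> {-1, 1}"

abbreviation signs :: "'a set => ('a => real) set" where
  "signs I \<equiv> PiE I (\<lambda>_. pm1)"

lemma finite_signs: "finite I ==> finite (signs I)"
  by (intro finite_PiE) auto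

lemma signs_nonempty: "signs I \<noteq> {}"
  by (simp add: PiE_eq_empty_iff)

lemma card_signs: "finite I ==> card (signs I) = 2 ^ card I"
  by (simp add: card_PiE numeral_2_eq_2)

lemma signs_sq: "h \<in> signs I ==> i \<in> I ==> h i * h i = 1"
  by (drule PiE_mem) auto

lemma sign_twist_bij:
  assumes "\<And>x. x \<in> P ==> m x \<in> pm1"
  shows "bij_betw (\<lambda>s. \<lambda>x\<in>P. s x * m x) (signs P) (signs P)"
proof -
  have mm: "m x * m x = 1" if "x \<in> P" for x using assms[OF that] by auto
  have in': "(\<lambda>x\<in>P. s x * m x) \<in> signs P" if "s \<in> signs P" for s
  proof (rule restrict_PiE_iff[THEN iffD2], intro ballI)
    fix x assume "x \<in> P"
    then show "s x * m x \<in> pm1" using assms[of x] PiE_mem[OF that, of x] by auto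
  qed
  have inv: "(\<lambda>x\<in>P. (\<lambda>x\<in>P. s x * m x) x * m x) = s" if "s \<in> signs P" for s
  proof
    fix x show "(\<lambda>x\<in>P. (\<lambda>x\<in>P. s x * m x) x * m x) x = s x"
      using that mm by (cases "x \<in> P") (auto simp: PiE_def extensional_def mult.assoc)
  qed
  show ?thesis by (rule bij_betwI[where g = "\<lambda>s. \<lambda>x\<in>P. s x * m x"]) (use in' inv in auto)
qed

lemma avg_sign_twist:
  assumes "\<And>x. x \<in> P ==> m x \<in> pm1"
  shows "avg (signs P) (\<lambda>s. G (\<lambda>x\<in>P. s x * m x)) = avg (signs P) G"
  using avg_reindex[OF sign_twist_bij[of P m]] assms by blast

text \<open>The uniform measure on signs is invariant under multiplication by a fixed pattern, so an
  independent random pattern \<open>m h\<close> may be multiplied in. Afterwards \<open>s\<close>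
  can be frozen and only the randomness of \<open>h\<close> used; conditioning on the entries
  outside a block is always done in this way.\<close>

lemma avg_sign_twist_family:
  assumes "finite HH" "HH \<noteq> {}" "\<And>h x. h \<in> HH ==> x \<in> P ==> m h x \<in> pm1"
  shows "avg (signs P) G = avg (signs P) (\<lambda>s. avg HH (\<lambda>h. G (\<lambda>x\<in>P. s x * m h x)))"
proof -
  have "avg (signs P) (\<lambda>s. avg HH (\<lambda>h. G (\<lambda>x\<in>P. s x * m h x)))
     = avg HH (\<lambda>h. avg (signs P) (\<lambda>s. G (\<lambda>x\<in>P. s x * m h x)))" by (rule avg_swap)
  also have "... = avg HH (\<lambda>h. avg (signs P) G)" using assms by (intro avg_cong refl avg_sign_twist) auto
  finally show ?thesis using assms by simp
qed

section \<open>Inner products and orthonormal systems in coordinates\<close>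

definition ip :: "'a set => ('a => real) => ('a => real) => real" where
  "ip C x y = (\<Sum>c\<in>C. x c * y c)"

definition orthon :: "'a set => (nat => 'a => real) => nat => bool" where
  "orthon C w k \<longleftrightarrow> (\<forall>i<k. \<forall>j<k. ip C (w i) (w j) = (if i = j then 1 else 0))"

lemma ip_commute: "ip C x y = ip C y x" by (simp add: ip_def mult.commute)

lemma ip_nonneg: "0 \<le> ip C x x" by (simp add: ip_def sum_nonneg)

lemma ip_cong: "(\<And>c. c \<in> C ==> x c = x' c) ==> (\<And>c. c \<in> C ==> y c = y' c) ==> ip C x y = ip C x' y'"
  by (simp add: ip_def)

lemma ip_diff_left: "ip C (\<lambda>c. x c - y c) z = ip C x z - ip C y z"
  by (simp add: ip_def sum_subtractf left_diff_distrib)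

lemma ip_diff_right: "ip C z (\<lambda>c. x c - y c) = ip C z x - ip C z y"
  by (simp add: ip_def sum_subtractf right_diff_distrib)

lemma ip_add_left: "ip C (\<lambda>c. x c + y c) z = ip C x z + ip C y z"
  by (simp add: ip_def sum.distrib distrib_right)

lemma ip_add_right: "ip C z (\<lambda>c. x c + y c) = ip C z x + ip C z y"
  by (simp add: ip_def sum.distrib distrib_left)

lemma ip_sum_left: "ip C (\<lambda>c. \<Sum>i\<in>I. a i * w i c) z = (\<Sum>i\<in>I. a i * ip C (w i) z)"
  unfolding ip_def sum_distrib_right sum_distrib_left
  by (subst sum.swap) (simp add: mult.assoc)

lemma ip_sum_right: "ip C z (\<lambda>c. \<Sum>i\<in>I. a i * w i c) = (\<Sum>i\<in>I. a i * ip C z (w i))"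
  by (subst (1 2) ip_commute) (rule ip_sum_left)

lemma ip_scale_left: "ip C (\<lambda>c. a * x c) z = a * ip C x z"
  by (simp add: ip_def sum_distrib_left mult.assoc)

lemma ip_scale_right: "ip C z (\<lambda>c. a * x c) = a * ip C z x"
  by (simp add: ip_def sum_distrib_left algebra_simps)

lemma cauchy_schwarz_ip: "(ip C x y)\<^sup>2 \<le> ip C x x * ip C y y"
proof (cases "ip C y y = 0")
  case True
  have "ip C x y = 0"
  proof (cases "finite C")
    case fin: True
    then have "\<forall>c\<in>C. y c * y c = 0" using True sum_nonneg_eq_0_iff[of C "\<lambda>c. y c * y c"] by (simp add: ip_def)
    then show ?thesis by (simp add: ip_def)
  qed (simp add: ip_def)
  then show ?thesis using True by simp
next
  case False
  then have pos: "ip C y y > 0" using ip_nonneg[of C y] by linarith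
  define t where "t = ip C x y / ip C y y"
  have "0 \<le> ip C (\<lambda>c. x c - t * y c) (\<lambda>c. x c - t * y c)" by (rule ip_nonneg)
  also have "... = ip C x x - 2 * t * ip C x y + t * t * ip C y y"
    by (simp add: ip_diff_left ip_diff_right ip_scale_left ip_scale_right ip_commute[of C y x] algebra_simps)
  also have "... = ip C x x - (ip C x y)\<^sup>2 / ip C y y" using pos by (simp add: t_def field_simps power2_eq_square)
  finally show ?thesis using pos by (simp add: field_simps)
qed

lemma ip_lincomb:
  assumes "orthon C w k" "I \<subseteq> {..<k}"
  shows "ip C (\<lambda>c. \<Sum>i\<in>I. a i * w i c) (\<lambda>c. \<Sum>i\<in>I. b i * w i c) = (\<Sum>i\<in>I. a i * b i)"
proof -
  have fin: "finite I" using assms(2) finite_subset by blast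
  have lt: "i < k" if "i \<in> I" for i using assms(2) that by auto
  have "ip C (w i) (\<lambda>c. \<Sum>j\<in>I. b j * w j c) = b i" if "i \<in> I" for i
  proof -
    have "ip C (w i) (\<lambda>c. \<Sum>j\<in>I. b j * w j c) = (\<Sum>j\<in>I. b j * ip C (w i) (w j))" by (rule ip_sum_right)
    also have "... = (\<Sum>j\<in>I. if i = j then b j else 0)" using assms(1) lt that by (intro sum.cong refl) (simp add: orthon_def)
    finally show ?thesis using that fin by simp
  qed
  then show ?thesis by (simp add: ip_sum_left)
qed

lemma bessel:
  assumes "orthon C w k" "I \<subseteq> {..<k}"
  shows "(\<Sum>i\<in>I. (ip C (w i) x)\<^sup>2) \<le> ip C x x"
proof -
  let ?p = "\<lambda>c. \<Sum>i\<in>I. ip C (w i) x * w i c"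
  have "0 \<le> ip C (\<lambda>c. x c - ?p c) (\<lambda>c. x c - ?p c)" by (rule ip_nonneg)
  also have "... = ip C x x - ip C x ?p - (ip C ?p x - ip C ?p ?p)" by (simp only: ip_diff_left ip_diff_right)
  also have "ip C ?p ?p = (\<Sum>i\<in>I. (ip C (w i) x)\<^sup>2)" using ip_lincomb[OF assms] by (simp add: power2_eq_square)
  also have "ip C ?p x = (\<Sum>i\<in>I. (ip C (w i) x)\<^sup>2)" by (simp add: ip_sum_left power2_eq_square)
  also have "ip C x ?p = (\<Sum>i\<in>I. (ip C (w i) x)\<^sup>2)" by (simp add: ip_sum_right power2_eq_square ip_commute[of C x "w _"])
  finally show ?thesis by simp
qed

lemma ip_unit_right:
  assumes "finite C" "c \<in> C"
  shows "ip C x (\<lambda>c'. if c' = c then 1 else 0) = x c"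
  using assms by (simp add: ip_def if_distrib cong: if_cong)

lemma orthon_coord:
  assumes "finite C" "orthon C w k" "c \<in> C"
  shows "(\<Sum>i<k. (w i c)\<^sup>2) \<le> 1"
  using bessel[OF assms(2) subset_refl, of "\<lambda>c'. if c' = c then 1 else 0"] assms
  by (simp add: ip_unit_right)

lemma orthon_sum_coord:
  assumes "orthon C w k"
  shows "(\<Sum>c\<in>C. \<Sum>i<k. (w i c)\<^sup>2) = real k"
proof -
  have "(\<Sum>c\<in>C. \<Sum>i<k. (w i c)\<^sup>2) = (\<Sum>i<k. ip C (w i) (w i))" unfolding ip_def by (subst sum.swap) (simp add: power2_eq_square)
  also have "... = (\<Sum>i<k. 1)" using assms by (intro sum.cong) (auto simp: orthon_def)
  finally show ?thesis by simp
qed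

lemma orthon_card_le:
  assumes "finite C" "orthon C w k"
  shows "k \<le> card C"
proof -
  have "real k \<le> (\<Sum>c\<in>C. 1)" unfolding orthon_sum_coord[OF assms(2), symmetric] using orthon_coord[OF assms] by (intro sum_mono) auto
  then show ?thesis by simp
qed

text \<open>The squared projections of the coordinate vectors onto the system add up to
  \<open>k < card C\<close>, so one coordinate vector has a projection of norm below 1. Its
  normalised residual extends the system.\<close>

lemma orthon_extend:
  assumes "finite C" "orthon C w k" "k < card C"
  shows "\<exists>x. ip C x x = 1 \<and> (\<forall>i<k. ip C (w i) x = 0)"
proof -
  have "\<exists>c\<in>C. (\<Sum>i<k. (w i c)\<^sup>2) < 1"
  proof (rule ccontr)
    assume "\<not> ?thesis"
    then have "(\<Sum>c\<in>C. 1) \<le> (\<Sum>c\<in>C. \<Sum>i<k. (w i c)\<^sup>2)" by (intro sum_mono) force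
    then show False using orthon_sum_coord[OF assms(2)] assms(3) by simp
  qed
  then obtain c where c: "c \<in> C" "(\<Sum>i<k. (w i c)\<^sup>2) < 1" by blast
  define u where "u = (\<lambda>c'. if c' = c then 1 else (0::real))"
  define p where "p = (\<lambda>c'. \<Sum>i<k. w i c * w i c')"
  define y where "y = (\<lambda>c'. u c' - p c')"
  have wu: "ip C x u = x c" for x unfolding u_def using assms(1) c(1) by (rule ip_unit_right)
  have pp: "ip C p p = (\<Sum>i<k. (w i c)\<^sup>2)"
    unfolding p_def using ip_lincomb[OF assms(2) subset_refl, of "\<lambda>i. w i c" "\<lambda>i. w i c"] by (simp add: power2_eq_square)
  have pu: "ip C p u = (\<Sum>i<k. (w i c)\<^sup>2)" by (simp add: wu p_def power2_eq_square)
  have wp: "ip C (w i) p = w i c" if "i < k" for i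
  proof -
    have "ip C (w i) p = (\<Sum>j<k. w j c * ip C (w i) (w j))" unfolding p_def by (rule ip_sum_right)
    also have "... = (\<Sum>j<k. if i = j then w j c else 0)" using assms(2) that by (intro sum.cong refl) (auto simp: orthon_def)
    finally show ?thesis using that by simp
  qed
  have uu: "ip C u u = 1" by (subst wu) (simp add: u_def)
  have yy: "ip C y y = 1 - (\<Sum>i<k. (w i c)\<^sup>2)" unfolding y_def by (simp add: ip_diff_left ip_diff_right uu pu pp ip_commute[of C u p])
  then have pos: "ip C y y > 0" using c by simp
  have wy: "ip C (w i) y = 0" if "i < k" for i unfolding y_def using wp[OF that] by (simp add: ip_diff_right wu)
  define r where "r = 1 / sqrt (ip C y y)"
  have "ip C (\<lambda>c. r * y c) (\<lambda>c. r * y c) = 1"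
  proof -
    have "ip C (\<lambda>c. r * y c) (\<lambda>c. r * y c) = (r * r) * ip C y y" by (simp only: ip_scale_left ip_scale_right mult.assoc)
    also have "r * r = 1 / ip C y y" using pos by (simp add: r_def)
    finally show ?thesis using pos by simp
  qed
  moreover have "\<forall>i<k. ip C (w i) (\<lambda>c. r * y c) = 0" by (simp add: ip_scale_right wy)
  ultimately show ?thesis by blast
qed

lemma orthon_Suc:
  assumes "orthon C w k" "ip C x x = 1" "\<forall>i<k. ip C (w i) x = 0"
  shows "orthon C (w(k := x)) (Suc k)"
  unfolding orthon_def
proof (intro allI impI)
  fix i j assume "i < Suc k" "j < Suc k"
  then show "ip C ((w(k := x)) i) ((w(k := x)) j) = (if i = j then 1 else 0)"
    using assms by (cases "i = k"; cases "j = k") (auto simp: orthon_def ip_commute[of C x "w j"])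
qed

lemma orthon_complete:
  assumes "finite C" "orthon C w k"
  shows "\<exists>w'. orthon C w' (card C) \<and> (\<forall>i<k. w' i = w i)"
proof -
  have "k \<le> card C" using orthon_card_le[OF assms] .
  then show ?thesis using assms(2)
  proof (induction "card C - k" arbitrary: k w)
    case 0
    then show ?case by (intro exI[of _ w]) auto
  next
    case (Suc q)
    then have lt: "k < card C" by linarith
    from orthon_extend[OF assms(1) Suc.prems(2) lt] obtain x
      where x: "ip C x x = 1" "\<forall>i<k. ip C (w i) x = 0" by blast
    have "orthon C (w(k := x)) (Suc k)" by (rule orthon_Suc[OF Suc.prems(2) x])
    moreover have "q = card C - Suc k" using Suc.hyps(2) by linarith
    ultimately obtain w' where "orthon C w' (card C)" "\<forall>i<Suc k. w' i = (w(k := x)) i" using Suc.hyps(1)[of "Suc k" "w(k := x)"] lt by auto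
    then show ?case by (intro exI[of _ w']) auto
  qed
qed

text \<open>A longest orthonormal system of vectors with property \<open>P\<close> exists because
  lengths are bounded by \<open>card C\<close>. After completion to a basis, maximality forbids
  \<open>P\<close> on every unit vector orthogonal to the first \<open>k\<close>, so one index
  separates the exceptional directions from all others.\<close>

lemma greedy_onb:
  assumes "finite C"
  shows "\<exists>w k. k \<le> card C \<and> orthon C w (card C) \<and> (\<forall>i<k. P (w i)) \<and>
    (\<forall>x. ip C x x = 1 --> (\<forall>i<k. ip C (w i) x = 0) --> \<not> P x)"
proof -
  define Q where "Q k \<longleftrightarrow> (\<exists>w. orthon C w k \<and> (\<forall>i<k. P (w i)))" for k
  have Q0: "Q 0" by (simp add: Q_def orthon_def)
  have Qb: "k \<le> card C" if "Q k" for k using that orthon_card_le[OF assms] by (auto simp: Q_def)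
  define k where "k = (GREATEST k. Q k)"
  have Qk: "Q k" unfolding k_def using Q0 Qb by (rule GreatestI_nat)
  then obtain w where w: "orthon C w k" "\<forall>i<k. P (w i)" by (auto simp: Q_def)
  obtain w' where w': "orthon C w' (card C)" "\<forall>i<k. w' i = w i"
    using orthon_complete[OF assms w(1)] by blast
  have "\<not> P x" if x: "ip C x x = 1" "\<forall>i<k. ip C (w' i) x = 0" for x
  proof
    assume "P x"
    have "orthon C (w(k := x)) (Suc k)" using w(1) x w'(2) by (intro orthon_Suc) auto
    then have "Q (Suc k)" unfolding Q_def using \<open>P x\<close> w(2) by (intro exI[of _ "w(k := x)"]) (auto simp: less_Suc_eq)
    then have "Suc k \<le> k" unfolding k_def using Qb by (intro Greatest_le_nat)
    then show False by simp
  qed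
  then show ?thesis using w w' Qb[OF Qk] by (intro exI[of _ w'] exI[of _ k]) auto
qed

text \<open>Randomised rounding made deterministic by conditional expectations. A coordinate with
  fractional part f goes up with probability f and down otherwise: the mean is exact and the
  variance f (1 - f) is at most 1/4, whence the quarter. Coordinates are fixed one after another,
  \<open>e\<close> being the error collected so far; one choice controls all quadratic forms and the
  weighted l1 norm together.\<close>

lemma rounding_aux:
  fixes v h :: "'a => real" and a :: "'l => 'a => real"
  assumes "finite J" "finite L" "\<And>l. l \<in> L ==> 0 \<le> c l"
  shows "\<exists>u::'a => int. (\<forall>j\<in>J. \<bar>of_int (u j) - v j\<bar> \<le> 1) \<and>
    (\<Sum>l\<in>L. c l * (e l + (\<Sum>j\<in>J. a l j * (of_int (u j) - v j)))\<^sup>2) + (\<Sum>j\<in>J. h j * \<bar>of_int (u j)\<bar>)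
     \<le> (\<Sum>l\<in>L. c l * (e l)\<^sup>2) + (\<Sum>l\<in>L. c l * (\<Sum>j\<in>J. (a l j)\<^sup>2)) / 4 + (\<Sum>j\<in>J. h j * \<bar>v j\<bar>)"
  using assms(1)
proof (induction J arbitrary: e rule: finite_induct)
  case empty
  then show ?case by simp
next
  case (insert x J)
  define A where "A = (\<Sum>l\<in>L. c l * (e l)\<^sup>2)"
  define B where "B = (\<Sum>l\<in>L. c l * e l * a l x)"
  define S where "S = (\<Sum>l\<in>L. c l * (a l x)\<^sup>2)"
  have S0: "0 \<le> S" unfolding S_def using assms(3) by (intro sum_nonneg) auto
  \<comment> \<open>Cost after moving coordinate \<open>x\<close> by \<open>\<delta>\<close>. In the
    two-point mean over -f and 1 - f the term linear in \<open>\<delta>\<close> disappears.\<close>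
  define Phi where "Phi \<delta> = (\<Sum>l\<in>L. c l * (e l + a l x * \<delta>)\<^sup>2) + h x * \<bar>v x + \<delta>\<bar>" for \<delta>
  have Phi: "Phi \<delta> = A + 2 * \<delta> * B + \<delta>\<^sup>2 * S + h x * \<bar>v x + \<delta>\<bar>" for \<delta>
    unfolding Phi_def A_def B_def S_def sum_distrib_left sum.distrib[symmetric]
    by (intro arg_cong2[where f = "(+)"] sum.cong refl) (auto simp: power2_eq_square algebra_simps)
  define f where "f = v x - of_int \<lfloor>v x\<rfloor>"
  have f: "0 \<le> f" "f < 1" unfolding f_def by linarith+
  have lin: "(1 - f) * \<bar>v x - f\<bar> + f * \<bar>v x + (1 - f)\<bar> = \<bar>v x\<bar>"
  proof (cases "0 \<le> v x")
    case True
    then have "0 \<le> v x - f" by (simp add: f_def)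
    then show ?thesis using f True by (simp add: algebra_simps)
  next
    case False
    then have "\<lfloor>v x\<rfloor> \<le> -1" by linarith
    then have "of_int \<lfloor>v x\<rfloor> \<le> (-1::real)" by linarith
    then have "v x + (1 - f) \<le> 0" "v x - f \<le> 0" unfolding f_def by linarith+
    then show ?thesis using False by (simp add: algebra_simps)
  qed
  have "(1 - f) * Phi (- f) + f * Phi (1 - f)
      = A + f * (1 - f) * S + h x * ((1 - f) * \<bar>v x - f\<bar> + f * \<bar>v x + (1 - f)\<bar>)"
    unfolding Phi by (simp add: power2_eq_square algebra_simps)
  also have "... = A + f * (1 - f) * S + h x * \<bar>v x\<bar>" by (simp only: lin)
  also have "f * (1 - f) * S \<le> 1/4 * S"
  proof (rule mult_right_mono[OF _ S0])
    have "0 \<le> (f - 1/2)\<^sup>2" by simp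
    then show "f * (1 - f) \<le> 1/4" by (simp add: power2_eq_square algebra_simps)
  qed
  finally have avgle: "(1 - f) * Phi (- f) + f * Phi (1 - f) \<le> A + 1/4 * S + h x * \<bar>v x\<bar>" by simp
  have "\<exists>\<delta>\<in>{-f, 1 - f}. Phi \<delta> \<le> A + 1/4 * S + h x * \<bar>v x\<bar>"
  proof (rule ccontr)
    define R where "R = A + 1/4 * S + h x * \<bar>v x\<bar>"
    assume "\<not> ?thesis"
    then have "Phi (- f) > R" "Phi (1 - f) > R" by (auto simp: R_def)
    then have "(1 - f) * R < (1 - f) * Phi (- f)" "f * R \<le> f * Phi (1 - f)" using f by (auto intro: mult_left_mono)
    then show False using avgle unfolding R_def[symmetric] by (simp add: algebra_simps)
  qed
  then obtain \<delta> where d: "\<delta> \<in> {-f, 1 - f}" "Phi \<delta> \<le> A + 1/4 * S + h x * \<bar>v x\<bar>" by blast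
  define z where "z = (if \<delta> = -f then \<lfloor>v x\<rfloor> else \<lfloor>v x\<rfloor> + 1)"
  have z: "of_int z = v x + \<delta>" using d(1) by (auto simp: z_def f_def)
  have dl: "\<bar>\<delta>\<bar> \<le> 1" using d(1) f by auto
  obtain u where u: "\<forall>j\<in>J. \<bar>of_int (u j) - v j\<bar> \<le> 1"
    "(\<Sum>l\<in>L. c l * ((e l + a l x * \<delta>) + (\<Sum>j\<in>J. a l j * (of_int (u j) - v j)))\<^sup>2) + (\<Sum>j\<in>J. h j * \<bar>of_int (u j)\<bar>)
     \<le> (\<Sum>l\<in>L. c l * (e l + a l x * \<delta>)\<^sup>2) + (\<Sum>l\<in>L. c l * (\<Sum>j\<in>J. (a l j)\<^sup>2)) / 4 + (\<Sum>j\<in>J. h j * \<bar>v j\<bar>)"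
    using insert.IH[of "\<lambda>l. e l + a l x * \<delta>"] by blast
  define u' where "u' = u(x := z)"
  have s1: "(\<Sum>j\<in>insert x J. a l j * (of_int (u' j) - v j)) = a l x * \<delta> + (\<Sum>j\<in>J. a l j * (of_int (u j) - v j))" for l
  proof -
    have "(\<Sum>j\<in>J. a l j * (of_int (u' j) - v j)) = (\<Sum>j\<in>J. a l j * (of_int (u j) - v j))"
      using insert.hyps by (intro sum.cong) (auto simp: u'_def)
    then show ?thesis using insert.hyps z by (simp add: u'_def)
  qed
  have s2: "(\<Sum>j\<in>insert x J. h j * \<bar>of_int (u' j)\<bar>) = h x * \<bar>v x + \<delta>\<bar> + (\<Sum>j\<in>J. h j * \<bar>of_int (u j)\<bar>)"
  proof -
    have "(\<Sum>j\<in>J. h j * \<bar>of_int (u' j)\<bar>) = (\<Sum>j\<in>J. h j * \<bar>of_int (u j)\<bar> :: real)" using insert.hyps by (intro sum.cong) (auto simp: u'_def)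
    then show ?thesis using insert.hyps z by (simp add: u'_def)
  qed
  have s3: "(\<Sum>l\<in>L. c l * (\<Sum>j\<in>insert x J. (a l j)\<^sup>2)) = S + (\<Sum>l\<in>L. c l * (\<Sum>j\<in>J. (a l j)\<^sup>2))"
    using insert.hyps by (simp add: S_def distrib_left sum.distrib)
  show ?case
  proof (intro exI[of _ u'] conjI)
    show "\<forall>j\<in>insert x J. \<bar>of_int (u' j) - v j\<bar> \<le> 1" using u(1) insert.hyps z dl by (auto simp: u'_def)
    show "(\<Sum>l\<in>L. c l * (e l + (\<Sum>j\<in>insert x J. a l j * (of_int (u' j) - v j)))\<^sup>2) + (\<Sum>j\<in>insert x J. h j * \<bar>of_int (u' j)\<bar>)
     \<le> (\<Sum>l\<in>L. c l * (e l)\<^sup>2) + (\<Sum>l\<in>L. c l * (\<Sum>j\<in>insert x J. (a l j)\<^sup>2)) / 4 + (\<Sum>j\<in>insert x J. h j * \<bar>v j\<bar>)"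
    proof -
      have i1: "(\<Sum>j\<in>insert x J. h j * \<bar>v j\<bar>) = h x * \<bar>v x\<bar> + (\<Sum>j\<in>J. h j * \<bar>v j\<bar>)" using insert.hyps by simp
      show ?thesis unfolding s1 s2 s3 i1 using u(2) d(2) unfolding Phi_def A_def by (simp add: add.assoc[symmetric] add_divide_distrib)
    qed
  qed
qed

lemma rounding:
  fixes v h :: "'a => real" and a :: "'l => 'a => real"
  assumes "finite J" "finite L" "\<And>l. l \<in> L ==> 0 \<le> c l"
  obtains u :: "'a => int" where "\<And>j. j \<in> J ==> \<bar>of_int (u j) - v j\<bar> \<le> 1"
    "(\<Sum>l\<in>L. c l * (\<Sum>j\<in>J. a l j * (of_int (u j) - v j))\<^sup>2) + (\<Sum>j\<in>J. h j * \<bar>of_int (u j)\<bar>)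
     \<le> (\<Sum>l\<in>L. c l * (\<Sum>j\<in>J. (a l j)\<^sup>2)) / 4 + (\<Sum>j\<in>J. h j * \<bar>v j\<bar>)"
proof -
  have "\<exists>u::'a => int. (\<forall>j\<in>J. \<bar>of_int (u j) - v j\<bar> \<le> 1) \<and>
    (\<Sum>l\<in>L. c l * (0 + (\<Sum>j\<in>J. a l j * (of_int (u j) - v j)))\<^sup>2) + (\<Sum>j\<in>J. h j * \<bar>of_int (u j)\<bar>)
     \<le> (\<Sum>l\<in>L. c l * (0::real)\<^sup>2) + (\<Sum>l\<in>L. c l * (\<Sum>j\<in>J. (a l j)\<^sup>2)) / 4 + (\<Sum>j\<in>J. h j * \<bar>v j\<bar>)"
    by (rule rounding_aux) (use assms in auto)
  then show ?thesis using that by auto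
qed

section \<open>Fejer kernels and lazy blocks\<close>

lemma cos_ge_quadratic: "1 - x\<^sup>2 / 2 \<le> cos (x::real)"
proof -
  have "cos x = 1 - 2 * (sin (x/2))\<^sup>2" using cos_double_sin[of "x/2"] by simp
  moreover have "(sin (x/2))\<^sup>2 \<le> (x/2)\<^sup>2" using abs_sin_x_le_abs_x[of "x/2"] by (rule abs_le_square_iff[THEN iffD1])
  ultimately show ?thesis by (simp add: power2_eq_square)
qed

text \<open>5/6 is 1 - 1/6, from the cubic Taylor remainder on the unit interval.\<close>

lemma sin_lower:
  fixes x :: real assumes "\<bar>x\<bar> \<le> 1" shows "5/6 * \<bar>x\<bar> \<le> \<bar>sin x\<bar>"
proof -
  have "\<bar>sin x - (\<Sum>m<3. sin_coeff m * x ^ m)\<bar> \<le> inverse (fact 3) * \<bar>x\<bar> ^ 3" by (rule Maclaurin_sin_bound)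
  then have "\<bar>sin x - x\<bar> \<le> \<bar>x\<bar> ^ 3 / 6" by (simp add: numeral_3_eq_3 sin_coeff_def fact_numeral)
  moreover have "\<bar>x\<bar> ^ 3 \<le> \<bar>x\<bar>"
  proof -
    have "\<bar>x\<bar> * \<bar>x\<bar> \<le> 1" using assms by (intro mult_le_one) auto
    then have "\<bar>x\<bar> * (\<bar>x\<bar> * \<bar>x\<bar>) \<le> \<bar>x\<bar> * 1" by (intro mult_left_mono) auto
    then show ?thesis by (simp only: power3_eq_cube mult.assoc mult_1_right)
  qed
  ultimately show ?thesis by linarith
qed

lemma sin_sq_lower:
  fixes x :: real assumes "\<bar>x\<bar> \<le> 1" shows "x\<^sup>2 / 2 \<le> (sin x)\<^sup>2"
proof -
  have "(5/6 * \<bar>x\<bar>)\<^sup>2 \<le> \<bar>sin x\<bar>\<^sup>2" using sin_lower[OF assms] by (intro power_mono) auto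
  then show ?thesis by (simp add: power2_eq_square) (smt (verit) zero_le_square)
qed

lemma cis_sum: "cis (\<Sum>i\<in>I. f i) = (\<Prod>i\<in>I. cis (f i))"
  by (induction I rule: infinite_finite_induct) (auto simp: cis_mult[symmetric])

text \<open>Like a Gaussian, \<open>fej\<close> is nonnegative and has nonnegative Fourier weights, here on finitely many frequencies.\<close>

definition fej :: "nat => real => real => real" where
  "fej T \<sigma> x = (cmod (\<Sum>t<T. cis (real t * (x / (\<sigma> * real T)))))\<^sup>2 / (real T)\<^sup>2"

abbreviation FQ :: "nat => (nat \<times> nat) set" where "FQ T \<equiv> {..<T} \<times> {..<T}"

text \<open>Squaring the modulus of a sum over T equispaced frequencies produces exactly the
  pairwise differences; a uniformly random pair therefore carries the triangular Fejer
  weights.\<close>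

definition fr :: "real => nat => nat \<times> nat => real" where
  "fr \<sigma> T p = (real (fst p) - real (snd p)) / (\<sigma> * real T)"

lemma fej_nonneg: "0 \<le> fej T \<sigma> x" by (simp add: fej_def)

lemma fej_le1: "fej T \<sigma> x \<le> 1"
proof (cases "T = 0")
  case False
  have "cmod (\<Sum>t<T. cis (real t * (x / (\<sigma> * real T)))) \<le> (\<Sum>t<T. 1)" by (rule order_trans[OF norm_sum]) simp
  then have "(cmod (\<Sum>t<T. cis (real t * (x / (\<sigma> * real T)))))\<^sup>2 \<le> (real T)\<^sup>2" by (intro power_mono) auto
  then show ?thesis using False by (simp add: fej_def)
qed (simp add: fej_def)

lemma fej_avg: "complex_of_real (fej T \<sigma> x) = avg (FQ T) (\<lambda>p. cis (fr \<sigma> T p * x))"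
proof -
  define z where "z = (\<Sum>t<T. cis (real t * (x / (\<sigma> * real T))))"
  have "complex_of_real ((cmod z)\<^sup>2) = z * cnj z" by (simp add: complex_norm_square[symmetric])
  also have "... = (\<Sum>t<T. \<Sum>t'<T. cis (real t * (x / (\<sigma> * real T))) * cis (- (real t' * (x / (\<sigma> * real T)))))"
    unfolding z_def cnj_sum cis_cnj by (rule sum_product)
  also have "... = (\<Sum>t<T. \<Sum>t'<T. cis (fr \<sigma> T (t, t') * x))"
    unfolding cis_mult by (intro sum.cong refl arg_cong[where f = cis]) (simp add: fr_def algebra_simps diff_divide_distrib)
  also have "... = (\<Sum>p\<in>FQ T. cis (fr \<sigma> T p * x))" by (simp add: sum.cartesian_product)
  finally have eq: "complex_of_real ((cmod z)\<^sup>2) = (\<Sum>p\<in>FQ T. cis (fr \<sigma> T p * x))" .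
  have "fej T \<sigma> x = (cmod z)\<^sup>2 / (real T)\<^sup>2" by (simp only: fej_def z_def)
  then have "complex_of_real (fej T \<sigma> x) = complex_of_real ((cmod z)\<^sup>2) / (of_nat T)\<^sup>2" by simp
  then show ?thesis unfolding eq by (simp add: avg_def power2_eq_square)
qed

lemma fej_avg_real: "fej T \<sigma> x = avg (FQ T) (\<lambda>p. cos (fr \<sigma> T p * x))"
  using arg_cong[OF fej_avg[of T \<sigma> x], of Re] by (simp add: Re_avg)

lemma fr_abs: "p \<in> FQ T ==> \<sigma> > 0 ==> \<bar>fr \<sigma> T p\<bar> \<le> 1 / \<sigma>"
proof -
  assume p: "p \<in> FQ T" and s: "\<sigma> > 0"
  then have T: "real T > 0" "\<bar>real (fst p) - real (snd p)\<bar> \<le> real T" by (cases p; auto)+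
  then have "\<bar>real (fst p) - real (snd p)\<bar> / (\<sigma> * real T) \<le> real T / (\<sigma> * real T)" using s by (intro divide_right_mono) auto
  then show ?thesis using T s by (simp add: fr_def abs_mult)
qed

text \<open>All frequencies are at most 1/\<sigma>, so on this window each cosine in the average is
  at least 1 - 1/2.\<close>

lemma fej_ge_half:
  assumes "T > 0" "\<sigma> > 0" "\<bar>x\<bar> \<le> \<sigma>"
  shows "1/2 \<le> fej T \<sigma> x"
  unfolding fej_avg_real
proof (rule avg_ge)
  fix p assume p: "p \<in> FQ T"
  have "\<bar>fr \<sigma> T p * x\<bar> \<le> 1 / \<sigma> * \<sigma>" unfolding abs_mult using fr_abs[OF p assms(2)] assms by (intro mult_mono) auto
  then have "(fr \<sigma> T p * x)\<^sup>2 \<le> 1" using assms by (simp add: abs_square_le_1)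
  then show "1/2 \<le> cos (fr \<sigma> T p * x)" using cos_ge_quadratic[of "fr \<sigma> T p * x"] by simp
qed (use assms in auto)

text \<open>The geometric sum is at most 2 / |1 - e^(iy)|, and the denominator is at least 5 |y| /
  6. The restriction to \<open>\<sigma> * T\<close> is essential: the kernel is periodic and returns
  to 1. The 17 is 16 + 1, combining the decay bound with the trivial bound 1 near the
  origin.\<close>

lemma fej_decay:
  assumes "T > 0" "\<sigma> > 0" "\<bar>x\<bar> \<le> \<sigma> * real T"
  shows "fej T \<sigma> x \<le> 17 / (1 + (x / \<sigma>)\<^sup>2)"
proof (cases "x = 0")
  case True
  then show ?thesis using fej_le1[of T \<sigma> x] by simp
next
  case False
  define y where "y = x / (\<sigma> * real T)"
  have y0: "y \<noteq> 0" and y1: "\<bar>y\<bar> \<le> 1" using assms False by (auto simp: y_def)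
  define z where "z = (\<Sum>t<T. cis (real t * y))"
  have "z = (\<Sum>t<T. cis y ^ t)" by (simp add: z_def DeMoivre)
  then have "z * (1 - cis y) = 1 - cis y ^ T" by (simp add: one_diff_power_eq mult.commute)
  then have "cmod z * cmod (1 - cis y) = cmod (1 - cis y ^ T)" by (metis norm_mult)
  also have "... \<le> 1 + 1" by (rule order_trans[OF norm_triangle_ineq4]) (simp add: norm_power)
  finally have zb: "cmod z * cmod (1 - cis y) \<le> 2" by simp
  have "\<bar>Im (1 - cis y)\<bar> \<le> cmod (1 - cis y)" by (rule abs_Im_le_cmod)
  then have "5/6 * \<bar>y\<bar> \<le> cmod (1 - cis y)" using sin_lower[OF y1] by simp
  then have "cmod z * (5/6 * \<bar>y\<bar>) \<le> cmod z * cmod (1 - cis y)" by (intro mult_left_mono) auto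
  with zb have "cmod z * (5/6 * \<bar>y\<bar>) \<le> 2" by linarith
  then have "cmod z \<le> 4 / \<bar>y\<bar>" using y0 by (simp add: field_simps)
  then have "(cmod z)\<^sup>2 \<le> (4 / \<bar>y\<bar>)\<^sup>2" by (intro power_mono) auto
  then have "fej T \<sigma> x \<le> (4 / \<bar>y\<bar>)\<^sup>2 / (real T)\<^sup>2" unfolding fej_def z_def y_def by (intro divide_right_mono) auto
  also have "... = 16 / (x / \<sigma>)\<^sup>2" using assms False by (simp add: y_def field_simps)
  finally have b: "fej T \<sigma> x \<le> 16 / (x / \<sigma>)\<^sup>2" .
  define q where "q = (x / \<sigma>)\<^sup>2"
  have q: "q > 0" using False assms by (simp add: q_def)
  show ?thesis
  proof (cases "q \<le> 16")
    case True
    then have "1 \<le> 17 / (1 + q)" using q by (simp add: field_simps)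
    then show ?thesis using fej_le1[of T \<sigma> x] unfolding q_def by linarith
  next
    case False
    then have "16 / q \<le> 17 / (1 + q)" using q by (simp add: field_simps)
    then show ?thesis using b unfolding q_def by linarith
  qed
qed

lemma prod_fej:
  assumes "finite Z"
  shows "complex_of_real (\<Prod>z\<in>Z. fej T \<sigma> (x z)) = avg (PiE Z (\<lambda>_. FQ T)) (\<lambda>p. cis (\<Sum>z\<in>Z. fr \<sigma> T (p z) * x z))"
  unfolding cis_sum by (subst avg_PiE_prod) (simp_all add: assms fej_avg)

lemma char_matrix:
  assumes "finite E" "finite C" "finite S" "\<And>x. avg S (\<lambda>s. cis (val s * x)) = complex_of_real (\<phi> x)"
  shows "avg (PiE E (\<lambda>_. PiE C (\<lambda>_. S))) (\<lambda>H. cis (\<Sum>i\<in>E. \<Sum>c\<in>C. val (H i c) * g i c))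
     = complex_of_real (\<Prod>i\<in>E. \<Prod>c\<in>C. \<phi> (g i c))"
  unfolding cis_sum
  by (subst avg_PiE_prod, use assms in \<open>auto intro!: finite_PiE\<close>)
     (intro prod.cong refl, subst avg_PiE_prod, use assms in auto)

lemma char_vec:
  assumes "finite C" "finite S" "\<And>x. avg S (\<lambda>s. cis (val s * x)) = complex_of_real (\<phi> x)"
  shows "avg (PiE C (\<lambda>_. S)) (\<lambda>r. cis (\<Sum>c\<in>C. val (r c) * g c)) = complex_of_real (\<Prod>c\<in>C. \<phi> (g c))"
  unfolding cis_sum by (subst avg_PiE_prod, use assms in auto)

text \<open>A seed below \<open>8\<close> encodes a lazy difference of signs: \<open>2\<close> and \<open>-2\<close> with probability \<open>1/8\<close> each, otherwise \<open>0\<close>.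
  Its characteristic function \<open>phi\<close> dominates \<open>\<bar>cos\<bar>\<close> (one sign) and \<open>cos\<^sup>2\<close> (a difference of two signs).\<close>

definition lv :: "nat => real" where "lv k = (if k = 0 then 2 else if k = 1 then -2 else 0)"

definition phi :: "real => real" where "phi x = 3/4 + cos (2 * x) / 4"

abbreviation seeds :: "'a set => ('a => nat) set" where "seeds I \<equiv> PiE I (\<lambda>_. {..<8})"

text \<open>Fraction of the T equispaced frequencies that can lie in a window of length 2 / sqrt B,
  the term 1/T being the endpoint error in counting integers. It occurs squared because a second
  moment involves two frequencies per row.\<close>

abbreviation gap :: "real => real => nat => real" where "gap \<sigma> B T \<equiv> 2 * \<sigma> / sqrt B + 1 / real T"

lemma char_lazy: "avg {..<8} (\<lambda>k. cis (lv k * x)) = complex_of_real (phi x)"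
  by (simp add: avg_def lv_def phi_def numeral_eq_Suc complex_eq_iff field_simps)

lemma char_sign: "avg pm1 (\<lambda>s. cis (s * x)) = complex_of_real (cos x)"
  by (simp add: avg_def complex_eq_iff)

lemma phi_sin: "phi x = 1 - (sin x)\<^sup>2 / 2"
  unfolding phi_def cos_double_sin by (simp add: field_simps)

lemma phi_bounds: "1/2 \<le> phi x" "phi x \<le> 1"
  using cos_le_one[of "2*x"] cos_ge_minus_one[of "2*x"] unfolding phi_def by linarith+

lemma phi_exp: "phi x \<le> exp (- (sin x)\<^sup>2 / 2)"
  unfolding phi_sin using exp_ge_add_one_self[of "- (sin x)\<^sup>2 / 2"] by simp

text \<open>Since \<open>phi\<close> equals (1 + cos^2) / 2, this is the inequality between
  geometric and arithmetic mean.\<close>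

lemma abs_cos_le_phi: "\<bar>cos x\<bar> \<le> phi x"
proof -
  have "0 \<le> (\<bar>cos x\<bar> - 1)\<^sup>2" by simp
  then have "\<bar>cos x\<bar> \<le> (1 + (cos x)\<^sup>2) / 2" by (simp add: power2_eq_square algebra_simps)
  also have "... = phi x" unfolding phi_def cos_double_cos by (simp add: field_simps)
  finally show ?thesis .
qed

lemma cos_sq_le_phi: "(cos x)\<^sup>2 \<le> phi x"
proof -
  have "\<bar>cos x\<bar> * \<bar>cos x\<bar> \<le> \<bar>cos x\<bar> * 1" by (intro mult_left_mono) auto
  then have "(cos x)\<^sup>2 \<le> \<bar>cos x\<bar>" by (simp add: power2_eq_square)
  then show ?thesis using abs_cos_le_phi[of x] by linarith
qed

text \<open>Action on \<open>u\<close> of the symmetric matrix that has \<open>H\<close> and its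
  transpose as off-diagonal blocks and zero diagonal blocks.\<close>

definition bl :: "'v set => 'v set => ('v => 'v => real) => ('v => real) => 'v => real" where
  "bl D E H u v = (if v \<in> E then \<Sum>j\<in>D. H v j * u j else \<Sum>i\<in>E. H i v * u i)"

lemma bl_dual:
  assumes "finite D" "finite E" "D \<inter> E = {}"
  shows "(\<Sum>v\<in>D \<union> E. \<xi> v * bl D E H u v) = (\<Sum>i\<in>E. \<Sum>j\<in>D. H i j * (\<xi> i * u j + \<xi> j * u i))"
proof -
  have "(\<Sum>v\<in>D \<union> E. \<xi> v * bl D E H u v) = (\<Sum>v\<in>D. \<xi> v * (\<Sum>i\<in>E. H i v * u i)) + (\<Sum>v\<in>E. \<xi> v * (\<Sum>j\<in>D. H v j * u j))"
    using assms by (subst sum.union_disjoint) (auto intro!: arg_cong2[where f = "(+)"] sum.cong simp: bl_def)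
  also have "(\<Sum>v\<in>D. \<xi> v * (\<Sum>i\<in>E. H i v * u i)) = (\<Sum>i\<in>E. \<Sum>j\<in>D. H i j * (\<xi> j * u i))"
    unfolding sum_distrib_left by (subst sum.swap) (simp add: mult.left_commute)
  finally show ?thesis by (simp add: sum_distrib_left sum.distrib distrib_left mult.left_commute)
qed

text \<open>Fourier expansion of the product of kernels. By \<open>bl_dual\<close> the entry
  \<open>H i j\<close> occurs with the coefficient \<open>\<xi> i * u j + \<xi> j * u i\<close>, so
  independence of the entries gives one factor each, while the shift \<open>a\<close> enters only
  through a phase of modulus one.\<close>

lemma bl_char:
  assumes "finite D" "finite E" "D \<inter> E = {}" "finite S"
    "\<And>x. avg S (\<lambda>s. cis (val s * x)) = complex_of_real (\<phi> x)"
  shows "complex_of_real (avg (PiE E (\<lambda>_. PiE D (\<lambda>_. S)))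
      (\<lambda>H. \<Prod>v\<in>D \<union> E. fej T \<sigma> (bl D E (\<lambda>i j. val (H i j) * s i j) u v - a v)))
    = avg (PiE (D \<union> E) (\<lambda>_. FQ T)) (\<lambda>p. cis (- (\<Sum>v\<in>D \<union> E. fr \<sigma> T (p v) * a v)) *
        complex_of_real (\<Prod>i\<in>E. \<Prod>j\<in>D. \<phi> (s i j * (fr \<sigma> T (p i) * u j + fr \<sigma> T (p j) * u i))))"
proof -
  have fin: "finite (D \<union> E)" using assms by simp
  define g where "g p i j = s i j * (fr \<sigma> T (p i) * u j + fr \<sigma> T (p j) * u i)" for p i j
  have step: "cis (\<Sum>v\<in>D \<union> E. fr \<sigma> T (p v) * (bl D E (\<lambda>i j. val (H i j) * s i j) u v - a v))
     = cis (- (\<Sum>v\<in>D \<union> E. fr \<sigma> T (p v) * a v)) * cis (\<Sum>i\<in>E. \<Sum>j\<in>D. val (H i j) * g p i j)" for p H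
    unfolding cis_mult right_diff_distrib sum_subtractf
    using bl_dual[OF assms(1-3), of "\<lambda>v. fr \<sigma> T (p v)" "\<lambda>i j. val (H i j) * s i j" u]
    by (simp add: g_def mult.assoc)
  show ?thesis unfolding of_real_avg prod_fej[OF fin] step
    by (subst avg_swap) (simp only: avg_cmult g_def[symmetric] char_matrix[OF assms(2,1,4,5)])
qed

text \<open>Smoothed probability that a lazy block sends \<open>u\<close> to a vector whose
  coordinates are all of order \<open>\<sigma>\<close>. Its Fourier expansion
  \<open>fM_fourier\<close> has positive terms only, which makes it an upper bound for sign blocks
  with arbitrary shifts; it is also bounded below when sign blocks concentrate.\<close>

definition fM :: "'v set => 'v set => nat => real => ('v => real) => real" where
  "fM D E T \<sigma> u = avg (PiE E (\<lambda>_. seeds D))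
     (\<lambda>M. \<Prod>v\<in>D \<union> E. fej T \<sigma> (bl D E (\<lambda>i j. lv (M i j)) u v))"

lemma fM_fourier:
  assumes "finite D" "finite E" "D \<inter> E = {}"
  shows "fM D E T \<sigma> u = avg (PiE (D \<union> E) (\<lambda>_. FQ T))
     (\<lambda>p. \<Prod>i\<in>E. \<Prod>j\<in>D. phi (fr \<sigma> T (p i) * u j + fr \<sigma> T (p j) * u i))"
proof -
  have "complex_of_real (fM D E T \<sigma> u) = complex_of_real (avg (PiE (D \<union> E) (\<lambda>_. FQ T))
     (\<lambda>p. \<Prod>i\<in>E. \<Prod>j\<in>D. phi (fr \<sigma> T (p i) * u j + fr \<sigma> T (p j) * u i)))"
    using bl_char[OF assms, of "{..<8}" lv phi T \<sigma> "\<lambda>_ _. 1" u "\<lambda>_. 0"] char_lazy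
    by (simp add: fM_def of_real_avg)
  then show ?thesis by (simp only: of_real_eq_iff)
qed

lemma fM_nonneg: "0 \<le> fM D E T \<sigma> u"
  unfolding fM_def by (intro avg_nonneg prod_nonneg) (simp add: fej_nonneg)

lemma fM_le1: "fM D E T \<sigma> u \<le> 1"
  unfolding fM_def by (intro avg_le0 prod_le_1) (simp_all add: fej_nonneg fej_le1)

lemma sign_block_le_fM:
  assumes "finite D" "finite E" "D \<inter> E = {}" "\<And>i j. i \<in> E ==> j \<in> D ==> \<bar>s i j\<bar> = 1"
  shows "avg (PiE E (\<lambda>_. signs D)) (\<lambda>H. \<Prod>v\<in>D \<union> E. fej T \<sigma> (bl D E (\<lambda>i j. H i j * s i j) u v - a v)) \<le> fM D E T \<sigma> u"
proof -
  have "avg (PiE E (\<lambda>_. signs D)) (\<lambda>H. \<Prod>v\<in>D \<union> E. fej T \<sigma> (bl D E (\<lambda>i j. H i j * s i j) u v - a v))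
     \<le> cmod (complex_of_real (avg (PiE E (\<lambda>_. signs D)) (\<lambda>H. \<Prod>v\<in>D \<union> E. fej T \<sigma> (bl D E (\<lambda>i j. H i j * s i j) u v - a v))))"
    by simp
  also have "... \<le> avg (PiE (D \<union> E) (\<lambda>_. FQ T)) (\<lambda>p. cmod (cis (- (\<Sum>v\<in>D \<union> E. fr \<sigma> T (p v) * a v)) *
        complex_of_real (\<Prod>i\<in>E. \<Prod>j\<in>D. cos (s i j * (fr \<sigma> T (p i) * u j + fr \<sigma> T (p j) * u i)))))"
    by (subst bl_char[OF assms(1-3), of pm1 "\<lambda>x. x" cos]) (auto intro: norm_avg_le simp: char_sign)
  also have "... \<le> fM D E T \<sigma> u" unfolding fM_fourier[OF assms(1-3)]
  proof (rule avg_mono)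
    fix p assume "p \<in> PiE (D \<union> E) (\<lambda>_. FQ T)"
    have "\<bar>cos (s i j * x)\<bar> \<le> phi x" if "i \<in> E" "j \<in> D" for i j x
      using assms(4)[OF that] abs_cos_le_phi[of x] by (cases "s i j \<ge> 0") (auto simp: abs_if split: if_splits)
    then show "cmod (cis (- (\<Sum>v\<in>D \<union> E. fr \<sigma> T (p v) * a v)) *
        complex_of_real (\<Prod>i\<in>E. \<Prod>j\<in>D. cos (s i j * (fr \<sigma> T (p i) * u j + fr \<sigma> T (p j) * u i))))
        \<le> (\<Prod>i\<in>E. \<Prod>j\<in>D. phi (fr \<sigma> T (p i) * u j + fr \<sigma> T (p j) * u i))"
      unfolding norm_mult norm_of_real abs_prod by (simp add: prod_nonneg prod_mono)
  qed
  finally show ?thesis .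
qed

text \<open>The difference of two independent sign blocks has characteristic function cos^2, again
  dominated by \<open>phi\<close>. This is the comparison needed for lower bounds on
  \<open>fM\<close>.\<close>

lemma sign_diff_le_fM:
  assumes "finite D" "finite E" "D \<inter> E = {}"
  shows "avg (PiE E (\<lambda>_. signs D)) (\<lambda>H'. avg (PiE E (\<lambda>_. signs D))
     (\<lambda>H. \<Prod>v\<in>D \<union> E. fej T \<sigma> (bl D E H u v - bl D E H' u v))) \<le> fM D E T \<sigma> u"
proof -
  let ?M = "PiE E (\<lambda>_. signs D)" and ?P = "PiE (D \<union> E) (\<lambda>_. FQ T)"
  let ?g = "\<lambda>p i j. fr \<sigma> T (p i) * u j + fr \<sigma> T (p j) * u i"
  have cs: "\<And>x. avg pm1 (\<lambda>s. cis (s * x)) = complex_of_real (cos x)" by (rule char_sign)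
  have e1: "complex_of_real (avg ?M (\<lambda>H. \<Prod>v\<in>D \<union> E. fej T \<sigma> (bl D E H u v - bl D E H' u v)))
     = avg ?P (\<lambda>p. complex_of_real (\<Prod>i\<in>E. \<Prod>j\<in>D. cos (?g p i j)) * cis (- (\<Sum>v\<in>D \<union> E. fr \<sigma> T (p v) * bl D E H' u v)))" for H'
    using bl_char[OF assms, of pm1 "\<lambda>x. x" cos T \<sigma> "\<lambda>_ _. 1" u "bl D E H' u"] cs
    by (simp add: mult.commute)
  have e2: "avg ?M (\<lambda>H'. cis (- (\<Sum>v\<in>D \<union> E. fr \<sigma> T (p v) * bl D E H' u v))) = complex_of_real (\<Prod>i\<in>E. \<Prod>j\<in>D. cos (?g p i j))" for p
  proof -
    have "avg ?M (\<lambda>H'. cis (- (\<Sum>v\<in>D \<union> E. fr \<sigma> T (p v) * bl D E H' u v)))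
       = avg ?M (\<lambda>H'. cis (\<Sum>i\<in>E. \<Sum>j\<in>D. H' i j * (- ?g p i j)))"
      unfolding bl_dual[OF assms] by (simp only: sum_negf mult_minus_right)
    also have "... = complex_of_real (\<Prod>i\<in>E. \<Prod>j\<in>D. cos (- ?g p i j))" by (rule char_matrix) (use assms cs in auto)
    finally show ?thesis by (simp only: cos_minus)
  qed
  have "complex_of_real (avg ?M (\<lambda>H'. avg ?M (\<lambda>H. \<Prod>v\<in>D \<union> E. fej T \<sigma> (bl D E H u v - bl D E H' u v))))
    = avg ?M (\<lambda>H'. complex_of_real (avg ?M (\<lambda>H. \<Prod>v\<in>D \<union> E. fej T \<sigma> (bl D E H u v - bl D E H' u v))))"
    by (rule of_real_avg)
  also have "... = avg ?M (\<lambda>H'. avg ?P (\<lambda>p. complex_of_real (\<Prod>i\<in>E. \<Prod>j\<in>D. cos (?g p i j)) *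
      cis (- (\<Sum>v\<in>D \<union> E. fr \<sigma> T (p v) * bl D E H' u v))))" by (simp only: e1)
  also have "... = avg ?P (\<lambda>p. avg ?M (\<lambda>H'. complex_of_real (\<Prod>i\<in>E. \<Prod>j\<in>D. cos (?g p i j)) *
      cis (- (\<Sum>v\<in>D \<union> E. fr \<sigma> T (p v) * bl D E H' u v))))" by (rule avg_swap)
  also have "... = avg ?P (\<lambda>p. complex_of_real (\<Prod>i\<in>E. \<Prod>j\<in>D. cos (?g p i j)) * complex_of_real (\<Prod>i\<in>E. \<Prod>j\<in>D. cos (?g p i j)))"
    by (simp only: avg_cmult e2)
  also have "... = complex_of_real (avg ?P (\<lambda>p. \<Prod>i\<in>E. \<Prod>j\<in>D. (cos (?g p i j))\<^sup>2))" by (simp add: of_real_avg power2_eq_square prod.distrib)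
  finally have "avg ?M (\<lambda>H'. avg ?M (\<lambda>H. \<Prod>v\<in>D \<union> E. fej T \<sigma> (bl D E H u v - bl D E H' u v)))
     = avg ?P (\<lambda>p. \<Prod>i\<in>E. \<Prod>j\<in>D. (cos (?g p i j))\<^sup>2)" by (simp only: of_real_eq_iff)
  also have "... \<le> fM D E T \<sigma> u" unfolding fM_fourier[OF assms]
    by (intro avg_mono prod_mono conjI prod_nonneg) (auto simp: cos_sq_le_phi prod_nonneg)
  finally show ?thesis .
qed

section \<open>Anti-concentration of one row\<close>

text \<open>Comparable to the squared distance from the vectors with coordinates in \<pi> Z, and
  subadditive up to a factor 2 by \<open>Ssin_add\<close>.\<close>

definition Ssin :: "'c set => ('c => real) => real" where
  "Ssin C x = (\<Sum>c\<in>C. (sin (x c))\<^sup>2)"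

lemma Ssin_nonneg: "0 \<le> Ssin C x" by (simp add: Ssin_def sum_nonneg)

lemma Ssin_cong: "(\<And>c. c \<in> C ==> x c = y c) ==> Ssin C x = Ssin C y"
  by (simp add: Ssin_def)

lemma sin_sq_add: "(sin (a + b))\<^sup>2 \<le> 2 * (sin a)\<^sup>2 + 2 * (sin (b::real))\<^sup>2"
proof -
  have "\<bar>sin (a + b)\<bar> \<le> \<bar>sin a\<bar> * \<bar>cos b\<bar> + \<bar>cos a\<bar> * \<bar>sin b\<bar>" unfolding sin_add abs_mult[symmetric] by (rule abs_triangle_ineq)
  also have "... \<le> \<bar>sin a\<bar> * 1 + 1 * \<bar>sin b\<bar>" by (intro add_mono mult_left_mono mult_right_mono) auto
  finally have "\<bar>sin (a + b)\<bar>\<^sup>2 \<le> (\<bar>sin a\<bar> + \<bar>sin b\<bar>)\<^sup>2" by (intro power_mono) auto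
  moreover have "0 \<le> (\<bar>sin a\<bar> - \<bar>sin b\<bar>)\<^sup>2" by simp
  ultimately show ?thesis by (simp add: power2_sum power2_diff)
qed

lemma Ssin_add: "Ssin C (\<lambda>c. x c + y c) \<le> 2 * Ssin C x + 2 * Ssin C y"
  unfolding Ssin_def sum_distrib_left sum.distrib[symmetric] by (intro sum_mono sin_sq_add)

lemma Ssin_minus: "Ssin C (\<lambda>c. - x c) = Ssin C x"
  by (simp add: Ssin_def)

lemma Ssin_diff: "Ssin C (\<lambda>c. x c - y c) \<le> 2 * Ssin C x + 2 * Ssin C y"
  using Ssin_add[of C x "\<lambda>c. - y c"] by (simp add: Ssin_minus)

lemma Ssin_le_sq: "Ssin C x \<le> (\<Sum>c\<in>C. (x c)\<^sup>2)"
  unfolding Ssin_def by (intro sum_mono) (simp add: abs_le_square_iff[symmetric] abs_sin_x_le_abs_x)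

section \<open>Exponential moments and concentration in the Hamming metric\<close>

lemma exp_quad_bound:
  fixes x :: real assumes "\<bar>x\<bar> \<le> 1" shows "exp x \<le> 1 + x + x\<^sup>2"
proof (cases "0 \<le> x")
  case True then show ?thesis using exp_bound[of x] assms by auto
next
  case False
  define y where "y = - x"
  have y: "0 < y" using False by (simp add: y_def)
  have "exp x = 1 / exp y" by (simp add: y_def exp_minus field_simps)
  also have "... \<le> 1 / (1 + y)" using y by (intro divide_left_mono) auto
  also have "... \<le> 1 - y + y\<^sup>2" using y by (simp add: field_simps power2_eq_square)
  finally show ?thesis by (simp add: y_def)
qed

lemma avg_PiE_insert:
  assumes "finite I" "i \<notin> I"
  shows "avg (PiE (insert i I) (\<lambda>_. S)) F = avg S (\<lambda>s. avg (PiE I (\<lambda>_. S)) (\<lambda>h. F (h(i := s))))"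
proof -
  let ?c = "\<lambda>(y, g). g(i := y)"
  have inj: "inj_on ?c (S \<times> PiE I (\<lambda>_. S))" using inj_combinator[OF assms(2), of "\<lambda>_. S"] by simp
  have eq: "PiE (insert i I) (\<lambda>_. S) = ?c ` (S \<times> PiE I (\<lambda>_. S))" by (simp add: PiE_insert_eq)
  have "card (PiE (insert i I) (\<lambda>_. S)) = card S * card (PiE I (\<lambda>_. S))"
    unfolding eq using inj by (simp add: card_image card_cartesian_product)
  moreover have "sum F (PiE (insert i I) (\<lambda>_. S)) = (\<Sum>s\<in>S. \<Sum>h\<in>PiE I (\<lambda>_. S). F (h(i := s)))"
    unfolding eq using inj by (subst sum.reindex) (auto simp: sum.cartesian_product case_prod_beta)
  ultimately show ?thesis by (simp add: avg_def sum_divide_distrib[symmetric])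
qed

text \<open>Reveal one coordinate at a time. The conditional means \<open>m s\<close> differ from
  their average by at most 1, and e^x \<le> 1 + x + x^2 on [-1, 1] turns this into a factor
  e^(lam^2) per coordinate.\<close>

lemma bounded_differences:
  fixes F :: "('i => 's) => real"
  assumes "finite I" "finite S" "S \<noteq> {}" "0 \<le> lam" "lam \<le> 1"
    "\<And>h i s. h \<in> PiE I (\<lambda>_. S) ==> i \<in> I ==> s \<in> S ==> \<bar>F (h(i := s)) - F h\<bar> \<le> 1"
  shows "avg (PiE I (\<lambda>_. S)) (\<lambda>h. exp (lam * F h)) \<le> exp (lam * avg (PiE I (\<lambda>_. S)) F + real (card I) * lam\<^sup>2)"
  using assms(1,6)
proof (induction I arbitrary: F rule: finite_induct)
  case empty
  then show ?case by (simp add: avg_def)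
next
  case (insert i I)
  let ?P = "PiE I (\<lambda>_. S)"
  have fin: "finite ?P" "?P \<noteq> {}" using insert.hyps assms by (auto intro!: finite_PiE simp: PiE_eq_empty_iff)
  have mem: "h(i := s) \<in> PiE (insert i I) (\<lambda>_. S)" if "h \<in> ?P" "s \<in> S" for h s
    using that insert.hyps by (auto simp: PiE_iff extensional_def)
  define m where "m s = avg ?P (\<lambda>h. F (h(i := s)))" for s
  define mm where "mm = avg S m"
  have IH: "avg ?P (\<lambda>h. exp (lam * F (h(i := s)))) \<le> exp (lam * m s + real (card I) * lam\<^sup>2)" if s: "s \<in> S" for s unfolding m_def
  proof (rule insert.IH)
    fix h j t assume h: "h \<in> ?P" "j \<in> I" "t \<in> S"
    have "j \<noteq> i" using h insert.hyps by auto
    then have eq: "(h(j := t))(i := s) = (h(i := s))(j := t)" by (rule fun_upd_twist)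
    show "\<bar>F ((h(j := t))(i := s)) - F (h(i := s))\<bar> \<le> 1" unfolding eq using h by (intro insert.prems mem s) auto
  qed
  have m12: "\<bar>m s - m t\<bar> \<le> 1" if "s \<in> S" "t \<in> S" for s t
  proof -
    have "m s - m t \<le> 1" if st: "s \<in> S" "t \<in> S" for s t
    proof -
      have "m s - m t = avg ?P (\<lambda>h. F (h(i := s)) - F (h(i := t)))" by (simp add: m_def avg_diff)
      also have "... \<le> 1"
      proof (rule avg_le[OF fin])
        fix h assume h: "h \<in> ?P"
        show "F (h(i := s)) - F (h(i := t)) \<le> 1"
        proof -
          have "\<bar>F ((h(i := t))(i := s)) - F (h(i := t))\<bar> \<le> 1" using st by (intro insert.prems mem h) auto
          then show ?thesis unfolding fun_upd_upd by linarith
        qed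
      qed
      finally show ?thesis .
    qed
    from this[OF that] this[OF that(2,1)] show ?thesis by linarith
  qed
  have mdev: "\<bar>m s - mm\<bar> \<le> 1" if s: "s \<in> S" for s
  proof -
    have eq: "m s - mm = avg S (\<lambda>t. m s - m t)" using assms by (simp add: avg_diff mm_def)
    have "m s - mm \<le> 1" unfolding eq using m12[OF s] assms by (intro avg_le) (auto simp: abs_le_iff)
    moreover have "-1 \<le> m s - mm" unfolding eq using m12[OF s] assms by (intro avg_ge) (force simp: abs_le_iff)+
    ultimately show ?thesis by linarith
  qed
  have "avg S (\<lambda>s. exp (lam * (m s - mm))) \<le> avg S (\<lambda>s. (1 + lam\<^sup>2) + lam * (m s - mm))"
  proof (rule avg_mono)
    fix s assume s: "s \<in> S"
    have b: "\<bar>lam * (m s - mm)\<bar> \<le> lam * 1" unfolding abs_mult using mdev[OF s] assms by (intro mult_mono) auto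
    then have b1: "\<bar>lam * (m s - mm)\<bar> \<le> 1" using assms by linarith
    have "(lam * (m s - mm))\<^sup>2 \<le> lam\<^sup>2" using b assms by (simp add: abs_le_square_iff[symmetric])
    then show "exp (lam * (m s - mm)) \<le> (1 + lam\<^sup>2) + lam * (m s - mm)" using exp_quad_bound[OF b1] by linarith
  qed
  also have "... = 1 + lam\<^sup>2" using assms by (simp add: avg_add avg_cmult avg_diff mm_def)
  also have "... \<le> exp (lam\<^sup>2)" by (rule exp_ge_add_one_self)
  finally have step: "avg S (\<lambda>s. exp (lam * (m s - mm))) \<le> exp (lam\<^sup>2)" .
  have tot: "avg (PiE (insert i I) (\<lambda>_. S)) F = mm" unfolding avg_PiE_insert[OF insert.hyps] mm_def m_def ..
  have "avg (PiE (insert i I) (\<lambda>_. S)) (\<lambda>h. exp (lam * F h)) = avg S (\<lambda>s. avg ?P (\<lambda>h. exp (lam * F (h(i := s)))))"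
    by (rule avg_PiE_insert[OF insert.hyps])
  also have "... \<le> avg S (\<lambda>s. exp (lam * m s + real (card I) * lam\<^sup>2))" by (intro avg_mono IH)
  also have "... = avg S (\<lambda>s. exp (lam * mm + real (card I) * lam\<^sup>2) * exp (lam * (m s - mm)))"
    unfolding exp_add[symmetric] by (simp add: algebra_simps)
  also have "... \<le> exp (lam * mm + real (card I) * lam\<^sup>2) * exp (lam\<^sup>2)" unfolding avg_cmult by (intro mult_left_mono step) auto
  also have "... = exp (lam * mm + real (card (insert i I)) * lam\<^sup>2)"
    unfolding exp_add[symmetric] using insert.hyps by (simp add: algebra_simps)
  finally show ?case unfolding tot .
qed

abbreviation HS :: "nat => (nat => nat) set" where "HS k \<equiv> seeds {..<k}"

lemma HS_fin: "finite (HS k)" "HS k \<noteq> {}"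
  by (auto intro!: finite_PiE simp: PiE_eq_empty_iff lessThan_empty_iff)

definition hamd :: "nat => (nat => nat) => (nat => nat) => nat" where
  "hamd k h g = card {l\<in>{..<k}. h l \<noteq> g l}"

text \<open>Minus the distance to \<open>V\<close> changes by at most 1 with each coordinate,
  vanishes on \<open>V\<close> and has mean at most -\<rho> k. The choice lam = \<rho>/2 minimises
  the exponent -lam \<rho> k + lam^2 k.\<close>

lemma hamming_concentration:
  assumes "V \<subseteq> HS k" "V \<noteq> {}" "0 \<le> \<rho>" "\<rho> \<le> 1"
    "\<rho> * real k \<le> avg (HS k) (\<lambda>h. real (Min (hamd k h ` V)))"
  shows "Pr (HS k) (\<lambda>h. h \<in> V) \<le> exp (- (\<rho>\<^sup>2 / 4 * real k))"
proof -
  have fV: "finite V" using assms(1) HS_fin(1) finite_subset by blast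
  define f where "f h = Min (hamd k h ` V)" for h
  have step: "f (h(i := s)) \<le> f h + 1" for h i s
  proof -
    have "f h \<in> hamd k h ` V" unfolding f_def using fV assms(2) by (intro Min_in) auto
    then obtain g where g: "g \<in> V" "f h = hamd k h g" by blast
    have "f (h(i := s)) \<le> hamd k (h(i := s)) g" unfolding f_def using fV g by (intro Min_le) auto
    also have "... \<le> card (insert i {l\<in>{..<k}. h l \<noteq> g l})" unfolding hamd_def by (intro card_mono) auto
    also have "... \<le> hamd k h g + 1" unfolding hamd_def by (simp add: card_insert_if)
    finally show ?thesis using g by simp
  qed
  have bd: "\<bar>- real (f (h(i := s))) - - real (f h)\<bar> \<le> 1" for h i s using step[of h i s] step[of "h(i := s)" i "h i"] by simp
  have z: "f h = 0" if "h \<in> V" for h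
  proof -
    have "f h \<le> hamd k h h" unfolding f_def using fV that by (intro Min_le) auto
    then show ?thesis by (simp add: hamd_def)
  qed
  define lam where "lam = \<rho> / 2"
  have "Pr (HS k) (\<lambda>h. h \<in> V) \<le> avg (HS k) (\<lambda>h. exp (lam * - real (f h)))" by (intro avg_mono) (auto simp: z)
  also have "... \<le> exp (lam * avg (HS k) (\<lambda>h. - real (f h)) + real (card {..<k}) * lam\<^sup>2)"
    by (intro bounded_differences bd) (use assms in \<open>auto simp: lam_def lessThan_empty_iff\<close>)
  also have "... \<le> exp (- (\<rho>\<^sup>2 / 4 * real k))"
  proof -
    have "avg (HS k) (\<lambda>h. - real (f h)) \<le> - (\<rho> * real k)" using assms(5) avg_cmult[of "HS k" "-1" "\<lambda>h. real (f h)"] by (simp add: f_def)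
    then have "lam * avg (HS k) (\<lambda>h. - real (f h)) \<le> lam * - (\<rho> * real k)" using assms by (intro mult_left_mono) (auto simp: lam_def)
    then show ?thesis by (simp add: lam_def power2_eq_square algebra_simps)
  qed
  finally show ?thesis .
qed

section \<open>Small-ball estimates for lazy combinations of directions\<close>

definition Wh :: "('c => nat => real) => nat => (nat => nat) => 'c => real" where
  "Wh W k h c = (\<Sum>l<k. lv (h l) * (W c l / 8))"

text \<open>Operator norm at most 2 and squared Hilbert-Schmidt norm at least k/4. Injectivity is
  not asked for: these two bounds are what survives when an orthonormal system is replaced by points
  of a net.\<close>

definition wellcond :: "'c set => ('c => nat => real) => nat => bool" where
  "wellcond C W k \<longleftrightarrow> (\<forall>x. (\<Sum>c\<in>C. (\<Sum>l<k. W c l * x l)\<^sup>2) \<le> 4 * (\<Sum>l<k. (x l)\<^sup>2)) \<and>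
     real k / 4 \<le> (\<Sum>c\<in>C. \<Sum>l<k. (W c l)\<^sup>2)"

lemma wellcondD: "wellcond C W k ==> (\<Sum>c\<in>C. (\<Sum>l<k. W c l * x l)\<^sup>2) \<le> 4 * (\<Sum>l<k. (x l)\<^sup>2)"
  by (simp add: wellcond_def)

lemma wellcond_row:
  assumes "finite C" "wellcond C W k" "c \<in> C"
  shows "(\<Sum>l<k. (W c l)\<^sup>2) \<le> 4"
proof -
  define R where "R = (\<Sum>l<k. (W c l)\<^sup>2)"
  have R0: "0 \<le> R" by (simp add: R_def sum_nonneg)
  have "(\<Sum>l<k. W c l * W c l)\<^sup>2 \<le> (\<Sum>c'\<in>C. (\<Sum>l<k. W c' l * W c l)\<^sup>2)" using assms by (intro member_le_sum) auto
  also have "... \<le> 4 * R" using assms(2) unfolding wellcond_def R_def by blast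
  finally have "R * R \<le> 4 * R" by (simp add: R_def power2_eq_square)
  then show ?thesis using R0 unfolding R_def[symmetric] by (cases "R = 0") auto
qed

lemma lv_diff: "\<bar>lv a - lv b\<bar> \<le> 4" by (simp add: lv_def)

text \<open>Changing one seed moves a coefficient by at most 4/8, and the squared norm bound 4
  cancels the resulting 1/4. The division by 8 in \<open>Wh\<close> is made for this.\<close>

lemma Wh_diff_sq:
  assumes "wellcond C W k"
  shows "(\<Sum>c\<in>C. (Wh W k h c - Wh W k g c)\<^sup>2) \<le> real (hamd k h g)"
proof -
  have e: "Wh W k h c - Wh W k g c = (\<Sum>l<k. W c l * ((lv (h l) - lv (g l)) / 8))" for c
    unfolding Wh_def sum_subtractf[symmetric] by (intro sum.cong refl) (simp add: field_simps)
  have "(\<Sum>c\<in>C. (Wh W k h c - Wh W k g c)\<^sup>2) = (\<Sum>c\<in>C. (\<Sum>l<k. W c l * ((lv (h l) - lv (g l)) / 8))\<^sup>2)" unfolding e ..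
  also have "... \<le> 4 * (\<Sum>l<k. ((lv (h l) - lv (g l)) / 8)\<^sup>2)" by (rule wellcondD[OF assms])
  also have "(\<Sum>l<k. ((lv (h l) - lv (g l)) / 8)\<^sup>2) \<le> (\<Sum>l<k. if h l \<noteq> g l then 1/4 else 0)"
  proof (rule sum_mono)
    fix l
    have "\<bar>(lv (h l) - lv (g l)) / 8\<bar>\<^sup>2 \<le> (1/2)\<^sup>2" using lv_diff[of "h l" "g l"] by (intro power_mono) auto
    then show "((lv (h l) - lv (g l)) / 8)\<^sup>2 \<le> (if h l \<noteq> g l then 1/4 else 0)" by (auto simp: power2_eq_square)
  qed
  also have "... = real (hamd k h g) / 4" by (simp add: sum.If_cases hamd_def Int_def)
  finally show ?thesis by simp
qed

text \<open>As sin^2 y = (1 - cos 2y) / 2, only the mean of cos 2y matters; it is the real part of a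
  phase times a product of values of \<open>phi\<close>. With R the squared norm of a row that
  product is at most e^(-R/64) \<le> 1 - R/128, whatever the shift \<open>a\<close>.\<close>

lemma avg_Ssin_lower:
  assumes "finite C" "wellcond C W k"
  shows "real k / 1024 \<le> avg (HS k) (\<lambda>h. Ssin C (\<lambda>c. Wh W k h c + a c))"
proof -
  have one: "(\<Sum>l<k. (W c l)\<^sup>2) / 256 \<le> avg (HS k) (\<lambda>h. (sin (Wh W k h c + a c))\<^sup>2)" if c: "c \<in> C" for c
  proof -
    define R where "R = (\<Sum>l<k. (W c l)\<^sup>2)"
    have R: "0 \<le> R" "R \<le> 4" using wellcond_row[OF assms c] by (auto simp: R_def sum_nonneg)
    have e: "2 * (Wh W k h c + a c) = 2 * a c + (\<Sum>l<k. lv (h l) * (W c l / 4))" for h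
    proof -
      have "2 * Wh W k h c = (\<Sum>l<k. lv (h l) * (W c l / 4))" unfolding Wh_def sum_distrib_left by (intro sum.cong refl) simp
      then show ?thesis by (simp only: distrib_left add.commute)
    qed
    have "avg (HS k) (\<lambda>h. cis (2 * (Wh W k h c + a c))) = avg (HS k) (\<lambda>h. cis (2 * a c) * cis (\<Sum>l<k. lv (h l) * (W c l / 4)))"
      unfolding e cis_mult ..
    also have "... = cis (2 * a c) * complex_of_real (\<Prod>l<k. phi (W c l / 4))" unfolding avg_cmult by (subst char_vec[OF _ _ char_lazy]) auto
    finally have ce: "avg (HS k) (\<lambda>h. cis (2 * (Wh W k h c + a c))) = cis (2 * a c) * complex_of_real (\<Prod>l<k. phi (W c l / 4))" .
    have "avg (HS k) (\<lambda>h. cos (2 * (Wh W k h c + a c))) = Re (avg (HS k) (\<lambda>h. cis (2 * (Wh W k h c + a c))))" unfolding Re_avg cis.sel ..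
    also have "... = Re (cis (2 * a c) * complex_of_real (\<Prod>l<k. phi (W c l / 4)))" unfolding ce ..
    also have "... = cos (2 * a c) * (\<Prod>l<k. phi (W c l / 4))" by (simp del: of_real_prod)
    also have "... \<le> 1 * (\<Prod>l<k. phi (W c l / 4))"
      using phi_bounds(1) by (intro mult_right_mono prod_nonneg) (auto intro: order_trans[of 0 "1/2"])
    also have "(\<Prod>l<k. phi (W c l / 4)) \<le> (\<Prod>l<k. exp (- ((W c l)\<^sup>2 / 64)))"
    proof (rule prod_mono, intro conjI)
      fix l assume l: "l \<in> {..<k}"
      show "0 \<le> phi (W c l / 4)" using phi_bounds(1)[of "W c l / 4"] by linarith
      have "(W c l)\<^sup>2 \<le> R" unfolding R_def using l by (intro member_le_sum) auto
      then have "(W c l)\<^sup>2 \<le> 2\<^sup>2" using R by simp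
      then have "\<bar>W c l\<bar> \<le> 2" by (subst (asm) abs_le_square_iff[symmetric]) auto
      then have "(W c l / 4)\<^sup>2 / 2 \<le> (sin (W c l / 4))\<^sup>2" by (intro sin_sq_lower) auto
      then show "phi (W c l / 4) \<le> exp (- ((W c l)\<^sup>2 / 64))" using order_trans[OF phi_exp[of "W c l / 4"]] by (simp add: power2_eq_square)
    qed
    also have "... = exp (- (R / 64))" by (simp add: exp_sum[symmetric] R_def sum_negf sum_divide_distrib)
    also have "... \<le> 1 + (- (R/64)) + (- (R/64))\<^sup>2" using R by (intro exp_quad_bound) auto
    also have "... \<le> 1 - R / 128"
    proof -
      have "(R/64) * (R/64) \<le> (R/64) * (1/2)" using R by (intro mult_left_mono) auto
      then show ?thesis by (simp add: power2_eq_square)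
    qed
    finally have c1: "avg (HS k) (\<lambda>h. cos (2 * (Wh W k h c + a c))) \<le> 1 - R / 128" by simp
    have s: "(sin y)\<^sup>2 = 1/2 - 1/2 * cos (2 * y)" for y :: real unfolding cos_double_sin by (simp add: field_simps)
    have "avg (HS k) (\<lambda>h. (sin (Wh W k h c + a c))\<^sup>2) = 1/2 - 1/2 * avg (HS k) (\<lambda>h. cos (2 * (Wh W k h c + a c)))"
      unfolding s avg_diff avg_cmult by (simp only: avg_const[OF HS_fin])
    then show ?thesis using c1 unfolding R_def[symmetric] by linarith
  qed
  have "real k / 1024 = (real k / 4) / 256" by simp
  also have "... \<le> (\<Sum>c\<in>C. \<Sum>l<k. (W c l)\<^sup>2) / 256" using assms(2) unfolding wellcond_def by (intro divide_right_mono) auto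
  also have "... \<le> (\<Sum>c\<in>C. avg (HS k) (\<lambda>h. (sin (Wh W k h c + a c))\<^sup>2))" by (subst sum_divide_distrib) (intro sum_mono one)
  also have "... = avg (HS k) (\<lambda>h. Ssin C (\<lambda>c. Wh W k h c + a c))" unfolding Ssin_def avg_sum ..
  finally show ?thesis .
qed

text \<open>The rate \<rho>^2 / 4 of \<open>hamming_concentration\<close> at \<rho> = 1/4096, the
  value arising in \<open>small_ball_shift\<close>.\<close>

definition del0 :: real where "del0 = 1 / 2 ^ 26"

text \<open>At Hamming distance m from the exceptional set, \<open>Ssin\<close> is at most 2m +
  k/4096. Its mean is at least k/1024, so the mean distance from that set is at least k/4096, and
  the set is exponentially rare.\<close>

lemma small_ball_shift:
  assumes "finite C" "wellcond C W k"
  shows "Pr (HS k) (\<lambda>h. Ssin C (\<lambda>c. Wh W k h c + a c) \<le> real k / 8192) \<le> exp (- (del0 * real k))"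
proof -
  define V where "V = {h\<in>HS k. Ssin C (\<lambda>c. Wh W k h c + a c) \<le> real k / 8192}"
  have eq: "Pr (HS k) (\<lambda>h. Ssin C (\<lambda>c. Wh W k h c + a c) \<le> real k / 8192) = Pr (HS k) (\<lambda>h. h \<in> V)" by (rule avg_cong) (auto simp: V_def)
  show ?thesis
  proof (cases "V = {}")
    case True
    then show ?thesis unfolding eq by (simp add: avg_def)
  next
    case False
    have VH: "V \<subseteq> HS k" by (auto simp: V_def)
    have fV: "finite V" using VH HS_fin(1) finite_subset by blast
    have up: "Ssin C (\<lambda>c. Wh W k h c + a c) \<le> 2 * real (Min (hamd k h ` V)) + real k / 4096" for h
    proof -
      have "Min (hamd k h ` V) \<in> hamd k h ` V" using fV False by (intro Min_in) auto
      then obtain g where g: "g \<in> V" "Min (hamd k h ` V) = hamd k h g" by blast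
      have "Ssin C (\<lambda>c. Wh W k h c + a c) = Ssin C (\<lambda>c. (Wh W k h c - Wh W k g c) + (Wh W k g c + a c))" by (intro Ssin_cong) simp
      also have "... \<le> 2 * Ssin C (\<lambda>c. Wh W k h c - Wh W k g c) + 2 * Ssin C (\<lambda>c. Wh W k g c + a c)" by (rule Ssin_add)
      also have "Ssin C (\<lambda>c. Wh W k h c - Wh W k g c) \<le> real (hamd k h g)" by (rule order_trans[OF Ssin_le_sq Wh_diff_sq[OF assms(2)]])
      also have "Ssin C (\<lambda>c. Wh W k g c + a c) \<le> real k / 8192" using g by (simp add: V_def)
      finally show ?thesis using g by simp
    qed
    have "real k / 1024 \<le> avg (HS k) (\<lambda>h. Ssin C (\<lambda>c. Wh W k h c + a c))" by (rule avg_Ssin_lower[OF assms])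
    also have "... \<le> avg (HS k) (\<lambda>h. 2 * real (Min (hamd k h ` V)) + real k / 4096)" by (intro avg_mono up)
    also have "... = 2 * avg (HS k) (\<lambda>h. real (Min (hamd k h ` V))) + real k / 4096" using HS_fin by (simp add: avg_add avg_cmult)
    finally have "1/4096 * real k \<le> avg (HS k) (\<lambda>h. real (Min (hamd k h ` V)))" by simp
    from hamming_concentration[OF VH False _ _ this] show ?thesis unfolding eq by (simp add: del0_def power2_eq_square)
  qed
qed

section \<open>Localising the two frequencies attached to a pair of rows\<close>

abbreviation cols :: "'v set => (bool \<times> 'v) set" where "cols D \<equiv> UNIV \<times> D"

text \<open>Both copies of \<open>D\<close> carry the same vector \<open>X\<close>, each with its
  own frequency, because the two factors of a second moment share the vector but not the
  block.\<close>

definition shiftY :: "('v => real) => (bool => real) => bool \<times> 'v => real" where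
  "shiftY X th c = th (fst c) * X (snd c)"

text \<open>This plays the role of a large least common denominator in Littlewood--Offord theory.\<close>

definition nonlattice :: "'v set => real => real => real => ('v => real) => bool" where
  "nonlattice D \<sigma> A B X \<longleftrightarrow> (\<forall>\<theta>. \<bar>\<theta>\<bar> \<le> 2 / \<sigma> --> min A (B * \<theta>\<^sup>2) \<le> Ssin D (\<lambda>j. \<theta> * X j))"

lemma sum_cols: "finite D ==> (\<Sum>c\<in>cols D. f c) = (\<Sum>\<beta>\<in>UNIV. \<Sum>j\<in>D. f (\<beta>, j))"
  by (simp add: sum.cartesian_product)

lemma Ssin_shiftY: "finite D ==> Ssin (cols D) (shiftY X th) = (\<Sum>\<beta>\<in>UNIV. Ssin D (\<lambda>j. th \<beta> * X j))"
  unfolding Ssin_def by (subst sum_cols) (simp_all add: shiftY_def)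

lemma Ssin_shiftY_ge: "finite D ==> Ssin D (\<lambda>j. th \<beta> * X j) \<le> Ssin (cols D) (shiftY X th)"
  unfolding Ssin_shiftY by (rule member_le_sum) (auto simp: Ssin_nonneg)

lemma shiftY_diff: "shiftY X th c - shiftY X th' c = shiftY X (\<lambda>\<beta>. th \<beta> - th' \<beta>) c"
  by (simp add: shiftY_def left_diff_distrib)

text \<open>Two frequencies of size at most 1/\<sigma> differ by at most 2/\<sigma>, the range
  covered by \<open>nonlattice\<close>. The hypothesis \<open>s < A\<close> rules out the constant
  branch of the minimum, so the quadratic branch is the small one.\<close>

lemma nonlattice_close:
  assumes "finite D" "nonlattice D \<sigma> A B X" "B > 0" "s < A" "\<sigma> > 0"
    "\<bar>th \<beta>\<bar> \<le> 1/\<sigma>" "\<bar>th' \<beta>\<bar> \<le> 1/\<sigma>" "Ssin (cols D) (shiftY X (\<lambda>\<beta>. th \<beta> - th' \<beta>)) \<le> s"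
  shows "\<bar>th \<beta> - th' \<beta>\<bar> \<le> sqrt (s / B)"
proof -
  have "\<bar>th \<beta> - th' \<beta>\<bar> \<le> 2 / \<sigma>" using assms(6,7) by (simp add: field_simps abs_le_iff)
  then have "min A (B * (th \<beta> - th' \<beta>)\<^sup>2) \<le> Ssin D (\<lambda>j. (th \<beta> - th' \<beta>) * X j)" using assms(2) by (auto simp: nonlattice_def)
  also have "... \<le> s" using order_trans[OF Ssin_shiftY_ge[OF assms(1)] assms(8)] .
  finally have "B * (th \<beta> - th' \<beta>)\<^sup>2 \<le> s" using assms(4) by auto
  then have "(th \<beta> - th' \<beta>)\<^sup>2 \<le> s / B" using assms(3) by (simp add: field_simps)
  then show ?thesis using real_le_rsqrt[of "\<bar>th \<beta> - th' \<beta>\<bar>" "s/B"] by simp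
qed

definition near :: "'v set => real => ('v => real) => (bool \<times> 'v => nat => real) => nat => real => (nat => nat) => (bool => real) => bool" where
  "near D \<sigma> X W k s h th \<longleftrightarrow> (\<forall>\<beta>. \<bar>th \<beta>\<bar> \<le> 1/\<sigma>) \<and> Ssin (cols D) (\<lambda>c. Wh W k h c + shiftY X th c) \<le> s"

text \<open>4 \<open>c7\<close> is 1/8192, the threshold of \<open>small_ball_shift\<close>: the
  near point and the grid error each enter with a factor 2.\<close>

definition c7 :: real where "c7 = 1 / 32768"

text \<open>The square root is the ratio of the localisation radius sqrt (3 k / B) to the mesh
  \<open>g\<close> of \<open>near_prob\<close>; k and B cancel.\<close>

definition gridn :: "real => nat" where "gridn Q = nat \<lceil>sqrt (6 * Q / c7) + 1\<rceil>"

text \<open>The unknown frequencies are removed by a union bound over a grid. One reference pair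
  \<open>h0\<close>, \<open>th0\<close> confines all other near frequencies to a window of radius
  sqrt (3 k / B), because \<open>nonlattice\<close> would detect a larger displacement.
  \<open>Q\<close> compares that window with the mesh required for accuracy \<open>c7 * k\<close>,
  so the number of grid points does not depend on k.\<close>

lemma near_prob:
  assumes "finite D" "nonlattice D \<sigma> A B X" "B > 0" "\<sigma> > 0" "Q > 0"
    "(\<Sum>j\<in>D. (X j)\<^sup>2) \<le> Q * B" "wellcond (cols D) W k" "k \<ge> 1" "3 * real k < A"
  shows "Pr (HS k) (\<lambda>h. \<exists>th. near D \<sigma> X W k (c7 * real k) h th)
     \<le> real ((2 * gridn Q + 1)\<^sup>2) * exp (- (del0 * real k))"
proof -
  have c7: "c7 > 0" "c7 \<le> 1/8" by (auto simp: c7_def)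
  have kp: "real k > 0" using assms by simp
  \<comment> \<open>Mesh at which two frequency errors of size g change \<open>Ssin\<close> by at
    most \<open>c7 * k\<close>.\<close>
  define g where "g = sqrt (c7 * real k / (2 * Q * B))"
  have g: "g > 0" using assms c7 kp by (simp add: g_def)
  have g2: "2 * g\<^sup>2 * (Q * B) = c7 * real k" using assms c7 kp by (simp add: g_def)
  define U where "U = {h\<in>HS k. \<exists>th. near D \<sigma> X W k (c7 * real k) h th}"
  have eq: "Pr (HS k) (\<lambda>h. \<exists>th. near D \<sigma> X W k (c7 * real k) h th) = Pr (HS k) (\<lambda>h. h \<in> U)" by (rule avg_cong) (auto simp: U_def)
  show ?thesis
  proof (cases "U = {}")
    case True
    then show ?thesis unfolding eq by (simp add: avg_def)
  next
    case False
    then obtain h0 th0 where h0: "h0 \<in> HS k" "near D \<sigma> X W k (c7 * real k) h0 th0" by (auto simp: U_def)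
    define \<Gamma> where "\<Gamma> = {- int (gridn Q) .. int (gridn Q)}"
    define a where "a p = (\<lambda>c. shiftY X (\<lambda>\<beta>. th0 \<beta> + g * (if \<beta> then of_int (fst p) else of_int (snd p))) c)" for p :: "int \<times> int"
    have key: "\<exists>p\<in>\<Gamma> \<times> \<Gamma>. Ssin (cols D) (\<lambda>c. Wh W k h c + a p c) \<le> real k / 8192" if h: "h \<in> U" for h
    proof -
      from h obtain th where th: "near D \<sigma> X W k (c7 * real k) h th" by (auto simp: U_def)
      have hk: "hamd k h h0 \<le> k"
      proof -
        have "hamd k h h0 \<le> card {..<k}" unfolding hamd_def by (intro card_mono) auto
        then show ?thesis by simp
      qed
      have "Ssin (cols D) (shiftY X (\<lambda>\<beta>. th \<beta> - th0 \<beta>))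
         = Ssin (cols D) (\<lambda>c. ((Wh W k h c + shiftY X th c) - (Wh W k h0 c + shiftY X th0 c)) - (Wh W k h c - Wh W k h0 c))"
        by (intro Ssin_cong) (simp add: shiftY_diff[symmetric])
      also have "... \<le> 2 * Ssin (cols D) (\<lambda>c. (Wh W k h c + shiftY X th c) - (Wh W k h0 c + shiftY X th0 c))
          + 2 * Ssin (cols D) (\<lambda>c. Wh W k h c - Wh W k h0 c)" by (rule Ssin_diff)
      also have "Ssin (cols D) (\<lambda>c. (Wh W k h c + shiftY X th c) - (Wh W k h0 c + shiftY X th0 c))
         \<le> 2 * (c7 * real k) + 2 * (c7 * real k)"
        using th h0(2) by (intro order_trans[OF Ssin_diff]) (auto simp: near_def)
      also have "Ssin (cols D) (\<lambda>c. Wh W k h c - Wh W k h0 c) \<le> real k"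
        using order_trans[OF Ssin_le_sq Wh_diff_sq[OF assms(7), of h h0]] hk by simp
      finally have "Ssin (cols D) (shiftY X (\<lambda>\<beta>. th \<beta> - th0 \<beta>)) \<le> 8 * c7 * real k + 2 * real k" by simp
      moreover have "8 * c7 * real k \<le> 1 * real k" using c7 by (intro mult_right_mono) auto
      ultimately have S3: "Ssin (cols D) (shiftY X (\<lambda>\<beta>. th \<beta> - th0 \<beta>)) \<le> 3 * real k" by linarith
      define q where "q \<beta> = \<lfloor>(th \<beta> - th0 \<beta>) / g\<rfloor>" for \<beta>
      have qb: "q \<beta> \<in> \<Gamma>" for \<beta>
      proof -
        have "\<bar>th \<beta> - th0 \<beta>\<bar> \<le> sqrt (3 * real k / B)"
          using nonlattice_close[OF assms(1-3,9,4) _ _ S3, of \<beta>] th h0(2) by (simp add: near_def)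
        then have "\<bar>(th \<beta> - th0 \<beta>) / g\<bar> \<le> sqrt (3 * real k / B) / g" using g by (simp add: divide_right_mono abs_divide)
        also have "... = sqrt ((3 * real k / B) / (c7 * real k / (2 * Q * B)))" unfolding g_def real_sqrt_divide[symmetric] ..
        also have "(3 * real k / B) / (c7 * real k / (2 * Q * B)) = 6 * Q / c7" using assms kp c7 by (simp add: field_simps)
        finally have b: "\<bar>(th \<beta> - th0 \<beta>) / g\<bar> \<le> sqrt (6 * Q / c7)" .
        have "real_of_int \<bar>q \<beta>\<bar> \<le> sqrt (6 * Q / c7) + 1" using b unfolding q_def by linarith
        also have "... \<le> real (gridn Q)" unfolding gridn_def using assms c7 by linarith
        finally show ?thesis unfolding \<Gamma>_def by auto
      qed
      define p where "p = (q True, q False)"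
      define e where "e \<beta> = (th0 \<beta> + g * of_int (q \<beta>)) - th \<beta>" for \<beta>
      have e: "\<bar>e \<beta>\<bar> \<le> g" for \<beta>
      proof -
        have "of_int (q \<beta>) \<le> (th \<beta> - th0 \<beta>) / g" "(th \<beta> - th0 \<beta>) / g \<le> of_int (q \<beta>) + 1" unfolding q_def by linarith+
        then have "g * of_int (q \<beta>) \<le> th \<beta> - th0 \<beta>" "th \<beta> - th0 \<beta> \<le> g * of_int (q \<beta>) + g" using g by (simp_all add: field_simps)
        then show ?thesis unfolding e_def by linarith
      qed
      have "Ssin (cols D) (\<lambda>c. Wh W k h c + a p c) = Ssin (cols D) (\<lambda>c. (Wh W k h c + shiftY X th c) + shiftY X e c)"
        by (intro Ssin_cong) (auto simp: a_def shiftY_def e_def p_def algebra_simps)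
      also have "... \<le> 2 * Ssin (cols D) (\<lambda>c. Wh W k h c + shiftY X th c) + 2 * Ssin (cols D) (shiftY X e)" by (rule Ssin_add)
      also have "Ssin (cols D) (\<lambda>c. Wh W k h c + shiftY X th c) \<le> c7 * real k" using th by (simp add: near_def)
      also have "Ssin (cols D) (shiftY X e) \<le> c7 * real k"
      proof -
        have "Ssin (cols D) (shiftY X e) \<le> (\<Sum>c\<in>cols D. (shiftY X e c)\<^sup>2)" by (rule Ssin_le_sq)
        also have "... = (\<Sum>\<beta>\<in>UNIV. (e \<beta>)\<^sup>2 * (\<Sum>j\<in>D. (X j)\<^sup>2))" by (simp add: sum_cols assms(1) shiftY_def power_mult_distrib sum_distrib_left)
        also have "... \<le> (\<Sum>\<beta>\<in>(UNIV::bool set). g\<^sup>2 * (Q * B))"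
          using e g assms(6) by (intro sum_mono mult_mono) (auto simp: abs_le_square_iff[symmetric] sum_nonneg)
        also have "... = c7 * real k" using g2 by (simp add: UNIV_bool)
        finally show ?thesis .
      qed
      finally have "Ssin (cols D) (\<lambda>c. Wh W k h c + a p c) \<le> real k / 8192" by (simp add: c7_def)
      then show ?thesis using qb by (intro bexI[of _ p]) (auto simp: p_def)
    qed
    have "Pr (HS k) (\<lambda>h. h \<in> U)
       \<le> avg (HS k) (\<lambda>h. \<Sum>p\<in>\<Gamma> \<times> \<Gamma>. of_bool (Ssin (cols D) (\<lambda>c. Wh W k h c + a p c) \<le> real k / 8192))"
    proof (rule avg_mono)
      fix h assume "h \<in> HS k"
      show "of_bool (h \<in> U) \<le> (\<Sum>p\<in>\<Gamma> \<times> \<Gamma>. of_bool (Ssin (cols D) (\<lambda>c. Wh W k h c + a p c) \<le> real k / 8192) :: real)"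
      proof (cases "h \<in> U")
        case True
        from key[OF this] obtain p where p: "p \<in> \<Gamma> \<times> \<Gamma>" "Ssin (cols D) (\<lambda>c. Wh W k h c + a p c) \<le> real k / 8192" by blast
        have "(1::real) = of_bool (Ssin (cols D) (\<lambda>c. Wh W k h c + a p c) \<le> real k / 8192)" using p by simp
        also have "... \<le> (\<Sum>p\<in>\<Gamma> \<times> \<Gamma>. of_bool (Ssin (cols D) (\<lambda>c. Wh W k h c + a p c) \<le> real k / 8192))"
          using p by (intro member_le_sum) (auto simp: \<Gamma>_def)
        finally show ?thesis using True by simp
      qed (simp add: sum_nonneg)
    qed
    also have "... \<le> (\<Sum>p\<in>\<Gamma> \<times> \<Gamma>. exp (- (del0 * real k)))" unfolding avg_sum using assms by (intro sum_mono small_ball_shift) auto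
    also have "... = real ((2 * gridn Q + 1)\<^sup>2) * exp (- (del0 * real k))"
      by (simp add: \<Gamma>_def card_cartesian_product power2_eq_square nat_add_distrib)
    finally show ?thesis unfolding eq .
  qed
qed

lemma card_window:
  fixes S :: "nat set"
  assumes "finite S" "0 \<le> w" "\<And>a b. a \<in> S ==> b \<in> S ==> real a - real b \<le> w"
  shows "real (card S) \<le> w + 1"
proof (cases "S = {}")
  case False
  have "S \<subseteq> {Min S..Max S}" using assms(1) by auto
  then have "card S \<le> card {Min S..Max S}" by (intro card_mono) auto
  also have "... = Max S + 1 - Min S" by simp
  finally have "card S \<le> Max S + 1 - Min S" .
  moreover have "Min S \<le> Max S" using assms(1) False by simp
  ultimately have "real (card S) \<le> real (Max S) - real (Min S) + 1" by linarith
  also have "... \<le> w + 1" using assms(3)[of "Max S" "Min S"] assms(1) False by simp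
  finally show ?thesis .
qed (use assms in simp)

text \<open>For a fixed \<open>h\<close>, two near frequency pairs differ by at most sqrt (4 j / B)
  in each coordinate. Once the second index in each of the two index pairs is fixed, the first
  indices lie in a box with sides of at most w + 1 integers, out of T each.\<close>

lemma near_window:
  assumes "finite D" "nonlattice D \<sigma> A B X" "B > 0" "\<sigma> > 0" "T > 0" "j \<ge> 1" "4 * real j < A" "h \<in> HS k"
  shows "avg (FQ T) (\<lambda>p. Pr (FQ T) (\<lambda>p'. near D \<sigma> X W k (real j) h (\<lambda>\<beta>. fr \<sigma> T (if \<beta> then p else p'))))
     \<le> real j * (gap \<sigma> B T)\<^sup>2 * of_bool (\<exists>th. near D \<sigma> X W k (real j) h th)"
proof (cases "\<exists>th. near D \<sigma> X W k (real j) h th")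
  case False
  then show ?thesis by (simp add: avg_def)
next
  case True
  let ?P = "\<lambda>p p'. near D \<sigma> X W k (real j) h (\<lambda>\<beta>. fr \<sigma> T (if \<beta> then p else p'))"
  define w where "w = \<sigma> * real T * sqrt (4 * real j / B)"
  have w0: "0 \<le> w" using assms by (simp add: w_def)
  have fixed: "avg {..<T} (\<lambda>t. avg {..<T} (\<lambda>t'. of_bool (?P (t, s) (t', s')))) \<le> ((w + 1) / real T)\<^sup>2" for s s'
  proof -
    define Z where "Z = {z \<in> {..<T} \<times> {..<T}. ?P (fst z, s) (snd z, s')}"
    have Zf: "finite Z" unfolding Z_def by (rule finite_subset[of _ "{..<T} \<times> {..<T}"]) auto
    have cl: "real (fst z) - real (fst y) \<le> w \<and> real (snd z) - real (snd y) \<le> w" if "z \<in> Z" "y \<in> Z" for z y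
    proof -
      define th where "th \<beta> = fr \<sigma> T (if \<beta> then (fst z, s) else (snd z, s'))" for \<beta>
      define th' where "th' \<beta> = fr \<sigma> T (if \<beta> then (fst y, s) else (snd y, s'))" for \<beta>
      have n: "near D \<sigma> X W k (real j) h th" "near D \<sigma> X W k (real j) h th'"
        using that unfolding Z_def th_def th'_def by (simp_all only: mem_Collect_eq)
      have "Ssin (cols D) (shiftY X (\<lambda>\<beta>. th \<beta> - th' \<beta>))
         = Ssin (cols D) (\<lambda>c. (Wh W k h c + shiftY X th c) - (Wh W k h c + shiftY X th' c))"
        by (intro Ssin_cong) (simp add: shiftY_diff[symmetric])
      also have "... \<le> 2 * real j + 2 * real j" using n by (intro order_trans[OF Ssin_diff]) (auto simp: near_def)
      finally have S: "Ssin (cols D) (shiftY X (\<lambda>\<beta>. th \<beta> - th' \<beta>)) \<le> 4 * real j" by simp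
      have d: "\<bar>th \<beta> - th' \<beta>\<bar> \<le> sqrt (4 * real j / B)" for \<beta> using nonlattice_close[OF assms(1-3,7,4) _ _ S, of \<beta>] n by (simp add: near_def)
      have e: "th True - th' True = (real (fst z) - real (fst y)) / (\<sigma> * real T)"
        "th False - th' False = (real (snd z) - real (snd y)) / (\<sigma> * real T)"
        by (auto simp: th_def th'_def fr_def diff_divide_distrib)
      have "(real (fst z) - real (fst y)) / (\<sigma> * real T) \<le> sqrt (4 * real j / B)"
        "(real (snd z) - real (snd y)) / (\<sigma> * real T) \<le> sqrt (4 * real j / B)"
        using d[of True] d[of False] unfolding e by linarith+
      then show ?thesis using assms unfolding w_def by (simp add: pos_divide_le_eq mult.commute mult.left_commute)
    qed
    have c1: "real (card (fst ` Z)) \<le> w + 1" by (rule card_window) (use Zf w0 cl in auto)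
    have c2: "real (card (snd ` Z)) \<le> w + 1" by (rule card_window) (use Zf w0 cl in auto)
    have "card Z \<le> card (fst ` Z \<times> snd ` Z)" using Zf by (intro card_mono) (auto intro: rev_image_eqI)
    then have "real (card Z) \<le> real (card (fst ` Z)) * real (card (snd ` Z))" by (metis card_cartesian_product of_nat_le_iff of_nat_mult)
    also have "... \<le> (w + 1) * (w + 1)" using c1 c2 w0 by (intro mult_mono) auto
    finally have cZ: "real (card Z) \<le> (w + 1) * (w + 1)" .
    have "(\<Sum>t<T. \<Sum>t'<T. of_bool (?P (t, s) (t', s'))) = (\<Sum>z\<in>{..<T} \<times> {..<T}. of_bool (?P (fst z, s) (snd z, s')) :: real)"
      unfolding sum.cartesian_product by (intro sum.cong refl) (clarify, simp only: fst_conv snd_conv prod.case)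
    also have "... = (\<Sum>z\<in>{..<T} \<times> {..<T}. of_bool (z \<in> Z))" by (intro sum.cong refl) (auto simp: Z_def)
    also have "... = real (card Z)"
    proof -
      have "({..<T} \<times> {..<T}) \<inter> {z. z \<in> Z} = Z" by (auto simp: Z_def)
      then show ?thesis by (simp add: of_bool_def sum.If_cases)
    qed
    finally show ?thesis using cZ assms(5) by (simp add: avg_def sum_divide_distrib[symmetric] power2_eq_square divide_right_mono)
  qed
  have avgFQ: "avg (FQ T) f = avg {..<T} (\<lambda>s. avg {..<T} (\<lambda>t. f (t, s)))" for f :: "nat \<times> nat => real"
  proof -
    have "sum f (FQ T) = (\<Sum>t<T. \<Sum>s<T. f (t, s))" unfolding sum.cartesian_product by (intro sum.cong refl) auto
    then have "avg (FQ T) f = avg {..<T} (\<lambda>t. avg {..<T} (\<lambda>s. f (t, s)))"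
      by (simp add: avg_def sum_divide_distrib[symmetric] card_cartesian_product)
    also have "... = avg {..<T} (\<lambda>s. avg {..<T} (\<lambda>t. f (t, s)))" by (rule avg_swap)
    finally show ?thesis .
  qed
  have "avg (FQ T) (\<lambda>p. Pr (FQ T) (\<lambda>p'. ?P p p'))
      = avg {..<T} (\<lambda>s. avg {..<T} (\<lambda>t. avg {..<T} (\<lambda>s'. avg {..<T} (\<lambda>t'. of_bool (?P (t, s) (t', s'))))))"
    unfolding avgFQ ..
  also have "... = avg {..<T} (\<lambda>s. avg {..<T} (\<lambda>s'. avg {..<T} (\<lambda>t. avg {..<T} (\<lambda>t'. of_bool (?P (t, s) (t', s'))))))"
    by (rule avg_cong[OF refl], rule avg_swap)
  also have "... \<le> ((w + 1) / real T)\<^sup>2" by (rule avg_le[OF _ _ avg_le[OF _ _ fixed]]) (use assms in \<open>auto simp: lessThan_empty_iff\<close>)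
  also have "... \<le> real j * (gap \<sigma> B T)\<^sup>2"
  proof -
    have "(w + 1) / real T = sqrt (real j) * (2 * \<sigma> / sqrt B) + 1 / real T"
      using assms by (simp add: w_def add_divide_distrib real_sqrt_divide real_sqrt_mult)
    also have "... \<le> sqrt (real j) * (gap \<sigma> B T)"
    proof -
      have "1 * (1 / real T) \<le> sqrt (real j) * (1 / real T)" using assms by (intro mult_right_mono) auto
      then show ?thesis by (simp add: distrib_left)
    qed
    finally have "((w + 1) / real T)\<^sup>2 \<le> (sqrt (real j) * (gap \<sigma> B T))\<^sup>2" using w0 by (intro power_mono) auto
    then show ?thesis by (simp add: power_mult_distrib)
  qed
  finally show ?thesis using True by simp
qed

lemma sum_geo_deriv:
  fixes x :: real assumes "0 \<le> x" "x < 1"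
  shows "(\<Sum>i<J. real (Suc i) * x ^ i) \<le> 1 / (1 - x)\<^sup>2"
proof -
  have s: "(\<lambda>n. of_nat (Suc n) * x ^ n) sums (1 / (1 - x)\<^sup>2)" using geometric_deriv_sums[of x] assms by simp
  have "(\<Sum>i<J. of_nat (Suc i) * x ^ i) \<le> suminf (\<lambda>n. of_nat (Suc n) * x ^ n)" using s assms by (intro sum_le_suminf) (auto simp: sums_iff)
  then show ?thesis using s by (simp add: sums_iff)
qed

lemma exp_quarter: "exp (- (1/4)) \<le> (4/5 :: real)"
proof -
  have "exp (- (1/4)) = 1 / exp (1/4 :: real)" by (simp add: exp_minus field_simps)
  also have "... \<le> 1 / (1 + 1/4)" by (intro divide_left_mono exp_ge_add_one_self) auto
  finally show ?thesis by simp
qed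

text \<open>Layer-cake decomposition in unit steps, cut off at \<open>J\<close> because
  \<open>nonlattice\<close> gives no information on levels of order \<open>A\<close> and
  above.\<close>

lemma layer:
  fixes S :: real assumes "0 \<le> S"
  shows "exp (- S / 2) \<le> (\<Sum>i<J. exp (- (real i / 2)) * of_bool (S \<le> real (Suc i))) + exp (- (real J / 2))"
proof (cases "S \<le> real J \<and> J \<ge> 1")
  case False
  then have "real J \<le> S" using assms by (cases J) auto
  then have "exp (- S / 2) \<le> exp (- (real J / 2))" by simp
  moreover have "0 \<le> (\<Sum>i<J. exp (- (real i / 2)) * of_bool (S \<le> real (Suc i)))" by (intro sum_nonneg) auto
  ultimately show ?thesis by linarith
next
  case True
  define i where "i = nat \<lceil>S\<rceil> - 1"
  have i: "i < J" "S \<le> real (Suc i)" "real i \<le> S" using True assms by (auto simp: i_def) linarith+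
  have "exp (- S / 2) \<le> exp (- (real i / 2)) * of_bool (S \<le> real (Suc i))" using i by simp
  also have "... \<le> (\<Sum>i<J. exp (- (real i / 2)) * of_bool (S \<le> real (Suc i)))" using i by (intro member_le_sum) auto
  finally show ?thesis by (simp add: add_increasing2)
qed

text \<open>50 exceeds the sum of all (i + 1) (4/5)^i, the square counts the grid of
  \<open>near_prob\<close>, and the 2 covers the levels above \<open>c7 * k\<close>.\<close>

definition rowM :: "real => real" where
  "rowM Q = 50 * (real ((2 * gridn Q + 1)\<^sup>2) + 2)"

lemma near_mono: "near D \<sigma> X W k s h th ==> s \<le> s' ==> near D \<sigma> X W k s' h th"
  by (auto simp: near_def)

text \<open>Level i has weight e^(-i/2), split into two halves. One half makes the series converge.
  The other is spent on levels beyond \<open>c7 * k\<close>, where \<open>near_prob\<close> gives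
  nothing but e^(-i/4) is itself below 2 e^(-del0 k). The factor \<open>gap\<close> squared comes
  from \<open>near_window\<close> on every level.\<close>

lemma row_fourier_bound:
  assumes "finite D" "nonlattice D \<sigma> A B X" "B > 0" "\<sigma> > 0" "T > 0" "Q > 0"
    "(\<Sum>j\<in>D. (X j)\<^sup>2) \<le> Q * B" "wellcond (cols D) W k" "3 * real k < A" "4 * real J < A"
  shows "avg (HS k) (\<lambda>h. avg (FQ T) (\<lambda>p. avg (FQ T) (\<lambda>p'.
      exp (- Ssin (cols D) (\<lambda>c. Wh W k h c + shiftY X (\<lambda>\<beta>. fr \<sigma> T (if \<beta> then p else p')) c) / 2))))
    \<le> rowM Q * (gap \<sigma> B T)\<^sup>2 * exp (- (del0 * real k)) + exp (- (real J / 2))"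
proof -
  define Z where "Z = (gap \<sigma> B T)\<^sup>2"
  have Z: "0 \<le> Z" by (simp add: Z_def)
  define M where "M = real ((2 * gridn Q + 1)\<^sup>2)"
  have M: "0 \<le> M" by (simp add: M_def)
  let ?th = "\<lambda>p p' \<beta>. fr \<sigma> T (if \<beta> then p else p')"
  let ?S = "\<lambda>h p p'. Ssin (cols D) (\<lambda>c. Wh W k h c + shiftY X (?th p p') c)"
  define pr where "pr j = Pr (HS k) (\<lambda>h. \<exists>th. near D \<sigma> X W k (real j) h th)" for j
  have pr1: "pr j \<le> 1" for j unfolding pr_def by (intro avg_le HS_fin) auto
  have pr0: "0 \<le> pr j" for j unfolding pr_def by (rule avg_nonneg) simp
  have FQ: "finite (FQ T)" "FQ T \<noteq> {}" using assms by (auto simp: lessThan_empty_iff)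
  have thb: "\<bar>?th p p' \<beta>\<bar> \<le> 1 / \<sigma>" if "p \<in> FQ T" "p' \<in> FQ T" for p p' \<beta>
    using fr_abs[OF that(1) assms(4)] fr_abs[OF that(2) assms(4)] by (cases \<beta>) auto
  have "avg (HS k) (\<lambda>h. avg (FQ T) (\<lambda>p. avg (FQ T) (\<lambda>p'. exp (- ?S h p p' / 2))))
     \<le> avg (HS k) (\<lambda>h. avg (FQ T) (\<lambda>p. avg (FQ T) (\<lambda>p'.
        (\<Sum>i<J. exp (- (real i / 2)) * of_bool (near D \<sigma> X W k (real (Suc i)) h (?th p p'))) + exp (- (real J / 2)))))"
  proof (intro avg_mono)
    fix h p p' assume "p \<in> FQ T" "p' \<in> FQ T"
    then have "near D \<sigma> X W k s h (?th p p') \<longleftrightarrow> ?S h p p' \<le> s" for s using thb unfolding near_def by blast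
    then show "exp (- ?S h p p' / 2) \<le> (\<Sum>i<J. exp (- (real i / 2)) * of_bool (near D \<sigma> X W k (real (Suc i)) h (?th p p'))) + exp (- (real J / 2))"
      using layer[of "?S h p p'" J, OF Ssin_nonneg] by simp
  qed
  also have "... = (\<Sum>i<J. exp (- (real i / 2)) * avg (HS k) (\<lambda>h. avg (FQ T) (\<lambda>p. avg (FQ T) (\<lambda>p'.
        of_bool (near D \<sigma> X W k (real (Suc i)) h (?th p p')))))) + exp (- (real J / 2))"
    by (simp only: avg_add avg_sum avg_cmult avg_const[OF FQ] avg_const[OF HS_fin])
  also have "... \<le> (\<Sum>i<J. exp (- (real i / 2)) * (real (Suc i) * Z * pr (Suc i))) + exp (- (real J / 2))"
  proof (intro add_right_mono sum_mono mult_left_mono)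
    fix i assume i: "i \<in> {..<J}"
    have "avg (HS k) (\<lambda>h. avg (FQ T) (\<lambda>p. Pr (FQ T) (\<lambda>p'. near D \<sigma> X W k (real (Suc i)) h (?th p p'))))
      \<le> avg (HS k) (\<lambda>h. real (Suc i) * Z * of_bool (\<exists>th. near D \<sigma> X W k (real (Suc i)) h th))"
    proof (rule avg_mono)
      fix h assume h: "h \<in> HS k"
      have "4 * real (Suc i) \<le> 4 * real J" using i by (simp del: of_nat_Suc)
      then have "4 * real (Suc i) < A" using assms(10) by linarith
      then show "avg (FQ T) (\<lambda>p. Pr (FQ T) (\<lambda>p'. near D \<sigma> X W k (real (Suc i)) h (?th p p')))
        \<le> real (Suc i) * Z * of_bool (\<exists>th. near D \<sigma> X W k (real (Suc i)) h th)"
        unfolding Z_def using h by (intro near_window[OF assms(1-5)]) auto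
    qed
    then show "avg (HS k) (\<lambda>h. avg (FQ T) (\<lambda>p. Pr (FQ T) (\<lambda>p'. near D \<sigma> X W k (real (Suc i)) h (?th p p'))))
      \<le> real (Suc i) * Z * pr (Suc i)" by (simp only: avg_cmult pr_def)
  qed auto
  also have "(\<Sum>i<J. exp (- (real i / 2)) * (real (Suc i) * Z * pr (Suc i)))
      \<le> (\<Sum>i<J. (real (Suc i) * (4/5) ^ i) * (Z * ((M + 2) * exp (- (del0 * real k)))))"
  proof (rule sum_mono)
    fix i assume i: "i \<in> {..<J}"
    have q: "exp (- (real i / 4)) \<le> (4/5) ^ i"
    proof -
      have "exp (- (real i / 4)) = exp (- (1/4)) ^ i" by (simp add: exp_of_nat_mult[symmetric])
      also have "... \<le> (4/5) ^ i" using exp_quarter by (intro power_mono) auto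
      finally show ?thesis .
    qed
    have split: "exp (- (real i / 2)) = exp (- (real i / 4)) * exp (- (real i / 4))" unfolding exp_add[symmetric] by simp
    have "exp (- (real i / 4)) * pr (Suc i) \<le> (M + 2) * exp (- (del0 * real k))"
    proof (cases "real (Suc i) \<le> c7 * real k")
      case True
      then have k1: "k \<ge> 1" by (cases k) auto
      have "pr (Suc i) \<le> Pr (HS k) (\<lambda>h. \<exists>th. near D \<sigma> X W k (c7 * real k) h th)"
        unfolding pr_def using True by (intro avg_mono) (auto intro: near_mono)
      also have "... \<le> M * exp (- (del0 * real k))" unfolding M_def using k1 assms by (intro near_prob) auto
      finally have "pr (Suc i) \<le> M * exp (- (del0 * real k))" .
      then have "exp (- (real i / 4)) * pr (Suc i) \<le> 1 * (M * exp (- (del0 * real k)))" using pr0[of "Suc i"] by (intro mult_mono) auto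
      also have "... \<le> (M + 2) * exp (- (del0 * real k))" by simp
      finally show ?thesis .
    next
      case False
      have "exp (- (real i / 4)) * pr (Suc i) \<le> exp (- (real i / 4)) * 1" using pr1 by (intro mult_left_mono) auto
      also have "... \<le> exp (1/4 + - (del0 * real k))" using False by (simp add: c7_def del0_def field_simps)
      also have "... = exp (1/4) * exp (- (del0 * real k))" by (rule exp_add)
      also have "exp (1/4) \<le> (2::real)" using exp_quad_bound[of "1/4"] by (simp add: power2_eq_square)
      also have "2 * exp (- (del0 * real k)) \<le> (M + 2) * exp (- (del0 * real k))" using M by (intro mult_right_mono) auto
      finally show ?thesis by simp
    qed
    then have "exp (- (real i / 4)) * (exp (- (real i / 4)) * pr (Suc i)) \<le> (4/5) ^ i * ((M + 2) * exp (- (del0 * real k)))"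
    proof (rule mult_mono[OF q])
      show "0 \<le> exp (- (real i / 4)) * pr (Suc i)" using pr0[of "Suc i"] by (rule mult_nonneg_nonneg[OF exp_ge_zero])
    qed simp
    then have "exp (- (real i / 2)) * pr (Suc i) \<le> (4/5) ^ i * ((M + 2) * exp (- (del0 * real k)))" by (simp only: split mult.assoc)
    then have "(real (Suc i) * Z) * (exp (- (real i / 2)) * pr (Suc i)) \<le> (real (Suc i) * Z) * ((4/5) ^ i * ((M + 2) * exp (- (del0 * real k))))"
      using Z by (intro mult_left_mono) auto
    then show "exp (- (real i / 2)) * (real (Suc i) * Z * pr (Suc i)) \<le> (real (Suc i) * (4/5) ^ i) * (Z * ((M + 2) * exp (- (del0 * real k))))"
      by (simp only: mult_ac)
  qed
  also have "... = (\<Sum>i<J. real (Suc i) * (4/5) ^ i) * (Z * ((M + 2) * exp (- (del0 * real k))))" by (rule sum_distrib_right[symmetric])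
  also have "... \<le> 50 * (Z * ((M + 2) * exp (- (del0 * real k))))"
  proof (rule mult_right_mono)
    have "(\<Sum>i<J. real (Suc i) * (4/5) ^ i) \<le> 1 / (1 - 4/5)\<^sup>2" by (rule sum_geo_deriv) auto
    then show "(\<Sum>i<J. real (Suc i) * (4/5) ^ i) \<le> (50::real)" by (simp add: power2_eq_square)
  qed (use Z M in auto)
  finally show ?thesis unfolding rowM_def M_def[symmetric] Z_def[symmetric] by (simp only: mult_ac)
qed

lemma avg_prod3: "avg S f * (avg T g * avg U k) = avg S (\<lambda>x. avg T (\<lambda>y. avg U (\<lambda>z. f x * (g y * k z))))"
  by (simp only: avg_cmult avg_multc)

definition rr :: "('v => nat) => ('v => nat) => bool \<times> 'v => real" where
  "rr r r' c = lv (if fst c then r (snd c) else r' (snd c))"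

text \<open>The product of \<open>phi\<close> is a soft indicator that the pair of rows is almost
  orthogonal to all k columns of \<open>W\<close>. It is itself a characteristic function, with the
  seeds \<open>h\<close> as its random variables. Averaging over the rows first leaves the random
  point \<open>Wh\<close> shifted by the frequencies, so the randomness has moved from the rows to
  \<open>h\<close>.\<close>

lemma row_bound:
  assumes "finite D" "nonlattice D \<sigma> A B X" "B > 0" "\<sigma> > 0" "T > 0" "Q > 0"
    "(\<Sum>j\<in>D. (X j)\<^sup>2) \<le> Q * B" "wellcond (cols D) W k" "3 * real k < A" "4 * real J < A"
  shows "avg (seeds D) (\<lambda>r. avg (seeds D) (\<lambda>r'.
      (\<Prod>l<k. phi ((\<Sum>c\<in>cols D. W c l * rr r r' c) / 8)) *
      (fej T \<sigma> (\<Sum>j\<in>D. lv (r j) * X j) * fej T \<sigma> (\<Sum>j\<in>D. lv (r' j) * X j))))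
    \<le> rowM Q * (gap \<sigma> B T)\<^sup>2 * exp (- (del0 * real k)) + exp (- (real J / 2))"
proof -
  let ?R = "PiE D (\<lambda>_. {..<8::nat})"
  let ?th = "\<lambda>p p' \<beta>. fr \<sigma> T (if \<beta> then p else p')"
  define \<xi> where "\<xi> h p p' c = Wh W k h c + shiftY X (?th p p') c" for h p p' c
  define G where "G r r' = (\<Prod>l<k. phi ((\<Sum>c\<in>cols D. W c l * rr r r' c) / 8)) *
      (fej T \<sigma> (\<Sum>j\<in>D. lv (r j) * X j) * fej T \<sigma> (\<Sum>j\<in>D. lv (r' j) * X j))" for r r'
  have e1: "(\<Sum>l<k. lv (h l) * ((\<Sum>c\<in>cols D. W c l * rr r r' c) / 8)) + fr \<sigma> T p * (\<Sum>j\<in>D. lv (r j) * X j) + fr \<sigma> T p' * (\<Sum>j\<in>D. lv (r' j) * X j)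
     = (\<Sum>j\<in>D. lv (r j) * \<xi> h p p' (True, j)) + (\<Sum>j\<in>D. lv (r' j) * \<xi> h p p' (False, j))" for h p p' r r'
  proof -
    have "(\<Sum>l<k. lv (h l) * ((\<Sum>c\<in>cols D. W c l * rr r r' c) / 8)) = (\<Sum>c\<in>cols D. rr r r' c * Wh W k h c)"
      unfolding Wh_def sum_divide_distrib sum_distrib_left by (subst sum.swap) (simp add: mult_ac)
    also have "... = (\<Sum>j\<in>D. lv (r j) * Wh W k h (True, j)) + (\<Sum>j\<in>D. lv (r' j) * Wh W k h (False, j))"
      by (subst sum_cols) (simp_all add: assms UNIV_bool rr_def)
    finally show ?thesis by (simp add: \<xi>_def shiftY_def distrib_left sum.distrib sum_distrib_left mult_ac)
  qed
  have G: "complex_of_real (G r r') = avg (HS k) (\<lambda>h. avg (FQ T) (\<lambda>p. avg (FQ T) (\<lambda>p'.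
      cis (\<Sum>j\<in>D. lv (r j) * \<xi> h p p' (True, j)) * cis (\<Sum>j\<in>D. lv (r' j) * \<xi> h p p' (False, j)))))" for r r'
  proof -
    have p: "complex_of_real (\<Prod>l<k. phi ((\<Sum>c\<in>cols D. W c l * rr r r' c) / 8))
       = avg (HS k) (\<lambda>h. cis (\<Sum>l<k. lv (h l) * ((\<Sum>c\<in>cols D. W c l * rr r r' c) / 8)))"
      by (rule char_vec[symmetric]) (auto simp: char_lazy)
    show ?thesis unfolding G_def of_real_mult p fej_avg avg_prod3 cis_mult e1[symmetric] add.assoc ..
  qed
  have ch: "avg ?R (\<lambda>r. cis (\<Sum>j\<in>D. lv (r j) * g j)) = complex_of_real (\<Prod>j\<in>D. phi (g j))" for g
    by (rule char_vec) (auto simp: assms char_lazy)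
  have "complex_of_real (avg ?R (\<lambda>r. avg ?R (\<lambda>r'. G r r')))
     = avg ?R (\<lambda>r. avg ?R (\<lambda>r'. avg (HS k) (\<lambda>h. avg (FQ T) (\<lambda>p. avg (FQ T) (\<lambda>p'.
      cis (\<Sum>j\<in>D. lv (r j) * \<xi> h p p' (True, j)) * cis (\<Sum>j\<in>D. lv (r' j) * \<xi> h p p' (False, j)))))))"
    by (simp only: of_real_avg G)
  also have "... = avg (HS k) (\<lambda>h. avg (FQ T) (\<lambda>p. avg (FQ T) (\<lambda>p'. avg ?R (\<lambda>r. avg ?R (\<lambda>r'.
      cis (\<Sum>j\<in>D. lv (r j) * \<xi> h p p' (True, j)) * cis (\<Sum>j\<in>D. lv (r' j) * \<xi> h p p' (False, j)))))))"
    by (simp only: avg_swap[of ?R "HS k"] avg_swap[of ?R "FQ T"])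
  also have "... = avg (HS k) (\<lambda>h. avg (FQ T) (\<lambda>p. avg (FQ T) (\<lambda>p'. complex_of_real (\<Prod>c\<in>cols D. phi (\<xi> h p p' c)))))"
  proof -
    have "(\<Prod>j\<in>D. phi (g (True, j))) * (\<Prod>j\<in>D. phi (g (False, j))) = (\<Prod>c\<in>cols D. phi (g c))" for g
    proof -
      have "(\<Prod>c\<in>cols D. phi (g c)) = (\<Prod>\<beta>\<in>UNIV. \<Prod>j\<in>D. phi (g (\<beta>, j)))" by (simp add: prod.cartesian_product)
      then show ?thesis by (simp add: UNIV_bool)
    qed
    then show ?thesis by (simp only: avg_cmult avg_multc ch of_real_mult[symmetric])
  qed
  finally have "avg ?R (\<lambda>r. avg ?R (\<lambda>r'. G r r')) = avg (HS k) (\<lambda>h. avg (FQ T) (\<lambda>p. avg (FQ T) (\<lambda>p'. \<Prod>c\<in>cols D. phi (\<xi> h p p' c))))"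
    unfolding of_real_avg[symmetric] of_real_eq_iff .
  also have "... \<le> avg (HS k) (\<lambda>h. avg (FQ T) (\<lambda>p. avg (FQ T) (\<lambda>p'. exp (- Ssin (cols D) (\<xi> h p p') / 2))))"
  proof (intro avg_mono)
    fix h p p'
    have "(\<Prod>c\<in>cols D. phi (\<xi> h p p' c)) \<le> (\<Prod>c\<in>cols D. exp (- (sin (\<xi> h p p' c))\<^sup>2 / 2))"
    proof (rule prod_mono, intro conjI)
      fix c
      show "0 \<le> phi (\<xi> h p p' c)" using phi_bounds(1)[of "\<xi> h p p' c"] by linarith
      show "phi (\<xi> h p p' c) \<le> exp (- (sin (\<xi> h p p' c))\<^sup>2 / 2)" by (rule phi_exp)
    qed
    also have "... = exp (- Ssin (cols D) (\<xi> h p p') / 2)"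
      using assms(1) by (simp add: exp_sum[symmetric] Ssin_def sum_negf sum_divide_distrib)
    finally show "(\<Prod>c\<in>cols D. phi (\<xi> h p p' c)) \<le> exp (- Ssin (cols D) (\<xi> h p p') / 2)" .
  qed
  also have "... \<le> rowM Q * (gap \<sigma> B T)\<^sup>2 * exp (- (del0 * real k)) + exp (- (real J / 2))"
    unfolding \<xi>_def by (rule row_fourier_bound[OF assms])
  finally show ?thesis unfolding G_def .
qed

section \<open>Integer points near a subspace\<close>

text \<open>Extensionality outside \<open>C\<close> makes the set finite. The l1 norm is chosen
  because its generating function factorises over coordinates; in dimension at most n, a Euclidean
  ball of radius r sqrt n lies in the l1 ball of radius r n.\<close>

definition L1 :: "'c set => real => ('c => int) set" where
  "L1 C B = {y \<in> PiE C (\<lambda>_. UNIV). (\<Sum>c\<in>C. \<bar>of_int (y c)\<bar>) \<le> B}"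

lemma L1_box:
  assumes "finite C"
  shows "L1 C B \<subseteq> PiE C (\<lambda>_. {- int (nat \<lfloor>B\<rfloor>) .. int (nat \<lfloor>B\<rfloor>)})"
proof
  fix y assume y: "y \<in> L1 C B"
  show "y \<in> PiE C (\<lambda>_. {- int (nat \<lfloor>B\<rfloor>) .. int (nat \<lfloor>B\<rfloor>)})"
  proof (rule PiE_I)
    fix c assume c: "c \<in> C"
    have "\<bar>real_of_int (y c)\<bar> \<le> (\<Sum>c\<in>C. \<bar>of_int (y c)\<bar>)" using c assms by (intro member_le_sum) auto
    then have "\<bar>real_of_int (y c)\<bar> \<le> B" using y by (simp add: L1_def)
    then have "\<bar>y c\<bar> \<le> \<lfloor>B\<rfloor>" by (simp add: le_floor_iff)
    moreover from this have "0 \<le> \<lfloor>B\<rfloor>" by linarith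
    ultimately show "y c \<in> {- int (nat \<lfloor>B\<rfloor>) .. int (nat \<lfloor>B\<rfloor>)}" by (auto simp: abs_le_iff)
  qed (use y in \<open>auto simp: L1_def PiE_def extensional_def\<close>)
qed

lemma finite_L1: "finite C ==> finite (L1 C B)"
  by (rule finite_subset[OF L1_box]) (auto intro!: finite_PiE)

lemma sum_int_sym:
  fixes f :: "int => real"
  shows "(\<Sum>y\<in>{- int b..int b}. f y) = f 0 + (\<Sum>i\<in>{1..b}. f (int i) + f (- int i))"
proof (induction b)
  case (Suc b)
  have "{- int (Suc b)..int (Suc b)} = insert (- int (Suc b)) (insert (int (Suc b)) {- int b..int b})" by auto
  then have "(\<Sum>y\<in>{- int (Suc b)..int (Suc b)}. f y) = f (- int (Suc b)) + (f (int (Suc b)) + (\<Sum>y\<in>{- int b..int b}. f y))" by simp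
  then show ?case using Suc by simp
qed simp

lemma sum_exp_abs:
  fixes lam :: real
  assumes "lam > 0"
  shows "(\<Sum>y\<in>{- int b..int b}. exp (- (lam * \<bar>of_int y\<bar>))) \<le> 1 + 2 / (exp lam - 1)"
proof -
  define x where "x = exp (- lam)"
  have x: "0 < x" "x < 1" using assms by (auto simp: x_def)
  have e: "exp (- (lam * real i)) = x ^ i" for i by (simp add: x_def exp_of_nat_mult[symmetric] mult.commute)
  have "(\<Sum>y\<in>{- int b..int b}. exp (- (lam * \<bar>of_int y\<bar>))) = 1 + (\<Sum>i\<in>{1..b}. 2 * x ^ i)" unfolding sum_int_sym by (simp add: e)
  also have "(\<Sum>i\<in>{1..b}. 2 * x ^ i) \<le> 2 * (x / (1 - x))"
  proof -
    have "(\<Sum>i\<in>{1..b}. 2 * x ^ i) = 2 * (x * (\<Sum>i<b. x ^ i))" by (simp add: sum_distrib_left sum.atLeast1_atMost_eq)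
    also have "(\<Sum>i<b. x ^ i) \<le> 1 / (1 - x)" using x sum_le_suminf[of "\<lambda>i. x ^ i" "{..<b}"] by (simp add: suminf_geometric)
    finally show ?thesis using x by (simp add: mult_left_mono)
  qed
  also have "x / (1 - x) = 1 / (exp lam - 1)" using assms by (simp add: x_def exp_minus field_simps)
  finally show ?thesis by simp
qed

text \<open>Chernoff's method: each point has weight at least 1 under e^(lam (B - norm)), and the
  total weight factorises into two-sided geometric series.\<close>

lemma card_L1:
  assumes "finite C" "lam > 0"
  shows "real (card (L1 C B)) \<le> exp (lam * B) * (1 + 2 / (exp lam - 1)) ^ card C"
proof -
  let ?b = "nat \<lfloor>B\<rfloor>"
  let ?P = "PiE C (\<lambda>_. {- int ?b..int ?b})"
  have fP: "finite ?P" using assms by (intro finite_PiE) auto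
  have "real (card (L1 C B)) = (\<Sum>y\<in>L1 C B. 1)" by simp
  also have "... \<le> (\<Sum>y\<in>L1 C B. exp (lam * B) * (\<Prod>c\<in>C. exp (- (lam * \<bar>of_int (y c)\<bar>))))"
  proof (rule sum_mono)
    fix y assume y: "y \<in> L1 C B"
    have "exp (lam * B) * (\<Prod>c\<in>C. exp (- (lam * \<bar>of_int (y c)\<bar>))) = exp (lam * (B - (\<Sum>c\<in>C. \<bar>of_int (y c)\<bar>)))"
      using assms by (simp add: exp_sum[symmetric] exp_add[symmetric] sum_negf sum_distrib_left algebra_simps)
    then show "1 \<le> exp (lam * B) * (\<Prod>c\<in>C. exp (- (lam * \<bar>of_int (y c)\<bar>)))" using y assms by (simp add: L1_def)
  qed
  also have "... \<le> (\<Sum>y\<in>?P. exp (lam * B) * (\<Prod>c\<in>C. exp (- (lam * \<bar>of_int (y c)\<bar>))))"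
    using fP by (intro sum_mono2 L1_box assms) (auto intro!: mult_nonneg_nonneg prod_nonneg)
  also have "... = exp (lam * B) * (\<Prod>c\<in>C. \<Sum>y\<in>{- int ?b..int ?b}. exp (- (lam * \<bar>of_int y\<bar>)))"
    unfolding sum_distrib_left[symmetric] using assms by (subst prod_sum_PiE) auto
  also have "... \<le> exp (lam * B) * (\<Prod>c\<in>C. 1 + 2 / (exp lam - 1))" by (intro mult_left_mono prod_mono conjI sum_nonneg sum_exp_abs assms) auto
  finally show ?thesis by simp
qed

text \<open>With \<open>lam = 1 / N\<close> the cost e^(lam B) is only e^(R n), and each coordinate
  contributes at most 3 N.\<close>

lemma card_L1_scaled:
  fixes R N n :: real
  assumes "finite C" "R \<ge> 1" "N \<ge> 1" "real (card C) \<le> n"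
  shows "real (card (L1 C (R * N * n))) \<le> exp (R * n) * (3 * N) ^ card C"
proof -
  have N: "N > 0" using assms by simp
  have "real (card (L1 C (R * N * n))) \<le> exp (1/N * (R * N * n)) * (1 + 2 / (exp (1/N) - 1)) ^ card C" using assms by (intro card_L1) auto
  also have "1/N * (R * N * n) = R * n" using N by simp
  also have "(1 + 2 / (exp (1/N) - 1)) ^ card C \<le> (3 * N) ^ card C"
  proof (rule power_mono)
    have e: "1/N \<le> exp (1/N) - 1" using exp_ge_add_one_self[of "1/N"] by linarith
    then have "2 / (exp (1/N) - 1) \<le> 2 / (1/N)" using N by (intro divide_left_mono) (auto intro: mult_pos_pos)
    then show "1 + 2 / (exp (1/N) - 1) \<le> 3 * N" using assms N by simp
    show "0 \<le> 1 + 2 / (exp (1/N) - 1)" using N by simp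
  qed
  finally show ?thesis by (simp add: mult_left_mono)
qed

lemma sum_abs_le_sqrt:
  fixes y :: "'c => real"
  assumes "(\<Sum>c\<in>C. (y c)\<^sup>2) \<le> S"
  shows "(\<Sum>c\<in>C. \<bar>y c\<bar>) \<le> sqrt (real (card C) * S)"
proof -
  have "(\<Sum>c\<in>C. \<bar>y c\<bar>)\<^sup>2 \<le> real (card C) * S"
  proof -
    have "(ip C (\<lambda>_. 1) (\<lambda>c. \<bar>y c\<bar>))\<^sup>2 \<le> ip C (\<lambda>_. 1) (\<lambda>_. 1) * ip C (\<lambda>c. \<bar>y c\<bar>) (\<lambda>c. \<bar>y c\<bar>)" by (rule cauchy_schwarz_ip)
    also have "... = real (card C) * (\<Sum>c\<in>C. (y c)\<^sup>2)" by (simp add: ip_def power2_eq_square)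
    also have "... \<le> real (card C) * S" using assms by (intro mult_left_mono) auto
    finally show ?thesis by (simp add: ip_def)
  qed
  then show ?thesis by (rule real_le_rsqrt)
qed

lemma card_le_fibers:
  assumes "finite A" "finite B" "\<And>a. a \<in> A ==> f a \<in> B" "\<And>b. b \<in> B ==> real (card {a\<in>A. f a = b}) \<le> F"
  shows "real (card A) \<le> real (card B) * F"
proof -
  have "A = (\<Union>b\<in>B. {a\<in>A. f a = b})" using assms(3) by auto
  then have "card A \<le> (\<Sum>b\<in>B. card {a\<in>A. f a = b})" using card_UN_le[OF assms(2)] by metis
  then have "real (card A) \<le> (\<Sum>b\<in>B. real (card {a\<in>A. f a = b}))" by (metis of_nat_le_iff of_nat_sum)
  also have "... \<le> (\<Sum>b\<in>B. F)" using assms(4) by (intro sum_mono) auto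
  finally show ?thesis by simp
qed

lemma avg_PiE_square:
  fixes val :: "'s => real"
  assumes "finite I" "finite S" "S \<noteq> {}" "avg S val = 0" "avg S (\<lambda>s. (val s)\<^sup>2) \<le> v"
  shows "avg (PiE I (\<lambda>_. S)) (\<lambda>a. (\<Sum>l\<in>I. val (a l) * g l)\<^sup>2) \<le> v * (\<Sum>l\<in>I. (g l)\<^sup>2)"
  using assms(1)
proof (induction I rule: finite_induct)
  case empty
  then show ?case by (simp add: avg_def)
next
  case (insert i I)
  let ?P = "PiE I (\<lambda>_. S)"
  have fin: "finite ?P" "?P \<noteq> {}" using insert.hyps assms by (auto intro!: finite_PiE simp: PiE_eq_empty_iff)
  define Y where "Y a = (\<Sum>l\<in>I. val (a l) * g l)" for a
  have e: "(\<Sum>l\<in>insert i I. val ((a(i := s)) l) * g l)\<^sup>2 = (g i)\<^sup>2 * (val s)\<^sup>2 + (2 * g i * Y a) * val s + (Y a)\<^sup>2" for a s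
  proof -
    have "(\<Sum>l\<in>I. val ((a(i := s)) l) * g l) = Y a" unfolding Y_def using insert.hyps by (intro sum.cong) auto
    then have "(\<Sum>l\<in>insert i I. val ((a(i := s)) l) * g l) = val s * g i + Y a" using insert.hyps by simp
    then show ?thesis by (simp add: power2_eq_square algebra_simps)
  qed
  have "avg (PiE (insert i I) (\<lambda>_. S)) (\<lambda>a. (\<Sum>l\<in>insert i I. val (a l) * g l)\<^sup>2)
     = avg ?P (\<lambda>a. avg S (\<lambda>s. (g i)\<^sup>2 * (val s)\<^sup>2 + (2 * g i * Y a) * val s + (Y a)\<^sup>2))"
    unfolding avg_PiE_insert[OF insert.hyps] e by (rule avg_swap)
  also have "... = (g i)\<^sup>2 * avg S (\<lambda>s. (val s)\<^sup>2) + avg ?P (\<lambda>a. (Y a)\<^sup>2)"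
    by (simp only: avg_add avg_cmult assms(4) avg_const[OF assms(2,3)] avg_const[OF fin] mult_zero_right add_0_right)
  also have "... \<le> (g i)\<^sup>2 * v + v * (\<Sum>l\<in>I. (g l)\<^sup>2)" using insert.IH assms(5) unfolding Y_def by (intro add_mono mult_left_mono) auto
  finally show ?case using insert.hyps by (simp add: algebra_simps)
qed

section \<open>Integer points almost annihilated by the columns of a rectangular matrix\<close>

definition Hx :: "'c set => ('e => 'c => real) => ('c => real) => 'e => real" where
  "Hx C H x i = ip C (H i) x"

lemma Hx_dual: "ip E (Hx C H x) u = (\<Sum>c\<in>C. x c * (\<Sum>i\<in>E. H i c * u i))"
  unfolding Hx_def ip_def sum_distrib_left sum_distrib_right by (subst sum.swap) (simp add: mult_ac)

text \<open>Radius, in units of sqrt |C|, of the set of coefficient vectors that can represent the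
  same sum in \<open>count_near_kernel\<close>; \<beta> bounds the matrix from below on the good
  directions and \<tau> is the tolerance for the columns.\<close>

definition K1 :: "real => real => real" where "K1 \<beta> \<tau> = (2 * \<tau> / \<beta> + 2) / \<beta>"

text \<open>Integer points near a subspace are counted by adding to them a large separated family of
  integer points of that subspace; the sums have few representations and stay in a ball.\<close>

lemma count_near_kernel:
  fixes H :: "'e => 'c => real" and N :: nat
  assumes "finite E" "finite C" "C \<noteq> {}" "real (card E) \<le> n" "real (card C) \<le> n"
    "\<And>i c. i \<in> E ==> c \<in> C ==> \<bar>H i c\<bar> \<le> 2" "0 < \<beta>" "\<beta> \<le> 1" "\<tau> \<ge> 0" "\<rho> \<ge> 0" "N \<ge> 1"
    "orthon C w (card C)" "k \<le> card C"
    "\<And>x. ip C x x = 1 ==> (\<forall>i<k. ip C (w i) x = 0) ==> \<beta>\<^sup>2 * n \<le> ip E (Hx C H x) (Hx C H x)"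
  defines "Q \<equiv> {u \<in> PiE E (\<lambda>_. UNIV). (\<Sum>i\<in>E. (real_of_int (u i))\<^sup>2) \<le> \<rho>\<^sup>2 * (real N)\<^sup>2 * n \<and>
      (\<forall>c\<in>C. \<bar>\<Sum>i\<in>E. H i c * real_of_int (u i)\<bar> \<le> \<tau> * sqrt n)}"
  shows "finite Q" "real (card Q) * real N ^ (card C - k) \<le> 2 * exp ((2 * \<rho> + K1 \<beta> \<tau> + 12) * n) * real N ^ card E"
proof -
  define p where "p = card C"
  define m where "m = card E"
  have p: "p \<ge> 1" using assms(2,3) by (simp add: p_def Suc_leI card_gt_0_iff)
  have n: "n \<ge> 1" using p assms(5) by (simp add: p_def)
  have pn: "real p \<le> n" "real m \<le> n" using assms by (auto simp: p_def m_def)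
  have N: "real N \<ge> 1" using assms by simp
  have l1: "(\<Sum>i\<in>E. \<bar>real_of_int (u i)\<bar>) \<le> sqrt S * sqrt n" if "(\<Sum>i\<in>E. (real_of_int (u i))\<^sup>2) \<le> S" for u S
  proof -
    have S: "0 \<le> S" using that by (meson order_trans sum_nonneg zero_le_power2)
    have "(\<Sum>i\<in>E. \<bar>real_of_int (u i)\<bar>) \<le> sqrt (real (card E) * S)" by (rule sum_abs_le_sqrt[OF that])
    also have "... \<le> sqrt (n * S)" using assms(4) S by (simp add: mult_right_mono)
    finally show ?thesis by (simp add: real_sqrt_mult mult.commute)
  qed
  show finQ: "finite Q" by (rule finite_subset[OF _ finite_L1[OF assms(1), of "sqrt (\<rho>\<^sup>2 * (real N)\<^sup>2 * n) * sqrt n"]])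
       (auto simp: Q_def L1_def intro: l1)
  define I where "I = {k..<p}"
  have I: "finite I" "I \<subseteq> {..<p}" "card I = p - k" by (auto simp: I_def)
  have orth: "orthon C w p" using assms(12) by (simp add: p_def)
  define S where "S = {- int N .. int N}"
  have S: "finite S" "S \<noteq> {}" by (auto simp: S_def)
  define G where "G = PiE I (\<lambda>_. S)"
  have cS: "card S = 2 * N + 1" by (simp add: S_def nat_eq_iff)
  have G: "finite G" "G \<noteq> {}" "card G = (2 * N + 1) ^ (p - k)"
    using I S cS by (auto simp: G_def PiE_eq_empty_iff card_PiE intro!: finite_PiE)
  \<comment> \<open>Integer combinations x of the basis vectors beyond k, where \<open>H\<close> is
    bounded below, are mapped to \<open>H x\<close>, divided by sqrt p and rounded to
    \<open>pa\<close>. Members of \<open>Q\<close> are almost orthogonal to every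
    \<open>H x\<close>, so a sum of the two kinds nearly determines both summands.\<close>
  define xv where "xv a c = (\<Sum>l\<in>I. of_int (a l) * w l c)" for a :: "nat => int" and c
  define yv where "yv a i = Hx C H (xv a) i / sqrt (real p)" for a i
  define pa where "pa a i = round (yv a i)" for a i
  have Hxlin: "Hx C H (xv a) i = (\<Sum>l\<in>I. of_int (a l) * Hx C H (w l) i)" for a i unfolding Hx_def xv_def by (rule ip_sum_right)
  have avgS: "avg S (\<lambda>s. real_of_int s) = 0" unfolding avg_def S_def by (simp add: sum_int_sym)
  have avgS2: "avg S (\<lambda>s. (real_of_int s)\<^sup>2) \<le> (real N)\<^sup>2" using S by (intro avg_le) (auto simp: S_def abs_le_square_iff[symmetric])
  have avgy: "avg G (\<lambda>a. \<Sum>i\<in>E. (yv a i)\<^sup>2) \<le> 4 * n * (real N)\<^sup>2"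
  proof -
    have "avg G (\<lambda>a. \<Sum>i\<in>E. (yv a i)\<^sup>2) = (\<Sum>i\<in>E. avg G (\<lambda>a. (\<Sum>l\<in>I. real_of_int (a l) * (Hx C H (w l) i / sqrt (real p)))\<^sup>2))"
      unfolding yv_def Hxlin avg_sum by (simp add: sum_divide_distrib)
    also have "... \<le> (\<Sum>i\<in>E. (real N)\<^sup>2 * (\<Sum>l\<in>I. (Hx C H (w l) i / sqrt (real p))\<^sup>2))"
      unfolding G_def using I S avgS avgS2 by (intro sum_mono avg_PiE_square) auto
    also have "... = (real N)\<^sup>2 / real p * (\<Sum>i\<in>E. \<Sum>l\<in>I. (ip C (w l) (H i))\<^sup>2)"
      using p by (simp add: sum_distrib_left power_divide Hx_def ip_commute[of C "H _" "w _"])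
    also have "... \<le> (real N)\<^sup>2 / real p * (\<Sum>i\<in>E. 4 * real p)"
    proof (intro mult_left_mono sum_mono)
      fix i assume i: "i \<in> E"
      have "(\<Sum>l\<in>I. (ip C (w l) (H i))\<^sup>2) \<le> ip C (H i) (H i)" by (rule bessel[OF orth I(2)])
      also have "... \<le> (\<Sum>c\<in>C. 4)" unfolding ip_def
      proof (rule sum_mono)
        fix c assume "c \<in> C"
        then have "\<bar>H i c\<bar> * \<bar>H i c\<bar> \<le> 2 * 2" using assms(6)[OF i] by (intro mult_mono) auto
        then show "H i c * H i c \<le> 4" by simp
      qed
      finally show "(\<Sum>l\<in>I. (ip C (w l) (H i))\<^sup>2) \<le> 4 * real p" by (simp add: p_def)
    qed auto
    also have "... = 4 * real m * (real N)\<^sup>2" using p by (simp add: m_def)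
    also have "... \<le> 4 * n * (real N)\<^sup>2" using pn by (intro mult_right_mono) auto
    finally show ?thesis .
  qed
  \<comment> \<open>Markov's inequality: at least half of the coefficient vectors have an image of
    squared norm at most twice the bound on the mean, which keeps the sums inside a ball of
    comparable radius.\<close>
  define G' where "G' = {a\<in>G. (\<Sum>i\<in>E. (yv a i)\<^sup>2) \<le> 8 * n * (real N)\<^sup>2}"
  have fG': "finite G'" using G by (simp add: G'_def)
  have G'half: "real (card G) \<le> 2 * real (card G')"
  proof -
    have t: "0 < 8 * n * (real N)\<^sup>2" using n N by simp
    have "real (card (G - G')) * (8 * n * (real N)\<^sup>2) = (\<Sum>a\<in>G - G'. 8 * n * (real N)\<^sup>2)" by simp
    also have "... \<le> (\<Sum>a\<in>G - G'. \<Sum>i\<in>E. (yv a i)\<^sup>2)" by (rule sum_mono) (auto simp: G'_def)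
    also have "... \<le> (\<Sum>a\<in>G. \<Sum>i\<in>E. (yv a i)\<^sup>2)" using G by (intro sum_mono2) (auto simp: sum_nonneg)
    also have "... = real (card G) * avg G (\<lambda>a. \<Sum>i\<in>E. (yv a i)\<^sup>2)" using G by (simp add: avg_def card_gt_0_iff)
    also have "... \<le> real (card G) * (4 * n * (real N)\<^sup>2)" using avgy by (intro mult_left_mono) auto
    also have "... = (real (card G) / 2) * (8 * n * (real N)\<^sup>2)" by simp
    finally have "real (card (G - G')) \<le> real (card G) / 2" using t by (rule mult_right_le_imp_le)
    moreover have "card G = card G' + card (G - G')" using G card_Diff_subset[of G' G] card_mono[of G G'] fG' by (auto simp: G'_def)
    ultimately show ?thesis by simp
  qed
  have err: "\<bar>real_of_int (pa a i) - yv a i\<bar> \<le> 1" for a i using of_int_round_abs_le[of "yv a i"] unfolding pa_def by linarith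
  have panorm: "(\<Sum>i\<in>E. (real_of_int (pa a i))\<^sup>2) \<le> 18 * (real N)\<^sup>2 * n" if "a \<in> G'" for a
  proof -
    have "(real_of_int (pa a i))\<^sup>2 \<le> 2 * (yv a i)\<^sup>2 + 2" for i
    proof -
      define e where "e = real_of_int (pa a i) - yv a i"
      have "e\<^sup>2 \<le> 1" using err[of a i] by (simp add: e_def abs_square_le_1)
      moreover have "0 \<le> (yv a i - e)\<^sup>2" by simp
      moreover have "real_of_int (pa a i) = yv a i + e" by (simp add: e_def)
      ultimately show ?thesis by (simp add: power2_sum power2_diff)
    qed
    then have "(\<Sum>i\<in>E. (real_of_int (pa a i))\<^sup>2) \<le> (\<Sum>i\<in>E. 2 * (yv a i)\<^sup>2 + 2)" by (intro sum_mono) auto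
    also have "... = 2 * (\<Sum>i\<in>E. (yv a i)\<^sup>2) + 2 * real m" by (simp add: sum.distrib sum_distrib_left m_def)
    also have "... \<le> 2 * (8 * n * (real N)\<^sup>2) + 2 * (n * (real N)\<^sup>2)"
    proof -
      have "real m * 1 \<le> n * (real N)\<^sup>2" using pn N n by (intro mult_mono) auto
      then show ?thesis using that by (simp add: G'_def)
    qed
    finally show ?thesis by (simp add: mult_ac)
  qed
  define R where "R = 2 * \<rho> + 6"
  define f where "f = (\<lambda>(u :: 'e => int, a). \<lambda>i\<in>E. u i + pa a i)"
  have fin2: "finite (Q \<times> G')" using finQ fG' by simp
  have fZ: "f z \<in> L1 E (R * real N * n)" if zQ: "z \<in> Q \<times> G'" for z
  proof -
    obtain u a where z: "z = (u, a)" "u \<in> Q" "a \<in> G'" using zQ by blast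
    have "(\<Sum>i\<in>E. (real_of_int (u i + pa a i))\<^sup>2) \<le> (\<Sum>i\<in>E. 2 * (real_of_int (u i))\<^sup>2 + 2 * (real_of_int (pa a i))\<^sup>2)"
    proof (rule sum_mono)
      fix i
      have "0 \<le> (real_of_int (u i) - real_of_int (pa a i))\<^sup>2" by simp
      then show "(real_of_int (u i + pa a i))\<^sup>2 \<le> 2 * (real_of_int (u i))\<^sup>2 + 2 * (real_of_int (pa a i))\<^sup>2"
        by (simp add: power2_sum power2_diff)
    qed
    also have "... = 2 * (\<Sum>i\<in>E. (real_of_int (u i))\<^sup>2) + 2 * (\<Sum>i\<in>E. (real_of_int (pa a i))\<^sup>2)" by (simp add: sum.distrib sum_distrib_left)
    also have "... \<le> 2 * (\<rho>\<^sup>2 * (real N)\<^sup>2 * n) + 2 * (18 * (real N)\<^sup>2 * n)"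
      using z panorm[of a] by (intro add_mono mult_left_mono) (auto simp: Q_def)
    also have "... = (2 * \<rho>\<^sup>2 + 36) * ((real N)\<^sup>2 * n)" by (simp add: algebra_simps)
    also have "... \<le> R\<^sup>2 * ((real N)\<^sup>2 * n)" using assms(10) n by (intro mult_right_mono) (auto simp: R_def power2_eq_square algebra_simps)
    finally have "(\<Sum>i\<in>E. \<bar>real_of_int (u i + pa a i)\<bar>) \<le> sqrt (R\<^sup>2 * ((real N)\<^sup>2 * n)) * sqrt n" by (rule l1)
    also have "... = R * real N * n" using assms(10) n by (simp add: real_sqrt_mult R_def)
    finally show ?thesis by (simp add: L1_def z f_def)
  qed
  define KK where "KK = K1 \<beta> \<tau>"
  have KK: "KK \<ge> 0" using assms by (simp add: KK_def K1_def)
  have fiber: "real (card {z \<in> Q \<times> G'. f z = b}) \<le> exp (KK * n) * exp (2 * n)" if "b \<in> L1 E (R * real N * n)" for b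
  proof (cases "{z \<in> Q \<times> G'. f z = b} = {}")
    case True
    show ?thesis unfolding True by simp
  next
    case False
    then obtain u0 a0 where z0: "u0 \<in> Q" "a0 \<in> G'" "f (u0, a0) = b" by auto
    \<comment> \<open>For two representations of one sum, \<open>H x\<close> is, after scaling, u0 -
      u plus a bounded rounding error. Pairing this with \<open>H x\<close> itself makes the first
      part small, as u and u0 both lie in \<open>Q\<close>, and the second is controlled by
      Cauchy-Schwarz; the lower bound for \<open>H\<close> then limits x.\<close>
    have close: "(\<Sum>l\<in>I. (real_of_int (a l - a0 l))\<^sup>2) \<le> KK\<^sup>2 * real p" if z: "u \<in> Q" "a \<in> G'" "f (u, a) = b" for u a
    proof -
      define x where "x c = xv a c - xv a0 c" for c
      have xe: "x c = (\<Sum>l\<in>I. real_of_int (a l - a0 l) * w l c)" for c by (simp add: x_def xv_def sum_subtractf left_diff_distrib)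
      have xx: "ip C x x = (\<Sum>l\<in>I. (real_of_int (a l - a0 l))\<^sup>2)"
        unfolding xe[abs_def] using ip_lincomb[OF orth I(2)] by (simp add: power2_eq_square)
      define h where "h = Hx C H x"
      have hy: "h i = sqrt (real p) * (yv a i - yv a0 i)" for i
        using p by (simp add: h_def yv_def x_def[abs_def] Hx_def ip_diff_right right_diff_distrib)
      have perp: "\<forall>i<k. ip C (w i) x = 0"
      proof (intro allI impI)
        fix i assume i: "i < k"
        have "ip C (w i) x = (\<Sum>l\<in>I. real_of_int (a l - a0 l) * ip C (w i) (w l))" unfolding xe[abs_def] by (rule ip_sum_right)
        also have "... = 0" using i orth assms(13) by (intro sum.neutral) (auto simp: I_def orthon_def p_def)
        finally show "ip C (w i) x = 0" .
      qed
      have lower: "\<beta>\<^sup>2 * n * ip C x x \<le> ip E h h"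
      proof (cases "ip C x x = 0")
        case False
        then have pos: "ip C x x > 0" using ip_nonneg[of C x] by linarith
        define r where "r = 1 / sqrt (ip C x x)"
        have rr: "r * r = 1 / ip C x x" using pos by (simp add: r_def)
        have "ip C (\<lambda>c. r * x c) (\<lambda>c. r * x c) = 1" using pos by (simp only: ip_scale_left ip_scale_right mult.assoc[symmetric] rr) simp
        moreover have "\<forall>i<k. ip C (w i) (\<lambda>c. r * x c) = 0" using perp by (simp add: ip_scale_right)
        ultimately have "\<beta>\<^sup>2 * n \<le> ip E (Hx C H (\<lambda>c. r * x c)) (Hx C H (\<lambda>c. r * x c))" by (rule assms(14))
        also have "... = (r * r) * ip E h h" unfolding h_def Hx_def ip_scale_right ip_def[of E] by (simp add: sum_distrib_left mult_ac)
        finally show ?thesis using pos by (simp add: rr field_simps)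
      qed (simp add: ip_nonneg)
      have eqz: "u i + pa a i = u0 i + pa a0 i" if "i \<in> E" for i
      proof -
        have "f (u, a) i = f (u0, a0) i" using z(3) z0(3) by (simp only:)
        then show ?thesis using that by (simp add: f_def)
      qed
      define er where "er i = (yv a i - real_of_int (pa a i)) - (yv a0 i - real_of_int (pa a0 i))" for i
      have ere: "\<bar>er i\<bar> \<le> 2" for i using err[of a i] err[of a0 i] unfolding er_def by linarith
      have split: "yv a i - yv a0 i = (real_of_int (u0 i) - real_of_int (u i)) + er i" if "i \<in> E" for i
      proof -
        have "real_of_int (u i + pa a i) = real_of_int (u0 i + pa a0 i)" using eqz[OF that] by simp
        then show ?thesis by (simp add: er_def)
      qed
      have "ip E h h = sqrt (real p) * ip E h (\<lambda>i. yv a i - yv a0 i)"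
        using ip_scale_right[of E h "sqrt (real p)" "\<lambda>i. yv a i - yv a0 i"] hy[abs_def] by simp
      also have "ip E h (\<lambda>i. yv a i - yv a0 i) = ip E h (\<lambda>i. (real_of_int (u0 i) - real_of_int (u i)) + er i)"
        by (rule ip_cong) (auto simp: split)
      also have "... = ip E h (\<lambda>i. real_of_int (u0 i) - real_of_int (u i)) + ip E h er" by (rule ip_add_right)
      also have "ip E h (\<lambda>i. real_of_int (u0 i) - real_of_int (u i)) \<le> sqrt (ip C x x) * (2 * \<tau> * n)"
      proof -
        let ?d = "\<lambda>c. (\<Sum>i\<in>E. H i c * real_of_int (u0 i)) - (\<Sum>i\<in>E. H i c * real_of_int (u i))"
        have "ip E h (\<lambda>i. real_of_int (u0 i) - real_of_int (u i))
           = ip C x ?d"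
          unfolding h_def Hx_dual by (simp add: ip_def right_diff_distrib sum_subtractf)
        also have "... \<le> sqrt (ip C x x * (real p * (2 * \<tau> * sqrt n)\<^sup>2))"
        proof (rule real_le_rsqrt, rule order_trans[OF cauchy_schwarz_ip mult_left_mono[OF _ ip_nonneg]])
          have "ip C ?d
              ?d \<le> (\<Sum>c\<in>C. (2 * \<tau> * sqrt n)\<^sup>2)"
            unfolding ip_def power2_eq_square[symmetric]
          proof (rule sum_mono)
            fix c assume c: "c \<in> C"
            have "\<bar>\<Sum>i\<in>E. H i c * real_of_int (u0 i)\<bar> \<le> \<tau> * sqrt n" "\<bar>\<Sum>i\<in>E. H i c * real_of_int (u i)\<bar> \<le> \<tau> * sqrt n"
              using z0(1) z(1) c by (auto simp: Q_def)
            then have "\<bar>(\<Sum>i\<in>E. H i c * real_of_int (u0 i)) - (\<Sum>i\<in>E. H i c * real_of_int (u i))\<bar> \<le> \<bar>2 * \<tau> * sqrt n\<bar>" by linarith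
            then show "((\<Sum>i\<in>E. H i c * real_of_int (u0 i)) - (\<Sum>i\<in>E. H i c * real_of_int (u i)))\<^sup>2 \<le> (2 * \<tau> * sqrt n)\<^sup>2"
              by (simp only: abs_le_square_iff)
          qed
          then show "ip C ?d
              ?d \<le> real p * (2 * \<tau> * sqrt n)\<^sup>2"
            by (simp add: p_def)
        qed
        also have "... = sqrt (ip C x x) * (sqrt (real p) * (2 * \<tau> * sqrt n))" using assms(9) n by (simp add: real_sqrt_mult)
        also have "... \<le> sqrt (ip C x x) * (sqrt n * (2 * \<tau> * sqrt n))"
          using pn n assms(9) by (intro mult_left_mono mult_right_mono) (auto simp: ip_nonneg)
        also have "... = sqrt (ip C x x) * (2 * \<tau> * n)" using n by simp
        finally show ?thesis .
      qed
      also have "ip E h er \<le> sqrt (ip E h h) * (2 * sqrt n)"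
      proof -
        have "ip E er er \<le> (\<Sum>i\<in>E. 4)" unfolding ip_def
        proof (rule sum_mono)
          fix i show "er i * er i \<le> 4" using ere[of i] abs_le_square_iff[of "er i" 2] by (simp add: power2_eq_square)
        qed
        also have "... \<le> 4 * n" using assms(4) by simp
        finally have "(ip E h er)\<^sup>2 \<le> ip E h h * (4 * n)" by (intro order_trans[OF cauchy_schwarz_ip] mult_left_mono ip_nonneg)
        then have "ip E h er \<le> sqrt (ip E h h * (4 * n))" by (rule real_le_rsqrt)
        then show ?thesis by (simp add: real_sqrt_mult)
      qed
      finally have hh: "ip E h h \<le> sqrt (real p) * (sqrt (ip C x x) * (2 * \<tau> * n) + sqrt (ip E h h) * (2 * sqrt n))"
        by (simp add: mult_left_mono)
      define X where "X = sqrt (ip C x x)"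
      define Hn where "Hn = sqrt (ip E h h)"
      have X0: "X \<ge> 0" "Hn \<ge> 0" by (auto simp: X_def Hn_def ip_nonneg)
      have XX: "X * X = ip C x x" "Hn * Hn = ip E h h" by (auto simp: X_def Hn_def ip_nonneg)
      have bX: "\<beta> * sqrt n * X \<le> Hn"
      proof -
        have "sqrt (\<beta>\<^sup>2 * n * ip C x x) \<le> Hn" unfolding Hn_def using lower by simp
        then show ?thesis using assms(7) by (simp add: real_sqrt_mult X_def)
      qed
      have "Hn \<le> sqrt (real p) * ((2 * \<tau> / \<beta> + 2) * sqrt n)"
      proof (cases "Hn = 0")
        case False
        have "X * (2 * \<tau> * n) = (\<beta> * sqrt n * X) * (2 * \<tau> / \<beta> * sqrt n)" using assms(7) n by simp
        also have "... \<le> Hn * (2 * \<tau> / \<beta> * sqrt n)" using bX assms(7,9) n by (intro mult_right_mono) auto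
        finally have "sqrt (real p) * (X * (2 * \<tau> * n) + Hn * (2 * sqrt n)) \<le> sqrt (real p) * (Hn * (2 * \<tau> / \<beta> * sqrt n) + Hn * (2 * sqrt n))"
          by (intro mult_left_mono) auto
        then have "Hn * Hn \<le> Hn * (sqrt (real p) * ((2 * \<tau> / \<beta> + 2) * sqrt n))"
          using hh unfolding XX(2) X_def[symmetric] Hn_def[symmetric] by (simp add: algebra_simps)
        then show ?thesis using False X0 by (simp add: mult_le_cancel_left)
      next
        case True
        then show ?thesis using assms n by simp
      qed
      then have "\<beta> * sqrt n * X \<le> sqrt (real p) * ((2 * \<tau> / \<beta> + 2) * sqrt n)" using bX by linarith
      then have "(\<beta> * X) * sqrt n \<le> (sqrt (real p) * (2 * \<tau> / \<beta> + 2)) * sqrt n" by (simp add: mult_ac)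
      then have "\<beta> * X \<le> sqrt (real p) * (2 * \<tau> / \<beta> + 2)" using n by (simp add: mult_le_cancel_right)
      then have "X \<le> KK * sqrt (real p)" using assms(7) by (simp add: KK_def K1_def pos_le_divide_eq mult_ac)
      then have "X\<^sup>2 \<le> (KK * sqrt (real p))\<^sup>2" using X0 by (intro power_mono) auto
      then show ?thesis using XX xx by (simp add: power2_eq_square mult_ac)
    qed
    \<comment> \<open>Within a fibre the sum is prescribed, so \<open>a\<close> determines
      \<open>u\<close> and only the coefficients have to be counted.\<close>
    have inj: "inj_on (\<lambda>(u, a). \<lambda>l\<in>I. a l - a0 l) {z \<in> Q \<times> G'. f z = b}"
    proof (rule inj_onI, clarify)
      fix u a u' a' assume z: "u \<in> Q" "a \<in> G'" "u' \<in> Q" "a' \<in> G'" "f (u', a') = f (u, a)"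
        and eq: "(\<lambda>l\<in>I. a l - a0 l) = (\<lambda>l\<in>I. a' l - a0 l)"
      have aa: "a = a'"
      proof
        fix l show "a l = a' l"
        proof (cases "l \<in> I")
          case True then show ?thesis using fun_cong[OF eq, of l] by simp
        next
          case False then show ?thesis using z by (auto simp: G'_def G_def PiE_def extensional_def)
        qed
      qed
      have "u = u'"
      proof
        fix i show "u i = u' i"
        proof (cases "i \<in> E")
          case True then show ?thesis using fun_cong[OF z(5), of i] aa by (simp add: f_def)
        next
          case False then show ?thesis using z by (auto simp: Q_def PiE_def extensional_def)
        qed
      qed
      then show "u = u' \<and> a = a'" using aa by simp
    qed
    have img: "(\<lambda>(u, a). \<lambda>l\<in>I. a l - a0 l) ` {z \<in> Q \<times> G'. f z = b} \<subseteq> L1 I (KK * real p)"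
    proof clarify
      fix u a assume z: "u \<in> Q" "a \<in> G'" "b = f (u, a)"
      have "(\<Sum>l\<in>I. \<bar>real_of_int (a l - a0 l)\<bar>) \<le> sqrt (real (card I) * (KK\<^sup>2 * real p))"
        using close[of u a] z by (intro sum_abs_le_sqrt) auto
      also have "... \<le> sqrt (real p * (KK\<^sup>2 * real p))" using I by (intro real_sqrt_le_mono mult_right_mono) auto
      also have "... = KK * real p" using KK by (simp add: real_sqrt_mult)
      finally show "(\<lambda>l\<in>I. a l - a0 l) \<in> L1 I (KK * real p)" by (simp add: L1_def)
    qed
    have "card {z \<in> Q \<times> G'. f z = b} \<le> card (L1 I (KK * real p))" using card_mono[OF finite_L1[OF I(1)] img] card_image[OF inj] by simp
    then have "real (card {z \<in> Q \<times> G'. f z = b}) \<le> real (card (L1 I (KK * real p)))" by simp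
    also have "... \<le> exp (1 * (KK * real p)) * (1 + 2 / (exp 1 - 1)) ^ card I" by (rule card_L1[OF I(1)]) simp
    also have "... \<le> exp (KK * n) * exp (2 * n)"
    proof (rule mult_mono)
      show "exp (1 * (KK * real p)) \<le> exp (KK * n)" using KK pn by (simp add: mult_left_mono)
      have "1 \<le> exp 1 - (1::real)" using exp_ge_add_one_self[of 1] by simp
      then have "2 / (exp 1 - 1) \<le> (2::real)" by (simp add: divide_le_eq)
      moreover have e2: "1 + 2 \<le> exp (2::real)" using exp_ge_add_one_self[of 2] by simp
      ultimately have "(1 + 2 / (exp 1 - 1)) ^ card I \<le> exp (2::real) ^ card I" by (intro power_mono) (auto simp: add_nonneg_nonneg)
      also have "... = exp (2 * real (card I))" by (simp add: exp_of_nat_mult[symmetric] mult.commute)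
      also have "... \<le> exp (2 * n)" using pn I by simp
      finally show "(1 + 2 / (exp 1 - 1)) ^ card I \<le> exp (2 * n)" .
    qed (auto simp: add_nonneg_nonneg)
    finally show ?thesis .
  qed
  have "real (card Q) * real (card G') = real (card (Q \<times> G'))" by (simp add: card_cartesian_product)
  also have "... \<le> real (card (L1 E (R * real N * n))) * (exp (KK * n) * exp (2 * n))"
    by (rule card_le_fibers[where f = f]) (use fin2 finite_L1 assms(1) fZ fiber in auto)
  also have "... \<le> (exp (R * n) * (3 * real N) ^ card E) * (exp (KK * n) * exp (2 * n))"
    using assms N by (intro mult_right_mono card_L1_scaled) (auto simp: R_def)
  also have "... \<le> (exp (R * n) * (exp (2 * n) * real N ^ card E)) * (exp (KK * n) * exp (2 * n))"
  proof (intro mult_right_mono mult_left_mono)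
    have "(3::real) ^ card E \<le> exp 2 ^ card E" using exp_ge_add_one_self[of 2] by (intro power_mono) auto
    also have "... = exp (2 * real (card E))" by (simp add: exp_of_nat_mult[symmetric] mult.commute)
    also have "... \<le> exp (2 * n)" using assms(4) by simp
    finally show "(3 * real N) ^ card E \<le> exp (2 * n) * real N ^ card E" by (simp add: power_mult_distrib mult_right_mono)
  qed auto
  also have "... = exp ((2 * \<rho> + K1 \<beta> \<tau> + 10) * n) * real N ^ card E"
  proof -
    have "exp ((2 * \<rho> + K1 \<beta> \<tau> + 10) * n) = exp (R * n) * exp (2 * n) * exp (KK * n) * exp (2 * n)"
      unfolding exp_add[symmetric] R_def KK_def by (simp add: algebra_simps)
    then show ?thesis by (simp only: mult_ac)
  qed
  also have "... \<le> exp ((2 * \<rho> + K1 \<beta> \<tau> + 12) * n) * real N ^ card E" using n by (intro mult_right_mono) auto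
  finally have main: "real (card Q) * real (card G') \<le> exp ((2 * \<rho> + K1 \<beta> \<tau> + 12) * n) * real N ^ card E" .
  have "real N ^ (p - k) \<le> real (2 * N + 1) ^ (p - k)" by (intro power_mono) auto
  also have "... = real (card G)" by (simp add: G(3))
  also have "... \<le> 2 * real (card G')" by (rule G'half)
  finally have "real (card Q) * real N ^ (p - k) \<le> real (card Q) * (2 * real (card G'))" by (rule mult_left_mono) simp
  also have "... \<le> 2 * (exp ((2 * \<rho> + K1 \<beta> \<tau> + 12) * n) * real N ^ card E)" using main by simp
  finally show "real (card Q) * real N ^ (card C - k) \<le> 2 * exp ((2 * \<rho> + K1 \<beta> \<tau> + 12) * n) * real N ^ card E" by (simp add: p_def)
qed

section \<open>Summing Fejer weights over the integer points of a ball\<close>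

lemma inv_sq_sum: "(\<Sum>y\<in>{- int b..int b}. 1 / (1 + (real_of_int y)\<^sup>2)) \<le> 5"
proof -
  have "(\<Sum>i\<in>{1..b}. 1 / (1 + (real i)\<^sup>2)) \<le> 2 - 1 / real b" if "b \<ge> 1" for b :: nat using that
  proof (induction b rule: dec_induct)
    case (step b)
    then have b: "real b \<ge> 1" by simp
    have "1 / (1 + (real (Suc b))\<^sup>2) \<le> 1 / (real b * real (Suc b))"
      using b by (intro frac_le mult_pos_pos) (auto simp: power2_eq_square algebra_simps)
    also have "... = 1 / real b - 1 / real (Suc b)" using b by (simp add: field_simps)
    finally show ?case using step by simp
  qed simp
  then have s: "(\<Sum>i\<in>{1..b}. 1 / (1 + (real i)\<^sup>2)) \<le> 2" by (cases "b \<ge> 1") (auto intro: order_trans[of _ "2 - 1 / real b"])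
  have "(\<Sum>y\<in>{- int b..int b}. 1 / (1 + (real_of_int y)\<^sup>2)) = 1 + 2 * (\<Sum>i\<in>{1..b}. 1 / (1 + (real i)\<^sup>2))"
    unfolding sum_int_sym by (simp add: sum.distrib[symmetric] sum_distrib_left)
  then show ?thesis using s by simp
qed

lemma floor_decay: "1 / (1 + x\<^sup>2) \<le> 4 / (1 + (real_of_int \<lfloor>x\<rfloor>)\<^sup>2)"
proof -
  define a where "a = real_of_int \<lfloor>x\<rfloor>"
  have a: "a \<le> x" "x < a + 1" unfolding a_def by linarith+
  have "a\<^sup>2 \<le> 2 * x\<^sup>2 + 2"
  proof -
    have "(a - x)\<^sup>2 \<le> 1" using a by (simp add: abs_square_le_1)
    moreover have "0 \<le> (x - (a - x))\<^sup>2" by simp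
    moreover have "a = x + (a - x)" by simp
    then have "a\<^sup>2 = x\<^sup>2 + (a - x)\<^sup>2 + 2 * x * (a - x)" by (metis power2_sum)
    moreover have "(x - (a - x))\<^sup>2 = x\<^sup>2 + (a - x)\<^sup>2 - 2 * x * (a - x)" by (rule power2_diff)
    ultimately show ?thesis by linarith
  qed
  then have "1 + a\<^sup>2 \<le> 3 + 2 * x\<^sup>2" by simp
  also have "... \<le> 4 * (1 + x\<^sup>2)" by simp
  finally have "1 + a\<^sup>2 \<le> 4 * (1 + x\<^sup>2)" .
  then show ?thesis unfolding a_def[symmetric] by (simp add: field_simps add_nonneg_pos add_pos_nonneg)
qed

text \<open>Group the vectors by the cell of side \<open>\<sigma>\<close> that contains their image.
  Differences inside a cell are counted by \<open>count_near_kernel\<close>, with radius doubled and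
  tolerance 4 because \<open>\<sigma>\<close> is 4 sqrt n. Quadratic decay then sums over all cells
  to at most 68 * 5 = 340 per column. The bound on \<open>2 * \<rho> * N * n\<close> keeps every
  image inside the window of \<open>fej_decay\<close>.\<close>

lemma sum_fej_near_kernel:
  fixes H :: "'e => 'c => real" and N :: nat
  assumes "finite E" "finite C" "C \<noteq> {}" "real (card E) \<le> n" "real (card C) \<le> n"
    "\<And>i c. i \<in> E ==> c \<in> C ==> \<bar>H i c\<bar> \<le> 2" "0 < \<beta>" "\<beta> \<le> 1" "\<rho> \<ge> 0" "N \<ge> 1"
    "orthon C w (card C)" "k \<le> card C"
    "\<And>x. ip C x x = 1 ==> (\<forall>i<k. ip C (w i) x = 0) ==> \<beta>\<^sup>2 * n \<le> ip E (Hx C H x) (Hx C H x)"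
    "\<sigma> = 4 * sqrt n" "T > 0" "2 * \<rho> * real N * n \<le> \<sigma> * real T"
  defines "U \<equiv> {u \<in> PiE E (\<lambda>_. UNIV). (\<Sum>i\<in>E. (real_of_int (u i))\<^sup>2) \<le> \<rho>\<^sup>2 * (real N)\<^sup>2 * n}"
  shows "finite U" "(\<Sum>u\<in>U. \<Prod>c\<in>C. fej T \<sigma> (\<Sum>i\<in>E. H i c * real_of_int (u i))) * real N ^ (card C - k)
    \<le> 2 * exp ((4 * \<rho> + K1 \<beta> 4 + 352) * n) * real N ^ card E"
proof -
  have n: "n \<ge> 1" using assms(2,3,5) by (metis One_nat_def Suc_leI card_gt_0_iff le_trans of_nat_1 of_nat_le_iff order_trans)
  have sig: "\<sigma> > 0" using n assms by simp
  have l1: "(\<Sum>i\<in>E. \<bar>real_of_int (u i)\<bar>) \<le> \<rho> * real N * n" if "u \<in> U" for u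
  proof -
    have "(\<Sum>i\<in>E. \<bar>real_of_int (u i)\<bar>) \<le> sqrt (real (card E) * (\<rho>\<^sup>2 * (real N)\<^sup>2 * n))"
      using that by (intro sum_abs_le_sqrt) (auto simp: U_def)
    also have "... \<le> sqrt (n * (\<rho>\<^sup>2 * (real N)\<^sup>2 * n))" using assms(4) n by (intro real_sqrt_le_mono mult_right_mono) auto
    also have "... = \<rho> * real N * n" using n assms(9) by (simp add: real_sqrt_mult)
    finally show ?thesis .
  qed
  show fU: "finite U" by (rule finite_subset[OF _ finite_L1[OF assms(1), of "\<rho> * real N * n"]])
       (use l1 in \<open>auto simp: L1_def U_def\<close>)
  define X where "X u c = (\<Sum>i\<in>E. H i c * real_of_int (u i))" for u c
  have Xb: "\<bar>X u c\<bar> \<le> \<sigma> * real T" if "u \<in> U" "c \<in> C" for u c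
  proof -
    have "\<bar>X u c\<bar> \<le> (\<Sum>i\<in>E. \<bar>H i c\<bar> * \<bar>real_of_int (u i)\<bar>)" unfolding X_def abs_mult[symmetric] by (rule sum_abs)
    also have "... \<le> (\<Sum>i\<in>E. 2 * \<bar>real_of_int (u i)\<bar>)" using assms(6) that by (intro sum_mono mult_right_mono) auto
    also have "... \<le> 2 * (\<rho> * real N * n)" using l1[OF that(1)] by (simp add: sum_distrib_left[symmetric])
    finally show ?thesis using assms(16) by simp
  qed
  define cell where "cell u = (\<lambda>c\<in>C. \<lfloor>X u c / \<sigma>\<rfloor>)" for u
  define A where "A = T + 1"
  define P where "P = PiE C (\<lambda>_. {- int A..int A})"
  have fP: "finite P" unfolding P_def using assms by (intro finite_PiE) auto
  have cellP: "cell u \<in> P" if "u \<in> U" for u unfolding P_def cell_def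
  proof (rule restrict_PiE_iff[THEN iffD2], intro ballI)
    fix c assume c: "c \<in> C"
    have "\<bar>X u c / \<sigma>\<bar> \<le> real T" using Xb[OF that c] sig by (simp add: abs_divide pos_divide_le_eq mult.commute)
    then have "X u c / \<sigma> \<le> real T" "- real T \<le> X u c / \<sigma>" by linarith+
    then have "\<lfloor>X u c / \<sigma>\<rfloor> \<le> int A" "- int A \<le> \<lfloor>X u c / \<sigma>\<rfloor>" unfolding A_def by linarith+
    then show "\<lfloor>X u c / \<sigma>\<rfloor> \<in> {- int A..int A}" by simp
  qed
  define q where "q = 2 * exp ((2 * (2 * \<rho>) + K1 \<beta> 4 + 12) * n) * real N ^ card E / real N ^ (card C - k)"
  have q0: "q \<ge> 0" by (simp add: q_def)
  have cellcard: "real (card {u\<in>U. cell u = a}) \<le> q" for a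
  proof (cases "{u\<in>U. cell u = a} = {}")
    case True
    show ?thesis unfolding True using q0 by simp
  next
    case False
    then obtain u0 where u0: "u0 \<in> U" "cell u0 = a" by auto
    let ?Q = "{u \<in> PiE E (\<lambda>_. UNIV). (\<Sum>i\<in>E. (real_of_int (u i))\<^sup>2) \<le> (2 * \<rho>)\<^sup>2 * (real N)\<^sup>2 * n \<and>
      (\<forall>c\<in>C. \<bar>\<Sum>i\<in>E. H i c * real_of_int (u i)\<bar> \<le> 4 * sqrt n)}"
    have cnt1: "finite ?Q" by (rule count_near_kernel(1)[OF assms(1-5) _ assms(7,8)], rule assms(6), assumption, assumption,
          simp, use assms(9) in simp, rule assms(10), rule assms(11), rule assms(12), rule assms(13), assumption+)
    have cnt2: "real (card ?Q) * real N ^ (card C - k) \<le> 2 * exp ((2 * (2 * \<rho>) + K1 \<beta> 4 + 12) * n) * real N ^ card E"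
      by (rule count_near_kernel(2)[OF assms(1-5) _ assms(7,8)], rule assms(6), assumption, assumption,
          simp, use assms(9) in simp, rule assms(10), rule assms(11), rule assms(12), rule assms(13), assumption+)
    note cnt = cnt1 cnt2
    let ?g = "\<lambda>u. \<lambda>i\<in>E. u i - u0 i"
    have inj: "inj_on ?g {u\<in>U. cell u = a}"
    proof (rule inj_onI)
      fix u v assume uv: "u \<in> {u\<in>U. cell u = a}" "v \<in> {u\<in>U. cell u = a}" "?g u = ?g v"
      show "u = v"
      proof
        fix i
        have "?g u i = ?g v i" using uv(3) by (simp only:)
        then show "u i = v i" using uv(1,2) by (cases "i \<in> E") (auto simp: U_def PiE_def extensional_def)
      qed
    qed
    have img: "?g ` {u\<in>U. cell u = a} \<subseteq> ?Q"
    proof (rule image_subsetI)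
      fix u assume "u \<in> {u\<in>U. cell u = a}"
      then have u: "u \<in> U" "cell u = a" by auto
      have s1: "(\<Sum>i\<in>E. (real_of_int (?g u i))\<^sup>2) \<le> (2 * \<rho>)\<^sup>2 * (real N)\<^sup>2 * n"
      proof -
        have "(\<Sum>i\<in>E. (real_of_int (?g u i))\<^sup>2) \<le> (\<Sum>i\<in>E. 2 * (real_of_int (u i))\<^sup>2 + 2 * (real_of_int (u0 i))\<^sup>2)"
        proof (rule sum_mono)
          fix i assume "i \<in> E"
          have "0 \<le> (real_of_int (u i) + real_of_int (u0 i))\<^sup>2" by simp
          then show "(real_of_int (?g u i))\<^sup>2 \<le> 2 * (real_of_int (u i))\<^sup>2 + 2 * (real_of_int (u0 i))\<^sup>2"
            using \<open>i \<in> E\<close> by (simp add: power2_sum power2_diff)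
        qed
        also have "... = 2 * (\<Sum>i\<in>E. (real_of_int (u i))\<^sup>2) + 2 * (\<Sum>i\<in>E. (real_of_int (u0 i))\<^sup>2)" by (simp add: sum.distrib sum_distrib_left)
        also have "... \<le> 2 * (\<rho>\<^sup>2 * (real N)\<^sup>2 * n) + 2 * (\<rho>\<^sup>2 * (real N)\<^sup>2 * n)"
          using u(1) u0(1) by (intro add_mono mult_left_mono) (auto simp: U_def)
        finally show ?thesis by (simp add: power2_eq_square mult_ac)
      qed
      have s2: "\<bar>\<Sum>i\<in>E. H i c * real_of_int (?g u i)\<bar> \<le> 4 * sqrt n" if c: "c \<in> C" for c
      proof -
        have "(\<Sum>i\<in>E. H i c * real_of_int (?g u i)) = X u c - X u0 c"
          unfolding X_def sum_subtractf[symmetric] by (intro sum.cong refl) (simp add: right_diff_distrib)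
        moreover have "\<lfloor>X u c / \<sigma>\<rfloor> = \<lfloor>X u0 c / \<sigma>\<rfloor>"
        proof -
          have "cell u c = cell u0 c" using u(2) u0(2) by (simp only:)
          then show ?thesis using c by (simp add: cell_def)
        qed
        then have "\<bar>X u c / \<sigma> - X u0 c / \<sigma>\<bar> \<le> 1" by linarith
        then have "\<bar>X u c - X u0 c\<bar> \<le> \<sigma>" using sig by (simp add: diff_divide_distrib[symmetric] abs_divide)
        ultimately show ?thesis using assms(14) by simp
      qed
      show "?g u \<in> ?Q" using s1 s2 by simp
    qed
    have "real (card {u\<in>U. cell u = a}) \<le> real (card ?Q)" using card_mono[OF cnt(1) img] card_image[OF inj] by simp
    also have "... \<le> q" unfolding q_def using cnt(2) assms(10) by (simp add: pos_le_divide_eq)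
    finally show ?thesis .
  qed
  have "(\<Sum>u\<in>U. \<Prod>c\<in>C. fej T \<sigma> (X u c)) \<le> (\<Sum>u\<in>U. \<Prod>c\<in>C. 68 / (1 + (real_of_int (cell u c))\<^sup>2))"
  proof (intro sum_mono prod_mono conjI)
    fix u c assume u: "u \<in> U" and c: "c \<in> C"
    show "0 \<le> fej T \<sigma> (X u c)" by (rule fej_nonneg)
    have "fej T \<sigma> (X u c) \<le> 17 * (1 / (1 + (X u c / \<sigma>)\<^sup>2))" using fej_decay[OF assms(15) sig Xb[OF u c]] by simp
    also have "... \<le> 17 * (4 / (1 + (real_of_int \<lfloor>X u c / \<sigma>\<rfloor>)\<^sup>2))" by (intro mult_left_mono floor_decay) auto
    finally show "fej T \<sigma> (X u c) \<le> 68 / (1 + (real_of_int (cell u c))\<^sup>2)" using c by (simp add: cell_def)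
  qed
  also have "... = (\<Sum>a\<in>P. \<Sum>u\<in>{u\<in>U. cell u = a}. \<Prod>c\<in>C. 68 / (1 + (real_of_int (cell u c))\<^sup>2))"
    by (rule sum.group[symmetric]) (use fU fP cellP in auto)
  also have "... = (\<Sum>a\<in>P. real (card {u\<in>U. cell u = a}) * (\<Prod>c\<in>C. 68 / (1 + (real_of_int (a c))\<^sup>2)))" by (intro sum.cong refl) simp
  also have "... \<le> (\<Sum>a\<in>P. q * (\<Prod>c\<in>C. 68 / (1 + (real_of_int (a c))\<^sup>2)))"
    by (intro sum_mono mult_right_mono cellcard prod_nonneg) (auto intro!: divide_nonneg_pos add_pos_nonneg)
  also have "... = q * (\<Prod>c\<in>C. \<Sum>y\<in>{- int A..int A}. 68 / (1 + (real_of_int y)\<^sup>2))"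
    unfolding sum_distrib_left[symmetric] P_def using assms(2) by (subst prod_sum_PiE) auto
  also have "... \<le> q * (\<Prod>c\<in>C. 340)"
  proof (intro mult_left_mono prod_mono conjI q0)
    fix c
    show "0 \<le> (\<Sum>y\<in>{- int A..int A}. 68 / (1 + (real_of_int y)\<^sup>2))" by (intro sum_nonneg divide_nonneg_pos add_pos_nonneg) auto
    have "(\<Sum>y\<in>{- int A..int A}. 68 / (1 + (real_of_int y)\<^sup>2)) = 68 * (\<Sum>y\<in>{- int A..int A}. 1 / (1 + (real_of_int y)\<^sup>2))"
      by (simp add: sum_distrib_left)
    also have "... \<le> 68 * 5" by (intro mult_left_mono inv_sq_sum) auto
    finally show "(\<Sum>y\<in>{- int A..int A}. 68 / (1 + (real_of_int y)\<^sup>2)) \<le> 340" by simp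
  qed
  also have "... \<le> q * exp (340 * n)"
  proof (rule mult_left_mono[OF _ q0])
    have "(\<Prod>c\<in>C. 340) \<le> exp (340::real) ^ card C" using exp_ge_add_one_self[of "340::real"] by (simp add: power_mono)
    also have "... = exp (340 * real (card C))" by (simp add: exp_of_nat_mult[symmetric] mult.commute)
    also have "... \<le> exp (340 * n)" using assms(5) by simp
    finally show "(\<Prod>c\<in>C. 340) \<le> exp (340 * n)" .
  qed
  finally have "(\<Sum>u\<in>U. \<Prod>c\<in>C. fej T \<sigma> (X u c)) * real N ^ (card C - k) \<le> (q * exp (340 * n)) * real N ^ (card C - k)"
    by (rule mult_right_mono) simp
  also have "... = 2 * (exp ((2 * (2 * \<rho>) + K1 \<beta> 4 + 12) * n) * exp (340 * n)) * real N ^ card E" using assms(10) by (simp add: q_def)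
  also have "... = 2 * exp ((4 * \<rho> + K1 \<beta> 4 + 352) * n) * real N ^ card E" unfolding exp_add[symmetric] by (simp add: algebra_simps)
  finally show "(\<Sum>u\<in>U. \<Prod>c\<in>C. fej T \<sigma> (\<Sum>i\<in>E. H i c * real_of_int (u i))) * real N ^ (card C - k)
    \<le> 2 * exp ((4 * \<rho> + K1 \<beta> 4 + 352) * n) * real N ^ card E" unfolding X_def .
qed

section \<open>Nets for almost singular directions\<close>

lemma sq_add_le: "(a + b)\<^sup>2 \<le> 2 * a\<^sup>2 + 2 * (b::real)\<^sup>2"
proof -
  have "0 \<le> (a - b)\<^sup>2" by simp
  then show ?thesis by (simp add: power2_sum power2_diff)
qed

lemma ip_eq_sum_sq: "ip C x x = (\<Sum>c\<in>C. (x c)\<^sup>2)"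
  by (simp add: ip_def power2_eq_square)

text \<open>Rounding each vector separately controls only the Hilbert-Schmidt norm of the
  perturbation, by k \<zeta>^2. By Bessel's inequality at most half of the coefficient directions
  can carry 2 \<zeta>^2 or more; after discarding these by \<open>greedy_onb\<close> the
  perturbation is small in operator norm. Rotating by the remaining k' \<ge> k/2 coefficient vectors
  does not increase the quadratic form of the rounded system.\<close>

lemma wellcond_perturbation:
  fixes w wt :: "nat => 'c => real"
  assumes "finite C" "orthon C w k" "0 < \<zeta>" "\<zeta>\<^sup>2 \<le> 1/8"
    "\<And>l. l < k ==> (\<Sum>c\<in>C. (wt l c - w l c)\<^sup>2) \<le> \<zeta>\<^sup>2"
  shows "\<exists>W k'. k \<le> 2 * k' \<and> k' \<le> k \<and> wellcond C W k' \<and>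
    (\<forall>r. (\<Sum>l<k'. (\<Sum>c\<in>C. W c l * r c)\<^sup>2) \<le> (\<Sum>l<k. (ip C (wt l) r)\<^sup>2))"
proof -
  define \<Delta> where "\<Delta> l c = wt l c - w l c" for l c
  define Dn where "Dn x = (\<Sum>c\<in>C. (ip {..<k} x (\<lambda>l. \<Delta> l c))\<^sup>2)" for x
  obtain ov p0 where o: "p0 \<le> card {..<k}" "orthon {..<k} ov (card {..<k})" "\<forall>i<p0. 2 * \<zeta>\<^sup>2 \<le> Dn (ov i)"
    "\<forall>x. ip {..<k} x x = 1 --> (\<forall>i<p0. ip {..<k} (ov i) x = 0) --> \<not> 2 * \<zeta>\<^sup>2 \<le> Dn x"
    using greedy_onb[of "{..<k}" "\<lambda>x. 2 * \<zeta>\<^sup>2 \<le> Dn x"] by auto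
  have p0k: "p0 \<le> k" and orth: "orthon {..<k} ov k" using o(1,2) by auto
  have "real p0 * (2 * \<zeta>\<^sup>2) \<le> (\<Sum>i<p0. Dn (ov i))" using sum_mono[of "{..<p0}" "\<lambda>_. 2 * \<zeta>\<^sup>2" "\<lambda>i. Dn (ov i)"] o(3) by simp
  also have "... = (\<Sum>c\<in>C. \<Sum>i<p0. (ip {..<k} (ov i) (\<lambda>l. \<Delta> l c))\<^sup>2)" unfolding Dn_def by (rule sum.swap)
  also have "... \<le> (\<Sum>c\<in>C. ip {..<k} (\<lambda>l. \<Delta> l c) (\<lambda>l. \<Delta> l c))" using p0k by (intro sum_mono bessel[OF orth]) auto
  also have "... = (\<Sum>l<k. \<Sum>c\<in>C. (\<Delta> l c)\<^sup>2)" unfolding ip_eq_sum_sq by (rule sum.swap)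
  also have "... \<le> (\<Sum>l<k. \<zeta>\<^sup>2)" unfolding \<Delta>_def using assms(5) by (intro sum_mono) auto
  finally have "(2 * real p0) * \<zeta>\<^sup>2 \<le> real k * \<zeta>\<^sup>2" by (simp add: mult_ac)
  then have p02: "2 * p0 \<le> k" using assms(3) by (simp add: mult_le_cancel_right)
  define k' where "k' = k - p0"
  define o' where "o' l = ov (p0 + l)" for l
  define W where "W c l = (\<Sum>j<k. o' l j * wt j c)" for c l
  have orth': "orthon {..<k} o' k'" using orth p0k unfolding orthon_def o'_def k'_def by auto
  define \<xi> where "\<xi> x j = (\<Sum>l<k'. x l * o' l j)" for x j
  have xixi: "ip {..<k} (\<xi> x) (\<xi> x) = (\<Sum>l<k'. (x l)\<^sup>2)" for x
    unfolding \<xi>_def[abs_def] using ip_lincomb[OF orth' subset_refl, of x x] by (simp add: power2_eq_square)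
  have Dxi: "Dn (\<xi> x) \<le> 2 * \<zeta>\<^sup>2 * (\<Sum>l<k'. (x l)\<^sup>2)" for x
  proof (cases "ip {..<k} (\<xi> x) (\<xi> x) = 0")
    case True
    then have "Dn (\<xi> x) \<le> 0" unfolding Dn_def by (intro sum_nonpos order_trans[OF cauchy_schwarz_ip]) simp
    moreover have "0 \<le> 2 * \<zeta>\<^sup>2 * (\<Sum>l<k'. (x l)\<^sup>2)" by (simp add: sum_nonneg)
    ultimately show ?thesis by linarith
  next
    case False
    then have pos: "ip {..<k} (\<xi> x) (\<xi> x) > 0" using ip_nonneg[of "{..<k}" "\<xi> x"] by linarith
    define r where "r = 1 / sqrt (ip {..<k} (\<xi> x) (\<xi> x))"
    have rr: "r * r = 1 / ip {..<k} (\<xi> x) (\<xi> x)" using pos by (simp add: r_def)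
    have "ip {..<k} (\<lambda>j. r * \<xi> x j) (\<lambda>j. r * \<xi> x j) = 1"
      using pos by (simp only: ip_scale_left ip_scale_right mult.assoc[symmetric] rr) simp
    moreover have "\<forall>i<p0. ip {..<k} (ov i) (\<lambda>j. r * \<xi> x j) = 0"
    proof (intro allI impI)
      fix i assume i: "i < p0"
      have "ip {..<k} (ov i) (\<xi> x) = (\<Sum>l<k'. x l * ip {..<k} (ov i) (o' l))" unfolding \<xi>_def[abs_def] by (rule ip_sum_right)
      also have "... = 0" using i orth p0k by (intro sum.neutral) (auto simp: orthon_def o'_def k'_def)
      finally show "ip {..<k} (ov i) (\<lambda>j. r * \<xi> x j) = 0" by (simp add: ip_scale_right)
    qed
    ultimately have "Dn (\<lambda>j. r * \<xi> x j) \<le> 2 * \<zeta>\<^sup>2" using o(4) by force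
    moreover have "Dn (\<lambda>j. r * \<xi> x j) = (r * r) * Dn (\<xi> x)"
      unfolding Dn_def ip_scale_left by (simp add: sum_distrib_left power2_eq_square mult_ac)
    ultimately show ?thesis using pos unfolding rr xixi by (simp add: field_simps)
  qed
  have WX: "(\<Sum>l<k'. W c l * x l) = ip {..<k} (\<xi> x) (\<lambda>j. w j c) + ip {..<k} (\<xi> x) (\<lambda>j. \<Delta> j c)" for c x
  proof -
    have "(\<Sum>l<k'. W c l * x l) = (\<Sum>j<k. \<xi> x j * wt j c)" unfolding W_def \<xi>_def sum_distrib_right by (subst sum.swap) (simp add: mult_ac)
    also have "... = ip {..<k} (\<xi> x) (\<lambda>j. w j c + \<Delta> j c)" by (simp add: ip_def \<Delta>_def)
    finally show ?thesis by (simp add: ip_add_right)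
  qed
  have Wx: "(\<Sum>c\<in>C. (ip {..<k} (\<xi> x) (\<lambda>j. w j c))\<^sup>2) = (\<Sum>l<k'. (x l)\<^sup>2)" for x
  proof -
    have "(\<Sum>c\<in>C. (ip {..<k} (\<xi> x) (\<lambda>j. w j c))\<^sup>2) = ip C (\<lambda>c. \<Sum>j<k. \<xi> x j * w j c) (\<lambda>c. \<Sum>j<k. \<xi> x j * w j c)"
      by (simp add: ip_eq_sum_sq) (simp add: ip_def)
    also have "... = (\<Sum>j<k. \<xi> x j * \<xi> x j)" by (rule ip_lincomb[OF assms(2) subset_refl])
    also have "... = ip {..<k} (\<xi> x) (\<xi> x)" by (simp add: ip_def)
    finally show ?thesis by (simp add: xixi)
  qed
  have wc: "wellcond C W k'" unfolding wellcond_def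
  proof (intro conjI allI)
    fix x
    have "(\<Sum>c\<in>C. (\<Sum>l<k'. W c l * x l)\<^sup>2) \<le> (\<Sum>c\<in>C. 2 * (ip {..<k} (\<xi> x) (\<lambda>j. w j c))\<^sup>2 + 2 * (ip {..<k} (\<xi> x) (\<lambda>j. \<Delta> j c))\<^sup>2)"
      unfolding WX by (intro sum_mono sq_add_le)
    also have "... = 2 * (\<Sum>l<k'. (x l)\<^sup>2) + 2 * Dn (\<xi> x)" by (simp add: sum.distrib sum_distrib_left[symmetric] Wx Dn_def)
    also have "... \<le> 2 * (\<Sum>l<k'. (x l)\<^sup>2) + 2 * (2 * \<zeta>\<^sup>2 * (\<Sum>l<k'. (x l)\<^sup>2))" using Dxi[of x] by simp
    also have "... = (2 + 4 * \<zeta>\<^sup>2) * (\<Sum>l<k'. (x l)\<^sup>2)" by (simp add: algebra_simps)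
    also have "... \<le> 4 * (\<Sum>l<k'. (x l)\<^sup>2)" using assms(4) by (intro mult_right_mono) (auto simp: sum_nonneg)
    finally show "(\<Sum>c\<in>C. (\<Sum>l<k'. W c l * x l)\<^sup>2) \<le> 4 * (\<Sum>l<k'. (x l)\<^sup>2)" .
  next
    have "1/4 \<le> (\<Sum>c\<in>C. (W c l)\<^sup>2)" if l: "l < k'" for l
    proof -
      define x where "x = (\<lambda>l'. if l' = l then 1 else (0::real))"
      have x1: "(\<Sum>l<k'. (x l)\<^sup>2) = 1" using l by (simp add: x_def if_distrib[of "\<lambda>x. x\<^sup>2"] cong: if_cong)
      have x2: "(\<Sum>l<k'. W c l * x l) = W c l" for c using l by (simp add: x_def if_distrib cong: if_cong)
      have "(\<Sum>c\<in>C. (ip {..<k} (\<xi> x) (\<lambda>j. w j c))\<^sup>2) \<le> (\<Sum>c\<in>C. 2 * (W c l)\<^sup>2 + 2 * (ip {..<k} (\<xi> x) (\<lambda>j. \<Delta> j c))\<^sup>2)"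
      proof (rule sum_mono)
        fix c
        have "ip {..<k} (\<xi> x) (\<lambda>j. w j c) = W c l + - ip {..<k} (\<xi> x) (\<lambda>j. \<Delta> j c)" using WX[of c x] x2[of c] by simp
        then show "(ip {..<k} (\<xi> x) (\<lambda>j. w j c))\<^sup>2 \<le> 2 * (W c l)\<^sup>2 + 2 * (ip {..<k} (\<xi> x) (\<lambda>j. \<Delta> j c))\<^sup>2"
          using sq_add_le[of "W c l" "- ip {..<k} (\<xi> x) (\<lambda>j. \<Delta> j c)"] by simp
      qed
      also have "... = 2 * (\<Sum>c\<in>C. (W c l)\<^sup>2) + 2 * Dn (\<xi> x)" by (simp add: sum.distrib sum_distrib_left[symmetric] Dn_def)
      finally show ?thesis using Dxi[of x] assms(4) unfolding Wx x1 by linarith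
    qed
    then have "(\<Sum>l<k'. 1/4) \<le> (\<Sum>l<k'. \<Sum>c\<in>C. (W c l)\<^sup>2)" by (intro sum_mono) auto
    also have "... = (\<Sum>c\<in>C. \<Sum>l<k'. (W c l)\<^sup>2)" by (rule sum.swap)
    finally show "real k' / 4 \<le> (\<Sum>c\<in>C. \<Sum>l<k'. (W c l)\<^sup>2)" by simp
  qed
  have "(\<Sum>l<k'. (\<Sum>c\<in>C. W c l * r c)\<^sup>2) \<le> (\<Sum>l<k. (ip C (wt l) r)\<^sup>2)" for r
  proof -
    have "(\<Sum>c\<in>C. W c l * r c) = ip {..<k} (o' l) (\<lambda>j. ip C (wt j) r)" for l
      unfolding W_def ip_def sum_distrib_right sum_distrib_left by (subst sum.swap) (simp add: mult_ac)
    then have "(\<Sum>l<k'. (\<Sum>c\<in>C. W c l * r c)\<^sup>2) = (\<Sum>l<k'. (ip {..<k} (o' l) (\<lambda>j. ip C (wt j) r))\<^sup>2)" by simp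
    also have "... \<le> ip {..<k} (\<lambda>j. ip C (wt j) r) (\<lambda>j. ip C (wt j) r)" by (rule bessel[OF orth' subset_refl])
    finally show ?thesis by (simp add: ip_eq_sum_sq)
  qed
  then show ?thesis using wc p02 p0k by (intro exI[of _ W] exI[of _ k']) (auto simp: k'_def)
qed

text \<open>Turns a bound on a quadratic form into a lower bound for the soft indicator used in
  \<open>row_bound\<close>. It follows from 1 - x \<ge> e^(-2x) on [0, 1/2].\<close>

lemma phi_lower: "exp (- (y\<^sup>2 / 64)) \<le> phi (y / 8)"
proof -
  define x where "x = (sin (y/8))\<^sup>2 / 2"
  have x: "0 \<le> x" "x \<le> 1/2" by (auto simp: x_def abs_square_le_1)
  have "(sin (y/8))\<^sup>2 \<le> (y/8)\<^sup>2" using abs_sin_x_le_abs_x[of "y/8"] by (rule abs_le_square_iff[THEN iffD1])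
  then have x2: "2 * x \<le> y\<^sup>2 / 64" by (simp add: x_def power_divide)
  have "1 / (1 - x) = 1 + x / (1 - x)" using x by (simp add: field_simps)
  also have "x / (1 - x) \<le> x / (1/2)" using x by (intro divide_left_mono) auto
  finally have "1 / (1 - x) \<le> 1 + 2 * x" by simp
  also have "... \<le> exp (2 * x)" by (rule exp_ge_add_one_self)
  finally have "1 / (1 - x) \<le> exp (2 * x)" .
  then have "1 \<le> exp (2 * x) * (1 - x)" using x by (simp add: pos_divide_le_eq)
  then have "exp (- (2 * x)) * 1 \<le> exp (- (2 * x)) * (exp (2 * x) * (1 - x))" by (intro mult_left_mono) auto
  also have "... = 1 - x" by (simp add: exp_minus field_simps)
  finally have "exp (- (2 * x)) \<le> phi (y/8)" by (simp add: phi_sin x_def)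
  moreover have "exp (- (y\<^sup>2 / 64)) \<le> exp (- (2 * x))" using x2 by simp
  ultimately show ?thesis by linarith
qed

text \<open>The square root of \<open>del0\<close>, so that the error of the net in one direction
  matches the threshold in \<open>smallk\<close>.\<close>

definition \<zeta>0 :: real where "\<zeta>0 = 1 / 2 ^ 13"

lemma zeta0: "\<zeta>0 > 0" "\<zeta>0\<^sup>2 = del0" "\<zeta>0\<^sup>2 \<le> 1/8" "\<zeta>0 \<le> 1"
  by (simp_all add: \<zeta>0_def del0_def power2_eq_square)

text \<open>A lazy entry has variance 1, so a fixed unit vector has an image of mean squared norm
  \<open>card E\<close>; the directions counted here fall below a tiny fraction of that.\<close>

definition smallk :: "'e set => 'c set => ('e => 'c => real) => real => nat => bool" where
  "smallk E C H n k \<longleftrightarrow> (\<exists>w. orthon C w k \<and> (\<forall>l<k. ip E (Hx C H (w l)) (Hx C H (w l)) \<le> del0 * n))"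

definition latv :: "'c set => ('c => int) => 'c => real" where
  "latv C y c = \<zeta>0 / sqrt (real (card C)) * of_int (y c)"

definition YN :: "'c set => ('c => int) set" where "YN C = L1 C (2 * real (card C) / \<zeta>0)"

lemma card_YN:
  assumes "finite C"
  shows "real (card (YN C)) \<le> (2 ^ 18) ^ card C"
proof -
  have "real (card (YN C)) \<le> exp (\<zeta>0 * (2 * real (card C) / \<zeta>0)) * (1 + 2 / (exp \<zeta>0 - 1)) ^ card C"
    unfolding YN_def by (rule card_L1[OF assms zeta0(1)])
  also have "exp (\<zeta>0 * (2 * real (card C) / \<zeta>0)) = exp 2 ^ card C" using zeta0 by (simp add: exp_of_nat_mult[symmetric] mult.commute)
  also have "exp 2 ^ card C * (1 + 2 / (exp \<zeta>0 - 1)) ^ card C = (exp 2 * (1 + 2 / (exp \<zeta>0 - 1))) ^ card C" by (simp add: power_mult_distrib)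
  also have "... \<le> (2 ^ 18) ^ card C"
  proof (rule power_mono)
    have e: "\<zeta>0 \<le> exp \<zeta>0 - 1" using exp_ge_add_one_self[of \<zeta>0] by linarith
    then have "2 / (exp \<zeta>0 - 1) \<le> 2 / \<zeta>0" using zeta0 by (intro divide_left_mono) auto
    then have "1 + 2 / (exp \<zeta>0 - 1) \<le> 17000" by (simp add: \<zeta>0_def)
    moreover have "exp 2 \<le> (9::real)"
    proof -
      have "exp 1 * exp 1 \<le> (3 * 3 :: real)" using exp_le by (intro mult_mono) auto
      then show ?thesis by (simp add: exp_add[symmetric])
    qed
    moreover have nn: "0 \<le> 1 + 2 / (exp \<zeta>0 - 1)" using e zeta0 by simp
    ultimately have "exp 2 * (1 + 2 / (exp \<zeta>0 - 1)) \<le> 9 * 17000" by (intro mult_mono) auto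
    then show "exp 2 * (1 + 2 / (exp \<zeta>0 - 1)) \<le> 2 ^ 18" by simp
    show "0 \<le> exp 2 * (1 + 2 / (exp \<zeta>0 - 1))" using nn by simp
  qed
  finally show ?thesis .
qed

text \<open>The rounding lemma bounds the error of all rows of \<open>H\<close> on average by n |C|,
  whereas coordinatewise errors would only give order n |C|^2. A mesh of order 1 / sqrt |C|
  therefore suffices, and the net has a number of points per direction exponential in |C|,
  independently of n.\<close>

lemma smallk_net:
  fixes H :: "'e => 'c => real"
  assumes "finite E" "finite C" "C \<noteq> {}" "real (card E) \<le> n"
    "\<And>i c. i \<in> E ==> c \<in> C ==> \<bar>H i c\<bar> \<le> 2" "smallk E C H n k"
  shows "\<exists>y\<in>PiE {..<k} (\<lambda>_. YN C). (\<exists>w. orthon C w k \<and> (\<forall>l<k. (\<Sum>c\<in>C. (latv C (y l) c - w l c)\<^sup>2) \<le> \<zeta>0\<^sup>2)) \<and>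
     (\<Sum>i\<in>E. \<Sum>l<k. (ip C (latv C (y l)) (H i))\<^sup>2) \<le> 4 * del0 * n * real k"
proof -
  define p where "p = real (card C)"
  have p: "p > 0" using assms by (simp add: p_def card_gt_0_iff)
  obtain w where w: "orthon C w k" "\<And>l. l < k ==> ip E (Hx C H (w l)) (Hx C H (w l)) \<le> del0 * n"
    using assms(6) unfolding smallk_def by blast
  define s where "s = sqrt p / \<zeta>0"
  have s: "s > 0" using p zeta0 by (simp add: s_def)
  have sinv: "\<zeta>0 / sqrt p = 1 / s" by (simp add: s_def)
  have "\<exists>y\<in>YN C. (\<Sum>c\<in>C. (latv C y c - w l c)\<^sup>2) \<le> \<zeta>0\<^sup>2 \<and> (\<Sum>i\<in>E. (ip C (latv C y) (H i))\<^sup>2) \<le> 4 * del0 * n" if l: "l < k" for l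
  proof -
    obtain u :: "'c => int" where u: "\<And>c. c \<in> C ==> \<bar>of_int (u c) - s * w l c\<bar> \<le> 1"
      "(\<Sum>i\<in>E. 1 * (\<Sum>c\<in>C. H i c * (of_int (u c) - s * w l c))\<^sup>2) + (\<Sum>c\<in>C. 0 * \<bar>of_int (u c)\<bar>)
       \<le> (\<Sum>i\<in>E. 1 * (\<Sum>c\<in>C. (H i c)\<^sup>2)) / 4 + (\<Sum>c\<in>C. 0 * \<bar>s * w l c\<bar>)"
      by (rule rounding[of C E "\<lambda>_. 1" "\<lambda>c. s * w l c" H "\<lambda>_. 0"]) (use assms in auto)
    define y where "y = restrict u C"
    have ly: "latv C y c = of_int (u c) / s" if "c \<in> C" for c using that sinv by (simp add: latv_def y_def p_def[symmetric])
    have HH: "(\<Sum>i\<in>E. (\<Sum>c\<in>C. H i c * (of_int (u c) - s * w l c))\<^sup>2) \<le> n * p"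
    proof -
      have "(\<Sum>i\<in>E. \<Sum>c\<in>C. (H i c)\<^sup>2) \<le> (\<Sum>i\<in>E. \<Sum>c\<in>C. 4)"
      proof (intro sum_mono)
        fix i c assume "i \<in> E" "c \<in> C"
        then have "\<bar>H i c\<bar>\<^sup>2 \<le> 2\<^sup>2" using assms(5) by (intro power_mono) auto
        then show "(H i c)\<^sup>2 \<le> 4" by simp
      qed
      also have "... = 4 * (real (card E) * p)" by (simp add: p_def)
      also have "... \<le> 4 * (n * p)" using assms(4) p by simp
      finally show ?thesis using u(2) by simp
    qed
    have d: "latv C y c - w l c = (of_int (u c) - s * w l c) / s" if "c \<in> C" for c using ly[OF that] s by (simp add: diff_divide_distrib)
    have c1: "(\<Sum>c\<in>C. (latv C y c - w l c)\<^sup>2) \<le> \<zeta>0\<^sup>2"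
    proof -
      have "(\<Sum>c\<in>C. (latv C y c - w l c)\<^sup>2) \<le> (\<Sum>c\<in>C. (1 / s)\<^sup>2)"
      proof (rule sum_mono)
        fix c assume c: "c \<in> C"
        have "\<bar>latv C y c - w l c\<bar> \<le> \<bar>1 / s\<bar>" using d[OF c] u(1)[OF c] s by (simp add: abs_divide divide_right_mono)
        then show "(latv C y c - w l c)\<^sup>2 \<le> (1 / s)\<^sup>2" by (rule abs_le_square_iff[THEN iffD1])
      qed
      also have "... = p * (1 / s)\<^sup>2" by (simp add: p_def)
      also have "... = \<zeta>0\<^sup>2" using p zeta0 by (simp add: s_def power_divide)
      finally show ?thesis .
    qed
    have c2: "(\<Sum>i\<in>E. (ip C (latv C y) (H i))\<^sup>2) \<le> 4 * del0 * n"
    proof -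
      have "ip C (latv C y) (H i) = Hx C H (w l) i + (\<Sum>c\<in>C. H i c * (of_int (u c) - s * w l c)) / s" for i
      proof -
        have "ip C (latv C y) (H i) = ip C (\<lambda>c. w l c + (of_int (u c) - s * w l c) / s) (H i)"
          using d by (intro ip_cong) (auto simp: algebra_simps)
        also have "... = ip C (w l) (H i) + ip C (\<lambda>c. (of_int (u c) - s * w l c) / s) (H i)" by (rule ip_add_left)
        finally show ?thesis by (simp add: Hx_def ip_def sum_divide_distrib mult.commute)
      qed
      then have "(\<Sum>i\<in>E. (ip C (latv C y) (H i))\<^sup>2) \<le> (\<Sum>i\<in>E. 2 * (Hx C H (w l) i)\<^sup>2 + 2 * ((\<Sum>c\<in>C. H i c * (of_int (u c) - s * w l c)) / s)\<^sup>2)"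
        by (simp only:) (intro sum_mono sq_add_le)
      also have "... = 2 * ip E (Hx C H (w l)) (Hx C H (w l)) + 2 * ((\<Sum>i\<in>E. (\<Sum>c\<in>C. H i c * (of_int (u c) - s * w l c))\<^sup>2) / s\<^sup>2)"
        by (simp add: sum.distrib sum_distrib_left[symmetric] ip_eq_sum_sq power_divide sum_divide_distrib[symmetric])
      also have "... \<le> 2 * (del0 * n) + 2 * ((n * p) / s\<^sup>2)" using w(2)[OF l] HH s by (intro add_mono mult_left_mono divide_right_mono) auto
      also have "(n * p) / s\<^sup>2 = del0 * n" using p zeta0 by (simp add: s_def power_divide)
      finally show ?thesis by simp
    qed
    have ww: "(\<Sum>c\<in>C. (w l c)\<^sup>2) = 1" using w(1) l by (simp add: orthon_def ip_eq_sum_sq[symmetric])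
    have "(\<Sum>c\<in>C. (of_int (u c))\<^sup>2) \<le> (\<Sum>c\<in>C. 2 * s\<^sup>2 * (w l c)\<^sup>2 + 2)"
    proof (rule sum_mono)
      fix c assume c: "c \<in> C"
      have "(of_int (u c) - s * w l c)\<^sup>2 \<le> 1" using u(1)[OF c] by (simp add: abs_square_le_1)
      moreover have "(of_int (u c))\<^sup>2 \<le> 2 * (s * w l c)\<^sup>2 + 2 * (of_int (u c) - s * w l c)\<^sup>2"
        using sq_add_le[of "s * w l c" "of_int (u c) - s * w l c"] by simp
      ultimately show "(of_int (u c))\<^sup>2 \<le> 2 * s\<^sup>2 * (w l c)\<^sup>2 + 2" by (simp add: power_mult_distrib)
    qed
    also have "... = 2 * s\<^sup>2 + 2 * p" by (simp add: sum.distrib sum_distrib_left[symmetric] ww p_def)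
    also have "... \<le> 4 * s\<^sup>2"
    proof -
      have "del0 \<le> 1" "0 < del0" by (auto simp: del0_def)
      moreover from this have "p * del0 \<le> p * 1" using p by (intro mult_left_mono) auto
      moreover have "s\<^sup>2 = p / del0" using p zeta0 by (simp add: s_def power_divide)
      ultimately have "p \<le> s\<^sup>2" by (simp add: pos_le_divide_eq)
      then show ?thesis by simp
    qed
    finally have "(\<Sum>c\<in>C. \<bar>of_int (u c)\<bar>) \<le> sqrt (real (card C) * (4 * s\<^sup>2))" by (rule sum_abs_le_sqrt)
    also have "... = 2 * p / \<zeta>0" using s p zeta0(1) by (simp add: p_def[symmetric] real_sqrt_mult s_def)
    finally have "y \<in> YN C" by (simp add: YN_def L1_def y_def p_def)
    then show ?thesis using c1 c2 by blast
  qed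
  then obtain y where y: "\<And>l. l < k ==> y l \<in> YN C \<and> (\<Sum>c\<in>C. (latv C (y l) c - w l c)\<^sup>2) \<le> \<zeta>0\<^sup>2 \<and> (\<Sum>i\<in>E. (ip C (latv C (y l)) (H i))\<^sup>2) \<le> 4 * del0 * n"
    unfolding Bex_def by (atomize_elim, intro choice) blast
  define y' where "y' = restrict y {..<k}"
  have "y' \<in> PiE {..<k} (\<lambda>_. YN C)" using y by (auto simp: y'_def)
  moreover have "\<forall>l<k. (\<Sum>c\<in>C. (latv C (y' l) c - w l c)\<^sup>2) \<le> \<zeta>0\<^sup>2" using y by (simp add: y'_def)
  moreover have "(\<Sum>i\<in>E. \<Sum>l<k. (ip C (latv C (y' l)) (H i))\<^sup>2) \<le> 4 * del0 * n * real k"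
  proof -
    have "(\<Sum>i\<in>E. \<Sum>l<k. (ip C (latv C (y' l)) (H i))\<^sup>2) = (\<Sum>l<k. \<Sum>i\<in>E. (ip C (latv C (y' l)) (H i))\<^sup>2)" by (rule sum.swap)
    also have "... \<le> (\<Sum>l<k. 4 * del0 * n)" using y by (intro sum_mono) (simp add: y'_def)
    finally show ?thesis by (simp add: mult.commute)
  qed
  ultimately show ?thesis using w(1) by blast
qed

section \<open>Pairs of lazy blocks with almost singular directions\<close>

definition LZ :: "'v set => 'v set => ('v => 'v => nat) set" where
  "LZ E D = PiE E (\<lambda>_. seeds D)"

text \<open>The two blocks written side by side, as one matrix with rows \<open>E\<close> and
  columns \<open>cols D\<close>.\<close>

definition HM :: "('v => 'v => nat) => ('v => 'v => nat) => 'v => bool \<times> 'v => real" where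
  "HM M M' i = rr (M i) (M' i)"

lemma HM_bound: "\<bar>HM M M' i c\<bar> \<le> 2"
  by (simp add: HM_def rr_def lv_def)

definition RW :: "'v set => nat => real => ('v => real) => ('v => nat) => ('v => nat) => real" where
  "RW D T \<sigma> X r r' = fej T \<sigma> (\<Sum>j\<in>D. lv (r j) * X j) * fej T \<sigma> (\<Sum>j\<in>D. lv (r' j) * X j)"

lemma RW_nonneg: "0 \<le> RW D T \<sigma> X r r'" by (simp add: RW_def fej_nonneg)

lemma avg_rows2:
  assumes "finite E" "finite D"
  shows "avg (LZ E D) (\<lambda>M. avg (LZ E D) (\<lambda>M'. \<Prod>i\<in>E. G i (M i) (M' i)))
    = (\<Prod>i\<in>E. avg (seeds D) (\<lambda>r. avg (seeds D) (\<lambda>r'. G i r r' :: real)))"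
proof -
  have f: "finite (PiE D (\<lambda>_. {..<8::nat}))" using assms by (intro finite_PiE) auto
  have "avg (LZ E D) (\<lambda>M'. \<Prod>i\<in>E. G i (M i) (M' i)) = (\<Prod>i\<in>E. avg (seeds D) (G i (M i)))" for M
    unfolding LZ_def by (rule avg_PiE_prod[OF assms(1) f])
  moreover have "avg (LZ E D) (\<lambda>M. \<Prod>i\<in>E. avg (seeds D) (G i (M i)))
    = (\<Prod>i\<in>E. avg (seeds D) (\<lambda>r. avg (seeds D) (G i r)))"
    unfolding LZ_def by (rule avg_PiE_prod[OF assms(1) f])
  ultimately show ?thesis by simp
qed

text \<open>The exponents in units of \<open>del0\<close> n k: the net costs 1/16, replacing the
  event by soft indicators costs 1/16, and the at least n/2 independent rows, each with k' \<ge> k/2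
  effective directions, gain 1/4, leaving 1/8. The size of \<open>D\<close> enters through
  (2^18)^(2|D|) \<le> e^(36 |D|) \<le> e^(del0 n / 16). The last hypothesis absorbs the truncation
  at \<open>J\<close> into the 1 added to \<open>rowM Q\<close>.\<close>

lemma smallk_prob:
  fixes D E :: "'v set"
  assumes "finite D" "finite E" "D \<noteq> {}" "real (card E) \<le> n" "n \<le> 2 * real (card E)" "real (card D) * 2 ^ 36 \<le> n"
    "nonlattice D \<sigma> A B X" "B > 0" "\<sigma> > 0" "T > 0" "Q > 0"
    "(\<Sum>j\<in>D. (X j)\<^sup>2) \<le> Q * B" "3 * real k < A" "4 * real J < A"
    "exp (- (real J / 2)) \<le> (gap \<sigma> B T)\<^sup>2 * exp (- (del0 * real k))"
  shows "avg (LZ E D) (\<lambda>M. avg (LZ E D) (\<lambda>M'. of_bool (smallk E (cols D) (HM M M') n k) * (\<Prod>i\<in>E. RW D T \<sigma> X (M i) (M' i))))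
    \<le> ((rowM Q + 1) * (gap \<sigma> B T)\<^sup>2) ^ card E * exp (- (del0 / 8 * n * real k))"
proof -
  let ?C = "cols D"
  define Z where "Z = (gap \<sigma> B T)\<^sup>2"
  have Z: "0 \<le> Z" by (simp add: Z_def)
  have rM: "0 \<le> rowM Q" by (simp add: rowM_def)
  have C: "finite ?C" "?C \<noteq> {}" using assms by auto
  have cC: "card ?C = 2 * card D" by (simp add: card_cartesian_product)
  have d0: "0 < del0" by (simp add: del0_def)
  have n0: "n \<ge> 0" using assms(4) by (meson of_nat_0_le_iff order_trans)
  define good where "good y \<longleftrightarrow> (\<exists>w. orthon ?C w k \<and> (\<forall>l<k. (\<Sum>c\<in>?C. (latv ?C (y l) c - w l c)\<^sup>2) \<le> \<zeta>0\<^sup>2))" for y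
  define ev where "ev y M M' \<longleftrightarrow> (\<Sum>i\<in>E. \<Sum>l<k. (ip ?C (latv ?C (y l)) (HM M M' i))\<^sup>2) \<le> 4 * del0 * n * real k" for y M M'
  define YY where "YY = {y \<in> PiE {..<k} (\<lambda>_. YN ?C). good y}"
  have fYN: "finite (YN ?C)" unfolding YN_def by (rule finite_L1[OF C(1)])
  have fYY: "finite YY" unfolding YY_def using fYN by (auto intro!: finite_PiE)
  let ?A = "\<lambda>F. avg (LZ E D) (\<lambda>M. avg (LZ E D) (\<lambda>M'. F M M'))"
  let ?R = "\<lambda>M M'. \<Prod>i\<in>E. RW D T \<sigma> X (M i) (M' i)"
  have one: "?A (\<lambda>M M'. of_bool (ev y M M') * ?R M M') \<le> exp (del0 / 16 * n * real k) * (((rowM Q + 1) * Z) ^ card E * exp (- (del0 / 4 * n * real k)))"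
    if y: "y \<in> YY" for y
  proof -
    obtain w where w: "orthon ?C w k" "\<And>l. l < k ==> (\<Sum>c\<in>?C. (latv ?C (y l) c - w l c)\<^sup>2) \<le> \<zeta>0\<^sup>2"
      using y by (auto simp: YY_def good_def)
    obtain W k' where W: "k \<le> 2 * k'" "k' \<le> k" "wellcond ?C W k'"
      "\<And>r. (\<Sum>l<k'. (\<Sum>c\<in>?C. W c l * r c)\<^sup>2) \<le> (\<Sum>l<k. (ip ?C (latv ?C (y l)) r)\<^sup>2)"
      using wellcond_perturbation[OF C(1) w(1) zeta0(1,3), of "\<lambda>l. latv ?C (y l)"] w(2) by blast
    define Om where "Om r r' = (\<Prod>l<k'. phi ((\<Sum>c\<in>?C. W c l * rr r r' c) / 8))" for r r'
    have Om0: "0 \<le> Om r r'" for r r' unfolding Om_def using phi_bounds(1) by (intro prod_nonneg) (auto intro: order_trans[of 0 "1/2"])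
    have R0: "0 \<le> ?R M M'" for M M' by (intro prod_nonneg) (simp add: RW_nonneg)
    have "?A (\<lambda>M M'. of_bool (ev y M M') * ?R M M')
        \<le> ?A (\<lambda>M M'. exp (del0 / 16 * n * real k) * (\<Prod>i\<in>E. Om (M i) (M' i) * RW D T \<sigma> X (M i) (M' i)))"
    proof (rule avg_mono, rule avg_mono)
      fix M M'
      have "of_bool (ev y M M') \<le> exp (del0 / 16 * n * real k) * (\<Prod>i\<in>E. Om (M i) (M' i))"
      proof (cases "ev y M M'")
        case True
        have "(\<Sum>i\<in>E. \<Sum>l<k'. (\<Sum>c\<in>?C. W c l * HM M M' i c)\<^sup>2) \<le> (\<Sum>i\<in>E. \<Sum>l<k. (ip ?C (latv ?C (y l)) (HM M M' i))\<^sup>2)" by (intro sum_mono W)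
        also have "... \<le> 4 * del0 * n * real k" using True by (simp add: ev_def)
        finally have s: "(\<Sum>i\<in>E. \<Sum>l<k'. (\<Sum>c\<in>?C. W c l * HM M M' i c)\<^sup>2) \<le> 4 * del0 * n * real k" .
        have "exp (- (del0 / 16 * n * real k)) \<le> exp (- ((\<Sum>i\<in>E. \<Sum>l<k'. (\<Sum>c\<in>?C. W c l * HM M M' i c)\<^sup>2) / 64))" using s by simp
        also have "... = (\<Prod>i\<in>E. \<Prod>l<k'. exp (- ((\<Sum>c\<in>?C. W c l * HM M M' i c)\<^sup>2 / 64)))"
          using assms(2) by (simp add: exp_sum[symmetric] sum_negf sum_divide_distrib)
        also have "... \<le> (\<Prod>i\<in>E. \<Prod>l<k'. phi ((\<Sum>c\<in>?C. W c l * HM M M' i c) / 8))" by (intro prod_mono conjI prod_nonneg phi_lower) auto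
        also have "... = (\<Prod>i\<in>E. Om (M i) (M' i))" by (simp add: Om_def HM_def)
        finally have "exp (del0 / 16 * n * real k) * exp (- (del0 / 16 * n * real k)) \<le> exp (del0 / 16 * n * real k) * (\<Prod>i\<in>E. Om (M i) (M' i))"
          by (intro mult_left_mono) auto
        then show ?thesis using True by (simp add: exp_minus)
      qed (simp add: prod_nonneg Om0)
      then have "of_bool (ev y M M') * ?R M M' \<le> (exp (del0 / 16 * n * real k) * (\<Prod>i\<in>E. Om (M i) (M' i))) * ?R M M'"
        using R0 by (intro mult_right_mono) auto
      then show "of_bool (ev y M M') * ?R M M' \<le> exp (del0 / 16 * n * real k) * (\<Prod>i\<in>E. Om (M i) (M' i) * RW D T \<sigma> X (M i) (M' i))"
        by (simp add: prod.distrib mult.assoc)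
    qed
    also have "... = exp (del0 / 16 * n * real k) * (\<Prod>i\<in>E. avg (seeds D) (\<lambda>r. avg (seeds D) (\<lambda>r'. Om r r' * RW D T \<sigma> X r r')))"
      unfolding avg_cmult by (subst avg_rows2[OF assms(2,1)]) simp
    also have "... \<le> exp (del0 / 16 * n * real k) * (\<Prod>i\<in>E. (rowM Q + 1) * Z * exp (- (del0 * real k')))"
    proof (intro mult_left_mono prod_mono conjI)
      fix i
      show "0 \<le> avg (seeds D) (\<lambda>r. avg (seeds D) (\<lambda>r'. Om r r' * RW D T \<sigma> X r r'))"
        by (rule avg_nonneg, rule avg_nonneg) (simp add: Om0 RW_nonneg)
      have "avg (seeds D) (\<lambda>r. avg (seeds D) (\<lambda>r'. Om r r' * RW D T \<sigma> X r r'))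
        \<le> rowM Q * Z * exp (- (del0 * real k')) + exp (- (real J / 2))"
        unfolding Om_def RW_def Z_def
        by (rule row_bound[OF assms(1,7-12) W(3) _ assms(14)]) (use W(2) assms(13) in linarith)
      also have "exp (- (real J / 2)) \<le> Z * exp (- (del0 * real k'))"
      proof -
        have "exp (- (del0 * real k)) \<le> exp (- (del0 * real k'))" using W(2) d0 by simp
        then have "Z * exp (- (del0 * real k)) \<le> Z * exp (- (del0 * real k'))" using Z by (intro mult_left_mono)
        then show ?thesis using assms(15) unfolding Z_def by linarith
      qed
      finally show "avg (seeds D) (\<lambda>r. avg (seeds D) (\<lambda>r'. Om r r' * RW D T \<sigma> X r r'))
        \<le> (rowM Q + 1) * Z * exp (- (del0 * real k'))" by (simp add: algebra_simps)
    qed simp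
    also have "... = exp (del0 / 16 * n * real k) * (((rowM Q + 1) * Z) ^ card E * exp (- (del0 * real k')) ^ card E)"
      by (simp add: power_mult_distrib)
    also have "... \<le> exp (del0 / 16 * n * real k) * (((rowM Q + 1) * Z) ^ card E * exp (- (del0 / 4 * n * real k)))"
    proof (intro mult_left_mono)
      have "n * real k \<le> (2 * real (card E)) * (2 * real k')" using assms(5) W(1) n0 by (intro mult_mono) auto
      then have "del0 * (n * real k) \<le> del0 * (4 * (real (card E) * real k'))" using d0 by (intro mult_left_mono) auto
      then have "- (del0 * real k') * real (card E) \<le> - (del0 / 4 * n * real k)" by (simp add: mult_ac)
      then show "exp (- (del0 * real k')) ^ card E \<le> exp (- (del0 / 4 * n * real k))" by (simp add: exp_of_nat_mult[symmetric] mult_ac)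
    qed (use rM Z in auto)
    finally show ?thesis .
  qed
  have "?A (\<lambda>M M'. of_bool (smallk E ?C (HM M M') n k) * ?R M M') \<le> ?A (\<lambda>M M'. \<Sum>y\<in>YY. of_bool (ev y M M') * ?R M M')"
  proof (rule avg_mono, rule avg_mono)
    fix M M'
    have R0: "0 \<le> ?R M M'" by (intro prod_nonneg) (simp add: RW_nonneg)
    show "of_bool (smallk E ?C (HM M M') n k) * ?R M M' \<le> (\<Sum>y\<in>YY. of_bool (ev y M M') * ?R M M')"
    proof (cases "smallk E ?C (HM M M') n k")
      case True
      from smallk_net[OF assms(2) C assms(4) HM_bound this] obtain y where y: "y \<in> YY" "ev y M M'" by (auto simp: YY_def good_def ev_def)
      have "of_bool (ev y M M') * ?R M M' \<le> (\<Sum>y\<in>YY. of_bool (ev y M M') * ?R M M')" using y fYY R0 by (intro member_le_sum) auto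
      then show ?thesis using y True by simp
    qed (use R0 in \<open>auto intro!: sum_nonneg\<close>)
  qed
  also have "... = (\<Sum>y\<in>YY. ?A (\<lambda>M M'. of_bool (ev y M M') * ?R M M'))" by (simp only: avg_sum)
  also have "... \<le> (\<Sum>y\<in>YY. exp (del0 / 16 * n * real k) * (((rowM Q + 1) * Z) ^ card E * exp (- (del0 / 4 * n * real k))))"
    by (intro sum_mono one)
  also have "... = real (card YY) * (exp (del0 / 16 * n * real k) * (((rowM Q + 1) * Z) ^ card E * exp (- (del0 / 4 * n * real k))))" by simp
  also have "... \<le> exp (del0 / 16 * n * real k) * (exp (del0 / 16 * n * real k) * (((rowM Q + 1) * Z) ^ card E * exp (- (del0 / 4 * n * real k))))"
  proof (rule mult_right_mono)
    have "card YY \<le> card (PiE {..<k} (\<lambda>_. YN ?C))" unfolding YY_def using fYN by (intro card_mono) (auto intro!: finite_PiE)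
    also have "... = card (YN ?C) ^ k" by (simp add: card_PiE)
    finally have "real (card YY) \<le> real (card (YN ?C)) ^ k" by (metis of_nat_le_iff of_nat_power)
    also have "... \<le> ((2 ^ 18) ^ card ?C) ^ k" by (intro power_mono card_YN C) auto
    also have "... \<le> (exp (del0 / 16 * n)) ^ k"
    proof (rule power_mono)
      have "(2::real) ^ 18 \<le> exp 18"
      proof -
        have "(2::real) ^ 18 \<le> exp 1 ^ 18" using exp_ge_add_one_self[of "1::real"] by (intro power_mono) auto
        then show ?thesis by (simp add: exp_of_nat_mult[symmetric])
      qed
      then have "((2::real) ^ 18) ^ card ?C \<le> exp 18 ^ card ?C" by (intro power_mono) auto
      also have "... = exp (36 * real (card D))" by (simp add: exp_of_nat_mult[symmetric] cC)
      also have "... \<le> exp (del0 / 16 * n)"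
      proof -
        have "36 * real (card D) * 2 ^ 30 \<le> 64 * real (card D) * 2 ^ 30" by simp
        also have "... \<le> n" using assms(6) by simp
        finally have "36 * real (card D) * 2 ^ 30 \<le> n" .
        then show ?thesis by (simp add: del0_def)
      qed
      finally show "((2::real) ^ 18) ^ card ?C \<le> exp (del0 / 16 * n)" .
    qed simp
    also have "... = exp (del0 / 16 * n * real k)" by (simp add: exp_of_nat_mult[symmetric] mult.commute)
    finally show "real (card YY) \<le> exp (del0 / 16 * n * real k)" .
  qed (use rM Z in auto)
  also have "... = ((rowM Q + 1) * Z) ^ card E * (exp (del0 / 16 * n * real k) * exp (del0 / 16 * n * real k) * exp (- (del0 / 4 * n * real k)))"
    by (simp only: mult_ac)
  also have "exp (del0 / 16 * n * real k) * exp (del0 / 16 * n * real k) * exp (- (del0 / 4 * n * real k)) = exp (- (del0 / 8 * n * real k))"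
    unfolding exp_add[symmetric] by (simp add: algebra_simps)
  finally show ?thesis unfolding Z_def .
qed

text \<open>Row factors involve only \<open>u\<close> on \<open>D\<close>, column factors only
  \<open>u\<close> on \<open>E\<close>. With the first part fixed, summing over the second becomes,
  for each fixed pair of blocks, a count of integer points near a kernel.\<close>

lemma fM_square:
  fixes D E :: "'v set"
  assumes "finite D" "finite E" "D \<inter> E = {}"
  shows "(fM D E T \<sigma> u)\<^sup>2 = avg (LZ E D) (\<lambda>M. avg (LZ E D) (\<lambda>M'. (\<Prod>i\<in>E. RW D T \<sigma> u (M i) (M' i)) *
     (\<Prod>c\<in>cols D. fej T \<sigma> (\<Sum>i\<in>E. HM M M' i c * u i))))"
proof -
  have one: "(\<Prod>v\<in>D \<union> E. fej T \<sigma> (bl D E (\<lambda>i j. lv (M i j)) u v))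
     = (\<Prod>i\<in>E. fej T \<sigma> (\<Sum>j\<in>D. lv (M i j) * u j)) * (\<Prod>j\<in>D. fej T \<sigma> (\<Sum>i\<in>E. lv (M i j) * u i))" for M :: "'v => 'v => nat"
  proof -
    have "(\<Prod>v\<in>D \<union> E. fej T \<sigma> (bl D E (\<lambda>i j. lv (M i j)) u v))
      = (\<Prod>v\<in>D. fej T \<sigma> (bl D E (\<lambda>i j. lv (M i j)) u v)) * (\<Prod>v\<in>E. fej T \<sigma> (bl D E (\<lambda>i j. lv (M i j)) u v))"
      using assms by (intro prod.union_disjoint)
    also have "(\<Prod>v\<in>D. fej T \<sigma> (bl D E (\<lambda>i j. lv (M i j)) u v)) = (\<Prod>j\<in>D. fej T \<sigma> (\<Sum>i\<in>E. lv (M i j) * u i))"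
      using assms(3) by (intro prod.cong refl) (auto simp: bl_def)
    also have "(\<Prod>v\<in>E. fej T \<sigma> (bl D E (\<lambda>i j. lv (M i j)) u v)) = (\<Prod>i\<in>E. fej T \<sigma> (\<Sum>j\<in>D. lv (M i j) * u j))"
      by (intro prod.cong refl) (auto simp: bl_def)
    finally show ?thesis by (simp only: mult.commute)
  qed
  have two: "(\<Prod>c\<in>cols D. fej T \<sigma> (\<Sum>i\<in>E. HM M M' i c * u i))
     = (\<Prod>j\<in>D. fej T \<sigma> (\<Sum>i\<in>E. lv (M i j) * u i)) * (\<Prod>j\<in>D. fej T \<sigma> (\<Sum>i\<in>E. lv (M' i j) * u i))" for M M'
  proof -
    have "(\<Prod>c\<in>cols D. fej T \<sigma> (\<Sum>i\<in>E. HM M M' i c * u i)) = (\<Prod>\<beta>\<in>UNIV. \<Prod>j\<in>D. fej T \<sigma> (\<Sum>i\<in>E. HM M M' i (\<beta>, j) * u i))"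
      unfolding prod.cartesian_product by (intro prod.cong refl) auto
    then show ?thesis by (simp add: UNIV_bool HM_def rr_def)
  qed
  have "(fM D E T \<sigma> u)\<^sup>2 = avg (LZ E D) (\<lambda>M. avg (LZ E D) (\<lambda>M'.
     ((\<Prod>i\<in>E. fej T \<sigma> (\<Sum>j\<in>D. lv (M i j) * u j)) * (\<Prod>j\<in>D. fej T \<sigma> (\<Sum>i\<in>E. lv (M i j) * u i))) *
     ((\<Prod>i\<in>E. fej T \<sigma> (\<Sum>j\<in>D. lv (M' i j) * u j)) * (\<Prod>j\<in>D. fej T \<sigma> (\<Sum>i\<in>E. lv (M' i j) * u i)))))"
    unfolding power2_eq_square fM_def one LZ_def[symmetric] avg_prod2 ..
  also have "... = avg (LZ E D) (\<lambda>M. avg (LZ E D) (\<lambda>M'. (\<Prod>i\<in>E. RW D T \<sigma> u (M i) (M' i)) *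
     (\<Prod>c\<in>cols D. fej T \<sigma> (\<Sum>i\<in>E. HM M M' i c * u i))))"
  proof (rule avg_cong[OF refl], rule avg_cong[OF refl])
    fix M M'
    have r: "(a * b) * (c * d) = (a * c) * (b * d)" for a b c d :: real by simp
    show "((\<Prod>i\<in>E. fej T \<sigma> (\<Sum>j\<in>D. lv (M i j) * u j)) * (\<Prod>j\<in>D. fej T \<sigma> (\<Sum>i\<in>E. lv (M i j) * u i))) *
     ((\<Prod>i\<in>E. fej T \<sigma> (\<Sum>j\<in>D. lv (M' i j) * u j)) * (\<Prod>j\<in>D. fej T \<sigma> (\<Sum>i\<in>E. lv (M' i j) * u i)))
     = (\<Prod>i\<in>E. RW D T \<sigma> u (M i) (M' i)) * (\<Prod>c\<in>cols D. fej T \<sigma> (\<Sum>i\<in>E. HM M M' i c * u i))"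
      unfolding two RW_def prod.distrib by (rule r)
  qed
  finally show ?thesis .
qed

lemma smallk_mono: "smallk E C H n k ==> k' \<le> k ==> smallk E C H n k'"
proof -
  assume "smallk E C H n k" and k: "k' \<le> k"
  then obtain w where w: "orthon C w k" "\<forall>l<k. ip E (Hx C H (w l)) (Hx C H (w l)) \<le> del0 * n" by (auto simp: smallk_def)
  have "orthon C w k'" using w(1) k by (simp add: orthon_def)
  moreover have "\<forall>l<k'. ip E (Hx C H (w l)) (Hx C H (w l)) \<le> del0 * n" using w(2) k by simp
  ultimately show ?thesis unfolding smallk_def by blast
qed

definition GamC :: "real => real" where "GamC \<rho> = 4 * \<rho> + K1 \<zeta>0 4 + 352"

text \<open>For each pair of blocks, k is the number of almost singular directions found greedily.
  The sum over \<open>E\<close> loses N^k, and the weight of such pairs is smaller by N^k, so every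
  k contributes equally and the total carries the factor 2|D| + 1. Beyond \<open>kmax\<close> the
  row estimate no longer applies; there \<open>smallk\<close> is weakened to \<open>kmax\<close>
  directions, and the assumption on N^(2|D|) pays for all lost powers at once.\<close>

lemma second_moment_fixed:
  fixes D E :: "'v set" and N :: nat
  assumes "finite D" "finite E" "D \<inter> E = {}" "D \<noteq> {}" "real (card E) \<le> n" "n \<le> 2 * real (card E)" "real (card D) * 2 ^ 36 \<le> n"
    "nonlattice D \<sigma> A B X" "B > 0" "\<sigma> = 4 * sqrt n" "T > 0" "Q > 0"
    "(\<Sum>j\<in>D. (X j)\<^sup>2) \<le> Q * B" "3 * real kmax < A" "4 * real J < A"
    "exp (- (real J / 2)) \<le> (gap \<sigma> B T)\<^sup>2 * exp (- (del0 * real kmax))"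
    "N \<ge> 1" "\<rho> \<ge> 0" "2 * \<rho> * real N * n \<le> \<sigma> * real T" "real N \<le> exp (del0 / 8 * n)"
    "real N ^ (2 * card D) \<le> exp (del0 / 8 * n * real kmax)"
  defines "U \<equiv> {u \<in> PiE E (\<lambda>_. UNIV). (\<Sum>i\<in>E. (real_of_int (u i))\<^sup>2) \<le> \<rho>\<^sup>2 * (real N)\<^sup>2 * n}"
  shows "finite U" "(\<Sum>u\<in>U. (fM D E T \<sigma> (\<lambda>v. if v \<in> E then real_of_int (u v) else X v))\<^sup>2) * real N ^ (2 * card D)
    \<le> (2 * real (card D) + 1) * (2 * exp (GamC \<rho> * n) * real N ^ card E) *
      ((rowM Q + 1) * (gap \<sigma> B T)\<^sup>2) ^ card E"
proof -
  let ?C = "cols D"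
  define Z where "Z = (gap \<sigma> B T)\<^sup>2"
  have Z: "0 \<le> Z" by (simp add: Z_def)
  have C: "finite ?C" "?C \<noteq> {}" using assms by auto
  have cC: "card ?C = 2 * card D" by (simp add: card_cartesian_product)
  have Dge: "card D \<ge> 1" using assms(1,4) by (simp add: Suc_leI card_gt_0_iff)
  have d0: "0 < del0" by (simp add: del0_def)
  have n1: "n \<ge> 1"
  proof -
    have "(1::real) * 1 \<le> real (card D) * 2 ^ 36" using Dge by (intro mult_mono) auto
    then show ?thesis using assms(7) by linarith
  qed
  have sig: "\<sigma> > 0" using n1 assms(10) by simp
  have N1: "real N \<ge> 1" using assms(17) by simp
  have CN: "real (card ?C) \<le> n"
  proof -
    have "real (card ?C) = real (card D) * 2" by (simp add: cC)
    also have "... \<le> real (card D) * 2 ^ 36" by (intro mult_left_mono) auto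
    finally show ?thesis using assms(7) by linarith
  qed
  define \<Gamma> where "\<Gamma> = 2 * exp (GamC \<rho> * n) * real N ^ card E"
  have \<Gamma>0: "0 \<le> \<Gamma>" by (simp add: \<Gamma>_def)
  define SU where "SU M M' = (\<Sum>u\<in>U. \<Prod>c\<in>?C. fej T \<sigma> (\<Sum>i\<in>E. HM M M' i c * real_of_int (u i)))" for M M'
  have greedy: "\<exists>k\<le>2 * card D. smallk E ?C (HM M M') n k \<and> SU M M' * real N ^ (2 * card D - k) \<le> \<Gamma> \<and> finite U" for M M'
  proof -
    obtain w k where w: "k \<le> card ?C" "orthon ?C w (card ?C)"
      "\<forall>i<k. ip E (Hx ?C (HM M M') (w i)) (Hx ?C (HM M M') (w i)) \<le> del0 * n"
      "\<forall>x. ip ?C x x = 1 --> (\<forall>i<k. ip ?C (w i) x = 0) --> \<not> ip E (Hx ?C (HM M M') x) (Hx ?C (HM M M') x) \<le> del0 * n"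
      using greedy_onb[OF C(1), of "\<lambda>x. ip E (Hx ?C (HM M M') x) (Hx ?C (HM M M') x) \<le> del0 * n"] by blast
    have comp: "\<zeta>0\<^sup>2 * n \<le> ip E (Hx ?C (HM M M') x) (Hx ?C (HM M M') x)"
      if "ip ?C x x = 1" "\<forall>i<k. ip ?C (w i) x = 0" for x
      using w(4) that unfolding zeta0(2) by force
    have "smallk E ?C (HM M M') n k" unfolding smallk_def using w(1-3) by (intro exI[of _ w]) (auto simp: orthon_def)
    moreover have "SU M M' * real N ^ (card ?C - k) \<le> 2 * exp ((4 * \<rho> + K1 \<zeta>0 4 + 352) * n) * real N ^ card E" unfolding SU_def U_def
      by (rule sum_fej_near_kernel(2)[OF assms(2) C assms(5) CN HM_bound zeta0(1,4) assms(18,17) w(2,1) _ assms(10,11,19)], rule comp)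
    moreover have "finite U" unfolding U_def
      by (rule sum_fej_near_kernel(1)[OF assms(2) C assms(5) CN HM_bound zeta0(1,4) assms(18,17) w(2,1) _ assms(10,11,19)], rule comp)
    ultimately show ?thesis using w(1) unfolding cC \<Gamma>_def GamC_def by blast
  qed
  then show "finite U" by blast
  let ?A = "\<lambda>F. avg (LZ E D) (\<lambda>M. avg (LZ E D) (\<lambda>M'. F M M'))"
  let ?R = "\<lambda>M M'. \<Prod>i\<in>E. RW D T \<sigma> X (M i) (M' i)"
  have R0: "0 \<le> ?R M M'" for M M' by (intro prod_nonneg) (simp add: RW_nonneg)
  have eq: "(\<Sum>u\<in>U. (fM D E T \<sigma> (\<lambda>v. if v \<in> E then real_of_int (u v) else X v))\<^sup>2) = ?A (\<lambda>M M'. ?R M M' * SU M M')"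
  proof -
    have RWX: "RW D T \<sigma> (\<lambda>v. if v \<in> E then real_of_int (u v) else X v) r r' = RW D T \<sigma> X r r'" for u r r'
    proof -
      have "(\<Sum>j\<in>D. lv (r j) * (if j \<in> E then real_of_int (u j) else X j)) = (\<Sum>j\<in>D. lv (r j) * X j)" for r
        using assms(3) by (intro sum.cong refl) auto
      then show ?thesis by (simp add: RW_def)
    qed
    have col: "(\<Sum>i\<in>E. HM M M' i c * (if i \<in> E then real_of_int (u i) else X i)) = (\<Sum>i\<in>E. HM M M' i c * real_of_int (u i))" for M M' c u
      by (intro sum.cong refl) auto
    show ?thesis unfolding fM_square[OF assms(1-3)] RWX col SU_def sum_distrib_left avg_sum ..
  qed
  have pk: "real N ^ k * ?A (\<lambda>M M'. of_bool (smallk E ?C (HM M M') n k) * ?R M M') \<le> ((rowM Q + 1) * Z) ^ card E" if k: "k \<le> 2 * card D" for k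
  proof -
    define k1 where "k1 = min k kmax"
    have "?A (\<lambda>M M'. of_bool (smallk E ?C (HM M M') n k) * ?R M M') \<le> ?A (\<lambda>M M'. of_bool (smallk E ?C (HM M M') n k1) * ?R M M')"
      by (rule avg_mono, rule avg_mono, rule mult_right_mono[OF _ R0]) (use smallk_mono[of E ?C _ n k k1] in \<open>auto simp: k1_def\<close>)
    also have "... \<le> ((rowM Q + 1) * Z) ^ card E * exp (- (del0 / 8 * n * real k1))" unfolding Z_def
    proof (rule smallk_prob[OF assms(1,2,4-9) sig assms(11-13) _ assms(15)])
      show "3 * real k1 < A" using assms(14) by (simp add: k1_def)
      have "exp (- (del0 * real kmax)) \<le> exp (- (del0 * real k1))" using d0 by (simp add: k1_def)
      then have "(gap \<sigma> B T)\<^sup>2 * exp (- (del0 * real kmax)) \<le> (gap \<sigma> B T)\<^sup>2 * exp (- (del0 * real k1))" by (intro mult_left_mono) auto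
      then show "exp (- (real J / 2)) \<le> (gap \<sigma> B T)\<^sup>2 * exp (- (del0 * real k1))" using assms(16) by linarith
    qed
    finally have b: "?A (\<lambda>M M'. of_bool (smallk E ?C (HM M M') n k) * ?R M M') \<le> ((rowM Q + 1) * Z) ^ card E * exp (- (del0 / 8 * n * real k1))" .
    have Nk: "real N ^ k \<le> exp (del0 / 8 * n * real k1)"
    proof (cases "k \<le> kmax")
      case True
      have "real N ^ k \<le> exp (del0 / 8 * n) ^ k" using assms(20) by (intro power_mono) auto
      then show ?thesis using True by (simp add: k1_def exp_of_nat_mult[symmetric] mult_ac)
    next
      case False
      have "real N ^ k \<le> real N ^ (2 * card D)" using k N1 by (intro power_increasing) auto
      then show ?thesis using False assms(21) by (simp add: k1_def)
    qed
    have "real N ^ k * ?A (\<lambda>M M'. of_bool (smallk E ?C (HM M M') n k) * ?R M M')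
      \<le> exp (del0 / 8 * n * real k1) * (((rowM Q + 1) * Z) ^ card E * exp (- (del0 / 8 * n * real k1)))"
    proof (rule mult_mono[OF Nk b])
      show "0 \<le> ?A (\<lambda>M M'. of_bool (smallk E ?C (HM M M') n k) * ?R M M')" by (rule avg_nonneg, rule avg_nonneg) (simp add: R0)
    qed simp
    also have "... = ((rowM Q + 1) * Z) ^ card E" by (simp add: exp_minus)
    finally show ?thesis .
  qed
  have pt: "?R M M' * SU M M' * real N ^ (2 * card D) \<le> (\<Sum>k\<le>2 * card D. \<Gamma> * real N ^ k * (of_bool (smallk E ?C (HM M M') n k) * ?R M M'))" for M M'
  proof -
    obtain k where k: "k \<le> 2 * card D" "smallk E ?C (HM M M') n k" "SU M M' * real N ^ (2 * card D - k) \<le> \<Gamma>"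
      using greedy by blast
    have "SU M M' * real N ^ (2 * card D) = (SU M M' * real N ^ (2 * card D - k)) * real N ^ k"
      using k(1) by (simp add: power_add[symmetric])
    also have "... \<le> \<Gamma> * real N ^ k" using k(3) by (intro mult_right_mono) auto
    finally have "?R M M' * (SU M M' * real N ^ (2 * card D)) \<le> ?R M M' * (\<Gamma> * real N ^ k)" using R0 by (intro mult_left_mono)
    also have "... = \<Gamma> * real N ^ k * (of_bool (smallk E ?C (HM M M') n k) * ?R M M')" using k(2) by simp
    also have "... \<le> (\<Sum>k\<le>2 * card D. \<Gamma> * real N ^ k * (of_bool (smallk E ?C (HM M M') n k) * ?R M M'))"
      using k(1) R0 \<Gamma>0 by (intro member_le_sum) auto
    finally show ?thesis by (simp only: mult.assoc)
  qed
  have "?A (\<lambda>M M'. ?R M M' * SU M M') * real N ^ (2 * card D) = ?A (\<lambda>M M'. ?R M M' * SU M M' * real N ^ (2 * card D))"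
    by (simp only: avg_multc)
  also have "... \<le> ?A (\<lambda>M M'. \<Sum>k\<le>2 * card D. \<Gamma> * real N ^ k * (of_bool (smallk E ?C (HM M M') n k) * ?R M M'))"
    by (rule avg_mono, rule avg_mono, rule pt)
  also have "... = (\<Sum>k\<le>2 * card D. \<Gamma> * (real N ^ k * ?A (\<lambda>M M'. of_bool (smallk E ?C (HM M M') n k) * ?R M M')))"
    by (simp only: avg_sum avg_cmult mult.assoc)
  also have "... \<le> (\<Sum>k\<le>2 * card D. \<Gamma> * ((rowM Q + 1) * Z) ^ card E)" using \<Gamma>0 pk by (intro sum_mono mult_left_mono) auto
  also have "... = (2 * real (card D) + 1) * \<Gamma> * ((rowM Q + 1) * Z) ^ card E" by simp
  finally show "(\<Sum>u\<in>U. (fM D E T \<sigma> (\<lambda>v. if v \<in> E then real_of_int (u v) else X v))\<^sup>2) * real N ^ (2 * card D)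
    \<le> (2 * real (card D) + 1) * (2 * exp (GamC \<rho> * n) * real N ^ card E) *
      ((rowM Q + 1) * (gap \<sigma> B T)\<^sup>2) ^ card E"
    unfolding eq \<Gamma>_def Z_def .
qed

section \<open>Integer vectors with large fM\<close>

lemma sin_small_near_pi:
  fixes y s :: real
  assumes "\<bar>sin y\<bar> \<le> s" "s \<le> 1/2"
  shows "\<exists>k::int. \<bar>y - pi * of_int k\<bar> \<le> 2 * s"
proof -
  define k where "k = round (y / pi)"
  define z where "z = y - pi * of_int k"
  have "\<bar>of_int k - y / pi\<bar> \<le> 1/2" unfolding k_def by (rule of_int_round_abs_le)
  then have "\<bar>pi * (of_int k - y / pi)\<bar> \<le> pi * (1/2)" by (simp add: abs_mult)
  then have zb: "\<bar>z\<bar> \<le> pi / 2" by (simp add: z_def right_diff_distrib abs_minus_commute)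
  have "y = z + pi * of_int k" by (simp add: z_def)
  then have "sin y = sin z * cos (pi * of_int k) + cos z * sin (pi * of_int k)" by (simp only: sin_add)
  moreover have "sin (pi * of_int k) = 0" by (metis sin_zero_iff_int2 mult.commute)
  moreover from this have "\<bar>cos (pi * of_int k)\<bar> = 1" using sin_zero_abs_cos_one by blast
  ultimately have sz: "\<bar>sin z\<bar> = \<bar>sin y\<bar>" by (simp add: abs_mult)
  have "\<bar>z\<bar> \<le> 2 * s"
  proof (rule ccontr)
    assume n: "\<not> \<bar>z\<bar> \<le> 2 * s"
    have s0: "0 \<le> s" using assms(1) by linarith
    show False
    proof (cases "\<bar>z\<bar> \<le> 1")
      case True
      then show False using sin_lower[OF True] n s0 sz assms(1) by linarith
    next
      case False
      have "sin 1 \<le> sin \<bar>z\<bar>" using False zb by (intro sin_monotone_2pi_le) auto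
      moreover have "5/6 \<le> \<bar>sin (1::real)\<bar>" using sin_lower[of 1] by simp
      moreover have "0 \<le> sin (1::real)" by (intro sin_ge_zero) (use pi_ge_two in auto)
      moreover have "sin \<bar>z\<bar> \<le> \<bar>sin z\<bar>" by (cases "0 \<le> z") auto
      ultimately show False using sz assms by linarith
    qed
  qed
  then show ?thesis unfolding z_def by blast
qed

lemma card_int_interval:
  fixes a b :: real
  assumes "0 \<le> b - a"
  shows "finite {x::int. a \<le> of_int x \<and> of_int x \<le> b}" "real (card {x::int. a \<le> of_int x \<and> of_int x \<le> b}) \<le> b - a + 1"
proof -
  have eq: "{x::int. a \<le> of_int x \<and> of_int x \<le> b} = {\<lceil>a\<rceil>..\<lfloor>b\<rfloor>}" by (auto simp: ceiling_le_iff le_floor_iff)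
  then show "finite {x::int. a \<le> of_int x \<and> of_int x \<le> b}" by simp
  have "real (card {\<lceil>a\<rceil>..\<lfloor>b\<rfloor>}) = real (nat (\<lfloor>b\<rfloor> - \<lceil>a\<rceil> + 1))" by simp
  also have "... \<le> b - a + 1"
  proof (cases "\<lfloor>b\<rfloor> - \<lceil>a\<rceil> + 1 \<ge> 0")
    case True
    then have "real (nat (\<lfloor>b\<rfloor> - \<lceil>a\<rceil> + 1)) = real_of_int (\<lfloor>b\<rfloor> - \<lceil>a\<rceil> + 1)" by simp
    then show ?thesis by simp linarith
  next
    case False
    then show ?thesis using assms by simp
  qed
  finally show "real (card {x::int. a \<le> of_int x \<and> of_int x \<le> b}) \<le> b - a + 1" unfolding eq .
qed

text \<open>At most 3 \<theta> R multiples of \<pi> are relevant, and near each there are at most 5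
  s / \<theta> integers; \<theta> cancels in the product. \<open>\<theta> \<le> s\<close> absorbs
  the endpoint of each interval, \<open>1 \<le> \<theta> * R\<close> the extra central
  multiple.\<close>

lemma count_small_sin:
  fixes \<theta> R s :: real
  assumes "0 < \<theta>" "\<theta> \<le> s" "s \<le> 1/2" "1 \<le> \<theta> * R"
  shows "real (card {x::int. \<bar>of_int x\<bar> \<le> R \<and> \<bar>sin (\<theta> * of_int x)\<bar> \<le> s}) \<le> 15 * s * R"
proof -
  define K where "K = \<lfloor>\<theta> * R\<rfloor>"
  have K: "1 \<le> K" "real_of_int K \<le> \<theta> * R" "\<theta> * R < real_of_int K + 1" using assms by (auto simp: K_def le_floor_iff)
  define I where "I k = {x::int. (pi * of_int k - 2 * s) / \<theta> \<le> of_int x \<and> of_int x \<le> (pi * of_int k + 2 * s) / \<theta>}" for k :: int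
  have len: "(pi * of_int k + 2 * s) / \<theta> - (pi * of_int k - 2 * s) / \<theta> = 4 * s / \<theta>" for k :: int using assms by (simp add: field_simps)
  have I: "finite (I k)" "real (card (I k)) \<le> 5 * s / \<theta>" for k
  proof -
    have nn: "0 \<le> (pi * of_int k + 2 * s) / \<theta> - (pi * of_int k - 2 * s) / \<theta>" unfolding len using assms by simp
    show "finite (I k)" unfolding I_def by (rule card_int_interval(1)[OF nn])
    have "real (card (I k)) \<le> 4 * s / \<theta> + 1" using card_int_interval(2)[OF nn] unfolding I_def len .
    also have "1 \<le> s / \<theta>" using assms by simp
    finally show "real (card (I k)) \<le> 5 * s / \<theta>" by simp
  qed
  have sub: "{x::int. \<bar>of_int x\<bar> \<le> R \<and> \<bar>sin (\<theta> * of_int x)\<bar> \<le> s} \<subseteq> (\<Union>k\<in>{-K..K}. I k)"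
  proof clarify
    fix x :: int assume x: "\<bar>real_of_int x\<bar> \<le> R" "\<bar>sin (\<theta> * of_int x)\<bar> \<le> s"
    obtain k :: int where k: "\<bar>\<theta> * of_int x - pi * of_int k\<bar> \<le> 2 * s" using sin_small_near_pi[OF x(2) assms(3)] by blast
    have xk: "x \<in> I k"
    proof -
      have "pi * of_int k - 2 * s \<le> of_int x * \<theta>" "of_int x * \<theta> \<le> pi * of_int k + 2 * s" using k by (auto simp: abs_le_iff mult.commute)
      then show ?thesis using assms(1) by (simp add: I_def pos_divide_le_eq pos_le_divide_eq)
    qed
    have "\<bar>\<theta> * of_int x\<bar> \<le> \<theta> * R" using x(1) assms(1) by (simp add: abs_mult)
    then have "\<bar>pi * of_int k\<bar> \<le> \<theta> * R + 1" using k assms(3) by linarith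
    then have "pi * \<bar>of_int k\<bar> \<le> 2 * (\<theta> * R)" using assms(4) by (simp add: abs_mult)
    moreover have "2 * \<bar>real_of_int k\<bar> \<le> pi * \<bar>of_int k\<bar>" using pi_ge_two by (intro mult_right_mono) auto
    ultimately have "\<bar>real_of_int k\<bar> \<le> \<theta> * R" by linarith
    then have "\<bar>k\<bar> \<le> K" unfolding K_def by (simp add: le_floor_iff)
    then show "x \<in> (\<Union>k\<in>{-K..K}. I k)" using xk by (intro UN_I[of k]) auto
  qed
  have "card {x::int. \<bar>of_int x\<bar> \<le> R \<and> \<bar>sin (\<theta> * of_int x)\<bar> \<le> s} \<le> card (\<Union>k\<in>{-K..K}. I k)" using sub I(1) by (intro card_mono) auto
  also have "... \<le> (\<Sum>k\<in>{-K..K}. card (I k))" by (rule card_UN_le) simp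
  finally have "real (card {x::int. \<bar>of_int x\<bar> \<le> R \<and> \<bar>sin (\<theta> * of_int x)\<bar> \<le> s}) \<le> real (\<Sum>k\<in>{-K..K}. card (I k))" by (rule of_nat_mono)
  also have "... = (\<Sum>k\<in>{-K..K}. real (card (I k)))" by (rule of_nat_sum)
  finally have "real (card {x::int. \<bar>of_int x\<bar> \<le> R \<and> \<bar>sin (\<theta> * of_int x)\<bar> \<le> s}) \<le> (\<Sum>k\<in>{-K..K}. real (card (I k)))" .
  also have "... \<le> (\<Sum>k\<in>{-K..K}. 5 * s / \<theta>)" by (intro sum_mono I)
  also have "... = (2 * real_of_int K + 1) * (5 * s / \<theta>)" using K(1) by simp
  also have "... \<le> (3 * (\<theta> * R)) * (5 * s / \<theta>)" using K assms by (intro mult_right_mono) auto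
  also have "... = 15 * s * R" using assms by simp
  finally show ?thesis .
qed

text \<open>Entries are kept away from 0 too: for small dilations the sines then grow linearly,
  which is the quadratic branch of \<open>nonlattice\<close>.\<close>

definition boxS :: "real => real => nat => int set" where
  "boxS e1 K N = {x. e1 * real N \<le> \<bar>of_int x\<bar> \<and> \<bar>of_int x\<bar> \<le> K * real N}"

lemma boxS_card:
  assumes "K \<ge> 1" "N \<ge> 1"
  shows "finite (boxS e1 K N)" "real (card (boxS e1 K N)) \<le> 3 * K * real N"
proof -
  have KN: "1 \<le> K * real N" using assms mult_mono[of 1 K 1 "real N"] by simp
  let ?I = "{x::int. - (K * real N) \<le> of_int x \<and> of_int x \<le> K * real N}"
  have sub: "boxS e1 K N \<subseteq> ?I" by (auto simp: boxS_def abs_le_iff)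
  have nn: "0 \<le> K * real N - (- (K * real N))" using KN by simp
  show "finite (boxS e1 K N)" by (rule finite_subset[OF sub card_int_interval(1)[OF nn]])
  have "real (card (boxS e1 K N)) \<le> real (card ?I)" using card_mono[OF card_int_interval(1)[OF nn] sub] by simp
  also have "... \<le> 2 * (K * real N) + 1" using card_int_interval(2)[OF nn] by simp
  finally show "real (card (boxS e1 K N)) \<le> 3 * K * real N" using KN by simp
qed

text \<open>Discretise the dilation factor and use that \<open>sin\<^sup>2 (\<theta> x)\<close> is rarely small.\<close>

lemma bad_count:
  fixes D :: "'v set" and N :: nat
  assumes "finite D" "D \<noteq> {}" "0 < e1" "e1 \<le> 1" "K \<ge> 1" "N \<ge> 1" "0 < s" "s \<le> 1/2" "\<sigma> \<ge> 1" "4 / \<sigma> \<le> s"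
  shows "real (card {X \<in> PiE D (\<lambda>_. boxS e1 K N).
      \<not> nonlattice D \<sigma> (s ^ 4 * real (card D)) (e1\<^sup>2 / 2 * (real N)\<^sup>2 * real (card D)) (\<lambda>j. of_int (X j))})
    \<le> (3 * K * real N / s\<^sup>2) * (exp 4 * (18 * s * K * real N)) ^ card D"
proof -
  define d where "d = card D"
  define R where "R = K * real N"
  have R1: "R \<ge> 1" using assms mult_mono[of 1 K 1 "real N"] by (simp add: R_def)
  \<comment> \<open>Mesh for the dilations: an error of at most g moves each angle by at most s^2,
    hence contributes at most s^4 per coordinate, the order of the threshold itself.\<close>
  define g where "g = s\<^sup>2 / R"
  have g0: "g > 0" using assms R1 by (simp add: g_def)
  have s2: "s\<^sup>2 \<le> 1" using assms by (simp add: power_le_one)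
  let ?P = "PiE D (\<lambda>_. boxS e1 K N)"
  have fP: "finite ?P" using assms boxS_card by (intro finite_PiE) auto
  define Im where "Im = nat \<lfloor>2 * R / s\<^sup>2 + 1\<rfloor>"
  define Th where "Th = {i \<in> {..Im}. 1 / R \<le> g * real i \<and> g * real i \<le> s}"
  define BB where "BB i = {X \<in> ?P. Ssin D (\<lambda>j. g * real i * of_int (X j)) \<le> 4 * s ^ 4 * real d}" for i
  have sub: "{X \<in> ?P. \<not> nonlattice D \<sigma> (s ^ 4 * real (card D)) (e1\<^sup>2 / 2 * (real N)\<^sup>2 * real (card D)) (\<lambda>j. of_int (X j))}
     \<subseteq> (\<Union>i\<in>Th. BB i)"
  proof clarify
    fix X assume X: "X \<in> ?P" and nl: "\<not> nonlattice D \<sigma> (s ^ 4 * real (card D)) (e1\<^sup>2 / 2 * (real N)\<^sup>2 * real (card D)) (\<lambda>j. of_int (X j))"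
    have Xb: "e1 * real N \<le> \<bar>of_int (X j)\<bar>" "\<bar>of_int (X j)\<bar> \<le> R" if "j \<in> D" for j using PiE_mem[OF X that] by (auto simp: boxS_def R_def)
    obtain t0 where t0: "\<bar>t0\<bar> \<le> 2 / \<sigma>" "Ssin D (\<lambda>j. t0 * of_int (X j)) < min (s ^ 4 * real d) (e1\<^sup>2 / 2 * (real N)\<^sup>2 * real d * t0\<^sup>2)"
      using nl by (auto simp: nonlattice_def d_def not_le)
    define t where "t = \<bar>t0\<bar>"
    have "Ssin D (\<lambda>j. t * of_int (X j)) = Ssin D (\<lambda>j. t0 * of_int (X j))" unfolding t_def by (cases "0 \<le> t0") (auto simp: Ssin_def)
    then have t: "0 \<le> t" "t \<le> 2 / \<sigma>" "Ssin D (\<lambda>j. t * of_int (X j)) < s ^ 4 * real d"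
      "Ssin D (\<lambda>j. t * of_int (X j)) < e1\<^sup>2 / 2 * (real N)\<^sup>2 * real d * t\<^sup>2"
      using t0 by (auto simp: t_def)
    \<comment> \<open>If t R \<le> 1, all angles lie in the range where sin^2 is at least half the
      square, and the lower bound on the entries gives the quadratic branch. A violation therefore
      needs t > 1/R.\<close>
    have tR: "1 < t * R"
    proof (rule ccontr)
      assume n: "\<not> 1 < t * R"
      have "(\<Sum>j\<in>D. (e1 * real N)\<^sup>2 * t\<^sup>2 / 2) \<le> Ssin D (\<lambda>j. t * of_int (X j))" unfolding Ssin_def
      proof (rule sum_mono)
        fix j assume j: "j \<in> D"
        have "\<bar>t * of_int (X j)\<bar> \<le> t * R" unfolding abs_mult using t(1) Xb(2)[OF j] by (intro mult_mono) auto
        then have "(t * of_int (X j))\<^sup>2 / 2 \<le> (sin (t * of_int (X j)))\<^sup>2" using n by (intro sin_sq_lower) linarith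
        moreover have "(e1 * real N)\<^sup>2 \<le> \<bar>of_int (X j)\<bar>\<^sup>2" using Xb(1)[OF j] assms(3) by (intro power_mono) auto
        then have "(e1 * real N)\<^sup>2 * t\<^sup>2 \<le> (of_int (X j))\<^sup>2 * t\<^sup>2" by (intro mult_right_mono) auto
        ultimately show "(e1 * real N)\<^sup>2 * t\<^sup>2 / 2 \<le> (sin (t * of_int (X j)))\<^sup>2" by (simp add: power_mult_distrib mult.commute)
      qed
      then show False using t(4) by (simp add: d_def power_mult_distrib mult_ac)
    qed
    define i where "i = nat \<lceil>t / g\<rceil>"
    have tg: "0 \<le> t / g" using t g0 by simp
    have i: "t / g \<le> real i" "real i \<le> t / g + 1" using tg by (simp_all add: i_def)
    have gi: "t \<le> g * real i" "g * real i \<le> t + g" using i g0 by (simp_all add: field_simps)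
    have t2: "2 / \<sigma> \<le> s / 2" using assms(10) by simp
    have gt: "g \<le> t"
    proof -
      have "g \<le> 1 / R" unfolding g_def using s2 R1 by (intro divide_right_mono) auto
      also have "... \<le> t" using tR R1 by (simp add: pos_divide_le_eq)
      finally show ?thesis .
    qed
    have "i \<le> Im"
    proof -
      have "t \<le> 2" using t(2) t2 assms(8) by linarith
      then have "t / g \<le> 2 / g" using g0 by (intro divide_right_mono) auto
      then have "real i \<le> 2 * R / s\<^sup>2 + 1" using i(2) by (simp add: g_def)
      then show ?thesis unfolding Im_def by (rule le_nat_floor)
    qed
    moreover have "1 / R \<le> g * real i" using tR R1 gi(1) by (simp add: pos_divide_le_eq) (smt (verit) mult_right_mono)
    moreover have "g * real i \<le> s" using gi(2) gt t(2) t2 by linarith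
    ultimately have iTh: "i \<in> Th" by (simp add: Th_def)
    define e where "e = g * real i - t"
    have e: "0 \<le> e" "e \<le> g" using gi by (auto simp: e_def)
    have "Ssin D (\<lambda>j. g * real i * of_int (X j)) = Ssin D (\<lambda>j. t * of_int (X j) + e * of_int (X j))"
      by (intro Ssin_cong) (simp add: e_def algebra_simps)
    also have "... \<le> 2 * Ssin D (\<lambda>j. t * of_int (X j)) + 2 * Ssin D (\<lambda>j. e * of_int (X j))" by (rule Ssin_add)
    also have "Ssin D (\<lambda>j. e * of_int (X j)) \<le> (\<Sum>j\<in>D. s ^ 4)"
    proof (rule order_trans[OF Ssin_le_sq sum_mono])
      fix j assume j: "j \<in> D"
      have "\<bar>e * of_int (X j)\<bar> \<le> g * R" unfolding abs_mult using e Xb(2)[OF j] g0 by (intro mult_mono) auto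
      also have "g * R = s\<^sup>2" using R1 by (simp add: g_def)
      finally have "\<bar>e * of_int (X j)\<bar> \<le> \<bar>s\<^sup>2\<bar>" by simp
      then have "(e * of_int (X j))\<^sup>2 \<le> (s\<^sup>2)\<^sup>2" by (rule abs_le_square_iff[THEN iffD1])
      then show "(e * of_int (X j))\<^sup>2 \<le> s ^ 4" by (simp add: power_mult[symmetric])
    qed
    finally have "Ssin D (\<lambda>j. g * real i * of_int (X j)) \<le> 4 * s ^ 4 * real d" using t(3) by (simp add: d_def algebra_simps)
    then have "X \<in> BB i" using X by (simp add: BB_def)
    then show "X \<in> (\<Union>i\<in>Th. BB i)" using iTh by blast
  qed
  have cB: "real (card (BB i)) \<le> (exp 4 * (18 * s * K * real N)) ^ d" if i: "i \<in> Th" for i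
  proof -
    define th where "th = g * real i"
    have th: "1 \<le> th * R" "th \<le> s" using i R1 by (auto simp: Th_def th_def pos_divide_le_eq)
    have th0: "0 < th" using th(1) R1 by (smt (verit) mult_nonpos_nonneg)
    have fB: "finite (BB i)" using fP by (simp add: BB_def)
    \<comment> \<open>Chernoff weight with parameter s^(-4). Where the sine exceeds s the weight is
      at most e^(-1/s^2) \<le> s^2 \<le> s, and the remaining integers are counted by
      \<open>count_small_sin\<close>; together 15 + 3 = 18.\<close>
    have one: "(\<Sum>x\<in>boxS e1 K N. exp (- ((sin (th * of_int x))\<^sup>2 / s ^ 4))) \<le> 18 * s * R"
    proof -
      let ?S = "{x::int. \<bar>of_int x\<bar> \<le> R \<and> \<bar>sin (th * of_int x)\<bar> \<le> s}"
      have fb: "finite (boxS e1 K N)" using boxS_card assms by auto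
      have "(\<Sum>x\<in>boxS e1 K N. exp (- ((sin (th * of_int x))\<^sup>2 / s ^ 4))) \<le> (\<Sum>x\<in>boxS e1 K N. of_bool (x \<in> ?S) + s)"
      proof (rule sum_mono)
        fix x assume x: "x \<in> boxS e1 K N"
        show "exp (- ((sin (th * of_int x))\<^sup>2 / s ^ 4)) \<le> of_bool (x \<in> ?S) + s"
        proof (cases "x \<in> ?S")
          case True
          have "exp (- ((sin (th * of_int x))\<^sup>2 / s ^ 4)) \<le> 1" by simp
          also have "1 \<le> of_bool (x \<in> ?S) + s" using True assms(7) by simp
          finally show ?thesis .
        next
          case False
          then have "s < \<bar>sin (th * of_int x)\<bar>" using x by (auto simp: boxS_def R_def)
          then have "s\<^sup>2 \<le> \<bar>sin (th * of_int x)\<bar>\<^sup>2" using assms(7) by (intro power_mono) auto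
          then have "s\<^sup>2 / s ^ 4 \<le> (sin (th * of_int x))\<^sup>2 / s ^ 4" by (intro divide_right_mono) auto
          moreover have "s\<^sup>2 / s ^ 4 = 1 / s\<^sup>2" using assms(7) by (simp add: power_eq_if field_simps)
          ultimately have "exp (- ((sin (th * of_int x))\<^sup>2 / s ^ 4)) \<le> exp (- (1 / s\<^sup>2))" by simp
          also have "... = 1 / exp (1 / s\<^sup>2)" by (simp add: exp_minus field_simps)
          also have "... \<le> 1 / (1 / s\<^sup>2)"
          proof -
            have "1 / s\<^sup>2 \<le> exp (1 / s\<^sup>2)" using exp_ge_add_one_self[of "1 / s\<^sup>2"] by linarith
            then show ?thesis using assms(7) by (intro divide_left_mono) (auto intro!: mult_pos_pos)
          qed
          also have "... = s * s" by (simp add: power2_eq_square)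
          also have "... \<le> 1 * s" using assms by (intro mult_right_mono) auto
          finally show ?thesis using False by simp
        qed
      qed
      also have "... = real (card (boxS e1 K N \<inter> ?S)) + real (card (boxS e1 K N)) * s"
        using fb by (simp add: sum.distrib of_bool_def sum.If_cases Int_def)
      also have "... \<le> 15 * s * R + (3 * R) * s"
      proof (intro add_mono mult_right_mono)
        have fS: "finite ?S"
        proof (rule finite_subset)
          show "?S \<subseteq> {x::int. - R \<le> of_int x \<and> of_int x \<le> R}" by (auto simp: abs_le_iff)
          show "finite {x::int. - R \<le> of_int x \<and> of_int x \<le> R}" using R1 by (intro card_int_interval) auto
        qed
        have "real (card (boxS e1 K N \<inter> ?S)) \<le> real (card ?S)" using fS by (simp add: card_mono)
        also have "... \<le> 15 * s * R" by (rule count_small_sin[OF th0 th(2) assms(8) th(1)])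
        finally show "real (card (boxS e1 K N \<inter> ?S)) \<le> 15 * s * R" .
        show "real (card (boxS e1 K N)) \<le> 3 * R" using boxS_card(2)[OF assms(5,6)] by (simp add: R_def mult.assoc)
      qed (use assms in auto)
      finally show ?thesis by (simp add: algebra_simps)
    qed
    have "real (card (BB i)) = (\<Sum>X\<in>BB i. 1)" by simp
    also have "... \<le> (\<Sum>X\<in>BB i. exp (4 * real d) * (\<Prod>j\<in>D. exp (- ((sin (th * of_int (X j)))\<^sup>2 / s ^ 4))))"
    proof (rule sum_mono)
      fix X assume X: "X \<in> BB i"
      have "Ssin D (\<lambda>j. th * of_int (X j)) / s ^ 4 \<le> 4 * s ^ 4 * real d / s ^ 4"
        using X assms(7) by (intro divide_right_mono) (auto simp: BB_def th_def)
      also have "... = 4 * real d" using assms(7) by simp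
      finally have "1 \<le> exp (4 * real d + - (Ssin D (\<lambda>j. th * of_int (X j)) / s ^ 4))" by simp
      also have "... = exp (4 * real d) * (\<Prod>j\<in>D. exp (- ((sin (th * of_int (X j)))\<^sup>2 / s ^ 4)))"
        unfolding exp_add using assms(1) by (simp add: exp_sum[symmetric] Ssin_def sum_negf sum_divide_distrib)
      finally show "1 \<le> exp (4 * real d) * (\<Prod>j\<in>D. exp (- ((sin (th * of_int (X j)))\<^sup>2 / s ^ 4)))" .
    qed
    also have "... \<le> (\<Sum>X\<in>?P. exp (4 * real d) * (\<Prod>j\<in>D. exp (- ((sin (th * of_int (X j)))\<^sup>2 / s ^ 4))))"
      using fP by (intro sum_mono2) (auto simp: BB_def intro!: mult_nonneg_nonneg prod_nonneg)
    also have "... = exp (4 * real d) * (\<Prod>j\<in>D. \<Sum>x\<in>boxS e1 K N. exp (- ((sin (th * of_int x))\<^sup>2 / s ^ 4)))"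
      unfolding sum_distrib_left[symmetric] using assms boxS_card by (subst prod_sum_PiE) auto
    also have "... \<le> exp (4 * real d) * (\<Prod>j\<in>D. 18 * s * R)" by (intro mult_left_mono prod_mono conjI one sum_nonneg) auto
    also have "... = (exp 4 * (18 * s * R)) ^ d" by (simp add: power_mult_distrib exp_of_nat_mult[symmetric] d_def mult.commute)
    finally show ?thesis by (simp add: R_def mult.assoc)
  qed
  have cTh: "real (card Th) \<le> 3 * R / s\<^sup>2"
  proof -
    have Th1: "Th \<subseteq> {1..Im}"
    proof
      fix i assume i: "i \<in> Th"
      have "i \<noteq> 0"
      proof
        assume "i = 0"
        then have "1 / R \<le> 0" using i by (simp add: Th_def)
        then show False using R1 by (simp add: divide_le_0_iff)
      qed
      then show "i \<in> {1..Im}" using i by (auto simp: Th_def)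
    qed
    then have "card Th \<le> Im" using card_mono[OF _ Th1] by simp
    then have "real (card Th) \<le> real Im" by simp
    also have "... \<le> 2 * R / s\<^sup>2 + 1" using R1 unfolding Im_def by (simp add: add_nonneg_nonneg)
    also have "1 \<le> R / s\<^sup>2" using R1 s2 assms(7) by (simp add: pos_le_divide_eq)
    finally show ?thesis by (simp add: add_divide_distrib[symmetric])
  qed
  have fTh: "finite Th" by (simp add: Th_def)
  have fB: "finite (BB i)" for i using fP by (simp add: BB_def)
  have "card {X \<in> ?P. \<not> nonlattice D \<sigma> (s ^ 4 * real (card D)) (e1\<^sup>2 / 2 * (real N)\<^sup>2 * real (card D)) (\<lambda>j. of_int (X j))}
     \<le> card (\<Union>i\<in>Th. BB i)" using fTh fB by (intro card_mono sub) auto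
  also have "... \<le> (\<Sum>i\<in>Th. card (BB i))" by (rule card_UN_le[OF fTh])
  finally have "real (card {X \<in> ?P. \<not> nonlattice D \<sigma> (s ^ 4 * real (card D)) (e1\<^sup>2 / 2 * (real N)\<^sup>2 * real (card D)) (\<lambda>j. of_int (X j))})
     \<le> real (\<Sum>i\<in>Th. card (BB i))" by (rule of_nat_mono)
  also have "... = (\<Sum>i\<in>Th. real (card (BB i)))" by (rule of_nat_sum)
  also have "... \<le> (\<Sum>i\<in>Th. (exp 4 * (18 * s * K * real N)) ^ d)" by (intro sum_mono cB)
  also have "... = real (card Th) * (exp 4 * (18 * s * K * real N)) ^ d" by simp
  also have "... \<le> (3 * R / s\<^sup>2) * (exp 4 * (18 * s * K * real N)) ^ d" using cTh assms by (intro mult_right_mono) auto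
  finally show ?thesis by (simp add: R_def d_def mult.assoc)
qed

section \<open>Counting heavy vectors\<close>

lemma fM_cong:
  assumes "D \<inter> E = {}" "\<And>v. v \<in> D \<union> E ==> u v = u' v"
  shows "fM D E T \<sigma> u = fM D E T \<sigma> u'"
proof -
  have "bl D E H u v = bl D E H u' v" for H v using assms(2) by (auto simp: bl_def intro!: sum.cong)
  then show ?thesis by (simp add: fM_def)
qed

text \<open>Coordinates on \<open>D\<close> are boxed from both sides, as \<open>nonlattice\<close>
  requires; those on \<open>E\<close> are summed over and need only a Euclidean bound.
  \<open>L\<close> measures the excess of \<open>fM\<close> over N^(-n).\<close>

definition heavy :: "'v set => 'v set => real => real => real => nat => real => nat => real => ('v => int) set" where
  "heavy D E e1 K \<rho> N n T L = {u \<in> PiE (D \<union> E) (\<lambda>_. UNIV). (\<forall>j\<in>D. u j \<in> boxS e1 K N) \<and>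
     (\<Sum>i\<in>E. (real_of_int (u i))\<^sup>2) \<le> \<rho>\<^sup>2 * (real N)\<^sup>2 * n \<and> (L / real N) ^ (card D + card E) \<le> fM D E T (4 * sqrt n) (\<lambda>v. real_of_int (u v))}"

text \<open>Bound for N^2 times the square of \<open>gap\<close> when \<sigma> = 4 sqrt n, B = e1^2
  N^2 |D| / 2, |D| \<ge> kd n / 2 and T \<ge> N.\<close>

definition CZ :: "real => real => real" where "CZ e1 kd = (24 / (e1 * sqrt kd) + 1)\<^sup>2"

text \<open>Markov's inequality for the square of \<open>fM\<close>. The threshold contributes
  N^(2|D| + 2|E|), the second moment N^(|E| - 2|D| - 2|E|), the last exponent coming from
  \<open>gap\<close>; one power of N per coordinate of \<open>E\<close> is left, divided by L^2 for
  every coordinate.\<close>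

lemma good_fiber_count:
  fixes D E :: "'v set" and N :: nat
  assumes "finite D" "finite E" "D \<inter> E = {}" "D \<noteq> {}" "n = real (card D + card E)"
    "0 < kd" "kd \<le> 1" "kd / 2 * n \<le> real (card D)" "real (card D) * 2 ^ 36 \<le> n"
    "0 < e1" "e1 \<le> 1" "K \<ge> 1" "\<rho> \<ge> 0" "N \<ge> 1" "0 < \<alpha>" "\<alpha> \<le> 1" "100 \<le> \<alpha> * real (card D)"
    "real N \<le> exp (del0 * \<alpha> * kd / 200 * n)" "T > 0" "(2 * \<rho> + 1) * real N * n \<le> real T" "L > 0"
    "\<And>j. j \<in> D ==> x j \<in> boxS e1 K N"
    "nonlattice D (4 * sqrt n) (\<alpha> * real (card D)) (e1\<^sup>2 / 2 * (real N)\<^sup>2 * real (card D)) (\<lambda>j. of_int (x j))"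
  shows "real (card {u \<in> PiE E (\<lambda>_. UNIV). (\<Sum>i\<in>E. (real_of_int (u i))\<^sup>2) \<le> \<rho>\<^sup>2 * (real N)\<^sup>2 * n \<and>
      (L / real N) ^ (card D + card E) \<le> fM D E T (4 * sqrt n) (\<lambda>v. if v \<in> E then real_of_int (u v) else real_of_int (x v))})
     * L ^ (2 * (card D + card E)) \<le> (3 * n * 2 * exp (GamC \<rho> * n) * ((rowM (2 * K\<^sup>2 / e1\<^sup>2) + 1) * CZ e1 kd) ^ card E) * real N ^ card E"
proof -
  define d where "d = card D"
  define m where "m = card E"
  define \<sigma> where "\<sigma> = 4 * sqrt n"
  define B where "B = e1\<^sup>2 / 2 * (real N)\<^sup>2 * real d"
  define A where "A = \<alpha> * real d"
  define Q where "Q = 2 * K\<^sup>2 / e1\<^sup>2"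
  have N1: "real N \<ge> 1" using assms by simp
  have d1: "real d \<ge> 1" using assms(1,4) by (simp add: d_def Suc_leI card_gt_0_iff)
  have nd: "n = real d + real m" using assms(5) by (simp add: d_def m_def)
  have dn: "real d * 4 \<le> n"
  proof -
    have "real d * 4 \<le> real d * 2 ^ 36" by (intro mult_left_mono) auto
    then show ?thesis using assms(9) by (simp add: d_def)
  qed
  have n1: "n \<ge> 1" using dn d1 by linarith
  have sig: "\<sigma> > 0" "\<sigma> \<ge> 1" using n1 by (auto simp: \<sigma>_def intro: order_trans[of 1 "sqrt n"])
  have B0: "B > 0" using assms N1 d1 by (simp add: B_def)
  have Q0: "Q > 0" using assms by (simp add: Q_def)
  have A100: "A \<ge> 100" using assms(17) by (simp add: A_def d_def)
  have d0: "0 < del0" "del0 \<le> 1/100" by (auto simp: del0_def)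
  \<comment> \<open>Quarter and fifth of A respect \<open>3 * kmax < A\<close> and
    \<open>4 * J < A\<close>. Both remain proportional to n, which is what permits N to be
    exponentially large.\<close>
  define kmax where "kmax = nat \<lfloor>A / 4\<rfloor>"
  define J where "J = nat \<lfloor>A / 5\<rfloor>"
  have km: "real kmax \<le> A / 4" "A / 8 \<le> real kmax" using A100 unfolding kmax_def by linarith+
  have Jb: "real J \<le> A / 5" "A / 10 \<le> real J" using A100 unfolding J_def by linarith+
  define Z where "Z = (gap \<sigma> B T)\<^sup>2"
  have sB: "sqrt B = e1 * real N * sqrt (real d / 2)" using assms(10) by (simp add: B_def real_sqrt_mult real_sqrt_divide)
  have sd: "sqrt (real d / 2) > 0" using d1 by simp
  \<comment> \<open>\<open>gap\<close> is needed from below as well: the truncation error e^(-J/2)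
    has to stay under its square times e^(-del0 kmax).\<close>
  have Zlow: "1 / (real N)\<^sup>2 \<le> Z"
  proof -
    have "sqrt (real d / 2) \<le> \<sigma>"
    proof -
      have "sqrt (real d / 2) \<le> sqrt n" using dn d1 by (intro real_sqrt_le_mono) linarith
      also have "... \<le> \<sigma>" unfolding \<sigma>_def using n1 by simp
      finally show ?thesis .
    qed
    then have "e1 * real N * sqrt (real d / 2) \<le> 1 * real N * \<sigma>" using assms N1 sd by (intro mult_mono) auto
    then have "1 / real N \<le> \<sigma> / sqrt B" unfolding sB using assms N1 sd by (simp add: field_simps)
    also have "... \<le> 2 * \<sigma> / sqrt B + 1 / real T" using sig B0 by (simp add: field_simps add_nonneg_nonneg)
    finally have "(1 / real N)\<^sup>2 \<le> Z" unfolding Z_def by (intro power_mono) auto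
    then show ?thesis by (simp add: power_divide)
  qed
  have Zup: "Z \<le> CZ e1 kd / (real N)\<^sup>2"
  proof -
    have s1: "sqrt n \<le> sqrt (4 / kd) * sqrt (real d / 2)"
    proof -
      have "n \<le> (4 / kd) * (real d / 2)" using assms(6,8) by (simp add: d_def field_simps)
      then have "sqrt n \<le> sqrt ((4 / kd) * (real d / 2))" by (rule real_sqrt_le_mono)
      then show ?thesis by (simp only: real_sqrt_mult)
    qed
    have "2 * \<sigma> / sqrt B = (8 / (e1 * real N)) * (sqrt n / sqrt (real d / 2))" unfolding sB \<sigma>_def by simp
    also have "... \<le> (8 / (e1 * real N)) * sqrt (4 / kd)" using s1 sd assms N1 by (intro mult_left_mono) (auto simp: pos_divide_le_eq)
    also have "sqrt (4 / kd) = 2 / sqrt kd" by (simp add: real_sqrt_divide)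
    also have "(8 / (e1 * real N)) * (2 / sqrt kd) = (16 / (e1 * sqrt kd)) / real N" by simp
    also have "... \<le> (24 / (e1 * sqrt kd)) / real N" using assms by (intro divide_right_mono) auto
    finally have a: "2 * \<sigma> / sqrt B \<le> (24 / (e1 * sqrt kd)) / real N" .
    have "real N \<le> real T"
    proof -
      have "1 * real N * 1 \<le> (2 * \<rho> + 1) * real N * n" using assms(13) n1 by (intro mult_mono) auto
      then show ?thesis using assms(20) by linarith
    qed
    then have "1 / real T \<le> 1 / real N" using N1 by (intro divide_left_mono) auto
    then have "2 * \<sigma> / sqrt B + 1 / real T \<le> (24 / (e1 * sqrt kd) + 1) / real N" using a by (simp add: add_divide_distrib)
    then have "Z \<le> ((24 / (e1 * sqrt kd) + 1) / real N)\<^sup>2" unfolding Z_def using sig B0 by (intro power_mono) auto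
    then show ?thesis by (simp add: CZ_def power_divide)
  qed
  have aux: "del0 * \<alpha> * kd / 200 * n \<le> del0 * A / 100"
  proof -
    have "del0 * \<alpha> * kd / 200 * n = (del0 * \<alpha> / 100) * (kd / 2 * n)" by simp
    also have "... \<le> (del0 * \<alpha> / 100) * real d" using assms(8,15) d0 by (intro mult_left_mono) (auto simp: d_def)
    finally show ?thesis by (simp add: A_def)
  qed
  have NA: "real N \<le> exp (del0 * A / 100)" using assms(18) aux by (meson exp_le_cancel_iff order_trans)
  have h16: "exp (- (real J / 2)) \<le> Z * exp (- (del0 * real kmax))"
  proof -
    have "del0 * A \<le> A / 100" using d0 A100 by (simp add: field_simps)
    then have "2 * (del0 * A / 100) + del0 * real kmax \<le> real J / 2"
    proof -
      have "del0 * real kmax \<le> del0 * (A / 4)" using km d0 by (intro mult_left_mono) auto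
      moreover have "del0 * (A / 4) = del0 * A / 4" by simp
      ultimately show ?thesis using \<open>del0 * A \<le> A / 100\<close> Jb A100 by linarith
    qed
    then have "exp (- (real J / 2)) \<le> exp (- (2 * (del0 * A / 100)) + - (del0 * real kmax))" by simp
    also have "... = exp (- (2 * (del0 * A / 100))) * exp (- (del0 * real kmax))" by (rule exp_add)
    also have "exp (- (2 * (del0 * A / 100))) \<le> 1 / (real N)\<^sup>2"
    proof -
      have "(real N)\<^sup>2 \<le> (exp (del0 * A / 100))\<^sup>2" using NA by (intro power_mono) auto
      also have "... = exp (2 * (del0 * A / 100))" by (rule exp_double[symmetric])
      finally have "1 / exp (2 * (del0 * A / 100)) \<le> 1 / (real N)\<^sup>2" using N1 by (intro divide_left_mono) auto
      then show ?thesis by (simp add: exp_minus field_simps)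
    qed
    also have "1 / (real N)\<^sup>2 \<le> Z" by (rule Zlow)
    finally show ?thesis by simp
  qed
  have An: "A \<le> n"
  proof -
    have "A \<le> 1 * real d" unfolding A_def using assms(16) by (intro mult_right_mono) auto
    then show ?thesis using nd by linarith
  qed
  let ?xx = "\<lambda>j. real_of_int (x j)"
  have sumX: "(\<Sum>j\<in>D. (?xx j)\<^sup>2) \<le> Q * B"
  proof -
    have "(\<Sum>j\<in>D. (?xx j)\<^sup>2) \<le> (\<Sum>j\<in>D. (K * real N)\<^sup>2)"
    proof (rule sum_mono)
      fix j assume j: "j \<in> D"
      have "\<bar>?xx j\<bar> \<le> \<bar>K * real N\<bar>" using assms(22)[OF j] assms(12) by (auto simp: boxS_def)
      then show "(?xx j)\<^sup>2 \<le> (K * real N)\<^sup>2" by (rule abs_le_square_iff[THEN iffD1])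
    qed
    also have "... = Q * B" using assms(10) by (simp add: Q_def B_def d_def power_mult_distrib)
    finally show ?thesis .
  qed
  let ?U = "{u \<in> PiE E (\<lambda>_. UNIV). (\<Sum>i\<in>E. (real_of_int (u i))\<^sup>2) \<le> \<rho>\<^sup>2 * (real N)\<^sup>2 * n}"
  let ?F = "\<lambda>u. fM D E T \<sigma> (\<lambda>v. if v \<in> E then real_of_int (u v) else real_of_int (x v))"
    have t1: "real (card E) \<le> n" using nd by (simp add: m_def)
    have t2: "n \<le> 2 * real (card E)" using nd dn by (simp add: m_def)
    have t3: "nonlattice D \<sigma> A B ?xx" using assms(23) by (simp add: A_def B_def \<sigma>_def d_def)
    have t4: "3 * real kmax < A" "4 * real J < A" using km Jb A100 by auto
    have t5: "2 * \<rho> * real N * n \<le> \<sigma> * real T"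
    proof -
      have "2 * \<rho> * real N * n \<le> (2 * \<rho> + 1) * real N * n" using n1 by (intro mult_right_mono) auto
      also have "... \<le> real T" by (rule assms(20))
      also have "... \<le> \<sigma> * real T" using sig mult_right_mono[of 1 \<sigma> "real T"] by simp
      finally show ?thesis .
    qed
    have t6: "real N \<le> exp (del0 / 8 * n)"
    proof -
      have "del0 * A / 100 \<le> del0 / 8 * n"
      proof -
        have "del0 * A \<le> del0 * n" using An d0 by (intro mult_left_mono) auto
        then show ?thesis using d0 n1 by (simp add: field_simps)
      qed
      then show ?thesis using NA by (meson exp_le_cancel_iff order_trans)
    qed
    have t7: "real N ^ (2 * card D) \<le> exp (del0 / 8 * n * real kmax)"
    proof -
      have "real N ^ (2 * card D) \<le> exp (del0 * A / 100) ^ (2 * card D)" using NA by (intro power_mono) auto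
      also have "... = exp (2 * real d * (del0 * A / 100))" by (simp add: exp_of_nat_mult[symmetric] d_def)
      also have "... \<le> exp (del0 / 8 * n * real kmax)"
      proof -
        have "2 * real d * (del0 * A / 100) = del0 * (A * real d / 50)" by simp
        also have "... \<le> del0 * (n * (A / 8) / 8)"
        proof (rule mult_left_mono)
          have "A * (real d * 4) \<le> A * n" using dn A100 by (intro mult_left_mono) auto
          then show "A * real d / 50 \<le> n * (A / 8) / 8" using A100 d1 by (simp add: field_simps)
        qed (use d0 in simp)
        also have "... \<le> del0 * (n * real kmax / 8)" using km d0 n1 by (intro mult_left_mono divide_right_mono) auto
        finally show ?thesis by simp
      qed
      finally show ?thesis .
    qed
    note T = assms(1-4) t1 t2 assms(9) t3 B0 \<sigma>_def assms(19) Q0 sumX t4 h16[unfolded Z_def] assms(14,13) t5 t6 t7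
  have sm1: "finite ?U" by (rule second_moment_fixed(1)[where A = A and J = J and kmax = kmax and X = ?xx and \<sigma> = \<sigma>]) (fact T)+
  have sm2: "(\<Sum>u\<in>?U. (?F u)\<^sup>2) * real N ^ (2 * card D)
    \<le> (2 * real (card D) + 1) * (2 * exp (GamC \<rho> * n) * real N ^ card E) * ((rowM Q + 1) * (gap \<sigma> B T)\<^sup>2) ^ card E"
    by (rule second_moment_fixed(2)[where A = A and J = J and kmax = kmax and X = ?xx and \<sigma> = \<sigma>]) (fact T)+
  note sm = sm1 sm2
  define G where "G = {u \<in> ?U. (L / real N) ^ (d + m) \<le> ?F u}"
  have "real (card G) * ((L / real N) ^ (d + m))\<^sup>2 = (\<Sum>u\<in>G. ((L / real N) ^ (d + m))\<^sup>2)" by simp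
  also have "... \<le> (\<Sum>u\<in>G. (?F u)\<^sup>2)" using assms(21) by (intro sum_mono power_mono) (auto simp: G_def)
  also have "... \<le> (\<Sum>u\<in>?U. (?F u)\<^sup>2)" using sm(1) by (intro sum_mono2) (auto simp: G_def)
  finally have "real (card G) * ((L / real N) ^ (d + m))\<^sup>2 * real N ^ (2 * d) \<le> (\<Sum>u\<in>?U. (?F u)\<^sup>2) * real N ^ (2 * d)"
    by (rule mult_right_mono) simp
  also have "... \<le> (2 * real d + 1) * (2 * exp (GamC \<rho> * n) * real N ^ m) * ((rowM Q + 1) * Z) ^ m"
    using sm(2) by (simp only: d_def m_def Z_def)
  also have "... \<le> (3 * n) * (2 * exp (GamC \<rho> * n) * real N ^ m) * ((rowM Q + 1) * (CZ e1 kd / (real N)\<^sup>2)) ^ m"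
  proof (intro mult_mono power_mono)
    show "2 * real d + 1 \<le> 3 * n" using nd n1 by simp
    have rM: "0 \<le> rowM Q" by (simp add: rowM_def)
    show "(rowM Q + 1) \<le> (rowM Q + 1)" by simp
    show "Z \<le> CZ e1 kd / (real N)\<^sup>2" by (rule Zup)
    show "0 \<le> rowM Q + 1" using rM by simp
    show "0 \<le> Z" by (simp add: Z_def)
    show "0 \<le> (rowM Q + 1) * Z" using rM by (simp add: Z_def)
    then show "0 \<le> ((rowM Q + 1) * Z) ^ m" by simp
  qed (use n1 in auto)
  also have "... = (3 * n * 2 * exp (GamC \<rho> * n) * ((rowM Q + 1) * CZ e1 kd) ^ m) * (real N ^ m / real N ^ (2 * m))"
    by (simp add: power_mult_distrib power_divide power_mult[symmetric])
  finally have main: "real (card G) * ((L / real N) ^ (d + m))\<^sup>2 * real N ^ (2 * d) \<le> (3 * n * 2 * exp (GamC \<rho> * n) * ((rowM Q + 1) * CZ e1 kd) ^ m) * (real N ^ m / real N ^ (2 * m))" .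
  have "real (card G) * L ^ (2 * (d + m)) = (real (card G) * ((L / real N) ^ (d + m))\<^sup>2 * real N ^ (2 * d)) * real N ^ (2 * m)"
  proof -
    have "((L / real N) ^ (d + m))\<^sup>2 = L ^ (2 * (d + m)) / real N ^ (2 * (d + m))"
      by (simp add: power_divide power_mult[symmetric] mult.commute)
    moreover have "real N ^ (2 * (d + m)) = real N ^ (2 * d) * real N ^ (2 * m)" by (simp add: power_add[symmetric] distrib_left)
    ultimately show ?thesis using N1 by simp
  qed
  also have "... \<le> ((3 * n * 2 * exp (GamC \<rho> * n) * ((rowM Q + 1) * CZ e1 kd) ^ m) * (real N ^ m / real N ^ (2 * m))) * real N ^ (2 * m)"
    by (rule mult_right_mono[OF main]) simp
  also have "... = (3 * n * 2 * exp (GamC \<rho> * n) * ((rowM Q + 1) * CZ e1 kd) ^ m) * real N ^ m" using N1 by simp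
  finally have "real (card G) * L ^ (2 * (d + m)) \<le> (3 * n * 2 * exp (GamC \<rho> * n) * ((rowM Q + 1) * CZ e1 kd) ^ m) * real N ^ m" .
  moreover have "G = {u \<in> PiE E (\<lambda>_. UNIV). (\<Sum>i\<in>E. (real_of_int (u i))\<^sup>2) \<le> \<rho>\<^sup>2 * (real N)\<^sup>2 * n \<and>
      (L / real N) ^ (card D + card E) \<le> fM D E T (4 * sqrt n) (\<lambda>v. if v \<in> E then real_of_int (u v) else real_of_int (x v))}"
    unfolding G_def d_def m_def \<sigma>_def by blast
  ultimately show ?thesis by (simp only: d_def m_def Q_def)
qed

text \<open>Fibre over the restriction to \<open>D\<close>. Lattice-like restrictions are rare and
  receive the trivial bound for their fibres; all others receive the second moment bound.\<close>

lemma heavy_card: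
  fixes D E :: "'v set" and N :: nat
  assumes "finite D" "finite E" "D \<inter> E = {}" "D \<noteq> {}" "n = real (card D + card E)"
    "0 < kd" "kd \<le> 1" "kd / 2 * n \<le> real (card D)" "real (card D) * 2 ^ 36 \<le> n"
    "0 < e1" "e1 \<le> 1" "K \<ge> 1" "\<rho> \<ge> 1" "N \<ge> 1" "0 < s" "s \<le> 1/2" "100 \<le> s ^ 4 * real (card D)" "4 / (4 * sqrt n) \<le> s"
    "real N \<le> exp (del0 * s ^ 4 * kd / 200 * n)" "T > 0" "(2 * \<rho> + 1) * real N * n \<le> real T" "L > 0"
  shows "finite (heavy D E e1 K \<rho> N n T L)"
    "real (card (heavy D E e1 K \<rho> N n T L)) \<le>
      (3 * K * real N) ^ card D * ((3 * n * 2 * exp (GamC \<rho> * n) * ((rowM (2 * K\<^sup>2 / e1\<^sup>2) + 1) * CZ e1 kd) ^ card E) * real N ^ card E / L ^ (2 * (card D + card E)))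
      + ((3 * K * real N / s\<^sup>2) * (exp 4 * (18 * s * K * real N)) ^ card D) * (exp (\<rho> * n) * (3 * real N) ^ card E)"
proof -
  let ?W = "heavy D E e1 K \<rho> N n T L"
  have N1: "real N \<ge> 1" using assms by simp
  have n1: "n \<ge> 1"
  proof -
    have "card D \<ge> 1" using assms(1,4) by (simp add: Suc_leI card_gt_0_iff)
    then show ?thesis using assms(5) by simp
  qed
  have "1 \<le> sqrt n" using n1 by simp
  then have sig1: "1 \<le> 4 * sqrt n" by linarith
  let ?P = "PiE D (\<lambda>_. boxS e1 K N)"
  have fb: "finite (boxS e1 K N)" using boxS_card assms by auto
  have fP: "finite ?P" using fb assms by (intro finite_PiE) auto
  define Bad where "Bad = {X \<in> ?P. \<not> nonlattice D (4 * sqrt n) (s ^ 4 * real (card D)) (e1\<^sup>2 / 2 * (real N)\<^sup>2 * real (card D)) (\<lambda>j. of_int (X j))}"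
  have fBad: "finite Bad" using fP by (simp add: Bad_def)
  define f where "f u = restrict u D" for u :: "'v => int"
  define g where "g u = restrict u E" for u :: "'v => int"
  have fm: "f u \<in> ?P" if "u \<in> ?W" for u using that by (auto simp: f_def heavy_def)
  have el1: "(\<Sum>i\<in>E. \<bar>real_of_int (u i)\<bar>) \<le> \<rho> * real N * n" if "(\<Sum>i\<in>E. (real_of_int (u i))\<^sup>2) \<le> \<rho>\<^sup>2 * (real N)\<^sup>2 * n" for u
  proof -
    have "(\<Sum>i\<in>E. \<bar>real_of_int (u i)\<bar>) \<le> sqrt (real (card E) * (\<rho>\<^sup>2 * (real N)\<^sup>2 * n))" using that by (rule sum_abs_le_sqrt)
    also have "... \<le> sqrt (n * (\<rho>\<^sup>2 * (real N)\<^sup>2 * n))" using assms(5) n1 by (intro real_sqrt_le_mono mult_right_mono) auto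
    also have "... = \<rho> * real N * n" using n1 assms(13) by (simp add: real_sqrt_mult)
    finally show ?thesis .
  qed
  have ginj: "inj_on g {u \<in> ?W. f u = X}" for X
  proof (rule inj_onI)
    fix u v assume uv: "u \<in> {u \<in> ?W. f u = X}" "v \<in> {u \<in> ?W. f u = X}" "g u = g v"
    show "u = v"
    proof
      fix i
      have "f u i = f v i" "g u i = g v i" using uv by auto
      then show "u i = v i" using uv(1,2) by (cases "i \<in> D"; cases "i \<in> E") (auto simp: f_def g_def heavy_def PiE_def extensional_def)
    qed
  qed
  have gL1: "g ` {u \<in> ?W. f u = X} \<subseteq> L1 E (\<rho> * real N * n)" for X
  proof (rule image_subsetI)
    fix u assume "u \<in> {u \<in> ?W. f u = X}"
    then show "g u \<in> L1 E (\<rho> * real N * n)" using el1[of u] by (auto simp: L1_def g_def heavy_def)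
  qed
  have fib_fin: "finite {u \<in> ?W. f u = X}" for X using finite_imageD[OF finite_subset[OF gL1 finite_L1[OF assms(2)]] ginj] .
  show fW: "finite ?W"
  proof (rule finite_subset)
    show "?W \<subseteq> (\<Union>X\<in>?P. {u \<in> ?W. f u = X})" using fm by blast
    show "finite (\<Union>X\<in>?P. {u \<in> ?W. f u = X})" using fP fib_fin by blast
  qed
  define Wb where "Wb = {u \<in> ?W. f u \<in> Bad}"
  define Wg where "Wg = {u \<in> ?W. f u \<notin> Bad}"
  have fWb: "finite Wb" "finite Wg" using fW by (auto simp: Wb_def Wg_def)
  define F1 where "F1 = (3 * n * 2 * exp (GamC \<rho> * n) * ((rowM (2 * K\<^sup>2 / e1\<^sup>2) + 1) * CZ e1 kd) ^ card E) * real N ^ card E / L ^ (2 * (card D + card E))"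
  define F2 where "F2 = exp (\<rho> * n) * (3 * real N) ^ card E"
  have b2: "real (card Wb) \<le> real (card Bad) * F2"
  proof (rule card_le_fibers[where f = f, OF fWb(1) fBad])
    fix X assume "X \<in> Bad"
    have "card {u \<in> Wb. f u = X} \<le> card {u \<in> ?W. f u = X}" using fib_fin by (intro card_mono) (auto simp: Wb_def)
    also have "... = card (g ` {u \<in> ?W. f u = X})" using ginj by (simp add: card_image)
    also have "... \<le> card (L1 E (\<rho> * real N * n))" by (rule card_mono[OF finite_L1[OF assms(2)] gL1])
    finally have "real (card {u \<in> Wb. f u = X}) \<le> real (card (L1 E (\<rho> * real N * n)))" by simp
    also have "... \<le> F2" unfolding F2_def using assms N1 by (intro card_L1_scaled) auto
    finally show "real (card {u \<in> Wb. f u = X}) \<le> F2" .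
  qed (auto simp: Wb_def)
  have b1: "real (card Wg) \<le> real (card ?P) * F1"
  proof (rule card_le_fibers[where f = f, OF fWb(2) fP])
    fix u assume "u \<in> Wg" then show "f u \<in> ?P" using fm by (auto simp: Wg_def)
  next
    fix X assume X: "X \<in> ?P"
    show "real (card {u \<in> Wg. f u = X}) \<le> F1"
    proof (cases "X \<in> Bad")
      case True
      then have "{u \<in> Wg. f u = X} = {}" by (auto simp: Wg_def)
      then have "real (card {u \<in> Wg. f u = X}) = 0" by (metis card.empty of_nat_0)
      moreover have "0 \<le> F1" using n1 assms by (simp add: F1_def rowM_def CZ_def)
      ultimately show ?thesis by simp
    next
      case False
      let ?G = "{u \<in> PiE E (\<lambda>_. UNIV). (\<Sum>i\<in>E. (real_of_int (u i))\<^sup>2) \<le> \<rho>\<^sup>2 * (real N)\<^sup>2 * n \<and>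
        (L / real N) ^ (card D + card E) \<le> fM D E T (4 * sqrt n) (\<lambda>v. if v \<in> E then real_of_int (u v) else real_of_int (X v))}"
      have nl: "nonlattice D (4 * sqrt n) (s ^ 4 * real (card D)) (e1\<^sup>2 / 2 * (real N)\<^sup>2 * real (card D)) (\<lambda>j. of_int (X j))"
        using False X by (simp add: Bad_def)
      have s4: "0 < s ^ 4" "s ^ 4 \<le> 1" using assms(15,16) by (auto intro: power_le_one)
      have cG: "real (card ?G) * L ^ (2 * (card D + card E)) \<le> (3 * n * 2 * exp (GamC \<rho> * n) * ((rowM (2 * K\<^sup>2 / e1\<^sup>2) + 1) * CZ e1 kd) ^ card E) * real N ^ card E"
        by (rule good_fiber_count[OF assms(1-12) _ assms(14) s4 assms(17,19,20,21,22) _ nl])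
           (use assms(13) PiE_mem[OF X] in auto)
      have gG: "g ` {u \<in> Wg. f u = X} \<subseteq> ?G"
      proof (rule image_subsetI)
        fix u assume "u \<in> {u \<in> Wg. f u = X}"
        then have u: "u \<in> ?W" "f u = X" by (auto simp: Wg_def)
        have "fM D E T (4 * sqrt n) (\<lambda>v. real_of_int (u v)) = fM D E T (4 * sqrt n) (\<lambda>v. if v \<in> E then real_of_int (g u v) else real_of_int (X v))"
          by (rule fM_cong[OF assms(3)]) (auto simp: g_def u(2)[symmetric] f_def)
        moreover have "(\<Sum>i\<in>E. (real_of_int (g u i))\<^sup>2) = (\<Sum>i\<in>E. (real_of_int (u i))\<^sup>2)" by (intro sum.cong refl) (simp add: g_def)
        moreover have "g u \<in> PiE E (\<lambda>_. UNIV)" by (simp add: g_def)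
        ultimately show "g u \<in> ?G" using u(1) by (simp add: heavy_def)
      qed
      have fG: "finite ?G" by (rule finite_subset[OF _ finite_L1[OF assms(2), of "\<rho> * real N * n"]]) (use el1 in \<open>auto simp: L1_def\<close>)
      have inj2: "inj_on g {u \<in> Wg. f u = X}" by (rule inj_on_subset[OF ginj[of X]]) (auto simp: Wg_def)
      have "card {u \<in> Wg. f u = X} \<le> card ?G" using card_mono[OF fG gG] card_image[OF inj2] by simp
      then have "real (card {u \<in> Wg. f u = X}) \<le> real (card ?G)" by simp
      also have "... \<le> F1" unfolding F1_def using cG assms(22) by (simp add: pos_le_divide_eq)
      finally show ?thesis .
    qed
  qed
  have "card ?W = card Wb + card Wg"
  proof -
    have "?W = Wb \<union> Wg" "Wb \<inter> Wg = {}" by (auto simp: Wb_def Wg_def)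
    then show ?thesis using fWb card_Un_disjoint by metis
  qed
  then have "real (card ?W) \<le> real (card ?P) * F1 + real (card Bad) * F2" using b1 b2 by simp
  also have "... \<le> (3 * K * real N) ^ card D * F1 + ((3 * K * real N / s\<^sup>2) * (exp 4 * (18 * s * K * real N)) ^ card D) * F2"
  proof (intro add_mono mult_right_mono)
    have "real (card ?P) = real (card (boxS e1 K N)) ^ card D" using assms(1) by (simp add: card_PiE)
    also have "... \<le> (3 * K * real N) ^ card D" using boxS_card assms by (intro power_mono) auto
    finally show "real (card ?P) \<le> (3 * K * real N) ^ card D" .
    show "real (card Bad) \<le> (3 * K * real N / s\<^sup>2) * (exp 4 * (18 * s * K * real N)) ^ card D"
      unfolding Bad_def by (rule bad_count[OF assms(1,4,10-12,14-16) sig1 assms(18)])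
    show "0 \<le> F1" using n1 assms by (simp add: F1_def rowM_def CZ_def)
    show "0 \<le> F2" by (simp add: F2_def)
  qed
  finally show "real (card ?W) \<le>
      (3 * K * real N) ^ card D * ((3 * n * 2 * exp (GamC \<rho> * n) * ((rowM (2 * K\<^sup>2 / e1\<^sup>2) + 1) * CZ e1 kd) ^ card E) * real N ^ card E / L ^ (2 * (card D + card E)))
      + ((3 * K * real N / s\<^sup>2) * (exp 4 * (18 * s * K * real N)) ^ card D) * (exp (\<rho> * n) * (3 * real N) ^ card E)"
    unfolding F1_def F2_def .
qed

text \<open>\<open>C\<close> has to be independent of \<open>L\<close>. The parameter s is therefore
  chosen after L, as half of L^(-4/kd): then s^|D| \<le> L^(-2n) because |D| \<ge> kd n / 2, so the
  lattice-like vectors gain as much as the others. The dependence on L is confined to the rate c and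
  the initial dimension.\<close>

lemma heavy_count:
  assumes "0 < kd" "kd \<le> 1" "0 < e1" "e1 \<le> 1" "K \<ge> 1" "\<rho> \<ge> 1"
  shows "\<exists>C\<ge>1. \<forall>L\<ge>1. \<exists>c>0. \<exists>n0. \<forall>(D::'v set) E N T n. finite D --> finite E --> D \<inter> E = {} -->
     n = card D + card E --> n0 \<le> n --> kd / 2 * real n \<le> real (card D) --> real (card D) * 2 ^ 36 \<le> real n -->
     1 \<le> N --> real N \<le> exp (c * real n) --> (2 * \<rho> + 1) * real N * real n \<le> real T -->
     finite (heavy D E e1 K \<rho> N (real n) T L) \<and>
     real (card (heavy D E e1 K \<rho> N (real n) T L)) \<le> (C * real N / L\<^sup>2) ^ n"
proof -
  define G where "G = (rowM (2 * K\<^sup>2 / e1\<^sup>2) + 1) * CZ e1 kd"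
  have G1: "G \<ge> 1"
  proof -
    have "1 \<le> 24 / (e1 * sqrt kd) + 1" using assms by simp
    then have "1 \<le> CZ e1 kd" unfolding CZ_def by (rule one_le_power)
    moreover have "1 \<le> rowM (2 * K\<^sup>2 / e1\<^sup>2) + 1" by (simp add: rowM_def)
    ultimately show ?thesis unfolding G_def using mult_mono[of 1 "rowM (2 * K\<^sup>2 / e1\<^sup>2) + 1" 1 "CZ e1 kd"] by simp
  qed
  define C1 where "C1 = 3 * K * exp 6 * exp (GamC \<rho>) * G"
  define C2 where "C2 = exp 1 * exp 1 * (exp 4 * (18 * K)) * (exp \<rho> * 3)"
  have C1: "C1 \<ge> 0" using assms G1 by (simp add: C1_def)
  have C2: "C2 \<ge> 1"
  proof -
    have "(1::real) * 1 * (1 * (1 * 1)) * (1 * 1) \<le> exp 1 * exp 1 * (exp 4 * (18 * K)) * (exp \<rho> * 3)" using assms by (intro mult_mono) auto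
    then show ?thesis by (simp add: C2_def)
  qed
  show ?thesis
  proof (rule exI[of _ "C1 + C2"], intro conjI allI impI)
    show "1 \<le> C1 + C2" using C1 C2 by simp
    fix L :: real assume L: "1 \<le> L"
    define s where "s = 1/2 * (1 / L) powr (4 / kd)"
    have p1: "0 < (1 / L) powr (4 / kd)" "(1 / L) powr (4 / kd) \<le> 1" using L assms by (auto intro!: powr_le1)
    have s: "0 < s" "s \<le> 1/2" using p1 by (auto simp: s_def)
    define c where "c = del0 * s ^ 4 * kd / 200"
    have d0: "0 < del0" "del0 \<le> 1" by (auto simp: del0_def)
    have c: "0 < c" "c \<le> 1"
    proof -
      show "0 < c" using d0 s assms by (simp add: c_def)
      have "del0 * s ^ 4 * kd \<le> 1 * 1 * 1" using d0 s assms by (intro mult_mono power_le_one) auto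
      then show "c \<le> 1" by (simp add: c_def)
    qed
    define n0 where "n0 = nat \<lceil>200 / (s ^ 4 * kd) + 1 / s\<^sup>2 + 3 * K / s\<^sup>2 + 1\<rceil>"
    show "\<exists>c>0. \<exists>n0. \<forall>(D::'v set) E N T n. finite D --> finite E --> D \<inter> E = {} -->
     n = card D + card E --> n0 \<le> n --> kd / 2 * real n \<le> real (card D) --> real (card D) * 2 ^ 36 \<le> real n -->
     1 \<le> N --> real N \<le> exp (c * real n) --> (2 * \<rho> + 1) * real N * real n \<le> real T -->
     finite (heavy D E e1 K \<rho> N (real n) T L) \<and>
     real (card (heavy D E e1 K \<rho> N (real n) T L)) \<le> ((C1 + C2) * real N / L\<^sup>2) ^ n"
    proof (rule exI[of _ c], rule conjI[OF c(1)], rule exI[of _ n0], intro allI impI)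
      fix D E :: "'v set" and N T n :: nat
      assume h: "finite D" "finite E" "D \<inter> E = {}" "n = card D + card E" "n0 \<le> n" "kd / 2 * real n \<le> real (card D)"
        "real (card D) * 2 ^ 36 \<le> real n" "1 \<le> N" "real N \<le> exp (c * real n)" "(2 * \<rho> + 1) * real N * real n \<le> real T"
      have nb: "200 / (s ^ 4 * kd) + 1 / s\<^sup>2 + 3 * K / s\<^sup>2 + 1 \<le> real n" using h(5) unfolding n0_def by linarith
      have pos: "0 \<le> 200 / (s ^ 4 * kd)" "0 \<le> 1 / s\<^sup>2" "0 \<le> 3 * K / s\<^sup>2" using s assms by auto
      have n1: "real n \<ge> 1" "200 / (s ^ 4 * kd) \<le> real n" "1 / s\<^sup>2 \<le> real n" "3 * K / s\<^sup>2 \<le> real n" using nb pos by linarith+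
      have N1: "real N \<ge> 1" using h by simp
      have Dne: "D \<noteq> {}"
      proof
        assume "D = {}"
        then have "kd / 2 * real n \<le> 0" using h(6) by simp
        then show False using assms n1 by (simp add: mult_le_0_iff)
      qed
      have nn: "real n = real (card D + card E)" using h by simp
      have h17: "100 \<le> s ^ 4 * real (card D)"
      proof -
        have "200 \<le> real n * (s ^ 4 * kd)" using n1(2) s assms by (simp add: pos_divide_le_eq)
        then have "100 \<le> s ^ 4 * (kd / 2 * real n)" by (simp add: mult_ac)
        also have "... \<le> s ^ 4 * real (card D)" using h(6) s by (intro mult_left_mono) auto
        finally show ?thesis .
      qed
      have h18: "4 / (4 * sqrt (real n)) \<le> s"
      proof -
        have "sqrt (1 / s\<^sup>2) \<le> sqrt (real n)" using n1(3) by (rule real_sqrt_le_mono)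
        then have "1 / s \<le> sqrt (real n)" using s by (simp add: real_sqrt_divide)
        then show ?thesis using s n1 by (simp add: field_simps)
      qed
      have h20: "T > 0"
      proof -
        have "0 < (2 * \<rho> + 1) * real N * real n" using assms N1 n1 by (intro mult_pos_pos) auto
        then show ?thesis using h(10) by (metis of_nat_0_less_iff order_less_le_trans)
      qed
      have h22: "L > 0" using L by simp
      have h19: "real N \<le> exp (del0 * s ^ 4 * kd / 200 * real n)" using h(9) by (simp add: c_def)
      note H = heavy_card[OF h(1-3) Dne nn assms(1,2) h(6,7) assms(3-6) h(8) s h17 h18 h19 h20 h(10) h22]
      have cN: "exp (c * real n) \<le> exp 1 ^ n"
      proof -
        have "c * real n \<le> 1 * real n" using c by (intro mult_right_mono) auto
        then show ?thesis by (simp add: exp_of_nat_mult[symmetric])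
      qed
      have e54: "(18::real) ^ n * 3 ^ n = 54 ^ n" by (simp add: power_mult_distrib[symmetric])
      have eN: "real N ^ n = real N ^ card D * real N ^ card E" by (simp add: h(4) power_add)
      have eG: "exp (GamC \<rho> * real n) = exp (GamC \<rho>) ^ n" and eR: "exp (\<rho> * real n) = exp \<rho> ^ n"
        by (simp_all add: exp_of_nat_mult[symmetric] mult.commute)
      have t1: "(3 * K * real N) ^ card D * ((3 * real n * 2 * exp (GamC \<rho> * real n) * G ^ card E) * real N ^ card E / L ^ (2 * (card D + card E)))
          \<le> (C1 * real N / L\<^sup>2) ^ n"
      proof -
        have "(3 * K * real N) ^ card D * ((3 * real n * 2 * exp (GamC \<rho> * real n) * G ^ card E) * real N ^ card E / L ^ (2 * (card D + card E)))
           = ((3 * K) ^ card D * (6 * real n) * exp (GamC \<rho>) ^ n * G ^ card E) * (real N ^ n / L ^ (2 * n))"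
          by (simp add: eN eG h(4)[symmetric] power_mult_distrib)
        also have "... \<le> ((3 * K) ^ n * exp 6 ^ n * exp (GamC \<rho>) ^ n * G ^ n) * (real N ^ n / L ^ (2 * n))"
        proof (intro mult_right_mono mult_mono)
          show "(3 * K) ^ card D \<le> (3 * K) ^ n" using assms h(4) by (intro power_increasing) auto
          have "6 * real n \<le> exp (6 * real n)" using exp_ge_add_one_self[of "6 * real n"] by linarith
          then show "6 * real n \<le> exp 6 ^ n" by (simp add: exp_of_nat_mult[symmetric] mult.commute)
          show "G ^ card E \<le> G ^ n" using G1 h(4) by (intro power_increasing) auto
        qed (use assms G1 N1 in auto)
        also have "... = (C1 * real N / L\<^sup>2) ^ n" by (simp add: C1_def power_mult_distrib power_divide power_mult[symmetric])
        finally show ?thesis .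
      qed
      have sd: "s ^ card D \<le> 1 / (L\<^sup>2) ^ n"
      proof -
        have "s ^ card D \<le> ((1 / L) powr (4 / kd)) ^ card D" using s p1 by (intro power_mono) (auto simp: s_def)
        also have "... = (1 / L) powr (4 / kd * real (card D))" using p1 L by (simp add: powr_realpow[symmetric] powr_powr)
        also have "... \<le> (1 / L) powr real (2 * n)"
        proof (rule powr_mono')
          have "kd * real n \<le> 2 * real (card D)" using h(6) by simp
          then show "real (2 * n) \<le> 4 / kd * real (card D)" using assms by (simp add: field_simps)
        qed (use L in auto)
        also have "... = (1 / L) ^ (2 * n)" using L by (subst powr_realpow) auto
        also have "... = 1 / (L\<^sup>2) ^ n" by (simp add: power_divide power_mult)
        finally show ?thesis .
      qed
      have t2: "((3 * K * real N / s\<^sup>2) * (exp 4 * (18 * s * K * real N)) ^ card D) * (exp (\<rho> * real n) * (3 * real N) ^ card E)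
          \<le> (C2 * real N / L\<^sup>2) ^ n"
      proof -
        have "((3 * K * real N / s\<^sup>2) * (exp 4 * (18 * s * K * real N)) ^ card D) * (exp (\<rho> * real n) * (3 * real N) ^ card E)
           = ((3 * K / s\<^sup>2) * real N * (exp 4 * (18 * K)) ^ card D * (exp \<rho> ^ n * 3 ^ card E)) * (s ^ card D * real N ^ n)"
          by (simp add: eN eR power_mult_distrib)
        also have "... \<le> (exp 1 ^ n * exp 1 ^ n * (exp 4 * (18 * K)) ^ n * (exp \<rho> ^ n * 3 ^ n)) * (1 / (L\<^sup>2) ^ n * real N ^ n)"
        proof (intro mult_mono sd)
          have "3 * K / s\<^sup>2 \<le> exp (real n)" using n1(4) exp_ge_add_one_self[of "real n"] by linarith
          then show "3 * K / s\<^sup>2 \<le> exp 1 ^ n" by (simp add: exp_of_nat_mult[symmetric])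
          show "real N \<le> exp 1 ^ n" using h(9) cN by linarith
          have "1 * 1 \<le> exp 4 * (18 * K)" using assms by (intro mult_mono) auto
          then show "(exp 4 * (18 * K)) ^ card D \<le> (exp 4 * (18 * K)) ^ n" using h(4) by (intro power_increasing) auto
          show "(3::real) ^ card E \<le> 3 ^ n" using h(4) by (intro power_increasing) auto
        qed (use assms s N1 in auto)
        also have "... = (C2 * real N / L\<^sup>2) ^ n" using e54 by (simp add: C2_def power_mult_distrib power_divide)
        finally show ?thesis .
      qed
      have add: "a ^ n + b ^ n \<le> (a + b) ^ n" if "0 \<le> a" "0 \<le> b" for a b :: real
      proof -
        have "n \<ge> 1" using n1(1) by simp
        then show ?thesis
        proof (induction n rule: dec_induct)
          case (step k)
          have "a ^ Suc k + b ^ Suc k \<le> (a + b) * (a ^ k + b ^ k)" using that by (simp add: algebra_simps)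
          also have "... \<le> (a + b) * (a + b) ^ k" using step that by (intro mult_left_mono) auto
          finally show ?case by simp
        qed simp
      qed
      have "real (card (heavy D E e1 K \<rho> N (real n) T L)) \<le> (C1 * real N / L\<^sup>2) ^ n + (C2 * real N / L\<^sup>2) ^ n"
        using H(2) t1 t2 unfolding G_def by linarith
      also have "... \<le> (C1 * real N / L\<^sup>2 + C2 * real N / L\<^sup>2) ^ n" using C1 C2 L by (intro add) auto
      also have "C1 * real N / L\<^sup>2 + C2 * real N / L\<^sup>2 = (C1 + C2) * real N / L\<^sup>2" by (simp add: algebra_simps add_divide_distrib)
      finally have "real (card (heavy D E e1 K \<rho> N (real n) T L)) \<le> ((C1 + C2) * real N / L\<^sup>2) ^ n" .
      then show "finite (heavy D E e1 K \<rho> N (real n) T L) \<and>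
        real (card (heavy D E e1 K \<rho> N (real n) T L)) \<le> ((C1 + C2) * real N / L\<^sup>2) ^ n" using H(1) by blast
    qed
  qed
qed

section \<open>Symmetric sign matrices\<close>

text \<open>Positions on and above the diagonal: free signs on them parametrise the symmetric sign
  matrices without redundancy.\<close>

definition prs :: "nat set => (nat \<times> nat) set" where
  "prs V = {(i, j). i \<in> V \<and> j \<in> V \<and> i \<le> j}"

abbreviation symm :: "nat set => (nat \<times> nat => real) set" where "symm V \<equiv> signs (prs V)"

definition ent :: "(nat \<times> nat => real) => nat => nat => real" where
  "ent s i j = s (min i j, max i j)"

definition mv :: "(nat \<times> nat => real) => nat set => (nat => real) => nat => real" where
  "mv s V v i = (\<Sum>j\<in>V. ent s i j * v j)"

lemma finite_prs: "finite V ==> finite (prs V)"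
  by (rule finite_subset[of _ "V \<times> V"]) (auto simp: prs_def)

lemma symm_fin: "finite V ==> finite (symm V)" "symm V \<noteq> {}"
  using finite_prs by (auto intro!: finite_signs simp: PiE_eq_empty_iff)

lemma ent_sym: "ent s i j = ent s j i" by (simp add: ent_def min.commute max.commute)

lemma prs_mem: "i \<in> V ==> j \<in> V ==> (min i j, max i j) \<in> prs V"
  by (auto simp: prs_def min_def max_def)

lemma ent_pm: "s \<in> symm V ==> i \<in> V ==> j \<in> V ==> ent s i j \<in> pm1"
  using PiE_mem[of s "prs V" "\<lambda>_. pm1" "(min i j, max i j)"] prs_mem[of i V j] unfolding ent_def by blast

lemma ent_abs: "s \<in> symm V ==> i \<in> V ==> j \<in> V ==> \<bar>ent s i j\<bar> = 1"
  using ent_pm[of s V i j] by auto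

lemma ent_sq: "s \<in> symm V ==> i \<in> V ==> j \<in> V ==> (ent s i j)\<^sup>2 = 1"
  using ent_abs[of s V i j] by (metis power2_abs one_power2)

lemma mv_self_adjoint: "(\<Sum>i\<in>V. x i * mv s V y i) = (\<Sum>i\<in>V. y i * mv s V x i)"
  unfolding mv_def sum_distrib_left by (subst sum.swap) (simp add: ent_sym mult_ac)

lemma mv_diff: "mv s V (\<lambda>i. x i - y i) i = mv s V x i - mv s V y i"
  by (simp add: mv_def right_diff_distrib sum_subtractf)

lemma mv_scale: "mv s V (\<lambda>i. c * x i) i = c * mv s V x i"
  by (simp add: mv_def sum_distrib_left mult_ac)

section \<open>Resampling an off-diagonal block of a symmetric matrix\<close>

definition blockm :: "nat set => nat set => (nat => nat => real) => nat \<times> nat => real" where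
  "blockm D E H x = (if fst x \<in> E \<and> snd x \<in> D then H (fst x) (snd x)
     else if fst x \<in> D \<and> snd x \<in> E then H (snd x) (fst x) else 1)"

text \<open>Multiplies both copies of the \<open>D\<close>-\<open>E\<close> block by
  \<open>H\<close> and leaves the diagonal blocks alone. By \<open>avg_twist\<close> the result is
  again uniform, so \<open>s\<close> may be frozen.\<close>

definition twist :: "nat set => nat set => (nat \<times> nat => real) => (nat => nat => real) => nat \<times> nat => real" where
  "twist D E s H = (\<lambda>x\<in>prs (D \<union> E). s x * blockm D E H x)"

abbreviation BM :: "nat set => nat set => (nat => nat => real) set" where
  "BM D E \<equiv> PiE E (\<lambda>_. signs D)"

lemma BM_fin: "finite D ==> finite E ==> finite (BM D E)" "BM D E \<noteq> {}"
  by (auto intro!: finite_PiE simp: PiE_eq_empty_iff)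

lemma BM_mem: "H \<in> BM D E ==> i \<in> E ==> j \<in> D ==> H i j \<in> pm1"
  by (drule PiE_mem, assumption) (drule PiE_mem, assumption)

lemma avg_twist:
  assumes "finite D" "finite E"
  shows "avg (symm (D \<union> E)) G = avg (symm (D \<union> E)) (\<lambda>s. avg (BM D E) (\<lambda>H. G (twist D E s H)))"
  unfolding twist_def
proof (rule avg_sign_twist_family[OF BM_fin(1)[OF assms] BM_fin(2)])
  fix H x assume "H \<in> BM D E" "x \<in> prs (D \<union> E)"
  then show "blockm D E H x \<in> pm1" using BM_mem[of H D E] by (auto simp: blockm_def)
qed

lemma ent_twist:
  assumes "D \<inter> E = {}" "i \<in> D \<union> E" "j \<in> D \<union> E"
  shows "ent (twist D E s H) i j = ent s i j * (if i \<in> E \<and> j \<in> D then H i j else if i \<in> D \<and> j \<in> E then H j i else 1)"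
proof -
  have "(min i j, max i j) \<in> prs (D \<union> E)" by (rule prs_mem[OF assms(2,3)])
  then have "ent (twist D E s H) i j = ent s i j * blockm D E H (min i j, max i j)" by (simp add: ent_def twist_def)
  moreover have "blockm D E H (min i j, max i j) = (if i \<in> E \<and> j \<in> D then H i j else if i \<in> D \<and> j \<in> E then H j i else 1)"
    using assms(1) by (cases "i \<le> j") (auto simp: blockm_def min_def max_def)
  ultimately show ?thesis by simp
qed

lemma mv_twist:
  assumes "finite D" "finite E" "D \<inter> E = {}" "v \<in> D \<union> E"
  shows "mv (twist D E s H) (D \<union> E) u v = bl D E (\<lambda>i j. H i j * ent s i j) u v
     + (\<Sum>j\<in>(if v \<in> E then E else D). ent s v j * u j)"
proof -
  have "mv (twist D E s H) (D \<union> E) u v = (\<Sum>j\<in>D. ent (twist D E s H) v j * u j) + (\<Sum>j\<in>E. ent (twist D E s H) v j * u j)"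
    unfolding mv_def using assms by (intro sum.union_disjoint)
  moreover have "ent (twist D E s H) v j = ent s v j * (if v \<in> E then H v j else 1)" if "j \<in> D" for j
    using that assms(3,4) by (subst ent_twist[OF assms(3,4)]) auto
  moreover have "ent (twist D E s H) v j = ent s j v * (if v \<in> E then 1 else H j v)" if "j \<in> E" for j
    using that assms(3,4) by (subst ent_twist[OF assms(3,4)]) (auto simp: ent_sym)
  ultimately show ?thesis using assms(3) by (auto simp: bl_def ent_sym mult_ac intro!: sum.cong)
qed

text \<open>Cover the ball by cells of side 4 sqrt n, at most e^((q + 1) n) 3^n of them by the l1
  count. On a cell the product of shifted kernels is at least 2^(-n), and its mean is at most
  \<open>fM\<close> by \<open>sign_block_le_fM\<close> once the diagonal blocks are frozen. The 5 is
  1 + 4, since 6^n \<le> e^(4n).\<close>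

lemma small_ball_le_fM:
  fixes D E :: "nat set" and q :: real
  assumes "finite D" "finite E" "D \<inter> E = {}" "n = real (card (D \<union> E))" "n \<ge> 1" "q \<ge> 0" "T > 0"
  shows "Pr (symm (D \<union> E)) (\<lambda>s. (\<Sum>v\<in>D \<union> E. (mv s (D \<union> E) u v - y v)\<^sup>2) \<le> q\<^sup>2 * n\<^sup>2)
    \<le> exp ((q + 5) * n) * fM D E T (4 * sqrt n) u"
proof -
  let ?V = "D \<union> E"
  define \<sigma> where "\<sigma> = 4 * sqrt n"
  have sig: "\<sigma> > 0" using assms by (simp add: \<sigma>_def)
  have fV: "finite ?V" using assms by simp
  define KK where "KK = L1 ?V ((q + 1) * n)"
  have fK: "finite KK" unfolding KK_def by (rule finite_L1[OF fV])
  define x where "x s v = mv s ?V u v - y v" for s v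
  let ?S = "\<lambda>s. (\<Sum>k\<in>KK. \<Prod>v\<in>?V. fej T \<sigma> (x s v - \<sigma> * of_int (k v)))"
  have ind: "of_bool ((\<Sum>v\<in>?V. (x s v)\<^sup>2) \<le> q\<^sup>2 * n\<^sup>2) \<le> 2 ^ card ?V * ?S s" for s
  proof (cases "(\<Sum>v\<in>?V. (x s v)\<^sup>2) \<le> q\<^sup>2 * n\<^sup>2")
    case True
    define k where "k = (\<lambda>v\<in>?V. round (x s v / \<sigma>))"
    have kr: "\<bar>of_int (k v) - x s v / \<sigma>\<bar> \<le> 1/2" if "v \<in> ?V" for v using of_int_round_abs_le[of "x s v / \<sigma>"] that by (simp add: k_def)
    have "(\<Sum>v\<in>?V. \<bar>x s v\<bar>) \<le> sqrt (real (card ?V) * (q\<^sup>2 * n\<^sup>2))" by (rule sum_abs_le_sqrt[OF True])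
    also have "... = sqrt n * (q * n)" using assms by (simp add: real_sqrt_mult)
    finally have sx: "(\<Sum>v\<in>?V. \<bar>x s v\<bar>) \<le> sqrt n * (q * n)" .
    have "(\<Sum>v\<in>?V. \<bar>of_int (k v)\<bar>) \<le> (\<Sum>v\<in>?V. \<bar>x s v\<bar> / \<sigma> + 1)"
    proof (rule sum_mono)
      fix v assume v: "v \<in> ?V"
      have "\<bar>x s v / \<sigma>\<bar> = \<bar>x s v\<bar> / \<sigma>" using sig by (simp add: abs_divide)
      then show "\<bar>of_int (k v)\<bar> \<le> \<bar>x s v\<bar> / \<sigma> + 1" using kr[OF v] by linarith
    qed
    also have "... = (\<Sum>v\<in>?V. \<bar>x s v\<bar>) / \<sigma> + n" using assms(4) by (simp add: sum.distrib sum_divide_distrib)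
    also have "... \<le> (sqrt n * (q * n)) / \<sigma> + n" using sx sig by (simp add: divide_right_mono)
    also have "... = q * n / 4 + n" using assms(5) by (simp add: \<sigma>_def)
    also have "... \<le> (q + 1) * n" using assms(5,6) by (simp add: algebra_simps)
    finally have kK: "k \<in> KK" by (simp add: KK_def L1_def k_def)
    have "(1/2) ^ card ?V \<le> (\<Prod>v\<in>?V. fej T \<sigma> (x s v - \<sigma> * of_int (k v)))"
    proof -
      have "(\<Prod>v\<in>?V. 1/2) \<le> (\<Prod>v\<in>?V. fej T \<sigma> (x s v - \<sigma> * of_int (k v)))"
      proof (rule prod_mono, intro conjI)
        fix v assume v: "v \<in> ?V"
        have "x s v - \<sigma> * of_int (k v) = \<sigma> * (x s v / \<sigma> - of_int (k v))" using sig by (simp add: field_simps)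
        then have "\<bar>x s v - \<sigma> * of_int (k v)\<bar> = \<sigma> * \<bar>of_int (k v) - x s v / \<sigma>\<bar>" using sig by (simp add: abs_mult abs_minus_commute)
        also have "... \<le> \<sigma> * 1" using kr[OF v] sig by (intro mult_left_mono) auto
        finally show "1/2 \<le> fej T \<sigma> (x s v - \<sigma> * of_int (k v))" using fej_ge_half[OF assms(7) sig] by simp
      qed simp
      then show ?thesis by simp
    qed
    also have "... \<le> ?S s" using kK fK by (intro member_le_sum) (auto intro!: prod_nonneg fej_nonneg)
    finally have "2 ^ card ?V * (1/2) ^ card ?V \<le> 2 ^ card ?V * ?S s" by (intro mult_left_mono) auto
    then show ?thesis using True by (simp add: power_mult_distrib[symmetric])
  next
    case False
    have "0 \<le> ?S s" by (intro sum_nonneg prod_nonneg fej_nonneg)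
    then show ?thesis using False by simp
  qed
  have each: "avg (symm ?V) (\<lambda>s. \<Prod>v\<in>?V. fej T \<sigma> (x s v - \<sigma> * of_int (k v))) \<le> fM D E T \<sigma> u" for k
  proof -
    have "avg (BM D E) (\<lambda>H. \<Prod>v\<in>?V. fej T \<sigma> (x (twist D E s H) v - \<sigma> * of_int (k v))) \<le> fM D E T \<sigma> u" if s: "s \<in> symm ?V" for s
    proof -
      define a where "a v = y v + \<sigma> * of_int (k v) - (\<Sum>j\<in>(if v \<in> E then E else D). ent s v j * u j)" for v
      have e: "x (twist D E s H) v - \<sigma> * of_int (k v) = bl D E (\<lambda>i j. H i j * ent s i j) u v - a v" if "v \<in> ?V" for H v
        unfolding x_def mv_twist[OF assms(1-3) that] a_def by simp
      have "avg (BM D E) (\<lambda>H. \<Prod>v\<in>?V. fej T \<sigma> (x (twist D E s H) v - \<sigma> * of_int (k v)))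
        = avg (BM D E) (\<lambda>H. \<Prod>v\<in>?V. fej T \<sigma> (bl D E (\<lambda>i j. H i j * ent s i j) u v - a v))"
        by (intro avg_cong refl prod.cong) (simp add: e)
      also have "... \<le> fM D E T \<sigma> u" using ent_abs[OF s] by (intro sign_block_le_fM[OF assms(1-3)]) auto
      finally show ?thesis .
    qed
    then show ?thesis by (subst avg_twist[OF assms(1,2)]) (rule avg_le[OF symm_fin(1)[OF fV] symm_fin(2)])
  qed
  have "Pr (symm ?V) (\<lambda>s. (\<Sum>v\<in>?V. (x s v)\<^sup>2) \<le> q\<^sup>2 * n\<^sup>2)
    \<le> avg (symm ?V) (\<lambda>s. 2 ^ card ?V * ?S s)"
    by (intro avg_mono ind)
  also have "... = 2 ^ card ?V * (\<Sum>k\<in>KK. avg (symm ?V) (\<lambda>s. \<Prod>v\<in>?V. fej T \<sigma> (x s v - \<sigma> * of_int (k v))))" by (simp only: avg_cmult avg_sum)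
  also have "... \<le> 2 ^ card ?V * (\<Sum>k\<in>KK. fM D E T \<sigma> u)" by (intro mult_left_mono sum_mono each) auto
  also have "... = (2 ^ card ?V * real (card KK)) * fM D E T \<sigma> u" by simp
  also have "... \<le> exp ((q + 5) * n) * fM D E T \<sigma> u"
  proof (rule mult_right_mono[OF _ fM_nonneg])
    have "real (card KK) \<le> exp (1 * ((q + 1) * n)) * (1 + 2 / (exp 1 - 1)) ^ card ?V" unfolding KK_def by (rule card_L1[OF fV]) simp
    also have "(1 + 2 / (exp 1 - 1)) ^ card ?V \<le> (3::real) ^ card ?V"
    proof (rule power_mono)
      have "1 \<le> exp 1 - (1::real)" using exp_ge_add_one_self[of 1] by simp
      then show "1 + 2 / (exp 1 - 1) \<le> (3::real)" "0 \<le> 1 + 2 / (exp 1 - (1::real))" by (auto simp: divide_le_eq add_nonneg_nonneg)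
    qed
    finally have "2 ^ card ?V * real (card KK) \<le> 2 ^ card ?V * (exp ((q + 1) * n) * 3 ^ card ?V)" by (simp add: mult_left_mono)
    also have "... = exp ((q + 1) * n) * 6 ^ card ?V" by (simp add: power_mult_distrib[symmetric])
    also have "(6::real) ^ card ?V \<le> exp (4 * n)"
    proof -
      have "(6::real) \<le> exp 4"
      proof -
        have "(6::real) \<le> 3 * 3" by simp
        also have "... \<le> exp 2 * exp (2::real)" using exp_ge_add_one_self[of "2::real"] by (intro mult_mono) auto
        finally show ?thesis by (simp add: exp_add[symmetric])
      qed
      then have "(6::real) ^ card ?V \<le> exp 4 ^ card ?V" by (intro power_mono) auto
      then show ?thesis using assms(4) by (simp add: exp_of_nat_mult[symmetric] mult.commute)
    qed
    also have "exp ((q + 1) * n) * exp (4 * n) = exp ((q + 5) * n)" unfolding exp_add[symmetric] by (simp add: algebra_simps)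
    finally show "2 ^ card ?V * real (card KK) \<le> exp ((q + 5) * n)" by simp
  qed
  finally show ?thesis unfolding x_def \<sigma>_def .
qed

text \<open>Pigeonhole the column sums of the sign matrix
  over cells, and take the difference of two matrices in one cell.\<close>

lemma fM_lower:
  fixes D E :: "nat set" and c :: nat
  assumes "finite D" "finite E" "D \<inter> E = {}" "n \<ge> 1" "T > 0" "0 \<le> \<gamma>"
    "\<gamma> \<le> Pr (signs D) (\<lambda>r. \<bar>(\<Sum>j\<in>D. r j * u j) - b\<bar> \<le> 2 * sqrt n)"
    "(\<Sum>i\<in>E. \<bar>u i\<bar>) \<le> real c"
  shows "(\<gamma> ^ card E / real (2 * c + 3) ^ card D)\<^sup>2 * (1/2) ^ card (D \<union> E) \<le> fM D E T (4 * sqrt n) u"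
proof -
  let ?V = "D \<union> E"
  define \<sigma> where "\<sigma> = 4 * sqrt n"
  have sig: "\<sigma> > 0" using assms by (simp add: \<sigma>_def)
  have sig1: "\<sigma> \<ge> 1"
  proof -
    have "1 \<le> sqrt n" using assms by simp
    then show ?thesis unfolding \<sigma>_def by linarith
  qed
  \<comment> \<open>The rows in \<open>E\<close> concentrate independently. About the columns in
    \<open>D\<close> nothing is known, so their sums are merely sorted into cells, (2c + 3)^|D| in
    number, which is affordable because \<open>D\<close> is small.\<close>
  define ok where "ok H \<longleftrightarrow> (\<forall>i\<in>E. \<bar>(\<Sum>j\<in>D. H i j * u j) - b\<bar> \<le> 2 * sqrt n)" for H :: "nat => nat => real"
  define cell where "cell H = (\<lambda>j\<in>D. \<lfloor>(\<Sum>i\<in>E. H i j * u i) / \<sigma>\<rfloor>)" for H :: "nat => nat => real"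
  define P where "P = PiE D (\<lambda>_. {- int (c + 1)..int (c + 1)})"
  have fP: "finite P" "P \<noteq> {}" using assms by (auto simp: P_def PiE_eq_empty_iff intro!: finite_PiE)
  have cP: "card P = (2 * c + 3) ^ card D"
  proof -
    have "card {- int (c + 1)..int (c + 1)} = 2 * c + 3" by (simp add: nat_eq_iff)
    then show ?thesis using assms by (simp add: P_def card_PiE)
  qed
  have cellP: "cell H \<in> P" if H: "H \<in> BM D E" for H unfolding P_def cell_def
  proof (rule restrict_PiE_iff[THEN iffD2], intro ballI)
    fix j assume j: "j \<in> D"
    have "\<bar>\<Sum>i\<in>E. H i j * u i\<bar> \<le> (\<Sum>i\<in>E. \<bar>H i j * u i\<bar>)" by (rule sum_abs)
    also have "... = (\<Sum>i\<in>E. \<bar>u i\<bar>)" using BM_mem[OF H _ j] by (intro sum.cong refl) (force simp: abs_mult)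
    also have "... \<le> real c" by (rule assms(8))
    finally have "\<bar>\<Sum>i\<in>E. H i j * u i\<bar> \<le> real c" .
    then have "\<bar>(\<Sum>i\<in>E. H i j * u i) / \<sigma>\<bar> \<le> real c / 1" using sig sig1 unfolding abs_divide by (intro frac_le) auto
    then have "(\<Sum>i\<in>E. H i j * u i) / \<sigma> \<le> real c" "- real c \<le> (\<Sum>i\<in>E. H i j * u i) / \<sigma>" by linarith+
    then have "\<lfloor>(\<Sum>i\<in>E. H i j * u i) / \<sigma>\<rfloor> \<le> int (c + 1)" "- int (c + 1) \<le> \<lfloor>(\<Sum>i\<in>E. H i j * u i) / \<sigma>\<rfloor>" by linarith+
    then show "\<lfloor>(\<Sum>i\<in>E. H i j * u i) / \<sigma>\<rfloor> \<in> {- int (c + 1)..int (c + 1)}" by simp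
  qed
  have okp: "\<gamma> ^ card E \<le> Pr (BM D E) ok"
  proof -
    have "\<gamma> ^ card E = (\<Prod>i\<in>E. \<gamma>)" by simp
    also have "... \<le> (\<Prod>i\<in>E. Pr (signs D) (\<lambda>r. \<bar>(\<Sum>j\<in>D. r j * u j) - b\<bar> \<le> 2 * sqrt n))" using assms(6,7) by (intro prod_mono) auto
    also have "... = avg (BM D E) (\<lambda>H. \<Prod>i\<in>E. of_bool (\<bar>(\<Sum>j\<in>D. H i j * u j) - b\<bar> \<le> 2 * sqrt n))"
      by (rule avg_PiE_prod[symmetric]) (use assms finite_signs in auto)
    also have "... = Pr (BM D E) ok"
    proof (intro avg_cong refl)
      fix H
      show "(\<Prod>i\<in>E. of_bool (\<bar>(\<Sum>j\<in>D. H i j * u j) - b\<bar> \<le> 2 * sqrt n)) = (of_bool (ok H) :: real)"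
        using assms(2) by (cases "ok H") (auto simp: ok_def)
    qed
    finally show ?thesis .
  qed
  have "\<exists>a\<in>P. \<gamma> ^ card E / real (2 * c + 3) ^ card D \<le> Pr (BM D E) (\<lambda>H. ok H \<and> cell H = a)"
  proof -
    have "Pr (BM D E) ok = avg (BM D E) (\<lambda>H. \<Sum>a\<in>P. of_bool (ok H \<and> cell H = a))"
    proof (intro avg_cong refl)
      fix H assume H: "H \<in> BM D E"
      have "(\<Sum>a\<in>P. of_bool (ok H \<and> cell H = a)) = (\<Sum>a\<in>P. if cell H = a then of_bool (ok H) else (0::real))" by (intro sum.cong refl) simp
      also have "... = of_bool (ok H)" using cellP[OF H] fP by simp
      finally show "of_bool (ok H) = (\<Sum>a\<in>P. of_bool (ok H \<and> cell H = a) :: real)" by simp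
    qed
    also have "... = (\<Sum>a\<in>P. Pr (BM D E) (\<lambda>H. ok H \<and> cell H = a))" by (rule avg_sum)
    finally have "\<gamma> ^ card E / real (card P) \<le> avg P (\<lambda>a. Pr (BM D E) (\<lambda>H. ok H \<and> cell H = a))"
      using okp by (simp add: avg_def[of P] divide_right_mono)
    from avg_ex_ge[OF fP this] show ?thesis by (simp add: cP)
  qed
  then obtain a where a: "\<gamma> ^ card E / real (2 * c + 3) ^ card D \<le> Pr (BM D E) (\<lambda>H. ok H \<and> cell H = a)" by blast
  define h where "h H = (of_bool (ok H \<and> cell H = a) :: real)" for H
  \<comment> \<open>The squared probability of the fullest cell is the probability that two
    independent matrices both fall into it; every coordinate of their difference is then at most
    \<open>\<sigma>\<close>.\<close>
  have "(\<gamma> ^ card E / real (2 * c + 3) ^ card D)\<^sup>2 \<le> (avg (BM D E) h)\<^sup>2" using a assms(6) unfolding h_def by (intro power_mono) auto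
  also have "... = avg (BM D E) (\<lambda>H'. avg (BM D E) (\<lambda>H. h H' * h H))" by (simp add: power2_eq_square avg_prod2)
  finally have "(\<gamma> ^ card E / real (2 * c + 3) ^ card D)\<^sup>2 * (1/2) ^ card ?V \<le> avg (BM D E) (\<lambda>H'. avg (BM D E) (\<lambda>H. h H' * h H)) * (1/2) ^ card ?V"
    by (rule mult_right_mono) simp
  also have "... = avg (BM D E) (\<lambda>H'. avg (BM D E) (\<lambda>H. h H' * h H * (1/2) ^ card ?V))" by (simp only: avg_multc)
  also have "... \<le> avg (BM D E) (\<lambda>H'. avg (BM D E) (\<lambda>H. \<Prod>v\<in>?V. fej T \<sigma> (bl D E H u v - bl D E H' u v)))"
  proof (rule avg_mono, rule avg_mono)
    fix H' H assume H: "H' \<in> BM D E" "H \<in> BM D E"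
    show "h H' * h H * (1/2) ^ card ?V \<le> (\<Prod>v\<in>?V. fej T \<sigma> (bl D E H u v - bl D E H' u v))"
    proof (cases "ok H' \<and> cell H' = a \<and> ok H \<and> cell H = a")
      case True
      have "(\<Prod>v\<in>?V. 1/2) \<le> (\<Prod>v\<in>?V. fej T \<sigma> (bl D E H u v - bl D E H' u v))"
      proof (rule prod_mono, intro conjI)
        fix v assume v: "v \<in> ?V"
        have "\<bar>bl D E H u v - bl D E H' u v\<bar> \<le> \<sigma>"
        proof (cases "v \<in> E")
          case vE: True
          have "\<bar>(\<Sum>j\<in>D. H v j * u j) - b\<bar> \<le> 2 * sqrt n" "\<bar>(\<Sum>j\<in>D. H' v j * u j) - b\<bar> \<le> 2 * sqrt n" using True vE by (auto simp: ok_def)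
          then show ?thesis using vE by (simp add: bl_def \<sigma>_def)
        next
          case False
          then have vD: "v \<in> D" using v by simp
          have "cell H v = cell H' v" using True by simp
          then have "\<lfloor>(\<Sum>i\<in>E. H i v * u i) / \<sigma>\<rfloor> = \<lfloor>(\<Sum>i\<in>E. H' i v * u i) / \<sigma>\<rfloor>" using vD by (simp add: cell_def)
          then have "\<bar>(\<Sum>i\<in>E. H i v * u i) / \<sigma> - (\<Sum>i\<in>E. H' i v * u i) / \<sigma>\<bar> \<le> 1" by linarith
          then have "\<bar>((\<Sum>i\<in>E. H i v * u i) - (\<Sum>i\<in>E. H' i v * u i)) / \<sigma>\<bar> \<le> 1" by (simp only: diff_divide_distrib)
          then have "\<bar>(\<Sum>i\<in>E. H i v * u i) - (\<Sum>i\<in>E. H' i v * u i)\<bar> \<le> \<sigma>" using sig by (simp add: abs_divide)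
          then show ?thesis using False by (simp add: bl_def)
        qed
        then show "1/2 \<le> fej T \<sigma> (bl D E H u v - bl D E H' u v)" by (rule fej_ge_half[OF assms(5) sig])
      qed simp
      then show ?thesis using True by (simp add: h_def)
    next
      case False
      then have "h H' * h H = 0" by (auto simp: h_def)
      moreover have "0 \<le> (\<Prod>v\<in>?V. fej T \<sigma> (bl D E H u v - bl D E H' u v))" by (intro prod_nonneg fej_nonneg)
      ultimately show ?thesis by (simp only: mult_zero_left)
    qed
  qed
  also have "... \<le> fM D E T \<sigma> u" by (rule sign_diff_le_fM[OF assms(1-3)])
  finally show ?thesis unfolding \<sigma>_def .
qed

section \<open>Moments of sign sums and compressible solutions\<close>

lemma avg_pm1: "avg pm1 f = (f (-1) + f 1) / (2 :: real)"
  by (simp add: avg_def)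

lemma avg_signs_shift_insert:
  assumes "finite D" "d \<notin> D"
  shows "avg (signs (insert d D)) (\<lambda>h. G ((\<Sum>j\<in>insert d D. h j * x j) - b))
    = (avg (signs D) (\<lambda>h. G ((\<Sum>j\<in>D. h j * x j) - (b + x d)))
      + avg (signs D) (\<lambda>h. G ((\<Sum>j\<in>D. h j * x j) - (b - x d)))) / (2 :: real)"
proof -
  have "(\<Sum>j\<in>insert d D. (h(d := r)) j * x j) - b = (\<Sum>j\<in>D. h j * x j) - (b - r * x d)" for h r
  proof -
    have "(\<Sum>j\<in>D. (h(d := r)) j * x j) = (\<Sum>j\<in>D. h j * x j)" using assms(2) by (intro sum.cong) auto
    then show ?thesis using assms by simp
  qed
  then show ?thesis by (subst avg_PiE_insert[OF assms]) (simp only: avg_pm1, simp)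
qed

lemma avg_signs_quadratic:
  "finite D ==> avg (signs D) (\<lambda>h. ((\<Sum>j\<in>D. h j * x j) - b)\<^sup>2) = (\<Sum>j\<in>D. (x j)\<^sup>2) + (b::real)\<^sup>2"
proof (induction D arbitrary: b rule: finite_induct)
  case empty
  then show ?case by (simp add: avg_def)
next
  case (insert d D)
  show ?case unfolding avg_signs_shift_insert[OF insert.hyps, of "\<lambda>t. t\<^sup>2"] insert.IH
    using insert.hyps by (simp add: power2_eq_square algebra_simps)
qed

text \<open>For b = 0 this is Khintchine's inequality with the Gaussian constant 3; the shift is
  carried along so that the induction closes.\<close>

lemma avg_signs_quartic:
  "finite D ==> avg (signs D) (\<lambda>h. ((\<Sum>j\<in>D. h j * x j) - b) ^ 4)
    \<le> 3 * (\<Sum>j\<in>D. (x j)\<^sup>2)\<^sup>2 + 6 * (\<Sum>j\<in>D. (x j)\<^sup>2) * b\<^sup>2 + (b::real) ^ 4"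
proof (induction D arbitrary: b rule: finite_induct)
  case empty
  then show ?case by (simp add: avg_def)
next
  case (insert d D)
  define V where "V = (\<Sum>j\<in>D. (x j)\<^sup>2)"
  have "avg (signs (insert d D)) (\<lambda>h. ((\<Sum>j\<in>insert d D. h j * x j) - b) ^ 4)
     \<le> (3 * V\<^sup>2 + 6 * V * (b + x d)\<^sup>2 + (b + x d) ^ 4 + (3 * V\<^sup>2 + 6 * V * (b - x d)\<^sup>2 + (b - x d) ^ 4)) / 2"
    unfolding avg_signs_shift_insert[OF insert.hyps, of "\<lambda>t. t ^ 4"] V_def
    using insert.IH[of "b + x d"] insert.IH[of "b - x d"] by (intro divide_right_mono add_mono) auto
  also have "... \<le> 3 * ((x d)\<^sup>2 + V)\<^sup>2 + 6 * ((x d)\<^sup>2 + V) * b\<^sup>2 + b ^ 4"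
  proof -
    have "0 \<le> 2 * (x d) ^ 4" by simp
    then show ?thesis by (simp add: power2_eq_square power4_eq_xxxx algebra_simps)
  qed
  finally show ?case using insert.hyps by (simp add: V_def)
qed

text \<open>Decreasing lam only increases the mean, so it may be replaced by l = 1/(3 W), which
  minimises the bound obtained from e^(-t) \<le> 1 - t + t^2/2 with t = l Z^2. The second moment is
  W and the fourth at most 3 W^2, which gives 1 - 1/3 + 1/6.\<close>

lemma avg_signs_gauss:
  assumes "finite D" "1 \<le> 3 * lam * (\<Sum>j\<in>D. (x j)\<^sup>2)" "lam \<ge> 0"
  shows "avg (signs D) (\<lambda>h. exp (- (lam * ((\<Sum>j\<in>D. h j * x j) - b)\<^sup>2))) \<le> 5 / 6"
proof -
  define V where "V = (\<Sum>j\<in>D. (x j)\<^sup>2)"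
  have V: "V > 0"
  proof (rule ccontr)
    assume "\<not> V > 0"
    moreover have "V \<ge> 0" unfolding V_def by (intro sum_nonneg) auto
    ultimately have "V = 0" by simp
    then show False using assms(2) by (simp add: V_def)
  qed
  define W where "W = V + b\<^sup>2"
  have W: "W > 0" using V by (simp add: W_def add_pos_nonneg)
  define l where "l = 1 / (3 * W)"
  have l: "0 \<le> l" "l \<le> lam"
  proof -
    show "0 \<le> l" using W by (simp add: l_def)
    have "lam * V \<le> lam * W" using assms(3) by (intro mult_left_mono) (auto simp: W_def)
    then have "1 \<le> lam * (3 * W)" using assms(2) by (simp add: V_def)
    then show "l \<le> lam" using W unfolding l_def by (subst pos_divide_le_eq) auto
  qed
  have e: "exp (- t) \<le> 1 - t + t\<^sup>2 / 2" if "t \<ge> 0" for t :: real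
  proof -
    have "1 \<le> (1 - t + t\<^sup>2 / 2) * (1 + t + t\<^sup>2 / 2)"
    proof -
      have "(1 - t + t\<^sup>2 / 2) * (1 + t + t\<^sup>2 / 2) = 1 + (t\<^sup>2)\<^sup>2 / 4" by (simp add: power2_eq_square field_simps)
      then show ?thesis by simp
    qed
    also have "... \<le> (1 - t + t\<^sup>2 / 2) * exp t"
    proof (rule mult_left_mono[OF exp_lower_Taylor_quadratic[OF that]])
      have "0 \<le> (1 - t)\<^sup>2" by simp
      then have "0 \<le> 1 - 2 * t + t\<^sup>2" by (simp add: power2_eq_square algebra_simps)
      then show "0 \<le> 1 - t + t\<^sup>2 / 2" by linarith
    qed
    finally have "1 * exp (- t) \<le> (1 - t + t\<^sup>2 / 2) * exp t * exp (- t)" by (rule mult_right_mono) simp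
    then show ?thesis by (simp only: mult.assoc exp_minus_inverse mult_1_right mult_1_left)
  qed
  let ?Z = "\<lambda>h. (\<Sum>j\<in>D. h j * x j) - b"
  have "avg (signs D) (\<lambda>h. exp (- (lam * (?Z h)\<^sup>2))) \<le> avg (signs D) (\<lambda>h. 1 - l * (?Z h)\<^sup>2 + (l\<^sup>2 / 2) * (?Z h) ^ 4)"
  proof (rule avg_mono)
    fix h
    have "exp (- (lam * (?Z h)\<^sup>2)) \<le> exp (- (l * (?Z h)\<^sup>2))" using l by (simp add: mult_right_mono)
    also have "... \<le> 1 - l * (?Z h)\<^sup>2 + (l * (?Z h)\<^sup>2)\<^sup>2 / 2" using l by (intro e) auto
    also have "(l * (?Z h)\<^sup>2)\<^sup>2 / 2 = (l\<^sup>2 / 2) * (?Z h) ^ 4" by (simp add: power_mult_distrib)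
    finally show "exp (- (lam * (?Z h)\<^sup>2)) \<le> 1 - l * (?Z h)\<^sup>2 + (l\<^sup>2 / 2) * (?Z h) ^ 4" .
  qed
  also have "... = 1 - l * W + (l\<^sup>2 / 2) * avg (signs D) (\<lambda>h. (?Z h) ^ 4)"
    by (simp only: avg_add avg_diff avg_cmult avg_const[OF finite_signs[OF assms(1)] signs_nonempty] avg_signs_quadratic[OF assms(1)] W_def V_def)
  also have "... \<le> 1 - l * W + (l\<^sup>2 / 2) * (3 * W\<^sup>2)"
  proof -
    have "avg (signs D) (\<lambda>h. (?Z h) ^ 4) \<le> 3 * V\<^sup>2 + 6 * V * b\<^sup>2 + b ^ 4" unfolding V_def by (rule avg_signs_quartic[OF assms(1)])
    also have "... \<le> 3 * W\<^sup>2"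
    proof -
      have "3 * W\<^sup>2 = 3 * V\<^sup>2 + 6 * V * b\<^sup>2 + b ^ 4 + 2 * b ^ 4" by (simp add: W_def power2_eq_square power4_eq_xxxx algebra_simps)
      moreover have "0 \<le> 2 * b ^ 4" by simp
      ultimately show ?thesis by linarith
    qed
    finally show ?thesis by (intro add_left_mono mult_left_mono) auto
  qed
  also have "... = 5 / 6" using W by (simp add: l_def field_simps power2_eq_square)
  finally show ?thesis .
qed

text \<open>One half of \<open>V\<close> carries at least half of the mass of \<open>u\<close> and
  serves as \<open>D\<close>; the coordinates in the other half are then independent. This
  elementary bound has explicit constants and serves vectors for which no spread of the entries is
  known.\<close>

lemma small_ball_half:
  fixes V :: "nat set"
  assumes "finite V" "n = real (card V)" "n \<ge> 1" "81 * n \<le> (\<Sum>j\<in>V. (u j)\<^sup>2)"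
  shows "Pr (symm V) (\<lambda>s. (\<Sum>i\<in>V. (mv s V u i - y i)\<^sup>2) \<le> 13/10 * n\<^sup>2) \<le> exp (1/12 - 7/100 * n)"
proof -
  obtain D0 where D0: "D0 \<subseteq> V" "card D0 = card V div 2" by (rule obtain_subset_with_card_n[of "card V div 2" V]) auto
  have f0: "finite D0" using D0 assms(1) finite_subset by blast
  have sp: "(\<Sum>j\<in>V. (u j)\<^sup>2) = (\<Sum>j\<in>D0. (u j)\<^sup>2) + (\<Sum>j\<in>V - D0. (u j)\<^sup>2)" using sum.subset_diff[OF D0(1) assms(1), of "\<lambda>j. (u j)\<^sup>2"] by simp
  have cc: "card (V - D0) = card V - card V div 2" using D0 f0 by (simp add: card_Diff_subset)
  obtain D E where DE: "finite D" "finite E" "D \<inter> E = {}" "V = D \<union> E" "81/2 * n \<le> (\<Sum>j\<in>D. (u j)\<^sup>2)" "card V \<le> 2 * card E + 1"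
  proof (cases "81/2 * n \<le> (\<Sum>j\<in>D0. (u j)\<^sup>2)")
    case True
    moreover have "V = D0 \<union> (V - D0)" "card V \<le> 2 * card (V - D0) + 1" using D0 cc by auto
    ultimately show ?thesis using that[of D0 "V - D0"] f0 assms(1) by auto
  next
    case False
    moreover have "V = (V - D0) \<union> D0" "card V \<le> 2 * card D0 + 1" using D0 by auto
    ultimately show ?thesis using that[of "V - D0" D0] f0 assms(1,4) sp by auto
  qed
  \<comment> \<open>The least value that \<open>avg_signs_gauss\<close> admits for mass 81 n /
    2.\<close>
  define lam where "lam = 2 / (243 * n)"
  have lam: "lam \<ge> 0" "1 \<le> 3 * lam * (\<Sum>j\<in>D. (u j)\<^sup>2)"
  proof -
    show "lam \<ge> 0" using assms(3) by (simp add: lam_def)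
    have "3 * lam * (81/2 * n) \<le> 3 * lam * (\<Sum>j\<in>D. (u j)\<^sup>2)" using DE(5) \<open>lam \<ge> 0\<close> by (intro mult_left_mono) auto
    then show "1 \<le> 3 * lam * (\<Sum>j\<in>D. (u j)\<^sup>2)" using assms(3) by (simp add: lam_def)
  qed
  define x where "x s i = mv s V u i - y i" for s i
  have ind: "of_bool ((\<Sum>i\<in>V. (x s i)\<^sup>2) \<le> 13/10 * n\<^sup>2) \<le> exp (lam * (13/10 * n\<^sup>2)) * (\<Prod>i\<in>E. exp (- (lam * (x s i)\<^sup>2)))" for s
  proof (cases "(\<Sum>i\<in>V. (x s i)\<^sup>2) \<le> 13/10 * n\<^sup>2")
    case True
    have "(\<Sum>i\<in>E. (x s i)\<^sup>2) \<le> (\<Sum>i\<in>V. (x s i)\<^sup>2)" using DE assms(1) by (intro sum_mono2) auto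
    then have "lam * (\<Sum>i\<in>E. (x s i)\<^sup>2) \<le> lam * (13/10 * n\<^sup>2)" using True lam by (intro mult_left_mono) auto
    then have "1 \<le> exp (lam * (13/10 * n\<^sup>2) + (- (lam * (\<Sum>i\<in>E. (x s i)\<^sup>2))))" by simp
    also have "... = exp (lam * (13/10 * n\<^sup>2)) * exp (\<Sum>i\<in>E. - (lam * (x s i)\<^sup>2))" by (simp only: exp_add sum_negf sum_distrib_left)
    finally show ?thesis using True by (simp add: exp_sum[OF DE(2)])
  next
    case False
    then show ?thesis by (simp add: prod_nonneg)
  qed
  have fV: "finite (D \<union> E)" using DE by simp
  have each: "avg (symm V) (\<lambda>s. \<Prod>i\<in>E. exp (- (lam * (x s i)\<^sup>2))) \<le> (5/6) ^ card E" unfolding DE(4)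
  proof (subst avg_twist[OF DE(1,2)], rule avg_le[OF symm_fin(1)[OF fV] symm_fin(2)])
    fix s assume s: "s \<in> symm (D \<union> E)"
    define a where "a i = y i - (\<Sum>j\<in>E. ent s i j * u j)" for i
    have "x (twist D E s H) i = (\<Sum>j\<in>D. H i j * (ent s i j * u j)) - a i" if "i \<in> E" for H i
      unfolding x_def DE(4) using that DE(3) mv_twist[OF DE(1-3), of i s H u] by (simp add: a_def bl_def mult_ac)
    then have "avg (BM D E) (\<lambda>H. \<Prod>i\<in>E. exp (- (lam * (x (twist D E s H) i)\<^sup>2)))
      = avg (BM D E) (\<lambda>H. \<Prod>i\<in>E. exp (- (lam * ((\<Sum>j\<in>D. H i j * (ent s i j * u j)) - a i)\<^sup>2)))"
      by (intro avg_cong refl prod.cong) simp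
    also have "... = (\<Prod>i\<in>E. avg (signs D) (\<lambda>h. exp (- (lam * ((\<Sum>j\<in>D. h j * (ent s i j * u j)) - a i)\<^sup>2))))"
      by (rule avg_PiE_prod[OF DE(2) finite_signs[OF DE(1)]])
    also have "... \<le> (\<Prod>i\<in>E. 5/6)"
    proof (rule prod_mono, intro conjI)
      fix i assume i: "i \<in> E"
      show "0 \<le> avg (signs D) (\<lambda>h. exp (- (lam * ((\<Sum>j\<in>D. h j * (ent s i j * u j)) - a i)\<^sup>2)))" by (intro avg_nonneg) simp
      have "(\<Sum>j\<in>D. (ent s i j * u j)\<^sup>2) = (\<Sum>j\<in>D. (u j)\<^sup>2)" using ent_sq[OF s] i by (intro sum.cong refl) (simp add: power_mult_distrib)
      then show "avg (signs D) (\<lambda>h. exp (- (lam * ((\<Sum>j\<in>D. h j * (ent s i j * u j)) - a i)\<^sup>2))) \<le> 5/6"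
        using lam by (intro avg_signs_gauss[OF DE(1)]) auto
    qed
    finally show "avg (BM D E) (\<lambda>H. \<Prod>i\<in>E. exp (- (lam * (x (twist D E s H) i)\<^sup>2))) \<le> (5/6) ^ card E" by simp
  qed
  have "Pr (symm V) (\<lambda>s. (\<Sum>i\<in>V. (x s i)\<^sup>2) \<le> 13/10 * n\<^sup>2)
     \<le> avg (symm V) (\<lambda>s. exp (lam * (13/10 * n\<^sup>2)) * (\<Prod>i\<in>E. exp (- (lam * (x s i)\<^sup>2))))"
    by (rule avg_mono) (rule ind)
  also have "... \<le> exp (lam * (13/10 * n\<^sup>2)) * (5/6) ^ card E" unfolding avg_cmult by (rule mult_left_mono[OF each]) simp
  also have "(5/6::real) ^ card E \<le> exp (- (1/6)) ^ card E" using exp_ge_add_one_self[of "- (1/6)::real"] by (intro power_mono) auto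
  also have "exp (- (1/6)) ^ card E = exp (- (real (card E) / 6))" by (simp add: exp_of_nat_mult[symmetric])
  also have "exp (lam * (13/10 * n\<^sup>2)) * exp (- (real (card E) / 6)) = exp (lam * (13/10 * n\<^sup>2) - real (card E) / 6)"
    by (simp only: exp_add[symmetric] diff_conv_add_uminus)
  also have "... \<le> exp (1/12 - 7/100 * n)"
  proof -
    have "lam * (13/10 * n\<^sup>2) = 26/2430 * n" using assms(3) by (simp add: lam_def power2_eq_square)
    moreover have "n \<le> 2 * real (card E) + 1" using DE(6) assms(2) by linarith
    ultimately have "lam * (13/10 * n\<^sup>2) - real (card E) / 6 \<le> 1/12 - 7/100 * n" using assms(3) by linarith
    then show ?thesis by simp
  qed
  finally show ?thesis by (simp add: x_def mult_left_mono)
qed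

lemma mv_cong: "(\<And>j. j \<in> V ==> x j = y j) ==> mv s V x i = mv s V y i"
  by (simp add: mv_def)

text \<open>The scalar \<open>N * \<sigma>\<close> is rounded together with the vector
  \<open>N * v\<close>: index \<open>None\<close> stands for it, with column -w. Rows
  \<open>Inl i\<close> are the equations, whose exact residual is zero, rows \<open>Inr r\<close>
  further linear forms, and \<open>h\<close> is the weight of the l1 norm.\<close>

lemma round_solution:
  fixes V :: "nat set" and g :: "'r => nat => real" and v w :: "nat => real" and N \<sigma> \<kappa> h :: real
  assumes "finite V" "n = real (card V)" "n > 0" "\<And>i. i \<in> V ==> \<bar>w i\<bar> \<le> 2" "s \<in> symm V"
    "\<And>i. i \<in> V ==> mv s V v i = \<sigma> * w i" "finite R" "0 \<le> \<kappa>" "0 \<le> N"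
  obtains u z where "u \<in> PiE V (\<lambda>_. UNIV)" "\<And>j. j \<in> V ==> \<bar>real_of_int (u j) - N * v j\<bar> \<le> 1" "\<bar>real_of_int z - N * \<sigma>\<bar> \<le> 1"
    "(\<Sum>i\<in>V. (mv s V (\<lambda>j. real_of_int (u j)) i - real_of_int z * w i)\<^sup>2) / n\<^sup>2
      + \<kappa> * (\<Sum>r\<in>R. (\<Sum>j\<in>V. g r j * (real_of_int (u j) - N * v j))\<^sup>2) + h * (\<Sum>j\<in>V. \<bar>real_of_int (u j)\<bar>)
     \<le> ((4 + n) / n + \<kappa> * (\<Sum>r\<in>R. \<Sum>j\<in>V. (g r j)\<^sup>2)) / 4 + h * (N * (\<Sum>j\<in>V. \<bar>v j\<bar>))"
proof -
  define x where "x j = (case j of None => N * \<sigma> | Some j => N * v j)" for j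
  define a where "a l j = (case l of
      Inl i => (case j of None => - w i | Some j => ent s i j)
    | Inr r => (case j of None => 0 | Some j => g r j))" for l :: "nat + 'r" and j
  define c where "c l = (case l of Inl i => 1 / n\<^sup>2 | Inr r => \<kappa>)" for l :: "nat + 'r"
  define h' where "h' j = (case j of None => 0 | Some j => h)" for j :: "nat option"
  let ?J = "insert None (Some ` V)" and ?L = "Inl ` V \<union> Inr ` R :: (nat + 'r) set"
  have sJ: "(\<Sum>j\<in>?J. f j) = f None + (\<Sum>j\<in>V. f (Some j))" for f :: "nat option => real" using assms(1) by (simp add: sum.reindex)
  have sL: "(\<Sum>l\<in>?L. f l) = (\<Sum>i\<in>V. f (Inl i)) + (\<Sum>r\<in>R. f (Inr r))" for f :: "_ => real"
    using assms(1,7) by (subst sum.union_disjoint) (auto simp: sum.reindex)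
  obtain u :: "nat option => int" where u: "\<And>j. j \<in> ?J ==> \<bar>of_int (u j) - x j\<bar> \<le> 1"
    "(\<Sum>l\<in>?L. c l * (\<Sum>j\<in>?J. a l j * (of_int (u j) - x j))\<^sup>2) + (\<Sum>j\<in>?J. h' j * \<bar>of_int (u j)\<bar>)
     \<le> (\<Sum>l\<in>?L. c l * (\<Sum>j\<in>?J. (a l j)\<^sup>2)) / 4 + (\<Sum>j\<in>?J. h' j * \<bar>x j\<bar>)"
    by (rule rounding[of ?J ?L c x a h']) (use assms in \<open>auto simp: c_def\<close>)
  define u' where "u' = (\<lambda>j\<in>V. u (Some j))"
  define z where "z = u None"
  have A: "(\<Sum>j\<in>?J. a (Inl i) j * (of_int (u j) - x j)) = mv s V (\<lambda>j. of_int (u' j)) i - of_int z * w i" if "i \<in> V" for i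
  proof -
    have e: "(\<Sum>j\<in>?J. a (Inl i) j * (of_int (u j) - x j)) = mv s V (\<lambda>j. of_int (u' j) - N * v j) i - (of_int z - N * \<sigma>) * w i"
      unfolding sJ by (simp add: a_def x_def z_def mv_def u'_def)
    show ?thesis unfolding e mv_diff mv_scale assms(6)[OF that] by (simp add: algebra_simps)
  qed
  have B: "(\<Sum>j\<in>?J. a (Inr r) j * (of_int (u j) - x j)) = (\<Sum>j\<in>V. g r j * (of_int (u' j) - N * v j))" for r
    unfolding sJ by (simp add: a_def x_def u'_def)
  have l: "(\<Sum>l\<in>?L. c l * (\<Sum>j\<in>?J. a l j * (of_int (u j) - x j))\<^sup>2)
    = (\<Sum>i\<in>V. (mv s V (\<lambda>j. of_int (u' j)) i - of_int z * w i)\<^sup>2) / n\<^sup>2 + \<kappa> * (\<Sum>r\<in>R. (\<Sum>j\<in>V. g r j * (of_int (u' j) - N * v j))\<^sup>2)"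
    unfolding sL B by (simp add: A c_def sum_divide_distrib sum_distrib_left)
  have "(\<Sum>j\<in>?J. (a (Inl i) j)\<^sup>2) \<le> 4 + n" if i: "i \<in> V" for i
  proof -
    have "(\<Sum>j\<in>?J. (a (Inl i) j)\<^sup>2) = (w i)\<^sup>2 + n" unfolding sJ using ent_sq[OF assms(5) i] assms(2) by (simp add: a_def)
    moreover have "(w i)\<^sup>2 \<le> 2\<^sup>2" using assms(4)[OF i] by (metis abs_ge_zero power2_abs power_mono)
    ultimately show ?thesis by simp
  qed
  then have "(\<Sum>i\<in>V. c (Inl i) * (\<Sum>j\<in>?J. (a (Inl i) j)\<^sup>2)) \<le> (\<Sum>i\<in>V. 1 / n\<^sup>2 * (4 + n))"
    unfolding c_def sum.case by (intro sum_mono mult_left_mono) auto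
  also have "... = (4 + n) / n" using assms(2,3) by (simp add: power2_eq_square)
  finally have q: "(\<Sum>l\<in>?L. c l * (\<Sum>j\<in>?J. (a l j)\<^sup>2)) \<le> (4 + n) / n + \<kappa> * (\<Sum>r\<in>R. \<Sum>j\<in>V. (g r j)\<^sup>2)"
    unfolding sL sJ by (simp add: c_def a_def sum_distrib_left)
  have e1: "(\<Sum>j\<in>?J. h' j * \<bar>of_int (u j)\<bar>) = h * (\<Sum>j\<in>V. \<bar>real_of_int (u' j)\<bar>)" unfolding sJ by (simp add: h'_def u'_def sum_distrib_left)
  have e2: "(\<Sum>j\<in>?J. h' j * \<bar>x j\<bar>) = h * (N * (\<Sum>j\<in>V. \<bar>v j\<bar>))"
    unfolding sJ using assms(9) by (simp add: h'_def x_def abs_mult sum_distrib_left)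
  have "(\<Sum>i\<in>V. (mv s V (\<lambda>j. of_int (u' j)) i - of_int z * w i)\<^sup>2) / n\<^sup>2
      + \<kappa> * (\<Sum>r\<in>R. (\<Sum>j\<in>V. g r j * (of_int (u' j) - N * v j))\<^sup>2) + h * (\<Sum>j\<in>V. \<bar>real_of_int (u' j)\<bar>)
     \<le> ((4 + n) / n + \<kappa> * (\<Sum>r\<in>R. \<Sum>j\<in>V. (g r j)\<^sup>2)) / 4 + h * (N * (\<Sum>j\<in>V. \<bar>v j\<bar>))"
    by (rule order_trans[OF u(2)[unfolded l e1 e2] add_right_mono[OF divide_right_mono[OF q]]]) simp
  moreover have "\<bar>real_of_int (u' j) - N * v j\<bar> \<le> 1" if "j \<in> V" for j using u(1)[of "Some j"] that by (simp add: u'_def x_def)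
  moreover have "\<bar>real_of_int z - N * \<sigma>\<bar> \<le> 1" using u(1)[of None] by (simp add: z_def x_def)
  ultimately show ?thesis using that[of u' z] by (simp add: u'_def)
qed

text \<open>Rounding at the fixed scale 10 gives an integer vector of l1 norm at most 13 n / 20000,
  of which there are only e^(13 n / 1000), while its squared norm is still at least 81 n.
  \<open>small_ball_half\<close> therefore beats the union bound.\<close>

lemma compressible:
  fixes V :: "nat set" and w :: "nat => real"
  assumes "finite V" "n = real (card V)" "n \<ge> 230000" "\<And>i. i \<in> V ==> \<bar>w i\<bar> \<le> 2"
  shows "Pr (symm V) (\<lambda>s. \<exists>v \<sigma>. (\<Sum>i\<in>V. (v i)\<^sup>2) = n \<and> (\<Sum>i\<in>V. \<bar>v i\<bar>) \<le> n / 20000 \<and> \<bar>\<sigma>\<bar> \<le> n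
     \<and> (\<forall>i\<in>V. mv s V v i = \<sigma> * w i)) \<le> exp (- n / 50)"
proof -
  let ?P = "\<lambda>s. \<exists>v \<sigma>. (\<Sum>i\<in>V. (v i)\<^sup>2) = n \<and> (\<Sum>i\<in>V. \<bar>v i\<bar>) \<le> n / 20000 \<and> \<bar>\<sigma>\<bar> \<le> n \<and> (\<forall>i\<in>V. mv s V v i = \<sigma> * w i)"
  define LL where "LL = L1 V (13 / 20000 * n)"
  define U where "U = {u \<in> LL. 81 * n \<le> (\<Sum>j\<in>V. (real_of_int (u j))\<^sup>2)}"
  define Z where "Z = {- int (11 * card V)..int (11 * card V)}"
  define Q where "Q u z s \<longleftrightarrow> (\<Sum>i\<in>V. (mv s V (\<lambda>j. real_of_int (u j)) i - real_of_int z * w i)\<^sup>2) \<le> 13/10 * n\<^sup>2" for u z s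
  have fU: "finite U" "finite LL" unfolding U_def LL_def using finite_L1[OF assms(1)] by auto
  have key: "\<exists>u\<in>U. \<exists>z\<in>Z. Q u z s" if s: "s \<in> symm V" and P: "?P s" for s
  proof -
    from P obtain v \<sigma> where v: "(\<Sum>i\<in>V. (v i)\<^sup>2) = n" "(\<Sum>i\<in>V. \<bar>v i\<bar>) \<le> n / 20000" "\<bar>\<sigma>\<bar> \<le> n"
      "\<And>i. i \<in> V ==> mv s V v i = \<sigma> * w i" by blast
    have n0: "n > 0" using assms(3) by simp
    obtain u z where u: "u \<in> PiE V (\<lambda>_. UNIV)" "\<And>j. j \<in> V ==> \<bar>real_of_int (u j) - 10 * v j\<bar> \<le> 1" "\<bar>real_of_int z - 10 * \<sigma>\<bar> \<le> 1"
      "(\<Sum>i\<in>V. (mv s V (\<lambda>j. real_of_int (u j)) i - real_of_int z * w i)\<^sup>2) / n\<^sup>2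
        + 0 * (\<Sum>r\<in>{}. (\<Sum>j\<in>V. 0 * (real_of_int (u j) - 10 * v j))\<^sup>2) + 2000 / n * (\<Sum>j\<in>V. \<bar>real_of_int (u j)\<bar>)
       \<le> ((4 + n) / n + 0 * (\<Sum>r\<in>{}. \<Sum>j\<in>V. 0\<^sup>2)) / 4 + 2000 / n * (10 * (\<Sum>j\<in>V. \<bar>v j\<bar>))"
      by (rule round_solution[OF assms(1,2) n0 assms(4) s v(4), where R = "{}" and \<kappa> = 0 and N = 10 and h = "2000 / n" and g = "\<lambda>_ _. 0"]) auto
    have "2000 / n * (10 * (\<Sum>j\<in>V. \<bar>v j\<bar>)) \<le> 2000 / n * (10 * (n / 20000))" using v(2) n0 by (intro mult_left_mono) auto
    also have "... = 1" using n0 by simp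
    finally have t: "2000 / n * (10 * (\<Sum>j\<in>V. \<bar>v j\<bar>)) \<le> 1" .
    have b: "(\<Sum>i\<in>V. (mv s V (\<lambda>j. of_int (u j)) i - of_int z * w i)\<^sup>2) / n\<^sup>2 + 2000 / n * (\<Sum>j\<in>V. \<bar>of_int (u j)\<bar>)
      \<le> (4 + n) / n / 4 + 2000 / n * (10 * (\<Sum>j\<in>V. \<bar>v j\<bar>))" using u(4) by (simp only: mult_zero_left add_0_right)
    have "(4 + n) / n / 4 \<le> 3/10" using assms(3) by (simp add: field_simps)
    from order_trans[OF b add_mono[OF this t]] have tot: "(\<Sum>i\<in>V. (mv s V (\<lambda>j. of_int (u j)) i - of_int z * w i)\<^sup>2) / n\<^sup>2 + 2000 / n * (\<Sum>j\<in>V. \<bar>of_int (u j)\<bar>) \<le> 13/10"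
      by simp
    have "0 \<le> 2000 / n * (\<Sum>j\<in>V. \<bar>of_int (u j)\<bar>)" using n0 by (intro mult_nonneg_nonneg sum_nonneg) auto
    then have "(\<Sum>i\<in>V. (mv s V (\<lambda>j. of_int (u j)) i - of_int z * w i)\<^sup>2) / n\<^sup>2 \<le> 13/10" using tot by linarith
    then have q: "Q u z s" unfolding Q_def using n0 by (simp add: pos_divide_le_eq)
    have "0 \<le> (\<Sum>i\<in>V. (mv s V (\<lambda>j. of_int (u j)) i - of_int z * w i)\<^sup>2) / n\<^sup>2" by (intro divide_nonneg_nonneg sum_nonneg) auto
    then have "2000 / n * (\<Sum>j\<in>V. \<bar>of_int (u j)\<bar>) \<le> 13/10" using tot by linarith
    then have l1: "u \<in> LL" using n0 u(1) by (simp add: LL_def L1_def field_simps)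
    have "81 * n \<le> (\<Sum>j\<in>V. (real_of_int (u j))\<^sup>2)"
    proof -
      \<comment> \<open>(10 v + d)^2 - 90 v^2 + 9 d^2 is the square 10 (v + d)^2; summation gives 90
        n - 9 n.\<close>
      have "(\<Sum>j\<in>V. 90 * (v j)\<^sup>2 - 9) \<le> (\<Sum>j\<in>V. (real_of_int (u j))\<^sup>2)"
      proof (rule sum_mono)
        fix j assume j: "j \<in> V"
        define d where "d = real_of_int (u j) - 10 * v j"
        have "\<bar>d\<bar> \<le> 1" using u(2)[OF j] by (simp add: d_def)
        then have "d\<^sup>2 \<le> 1" by (simp add: abs_square_le_1)
        moreover have "0 \<le> 10 * (v j + d)\<^sup>2" by simp
        ultimately have "90 * (v j)\<^sup>2 - 9 \<le> (10 * v j + d)\<^sup>2" by (simp add: power2_eq_square algebra_simps)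
        then show "90 * (v j)\<^sup>2 - 9 \<le> (real_of_int (u j))\<^sup>2" by (simp add: d_def)
      qed
      moreover have "(\<Sum>j\<in>V. 90 * (v j)\<^sup>2 - 9) = 81 * n" using v(1) assms(2) by (simp add: sum_subtractf sum_distrib_left[symmetric])
      ultimately show ?thesis by simp
    qed
    moreover have "z \<in> Z"
    proof -
      have "\<bar>real_of_int z\<bar> \<le> 11 * n" using u(3) v(3) assms(3) by linarith
      then have "real_of_int \<bar>z\<bar> \<le> real_of_int (int (11 * card V))" using assms(2) by simp
      then have "\<bar>z\<bar> \<le> int (11 * card V)" by (simp only: of_int_le_iff)
      then show ?thesis by (auto simp: Z_def)
    qed
    ultimately show ?thesis using q l1 by (auto simp: U_def)
  qed
  have "Pr (symm V) ?P \<le> avg (symm V) (\<lambda>s. \<Sum>u\<in>U. \<Sum>z\<in>Z. of_bool (Q u z s) :: real)"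
  proof (rule avg_mono)
    fix s assume s: "s \<in> symm V"
    show "of_bool (?P s) \<le> (\<Sum>u\<in>U. \<Sum>z\<in>Z. of_bool (Q u z s) :: real)"
    proof (cases "?P s")
      case True
      then obtain u z where uz: "u \<in> U" "z \<in> Z" "Q u z s" using key[OF s] by blast
      have "1 \<le> (\<Sum>z\<in>Z. of_bool (Q u z s) :: real)" using uz member_le_sum[of z Z "\<lambda>z. of_bool (Q u z s) :: real"] by (simp add: Z_def)
      also have "... \<le> (\<Sum>u\<in>U. \<Sum>z\<in>Z. of_bool (Q u z s))"
        using uz fU by (intro member_le_sum[of u U "\<lambda>u. \<Sum>z\<in>Z. of_bool (Q u z s) :: real"]) (auto intro!: sum_nonneg)
      finally show ?thesis by simp
    next
      case False
      moreover have "0 \<le> (\<Sum>u\<in>U. \<Sum>z\<in>Z. of_bool (Q u z s) :: real)" by (intro sum_nonneg) simp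
      ultimately show ?thesis by (simp only: of_bool_eq)
    qed
  qed
  also have "... = (\<Sum>u\<in>U. \<Sum>z\<in>Z. Pr (symm V) (\<lambda>s. Q u z s))" by (simp only: avg_sum)
  also have "... \<le> (\<Sum>u\<in>U. \<Sum>z\<in>Z. exp (1/12 - 7/100 * n))"
  proof (intro sum_mono)
    fix u z assume "u \<in> U"
    then show "Pr (symm V) (\<lambda>s. Q u z s) \<le> exp (1/12 - 7/100 * n)" unfolding Q_def using assms by (intro small_ball_half) (auto simp: U_def)
  qed
  also have "... = real (card U) * (real (card Z) * exp (1/12 - 7/100 * n))" by simp
  also have "... \<le> exp (13/1000 * n) * ((23 * n) * exp (1/12 - 7/100 * n))"
  proof (intro mult_mono)
    have "real (card U) \<le> real (card LL)" using fU by (auto simp: U_def intro!: of_nat_mono card_mono)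
    also have "... \<le> exp (6 * (13 / 20000 * n)) * (1 + 2 / (exp 6 - 1)) ^ card V" unfolding LL_def by (rule card_L1[OF assms(1)]) simp
    also have "(1 + 2 / (exp 6 - 1)) ^ card V \<le> exp (9/1000::real) ^ card V"
    proof (rule power_mono)
      have "(5/2::real) ^ 6 \<le> exp 1 ^ 6" using exp_lower_Taylor_quadratic[of 1] by (intro power_mono) auto
      moreover have "exp 1 ^ 6 = exp (6::real)" by (simp add: exp_of_nat_mult[symmetric])
      ultimately have e6: "244 \<le> exp (6::real)" by (simp add: power_divide)
      then have "2 / (exp 6 - 1) \<le> (2::real) / 243" by (intro divide_left_mono) auto
      then show "1 + 2 / (exp 6 - 1) \<le> exp (9/1000::real)" using exp_ge_add_one_self[of "9/1000::real"] by linarith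
      show "0 \<le> 1 + 2 / (exp 6 - (1::real))" using e6 by (auto intro!: add_nonneg_nonneg)
    qed
    also have "exp (9/1000::real) ^ card V = exp (9/1000 * n)" using assms(2) by (simp add: exp_of_nat_mult[symmetric])
    also have "exp (6 * (13 / 20000 * n)) * exp (9/1000 * n) \<le> exp (13/1000 * n)" unfolding exp_add[symmetric] using assms(3) by simp
    finally show "real (card U) \<le> exp (13/1000 * n)" by (simp add: mult_left_mono)
    have "card Z = 22 * card V + 1" by (simp add: Z_def)
    then show "real (card Z) \<le> 23 * n" using assms(2,3) by simp
  qed (use assms(3) in auto)
  also have "... = 23 * n * exp (1/12 - 57/1000 * n)" by (simp add: exp_add[symmetric] algebra_simps)
  also have "... \<le> exp (1/100 * n) * exp (2/100 * n - 1/12) * exp (1/12 - 57/1000 * n)"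
  proof (rule mult_right_mono)
    have "n / 100 \<le> exp (1/100 * n)" using exp_ge_add_one_self[of "1/100 * n"] by linarith
    moreover have "2300 \<le> exp (2/100 * n - 1/12)" using exp_ge_add_one_self[of "2/100 * n - 1/12"] assms(3) by linarith
    ultimately have "n / 100 * 2300 \<le> exp (1/100 * n) * exp (2/100 * n - 1/12)" by (intro mult_mono) auto
    then show "23 * n \<le> exp (1/100 * n) * exp (2/100 * n - 1/12)" by simp
  qed simp
  also have "... \<le> exp (- n / 50)" unfolding exp_add[symmetric] using assms(3) by simp
  finally show ?thesis .
qed

section \<open>From structured solutions to heavy integer vectors\<close>

lemma concentration_restrict:
  fixes v :: "'a => real" and \<gamma> :: real
  assumes "finite J" "D \<subseteq> J" "\<gamma> \<le> Pr (signs J) (\<lambda>r. (\<Sum>j\<in>J. r j * v j) = b)"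
  shows "\<exists>b'. \<gamma> \<le> Pr (signs D) (\<lambda>r. (\<Sum>j\<in>D. r j * v j) = b')"
proof -
  have fD: "finite D" using assms finite_subset by blast
  define m where "m h x = (if x \<in> D then h x else 1)" for h :: "'a => real" and x
  have "Pr (signs J) (\<lambda>r. (\<Sum>j\<in>J. r j * v j) = b)
    = avg (signs J) (\<lambda>s. Pr (signs D) (\<lambda>h. (\<Sum>j\<in>J. (\<lambda>x\<in>J. s x * m h x) j * v j) = b))"
    by (rule avg_sign_twist_family[OF finite_signs[OF fD] signs_nonempty]) (auto simp: m_def dest: PiE_mem)
  \<comment> \<open>Some choice of the signs outside \<open>D\<close> does at least as well as the
    average; it is frozen and moved into the constant.\<close>
  then have "\<exists>s\<in>signs J. \<gamma> \<le> Pr (signs D) (\<lambda>h. (\<Sum>j\<in>J. (\<lambda>x\<in>J. s x * m h x) j * v j) = b)"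
    using assms(3) by (intro avg_ex_ge[OF finite_signs[OF assms(1)] signs_nonempty]) simp
  then obtain s where s: "s \<in> signs J" "\<gamma> \<le> Pr (signs D) (\<lambda>h. (\<Sum>j\<in>J. (\<lambda>x\<in>J. s x * m h x) j * v j) = b)" by blast
  define b' where "b' = b - (\<Sum>j\<in>J - D. s j * v j)"
  have "(\<Sum>j\<in>J. (\<lambda>x\<in>J. s x * m h x) j * v j) = (\<Sum>j\<in>J - D. s j * v j) + (\<Sum>j\<in>D. (\<lambda>x\<in>D. h x * s x) j * v j)" for h
  proof -
    have "(\<Sum>j\<in>J - D. (\<lambda>x\<in>J. s x * m h x) j * v j) = (\<Sum>j\<in>J - D. s j * v j)" by (intro sum.cong) (auto simp: m_def)
    moreover have "(\<Sum>j\<in>D. (\<lambda>x\<in>J. s x * m h x) j * v j) = (\<Sum>j\<in>D. (\<lambda>x\<in>D. h x * s x) j * v j)"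
      using assms(2) by (intro sum.cong) (auto simp: m_def)
    ultimately show ?thesis by (simp only: sum.subset_diff[OF assms(2,1)])
  qed
  then have "((\<Sum>j\<in>J. (\<lambda>x\<in>J. s x * m h x) j * v j) = b) = ((\<Sum>j\<in>D. (\<lambda>x\<in>D. h x * s x) j * v j) = b')" for h by (auto simp: b'_def)
  then have "\<gamma> \<le> Pr (signs D) (\<lambda>h. (\<Sum>j\<in>D. (\<lambda>x\<in>D. h x * s x) j * v j) = b')" using s(2) by simp
  also have "... = Pr (signs D) (\<lambda>r. (\<Sum>j\<in>D. r j * v j) = b')"
    using s(1) assms(2) by (intro avg_sign_twist[where G = "\<lambda>r. of_bool ((\<Sum>j\<in>D. r j * v j) = b')"]) (auto dest: PiE_mem)
  finally show ?thesis by blast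
qed

text \<open>The sign vectors that hit b exactly are used as additional linear forms in the rounding,
  with a total weight comparable to that of the equations. Their mean squared error is at most n, so
  at least three quarters of them miss N b by at most 2 sqrt n: concentration survives
  approximately.\<close>

lemma round_at_scale:
  fixes V D :: "nat set" and N :: nat and \<sigma> b :: real and v :: "nat => real" and \<gamma> :: real
  assumes "finite V" "n = real (card V)" "n \<ge> 2" "D \<subseteq> V" "\<And>i. i \<in> V ==> \<bar>w i\<bar> \<le> 2" "s \<in> symm V"
    "\<And>i. i \<in> V ==> mv s V v i = \<sigma> * w i" "0 < \<gamma>"
    "\<gamma> \<le> Pr (signs D) (\<lambda>r. (\<Sum>j\<in>D. r j * v j) = b)"
  shows "\<exists>u z. u \<in> PiE V (\<lambda>_. UNIV) \<and> (\<forall>j\<in>V. \<bar>real_of_int (u j) - real N * v j\<bar> \<le> 1) \<and> \<bar>real_of_int z - real N * \<sigma>\<bar> \<le> 1 \<and>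
    (\<Sum>i\<in>V. (mv s V (\<lambda>j. real_of_int (u j)) i - real_of_int z * w i)\<^sup>2) \<le> n\<^sup>2 \<and>
    \<gamma> / 2 \<le> Pr (signs D) (\<lambda>r. \<bar>(\<Sum>j\<in>D. r j * real_of_int (u j)) - real N * b\<bar> \<le> 2 * sqrt n)"
proof -
  have fD: "finite D" using assms(1,4) finite_subset by blast
  have n0: "n > 0" using assms(3) by simp
  define R0 where "R0 = {r \<in> signs D. (\<Sum>j\<in>D. r j * v j) = b}"
  have fR: "finite R0" using finite_signs[OF fD] by (simp add: R0_def)
  have cS: "0 < real (card (signs D))" using card_signs[OF fD] by simp
  have cR: "\<gamma> * real (card (signs D)) \<le> real (card R0)"
    using assms(9) cS by (simp add: avg_of_bool[OF finite_signs[OF fD]] R0_def pos_le_divide_eq)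
  then have R0: "0 < real (card R0)" using assms(8) cS by (smt (verit) mult_pos_pos)
  define g where "g r j = (if j \<in> D then r j else 0)" for r :: "nat => real" and j
  obtain u z where u: "u \<in> PiE V (\<lambda>_. UNIV)" "\<And>j. j \<in> V ==> \<bar>real_of_int (u j) - real N * v j\<bar> \<le> 1" "\<bar>real_of_int z - real N * \<sigma>\<bar> \<le> 1"
    "(\<Sum>i\<in>V. (mv s V (\<lambda>j. real_of_int (u j)) i - real_of_int z * w i)\<^sup>2) / n\<^sup>2
      + 1 / (n * real (card R0)) * (\<Sum>r\<in>R0. (\<Sum>j\<in>V. g r j * (real_of_int (u j) - real N * v j))\<^sup>2) + 0 * (\<Sum>j\<in>V. \<bar>real_of_int (u j)\<bar>)
     \<le> ((4 + n) / n + 1 / (n * real (card R0)) * (\<Sum>r\<in>R0. \<Sum>j\<in>V. (g r j)\<^sup>2)) / 4 + 0 * (real N * (\<Sum>j\<in>V. \<bar>v j\<bar>))"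
    by (rule round_solution[OF assms(1,2) n0 assms(5,6,7) fR, where \<kappa> = "1 / (n * real (card R0))" and N = "real N" and h = 0 and g = g])
      (use n0 in auto)
  define rA where "rA i = mv s V (\<lambda>j. real_of_int (u j)) i - real_of_int z * w i" for i
  define rB where "rB r = (\<Sum>j\<in>D. r j * real_of_int (u j)) - real N * b" for r
  have B: "(\<Sum>j\<in>V. g r j * (real_of_int (u j) - real N * v j)) = rB r" if r: "r \<in> R0" for r
  proof -
    have "(\<Sum>j\<in>V. g r j * (real_of_int (u j) - real N * v j)) = (\<Sum>j\<in>D. g r j * (real_of_int (u j) - real N * v j))"
      using assms(1,4) by (intro sum.mono_neutral_right) (auto simp: g_def)
    also have "... = (\<Sum>j\<in>D. r j * real_of_int (u j)) - real N * (\<Sum>j\<in>D. r j * v j)"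
      by (simp add: g_def right_diff_distrib sum_subtractf sum_distrib_left mult_ac)
    finally show ?thesis using r by (simp add: rB_def R0_def)
  qed
  have "(\<Sum>j\<in>V. (g r j)\<^sup>2) \<le> (\<Sum>j\<in>V. 1)" if r: "r \<in> R0" for r
    using r signs_sq[of r D] by (intro sum_mono) (auto simp: g_def R0_def power2_eq_square)
  then have "(\<Sum>r\<in>R0. \<Sum>j\<in>V. (g r j)\<^sup>2) \<le> (\<Sum>r\<in>R0. n)" using assms(2) by (intro sum_mono) simp
  then have h1: "1 / (n * real (card R0)) * (\<Sum>r\<in>R0. \<Sum>j\<in>V. (g r j)\<^sup>2) \<le> 1" using n0 R0 by (simp add: pos_divide_le_eq mult.commute)
  have h2: "(4 + n) / n \<le> 3" using assms(3) by (simp add: pos_divide_le_eq)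
  have h3: "(\<Sum>r\<in>R0. (\<Sum>j\<in>V. g r j * (real_of_int (u j) - real N * v j))\<^sup>2) = (\<Sum>r\<in>R0. (rB r)\<^sup>2)" by (intro sum.cong refl) (simp add: B)
  have AB: "(\<Sum>i\<in>V. (rA i)\<^sup>2) / n\<^sup>2 + (\<Sum>r\<in>R0. (rB r)\<^sup>2) / (n * real (card R0)) \<le> 1"
    using order_trans[OF u(4)[unfolded h3 mult_zero_left add_0_right] divide_right_mono[OF add_mono[OF h2 h1]]] unfolding rA_def by simp
  have nn: "0 \<le> (\<Sum>i\<in>V. (rA i)\<^sup>2) / n\<^sup>2" "0 \<le> (\<Sum>r\<in>R0. (rB r)\<^sup>2) / (n * real (card R0))"
    using n0 by (auto intro!: divide_nonneg_nonneg sum_nonneg)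
  have "(\<Sum>i\<in>V. (rA i)\<^sup>2) / n\<^sup>2 \<le> 1" "(\<Sum>r\<in>R0. (rB r)\<^sup>2) / (n * real (card R0)) \<le> 1" using AB nn by linarith+
  then have A1: "(\<Sum>i\<in>V. (rA i)\<^sup>2) \<le> n\<^sup>2" and B1: "(\<Sum>r\<in>R0. (rB r)\<^sup>2) \<le> n * real (card R0)" using n0 R0 by (auto simp: pos_divide_le_eq)
  define X where "X = {r \<in> R0. \<bar>rB r\<bar> > 2 * sqrt n}"
  have "real (card X) * (4 * n) = (\<Sum>r\<in>X. 4 * n)" by simp
  also have "... \<le> (\<Sum>r\<in>X. (rB r)\<^sup>2)"
  proof (rule sum_mono)
    fix r assume "r \<in> X"
    then have "(2 * sqrt n)\<^sup>2 \<le> \<bar>rB r\<bar>\<^sup>2" using n0 by (intro power_mono) (auto simp: X_def)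
    then show "4 * n \<le> (rB r)\<^sup>2" using n0 by (simp add: power_mult_distrib)
  qed
  also have "... \<le> (\<Sum>r\<in>R0. (rB r)\<^sup>2)" using fR by (intro sum_mono2) (auto simp: X_def)
  also have "... \<le> n * real (card R0)" by (rule B1)
  finally have "n * (4 * real (card X)) \<le> n * real (card R0)" by (simp add: mult_ac)
  then have cX: "4 * real (card X) \<le> real (card R0)" using n0 by simp
  have "real (card R0) - real (card X) \<le> real (card {r \<in> signs D. \<bar>rB r\<bar> \<le> 2 * sqrt n})"
  proof -
    have "card (R0 - X) \<le> card {r \<in> signs D. \<bar>rB r\<bar> \<le> 2 * sqrt n}" using finite_signs[OF fD] by (intro card_mono) (auto simp: X_def R0_def)
    moreover have "card (R0 - X) = card R0 - card X" using fR by (intro card_Diff_subset) (auto simp: X_def)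
    moreover have "card X \<le> card R0" using fR by (intro card_mono) (auto simp: X_def)
    ultimately show ?thesis by linarith
  qed
  then have "\<gamma> / 2 * real (card (signs D)) \<le> real (card {r \<in> signs D. \<bar>rB r\<bar> \<le> 2 * sqrt n})" using cX cR by linarith
  then have "\<gamma> / 2 \<le> Pr (signs D) (\<lambda>r. \<bar>rB r\<bar> \<le> 2 * sqrt n)" using cS by (simp add: avg_of_bool[OF finite_signs[OF fD]] pos_le_divide_eq)
  then show ?thesis using A1 u(1-3) unfolding rA_def rB_def by blast
qed

text \<open>Outside the middle range |x| \<le> \<epsilon>/2 + \<epsilon> x^2 / 4, so those
  coordinates account for at most 3 \<epsilon> n / 4 of the l1 norm. The middle ones carry the
  remaining \<epsilon> n / 4, and Cauchy-Schwarz turns this into a count.\<close>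

lemma middle_coordinates:
  fixes v :: "'a => real"
  assumes "finite V" "n = real (card V)" "(\<Sum>i\<in>V. (v i)\<^sup>2) = n" "\<not> (\<Sum>i\<in>V. \<bar>v i\<bar>) \<le> \<epsilon> * n" "\<epsilon> > 0" "n > 0"
  shows "\<epsilon>\<^sup>2 * n / 16 \<le> real (card {i\<in>V. \<epsilon> / 2 \<le> \<bar>v i\<bar> \<and> \<bar>v i\<bar> \<le> 4 / \<epsilon>})"
proof -
  define M where "M = {i\<in>V. \<epsilon> / 2 \<le> \<bar>v i\<bar> \<and> \<bar>v i\<bar> \<le> 4 / \<epsilon>}"
  have "(\<Sum>i\<in>V. \<bar>v i\<bar>) \<le> (\<Sum>i\<in>V. (if i \<in> M then \<bar>v i\<bar> else 0) + (\<epsilon> / 2 + \<epsilon> / 4 * (v i)\<^sup>2))"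
  proof (rule sum_mono)
    fix i assume i: "i \<in> V"
    show "\<bar>v i\<bar> \<le> (if i \<in> M then \<bar>v i\<bar> else 0) + (\<epsilon> / 2 + \<epsilon> / 4 * (v i)\<^sup>2)"
    proof (cases "4 / \<epsilon> \<le> \<bar>v i\<bar>")
      case True
      then have "1 * \<bar>v i\<bar> \<le> (\<epsilon> / 4 * \<bar>v i\<bar>) * \<bar>v i\<bar>" using assms(5) by (intro mult_right_mono) (auto simp: field_simps)
      then have "\<bar>v i\<bar> \<le> \<epsilon> / 4 * (v i)\<^sup>2" by (simp add: power2_eq_square mult.assoc)
      then show ?thesis using assms(5) by auto
    next
      case False
      then have "i \<in> M \<or> \<bar>v i\<bar> \<le> \<epsilon> / 2" using i by (auto simp: M_def)
      moreover have "0 \<le> \<epsilon> / 4 * (v i)\<^sup>2" using assms(5) by simp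
      ultimately have "\<bar>v i\<bar> \<le> (if i \<in> M then \<bar>v i\<bar> else 0) + \<epsilon> / 2 \<and> 0 \<le> \<epsilon> / 4 * (v i)\<^sup>2" using assms(5) by auto
      then show ?thesis by linarith
    qed
  qed
  also have "... = (\<Sum>i\<in>M. \<bar>v i\<bar>) + (\<epsilon> / 2 * n + \<epsilon> / 4 * n)"
  proof -
    have "(\<Sum>i\<in>V. if i \<in> M then \<bar>v i\<bar> else 0) = (\<Sum>i\<in>M. \<bar>v i\<bar>)"
      using sum.inter_restrict[OF assms(1), of "\<lambda>i. \<bar>v i\<bar>" M] by (simp add: M_def Int_def conj_commute)
    moreover have "(\<Sum>i\<in>V. \<epsilon> / 4 * (v i)\<^sup>2) = \<epsilon> / 4 * n" by (simp only: assms(3) sum_distrib_left[symmetric])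
    ultimately show ?thesis using assms(2) by (simp only: sum.distrib) simp
  qed
  finally have "\<epsilon> * n / 4 \<le> (\<Sum>i\<in>M. \<bar>v i\<bar>)" using assms(4) by linarith
  also have "(\<Sum>i\<in>M. \<bar>v i\<bar>) \<le> sqrt (real (card M) * n)"
  proof (rule sum_abs_le_sqrt)
    show "(\<Sum>i\<in>M. (v i)\<^sup>2) \<le> n" unfolding assms(3)[symmetric] using assms(1) by (intro sum_mono2) (auto simp: M_def)
  qed
  finally have "(\<epsilon> * n / 4)\<^sup>2 \<le> (sqrt (real (card M) * n))\<^sup>2" using assms(5,6) by (intro power_mono) auto
  then have "n * (\<epsilon>\<^sup>2 * n / 16) \<le> n * real (card M)" using assms(6) by (simp add: power2_eq_square field_simps)
  then show ?thesis using assms(6) unfolding M_def by simp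
qed

text \<open>Rescaling to squared norm n replaces the right-hand side by \<sigma> w. A nonzero entry
  of \<open>w\<close> has modulus 2, so v cannot be too short and \<sigma> is at most n, which
  leaves few integer roundings of it later. For w = 0 the scaling factor is uncontrolled, hence
  \<sigma> is set to 0.\<close>

lemma normalise_solution:
  fixes v :: "nat => real" and \<gamma> :: real
  assumes "finite V" "n = real (card V)" "s \<in> symm V" "\<exists>i\<in>V. v i \<noteq> 0" "\<And>i. i \<in> V ==> w i \<in> {-2, 0, 2}"
    "\<And>i. i \<in> V ==> mv s V v i = w i" "\<gamma> \<le> Pr (signs J) (\<lambda>r. (\<Sum>j\<in>J. r j * v j) = b)"
  shows "\<exists>v' \<sigma> b'. (\<Sum>i\<in>V. (v' i)\<^sup>2) = n \<and> \<bar>\<sigma>\<bar> \<le> n \<and> (\<forall>i\<in>V. mv s V v' i = \<sigma> * w i) \<and>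
     \<gamma> \<le> Pr (signs J) (\<lambda>r. (\<Sum>j\<in>J. r j * v' j) = b')"
proof -
  define q where "q = (\<Sum>i\<in>V. (v i)\<^sup>2)"
  have q0: "q > 0" using assms(1,4) unfolding q_def by (metis (no_types, lifting) sum_pos2 zero_less_power2 zero_le_power2)
  have n1: "n \<ge> 1" using assms(1,2,4) by (auto simp: Suc_le_eq card_gt_0_iff)
  define t where "t = sqrt (n / q)"
  have t: "t > 0" "t\<^sup>2 = n / q" using q0 n1 by (auto simp: t_def)
  define \<sigma> where "\<sigma> = (if \<forall>i\<in>V. w i = 0 then 0 else t)"
  have "(\<Sum>i\<in>V. (t * v i)\<^sup>2) = n" unfolding power_mult_distrib t(2) sum_distrib_left[symmetric] q_def[symmetric] using q0 by simp
  moreover have "\<forall>i\<in>V. mv s V (\<lambda>i. t * v i) i = \<sigma> * w i" unfolding mv_scale using assms(6) by (simp add: \<sigma>_def)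
  moreover have "\<bar>\<sigma>\<bar> \<le> n"
  proof (cases "\<forall>i\<in>V. w i = 0")
    case True
    then show ?thesis using n1 by (simp add: \<sigma>_def)
  next
    case False
    then obtain i where i: "i \<in> V" "w i \<noteq> 0" by blast
    have "2 = \<bar>mv s V v i\<bar>" using assms(5)[OF i(1)] assms(6)[OF i(1)] i(2) by auto
    also have "... \<le> (\<Sum>j\<in>V. \<bar>ent s i j * v j\<bar>)" unfolding mv_def by (rule sum_abs)
    also have "... = (\<Sum>j\<in>V. \<bar>v j\<bar>)" using ent_abs[OF assms(3) i(1)] by (intro sum.cong refl) (simp add: abs_mult)
    also have "... \<le> sqrt (n * q)" unfolding assms(2) by (rule sum_abs_le_sqrt) (simp add: q_def)
    finally have "2\<^sup>2 \<le> (sqrt (n * q))\<^sup>2" by (intro power_mono) auto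
    then have "1 \<le> n * q" using n1 q0 by simp
    then have "1 / q \<le> n" using q0 by (simp add: field_simps)
    then have "n * (1 / q) \<le> n * n" using n1 by (intro mult_left_mono) auto
    then have "n / q \<le> n\<^sup>2" by (simp add: power2_eq_square)
    then have "t \<le> n" unfolding t_def using n1 by (metis real_le_lsqrt less_eq_real_def order_trans zero_le_one real_sqrt_le_iff real_sqrt_abs abs_of_nonneg)
    then show ?thesis using t(1) by (simp add: \<sigma>_def)
  qed
  moreover have "((\<Sum>j\<in>J. r j * (t * v j)) = t * b) = ((\<Sum>j\<in>J. r j * v j) = b)" for r
  proof -
    have "(\<Sum>j\<in>J. r j * (t * v j)) = t * (\<Sum>j\<in>J. r j * v j)" by (simp add: sum_distrib_left mult_ac)
    then show ?thesis using t(1) by simp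
  qed
  then have "\<gamma> \<le> Pr (signs J) (\<lambda>r. (\<Sum>j\<in>J. r j * (t * v j)) = t * b)" using assms(7) by simp
  ultimately show ?thesis by (intro exI[of _ "\<lambda>i. t * v i"] exI[of _ \<sigma>] exI[of _ "t * b"] conjI) assumption+
qed

lemma avg_imp: "(\<And>s. s \<in> S ==> P s ==> Q s) ==> Pr S P \<le> (Pr S Q :: real)"
  by (rule avg_mono) (simp add: of_bool_def)

lemma avg_union_sum:
  assumes "finite X"
  shows "Pr S (\<lambda>s. \<exists>x\<in>X. Q x s) \<le> (\<Sum>x\<in>X. Pr S (\<lambda>s. Q x s) :: real)"
  unfolding avg_sum[symmetric]
proof (rule avg_mono)
  fix s
  show "of_bool (\<exists>x\<in>X. Q x s) \<le> (\<Sum>x\<in>X. of_bool (Q x s) :: real)"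
  proof (cases "\<exists>x\<in>X. Q x s")
    case True
    then obtain x where x: "x \<in> X" "Q x s" by blast
    have "of_bool (Q x s) \<le> (\<Sum>x\<in>X. of_bool (Q x s) :: real)" by (rule member_le_sum[of x X "\<lambda>x. of_bool (Q x s)"]) (use x assms(1) in auto)
    then show ?thesis using True x by simp
  next
    case False
    then have "of_bool (\<exists>x\<in>X. Q x s) = (0::real)" by simp
    then show ?thesis by (simp only:) (rule sum_nonneg, simp)
  qed
qed

lemma avg_union:
  fixes c p :: real
  assumes "finite X" "real (card X) \<le> c" "0 \<le> p" "\<And>x. x \<in> X ==> Pr S (\<lambda>s. Q x s) \<le> p"
  shows "Pr S (\<lambda>s. \<exists>x\<in>X. Q x s) \<le> c * p"
proof -
  have "Pr S (\<lambda>s. \<exists>x\<in>X. Q x s) \<le> (\<Sum>x\<in>X. Pr S (\<lambda>s. Q x s) :: real)" by (rule avg_union_sum[OF assms(1)])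
  also have "... \<le> (\<Sum>x\<in>X. p)" by (rule sum_mono) (rule assms(4))
  also have "... \<le> c * p" using assms by (simp add: mult_right_mono)
  finally show ?thesis .
qed

text \<open>Candidates for the rounding at scale 2^(j-1) when the rounding at 2^j is
  \<open>u\<close>: both roundings err by at most 1, so |u - 2 u'| \<le> 3, leaving at most four
  values per coordinate.\<close>

definition halves :: "'a set => ('a => int) => ('a => int) set" where
  "halves V u = PiE V (\<lambda>i. {(u i - 3) div 2..(u i + 3) div 2})"

lemma card_halves: "finite V ==> finite (halves V u)" "finite V ==> card (halves V u) = 4 ^ card V"
proof -
  have "card {(x - 3) div 2..(x + 3) div 2} = 4" for x :: int
  proof -
    have "(x + 3) div 2 = (x - 3) div 2 + 3" by presburger
    then show ?thesis by simp
  qed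
  then show "finite V ==> finite (halves V u)" "finite V ==> card (halves V u) = 4 ^ card V"
    by (auto simp: halves_def card_PiE intro!: finite_PiE)
qed

text \<open>Rounding \<open>2\<^sup>j v\<close> for growing \<open>j\<close>, the first scale at which \<open>fM\<close> exceeds \<open>(2\<^sup>l/2\<^sup>j)\<^sup>n\<close>
  provides a rare vector \<open>u\<close>, while \<open>fM\<close> is still small at the preceding approximation \<open>u'\<close>.\<close>

lemma critical_scale:
  fixes V D E :: "nat set" and l jm T :: nat and \<gamma> \<sigma> b :: real and v w :: "nat => real"
  assumes "finite D" "finite E" "D \<inter> E = {}" "V = D \<union> E" "n = real (card V)" "n \<ge> 2"
    "\<And>i. i \<in> V ==> \<bar>w i\<bar> \<le> 2" "s \<in> symm V" "\<And>i. i \<in> V ==> mv s V v i = \<sigma> * w i" "\<bar>\<sigma>\<bar> \<le> n"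
    "(\<Sum>i\<in>V. (v i)\<^sup>2) = n" "\<And>j. j \<in> D ==> 1 / 40000 \<le> \<bar>v j\<bar> \<and> \<bar>v j\<bar> \<le> 80000"
    "0 < \<gamma>" "\<gamma> \<le> Pr (signs D) (\<lambda>r. (\<Sum>j\<in>D. r j * v j) = b)" "17 \<le> l" "l < jm"
    "\<And>u b. (\<Sum>i\<in>E. \<bar>u i\<bar>) \<le> real (2 * 2 ^ jm * card V) ==>
       \<gamma> / 2 \<le> Pr (signs D) (\<lambda>r. \<bar>(\<Sum>j\<in>D. r j * u j) - b\<bar> \<le> 2 * sqrt n) ==>
       (2 ^ l / 2 ^ jm) ^ card V \<le> fM D E T (4 * sqrt n) u"
  shows "\<exists>j\<in>{l<..jm}. \<exists>u\<in>heavy D E (1/80000) 80001 2 (2 ^ j) n T (2 ^ l). \<exists>u'\<in>halves V u.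
    \<exists>z\<in>{- int (2 ^ jm * card V)..int (2 ^ jm * card V)}.
      fM D E T (4 * sqrt n) (\<lambda>i. real_of_int (u' i)) \<le> (2 * 2 ^ l / 2 ^ j) ^ card V \<and>
      (\<Sum>i\<in>V. (mv s V (\<lambda>j. real_of_int (u' j)) i - real_of_int z * w i)\<^sup>2) \<le> n\<^sup>2"
proof -
  have fV: "finite V" using assms by simp
  have cV: "card V = card D + card E" unfolding assms(4) by (rule card_Un_disjoint[OF assms(1-3)])
  define R where "R j u z \<longleftrightarrow> u \<in> PiE V (\<lambda>_. UNIV) \<and> (\<forall>i\<in>V. \<bar>real_of_int (u i) - real (2 ^ j) * v i\<bar> \<le> 1) \<and> \<bar>real_of_int z - real (2 ^ j) * \<sigma>\<bar> \<le> 1 \<and>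
    (\<Sum>i\<in>V. (mv s V (\<lambda>j. real_of_int (u j)) i - real_of_int z * w i)\<^sup>2) \<le> n\<^sup>2 \<and>
    \<gamma> / 2 \<le> Pr (signs D) (\<lambda>r. \<bar>(\<Sum>j\<in>D. r j * real_of_int (u j)) - real (2 ^ j) * b\<bar> \<le> 2 * sqrt n)" for j u z
  have "\<exists>u z. R j u z" for j unfolding R_def using assms(4) by (intro round_at_scale[OF fV assms(5,6) _ assms(7,8,9,13,14)]) auto
  then obtain U Z where UZ: "\<And>j. R j (U j) (Z j)" by metis
  define f where "f j = fM D E T (4 * sqrt n) (\<lambda>i. real_of_int (U j i))" for j
  define good where "good j \<longleftrightarrow> l < j \<and> (2 ^ l / 2 ^ j) ^ card V \<le> f j" for j
  have av: "(\<Sum>i\<in>V. \<bar>v i\<bar>) \<le> n"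
  proof -
    have "(\<Sum>i\<in>V. \<bar>v i\<bar>) \<le> sqrt (real (card V) * n)" by (rule sum_abs_le_sqrt) (simp add: assms(11))
    then show ?thesis using assms(5,6) by simp
  qed
  have "good jm"
  proof -
    have "(\<Sum>i\<in>E. \<bar>real_of_int (U jm i)\<bar>) \<le> (\<Sum>i\<in>V. \<bar>real_of_int (U jm i)\<bar>)" using fV assms(4) by (intro sum_mono2) auto
    also have "... \<le> (\<Sum>i\<in>V. 2 ^ jm * \<bar>v i\<bar> + 1)"
    proof (rule sum_mono)
      fix i assume "i \<in> V"
      then have "\<bar>real_of_int (U jm i) - 2 ^ jm * v i\<bar> \<le> 1" using UZ[of jm] by (simp add: R_def)
      moreover have "\<bar>2 ^ jm * v i\<bar> = 2 ^ jm * \<bar>v i\<bar>" by (simp add: abs_mult)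
      ultimately show "\<bar>real_of_int (U jm i)\<bar> \<le> 2 ^ jm * \<bar>v i\<bar> + 1" by linarith
    qed
    also have "... = 2 ^ jm * (\<Sum>i\<in>V. \<bar>v i\<bar>) + n" using assms(5) by (simp add: sum.distrib sum_distrib_left)
    also have "... \<le> 2 ^ jm * n + 2 ^ jm * n" using av assms(6) by (intro add_mono mult_left_mono) auto
    also have "... = real (2 * 2 ^ jm * card V)" using assms(5) by simp
    finally show ?thesis using assms(16) UZ[of jm] unfolding good_def f_def R_def by (intro conjI assms(17)) auto
  qed
  define j where "j = (LEAST j. good j)"
  have gj: "good j" unfolding j_def by (rule LeastI[where P = good]) (rule \<open>good jm\<close>)
  have jle: "j \<le> jm" unfolding j_def by (rule Least_le[where P = good]) (rule \<open>good jm\<close>)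
  have jl: "l < j" using gj by (simp add: good_def)
  define i where "i = j - 1"
  have ji: "j = Suc i" using jl by (simp add: i_def)
  have "\<not> good i" using not_less_Least[of i good] ji unfolding j_def[symmetric] by simp
  \<comment> \<open>For j = l + 1 the preceding scale is excluded from \<open>good\<close> by
    definition, but then the claimed bound is 1 and \<open>fM\<close> never exceeds it.\<close>
  then have fi: "f i \<le> (2 * 2 ^ l / 2 ^ j) ^ card V"
  proof (cases "l < i")
    case False
    then have "l = i" using jl ji by simp
    then show ?thesis using fM_le1 by (simp add: ji f_def)
  qed (simp add: good_def ji)
  \<comment> \<open>2^17 exceeds 80000, so a rounding error of 1 is at most half of 2^j / 40000 and
    the entries stay in the box.\<close>
  have N: "(131072::real) \<le> 2 ^ j"
  proof -
    have "(2::real) ^ 17 \<le> 2 ^ j" using jl assms(15) by (intro power_increasing) auto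
    then show ?thesis by simp
  qed
  note Rj = UZ[of j, unfolded R_def] and Ri = UZ[of i, unfolded R_def]
  have d1: "\<bar>real_of_int (U j k) - 2 ^ j * v k\<bar> \<le> 1" "\<bar>real_of_int (U i k) - 2 ^ i * v k\<bar> \<le> 1" if "k \<in> V" for k using Rj Ri that by auto
  have ab: "\<bar>2 ^ j * v k\<bar> = 2 ^ j * \<bar>v k\<bar>" for k by (simp add: abs_mult)
  have "U j \<in> heavy D E (1/80000) 80001 2 (2 ^ j) n T (2 ^ l)" unfolding heavy_def
  proof (intro CollectI conjI ballI)
    show "U j \<in> PiE (D \<union> E) (\<lambda>_. UNIV)" using Rj assms(4) by simp
    fix k assume k: "k \<in> D"
    then have "k \<in> V" using assms(4) by simp
    moreover have "2 ^ j * (1 / 40000) \<le> 2 ^ j * \<bar>v k\<bar>" "2 ^ j * \<bar>v k\<bar> \<le> 2 ^ j * 80000"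
      using assms(12)[OF k] by (auto intro!: mult_left_mono)
    ultimately have "1/80000 * 2 ^ j \<le> \<bar>real_of_int (U j k)\<bar>" "\<bar>real_of_int (U j k)\<bar> \<le> 80001 * 2 ^ j"
      using d1(1)[of k] ab[of k] N by linarith+
    then show "U j k \<in> boxS (1/80000) 80001 (2 ^ j)" by (simp add: boxS_def)
  next
    have "(\<Sum>k\<in>E. (real_of_int (U j k))\<^sup>2) \<le> (\<Sum>k\<in>V. (real_of_int (U j k))\<^sup>2)" using fV assms(4) by (intro sum_mono2) auto
    also have "... \<le> (\<Sum>k\<in>V. 2 * (2 ^ j)\<^sup>2 * (v k)\<^sup>2 + 2)"
    proof (rule sum_mono)
      fix k assume k: "k \<in> V"
      define d where "d = real_of_int (U j k) - 2 ^ j * v k"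
      have "d\<^sup>2 \<le> 1" using d1(1)[OF k] by (simp add: d_def abs_square_le_1)
      moreover have "(2 ^ j * v k + d)\<^sup>2 \<le> 2 * (2 ^ j * v k)\<^sup>2 + 2 * d\<^sup>2"
        using zero_le_power2[of "2 ^ j * v k - d"] by (simp add: power2_sum power2_diff)
      ultimately have "(2 ^ j * v k + d)\<^sup>2 \<le> 2 * (2 ^ j * v k)\<^sup>2 + 2" by linarith
      then show "(real_of_int (U j k))\<^sup>2 \<le> 2 * (2 ^ j)\<^sup>2 * (v k)\<^sup>2 + 2" by (simp add: d_def power_mult_distrib)
    qed
    also have "... = 2 * (2 ^ j)\<^sup>2 * n + 2 * n" using assms(5,11) by (simp add: sum.distrib sum_distrib_left[symmetric])
    also have "... \<le> 2 * (2 ^ j)\<^sup>2 * n + 2 * (2 ^ j)\<^sup>2 * n"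
    proof -
      have "(1::real) \<le> (2 ^ j)\<^sup>2" using N by (intro one_le_power) auto
      then have "1 * n \<le> (2 ^ j)\<^sup>2 * n" using assms(6) by (intro mult_right_mono) auto
      then show ?thesis by (simp add: mult_ac)
    qed
    finally show "(\<Sum>k\<in>E. (real_of_int (U j k))\<^sup>2) \<le> 2\<^sup>2 * (real (2 ^ j))\<^sup>2 * n" by (simp add: mult_ac)
    show "(2 ^ l / real (2 ^ j)) ^ (card D + card E) \<le> fM D E T (4 * sqrt n) (\<lambda>v. real_of_int (U j v))"
      using gj by (simp add: good_def f_def cV)
  qed
  moreover have "U i \<in> halves V (U j)" unfolding halves_def
  proof (rule PiE_I)
    fix k assume k: "k \<in> V"
    have "\<bar>real_of_int (U j k) - 2 * real_of_int (U i k)\<bar> \<le> 3" using d1[OF k] by (simp add: ji)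
    then have "real_of_int \<bar>U j k - 2 * U i k\<bar> \<le> real_of_int 3" by simp
    then have "\<bar>U j k - 2 * U i k\<bar> \<le> 3" by (simp only: of_int_le_iff)
    then show "U i k \<in> {(U j k - 3) div 2..(U j k + 3) div 2}" unfolding atLeastAtMost_iff by presburger
  next
    fix k assume "k \<notin> V"
    then show "U i k = undefined" using Ri by (auto simp: PiE_def extensional_def)
  qed
  moreover have "Z i \<in> {- int (2 ^ jm * card V)..int (2 ^ jm * card V)}"
  proof -
    have "\<bar>real_of_int (Z i) - 2 ^ i * \<sigma>\<bar> \<le> 1" using Ri by simp
    moreover have "\<bar>2 ^ i * \<sigma>\<bar> \<le> 2 ^ i * n" using assms(10) by (simp add: abs_mult)
    moreover have "1 \<le> 2 ^ i * n" using assms(6) mult_mono[of 1 "2 ^ i" 1 n] by simp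
    moreover have "2 ^ j * n \<le> 2 ^ jm * n" using jle assms(6) by (intro mult_right_mono power_increasing) auto
    moreover have "2 ^ j * n = 2 ^ i * n + 2 ^ i * n" by (simp add: ji)
    ultimately have "\<bar>real_of_int (Z i)\<bar> \<le> 2 ^ jm * n" by linarith
    then have "real_of_int \<bar>Z i\<bar> \<le> real_of_int (int (2 ^ jm * card V))" using assms(5) by simp
    then have "\<bar>Z i\<bar> \<le> int (2 ^ jm * card V)" by (simp only: of_int_le_iff)
    then show ?thesis by auto
  qed
  moreover have "(\<Sum>k\<in>V. (mv s V (\<lambda>j. real_of_int (U i j)) k - real_of_int (Z i) * w k)\<^sup>2) \<le> n\<^sup>2" using Ri by simp
  ultimately show ?thesis using fi jl jle unfolding f_def by (intro bexI[of _ j] bexI[of _ "U j"] bexI[of _ "U i"] bexI[of _ "Z i"] conjI) auto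
qed

text \<open>Logarithms in units of c n^2: by \<open>fM_lower\<close> the rows cost 1/4 and, as |D|
  \<le> n/16, the columns cost 1/4, against the 1 gained from 2^jm being about e^(c n) in each of n
  coordinates. The surplus 1/2 covers all losses linear in n once c n is large compared with
  l.\<close>

lemma last_scale:
  fixes D E :: "nat set" and l jm T :: nat and c b :: real
  assumes "finite D" "finite E" "D \<inter> E = {}" "n = real (card (D \<union> E))" "n \<ge> 1" "T > 0" "0 < c" "c \<le> 1"
    "2 ^ jm \<le> exp (c * n)" "exp (c * n) \<le> 2 ^ Suc jm" "real (card D) * 16 \<le> n" "7 * n \<le> exp (c * n)" "2 * (l + 4) \<le> c * n"
    "(\<Sum>i\<in>E. \<bar>u i\<bar>) \<le> real (2 * 2 ^ jm * card (D \<union> E))"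
    "exp (- (c / 8 * n)) / 2 \<le> Pr (signs D) (\<lambda>r. \<bar>(\<Sum>j\<in>D. r j * u j) - b\<bar> \<le> 2 * sqrt n)"
  shows "(2 ^ l / 2 ^ jm) ^ card (D \<union> E) \<le> fM D E T (4 * sqrt n) u"
proof -
  let ?nn = "card (D \<union> E)"
  define cc where "cc = 2 * 2 ^ jm * ?nn"
  define g where "g = exp (- (c / 8 * n)) / 2"
  have ehalf: "exp (-1) \<le> (1/2::real)"
  proof -
    have "1 / exp 1 \<le> (1 / 2 :: real)" using exp_ge_add_one_self[of "1::real"] by (intro divide_left_mono) auto
    then show ?thesis by (simp add: exp_minus inverse_eq_divide)
  qed
  have cE: "card E \<le> ?nn" using assms by (intro card_mono) auto
  have "exp (- (c / 8 * n) - 1) \<le> g"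
  proof -
    have "exp (- (c / 8 * n)) * exp (-1) \<le> exp (- (c / 8 * n)) * (1/2)" by (rule mult_left_mono[OF ehalf]) simp
    then show ?thesis unfolding g_def exp_add[symmetric] by simp
  qed
  then have "exp (- (c / 8 * n) - 1) ^ card E \<le> g ^ card E" by (intro power_mono) auto
  moreover have "exp (- (c / 8 * n) - 1) ^ ?nn \<le> exp (- (c / 8 * n) - 1) ^ card E" using assms by (intro power_decreasing cE) auto
  moreover have "exp (- (c / 8 * n) - 1) ^ ?nn = exp (- (c / 8 * n * n) - n)"
    unfolding exp_of_nat_mult[symmetric] assms(4)[symmetric] by (simp add: algebra_simps)
  ultimately have G: "exp (- (c / 8 * n * n) - n) \<le> g ^ card E" by simp
  have "1 \<le> 2 ^ jm * n" using assms(5) mult_mono[of 1 "2 ^ jm" 1 n] by simp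
  then have "real (2 * cc + 3) \<le> 2 ^ jm * (7 * n)" using assms(4) by (simp add: cc_def mult.commute)
  also have "... \<le> exp (c * n) * exp (c * n)" using assms(5,9,12) by (intro mult_mono) auto
  also have "... = exp (2 * c * n)" by (simp add: exp_add[symmetric])
  finally have "real (2 * cc + 3) ^ card D \<le> exp (2 * c * n) ^ card D" by (intro power_mono) auto
  also have "... = exp (real (card D) * (2 * c * n))" by (simp add: exp_of_nat_mult)
  also have "... \<le> exp (c / 8 * n * n)"
  proof -
    have "real (card D) * 16 * (c * n) \<le> n * (c * n)" using assms by (intro mult_right_mono) auto
    then show ?thesis by (simp add: mult_ac)
  qed
  finally have D: "real (2 * cc + 3) ^ card D \<le> exp (c / 8 * n * n)" .
  have "exp (- (c / 4 * n * n) - n) = exp (- (c / 8 * n * n) - n) / exp (c / 8 * n * n)" by (simp add: exp_diff[symmetric] field_simps)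
  also have "... \<le> g ^ card E / real (2 * cc + 3) ^ card D" by (intro frac_le G D) (auto simp: g_def)
  finally have q: "(exp (- (c / 4 * n * n) - n))\<^sup>2 \<le> (g ^ card E / real (2 * cc + 3) ^ card D)\<^sup>2" by (intro power_mono) auto
  have "2 ^ l / 2 ^ jm = 2 ^ Suc l / (2 ^ Suc jm :: real)" by simp
  also have "... \<le> 2 ^ Suc l / exp (c * n)" using assms(10) by (intro divide_left_mono) auto
  also have "... \<le> exp (real (Suc l)) / exp (c * n)"
  proof -
    have "(2::real) ^ Suc l \<le> exp 1 ^ Suc l" using exp_ge_add_one_self[of "1::real"] by (intro power_mono) auto
    also have "... = exp (real (Suc l))" by (simp only: exp_of_nat_mult[symmetric] mult_1_right)
    finally show ?thesis by (intro divide_right_mono) auto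
  qed
  also have "... = exp (real (Suc l) - c * n)" by (simp only: exp_diff)
  also have "... \<le> exp (- (c / 2 * n) - 3)" using assms(13) by simp
  finally have "(2 ^ l / 2 ^ jm) ^ ?nn \<le> exp (- (c / 2 * n) - 3) ^ ?nn" by (intro power_mono) auto
  also have "... = (exp (- (c / 4 * n * n) - n))\<^sup>2 * exp (- 1) ^ ?nn"
    unfolding power2_eq_square exp_of_nat_mult[symmetric] exp_add[symmetric] assms(4)[symmetric] by (simp add: algebra_simps)
  also have "... \<le> (g ^ card E / real (2 * cc + 3) ^ card D)\<^sup>2 * (1/2) ^ ?nn" by (intro mult_mono q power_mono ehalf) auto
  also have "... \<le> fM D E T (4 * sqrt n) u" by (rule fM_lower[OF assms(1-3,5,6)]) (use assms(14,15) in \<open>auto simp: g_def cc_def\<close>)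
  finally show ?thesis .
qed

text \<open>\<open>J\<close> is all of \<open>V\<close> for kernel vectors; when \<open>w\<close> is
  the difference of two columns, \<open>J\<close> consists of the indices on which the columns
  agree.\<close>

definition structured :: "real => nat set => nat set => (nat => real) => (nat \<times> nat => real) => bool" where
  "structured \<gamma> V J w s \<longleftrightarrow> (\<exists>v. (\<exists>i\<in>V. v i \<noteq> 0) \<and> (\<forall>i\<in>V. mv s V v i = w i) \<and>
     (\<exists>b. \<gamma> \<le> Pr (signs J) (\<lambda>r. (\<Sum>j\<in>J. r j * v j) = b)))"

text \<open>The conclusion of \<open>heavy_count\<close> for the parameters of
  \<open>critical_scale\<close>: the box leaves room for rounding entries between 1/40000 and
  80000.\<close>

definition few_heavy :: "real => real => real => nat => bool" where
  "few_heavy C L c n0 \<longleftrightarrow> (\<forall>(D::nat set) E N T n. finite D --> finite E --> D \<inter> E = {} -->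
     n = card D + card E --> n0 \<le> n --> 1 / 2 ^ 36 / 2 * real n \<le> real (card D) --> real (card D) * 2 ^ 36 \<le> real n -->
     1 \<le> N --> real N \<le> exp (c * real n) --> (2 * 2 + 1) * real N * real n \<le> real T -->
     finite (heavy D E (1/80000) 80001 2 N (real n) T L) \<and>
     real (card (heavy D E (1/80000) 80001 2 N (real n) T L)) \<le> (C * real N / L\<^sup>2) ^ n)"

text \<open>The union bound has factors 2^n for \<open>D\<close>, e^n for the scale, (C 2^j / L^2)^n
  for the heavy vector, 4^n for its half, 3 n e^n for the multiple of w, and e^(6n) (2 L / 2^j)^n
  for the small ball. The scale 2^j cancels, leaving 3 n e^(8n) (16 C / L)^n; L = 2^l is taken at
  least 16 C e^10, which makes this at most 3 e^(-n).\<close>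

lemma structured_solution_rare:
  "\<exists>c1>0. \<exists>n0. \<forall>V (w :: nat => real) J. finite V --> n0 \<le> card V --> (\<forall>i\<in>V. w i \<in> {-2, 0, 2}) --> J \<subseteq> V -->
     card (V - J) * 12800000000 \<le> card V -->
     Pr (symm V) (\<lambda>s. structured (exp (- c1 * real (card V))) V J w s) \<le> exp (- (real (card V) / 100))"
proof -
  have "\<exists>C\<ge>1. \<forall>L\<ge>1. \<exists>c>0. \<exists>n0. few_heavy C L c n0" unfolding few_heavy_def by (rule heavy_count) auto
  then obtain C where C: "C \<ge> 1" and hc: "\<And>L. L \<ge> 1 ==> \<exists>c>0. \<exists>n0. few_heavy C L c n0" by blast
  obtain l0 :: nat where l0: "16 * C * exp 10 < 2 ^ l0" using real_arch_pow[of 2 "16 * C * exp 10"] by auto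
  define l where "l = max 17 l0"
  have "(2::real) ^ l0 \<le> 2 ^ l" by (intro power_increasing) (auto simp: l_def)
  then have l: "16 * C * exp 10 \<le> 2 ^ l" "17 \<le> l" using l0 by linarith (simp add: l_def)
  have "(1::real) \<le> 2 ^ l" by simp
  from hc[OF this] obtain c0 n1 where c0: "c0 > 0" and "few_heavy C (2 ^ l) c0 n1" by blast
  note cnt = this(2)[unfolded few_heavy_def, rule_format]
  define c where "c = min c0 1"
  have c: "0 < c" "c \<le> 1" "c \<le> c0" using c0 by (auto simp: c_def)
  \<comment> \<open>From 2^37 on, rounding n / 2^36 down loses at most half. The last two entries
    make c n large compared with l and give 7 n \<le> e^(c n).\<close>
  define n0 where "n0 = Max {n1, 2 ^ 37, nat \<lceil>2 * (real l + 4) / c\<rceil>, nat \<lceil>14 / c\<^sup>2\<rceil>}"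
  have bound: "Pr (symm V) (\<lambda>s. structured (exp (- (c / 8) * real (card V))) V J w s) \<le> exp (- (real (card V) / 100))"
    if fV: "finite V" and n0: "n0 \<le> card V" and w: "\<And>i. i \<in> V ==> w i \<in> {-2, 0, 2}" and J: "J \<subseteq> V" "card (V - J) * 12800000000 \<le> card V"
    for V J and w :: "nat => real"
  proof -
    define n where "n = real (card V)"
    define \<gamma> where "\<gamma> = exp (- (c / 8 * n))"
    have nn: "n1 \<le> card V" "2 ^ 37 \<le> card V" "nat \<lceil>2 * (real l + 4) / c\<rceil> \<le> card V" "nat \<lceil>14 / c\<^sup>2\<rceil> \<le> card V" using n0 by (auto simp: n0_def)
    have n37: "2 ^ 37 \<le> n" using of_nat_mono[OF nn(2), where 'a = real] by (simp add: n_def)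
    have "2 * (real l + 4) / c \<le> n" unfolding n_def using nn(3) by linarith
    then have nl: "2 * (real l + 4) \<le> c * n" using c by (simp add: pos_divide_le_eq mult.commute)
    have n7: "7 * n \<le> exp (c * n)"
    proof -
      have "14 / c\<^sup>2 \<le> n" unfolding n_def using nn(4) by linarith
      then have "14 * n \<le> n * c\<^sup>2 * n" using c n37 by (intro mult_right_mono) (auto simp: pos_divide_le_eq)
      then have "7 * n \<le> (c * n)\<^sup>2 / 2" by (simp add: power2_eq_square mult_ac)
      also have "... \<le> 1 + c * n + (c * n)\<^sup>2 / 2" using c n37 by simp
      also have "... \<le> exp (c * n)" using c n37 by (intro exp_lower_Taylor_quadratic) simp
      finally show ?thesis .
    qed
    have w2: "\<bar>w i\<bar> \<le> 2" if "i \<in> V" for i using w[OF that] by auto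
    obtain jm where jm: "2 ^ jm \<le> exp (c * n)" "exp (c * n) \<le> 2 ^ Suc jm"
    proof -
      define x where "x = nat \<lfloor>exp (c * n)\<rfloor>"
      have x1: "1 \<le> x" using c n37 by (auto simp: x_def le_nat_iff)
      obtain k where k: "2 ^ k \<le> x" "x < 2 ^ (k + 1)" using ex_power_ivl1[of 2 x] x1 by auto
      have "real (2 ^ k) \<le> real x" using k(1) by (simp only: of_nat_le_iff)
      also have "... \<le> exp (c * n)" by (simp add: x_def)
      finally have 1: "2 ^ k \<le> exp (c * n)" by simp
      have "exp (c * n) \<le> real x + 1" unfolding x_def by linarith
      also have "... \<le> real (2 ^ (k + 1))" using k(2) by linarith
      finally show ?thesis using that[of k] 1 by simp
    qed
    have ljm: "l < jm"
    proof -
      have "(2::real) ^ Suc l < 2 ^ Suc jm"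
      proof -
        have "(2::real) ^ Suc l \<le> exp 1 ^ Suc l" using exp_ge_add_one_self[of "1::real"] by (intro power_mono) auto
        also have "... = exp (real (Suc l))" by (simp only: exp_of_nat_mult[symmetric] mult_1_right)
        also have "... < exp (c * n)" using nl by simp
        finally show ?thesis using jm(2) by linarith
      qed
      then show ?thesis by (simp only: power_strict_increasing_iff)
    qed
    \<comment> \<open>5 is 2 \<rho> + 1 at \<rho> = 2; taking the largest scale 2^jm makes one T
      serve all scales.\<close>
    define T where "T = 5 * 2 ^ jm * card V"
    have T0: "T > 0" using nn(2) by (auto simp: T_def intro!: Nat.gr0I)
    define P where "P s \<longleftrightarrow> structured \<gamma> V J w s" for s
    define P1 where "P1 s \<longleftrightarrow> (\<exists>v \<sigma>. (\<Sum>i\<in>V. (v i)\<^sup>2) = n \<and> (\<Sum>i\<in>V. \<bar>v i\<bar>) \<le> n / 20000 \<and> \<bar>\<sigma>\<bar> \<le> n \<and> (\<forall>i\<in>V. mv s V v i = \<sigma> * w i))" for s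
    define Q where "Q u z s \<longleftrightarrow> (\<Sum>i\<in>V. (mv s V (\<lambda>j. real_of_int (u j)) i - real_of_int z * w i)\<^sup>2) \<le> n\<^sup>2" for u :: "nat => int" and z :: int and s
    define Ds where "Ds = {D. D \<subseteq> V \<and> card D = card V div 2 ^ 36}"
    define Hv where "Hv D j = heavy D (V - D) (1/80000) 80001 2 (2 ^ j) n T (2 ^ l)" for D j
    define Us where "Us D j u = {u' \<in> halves V u. fM D (V - D) T (4 * sqrt n) (\<lambda>i. real_of_int (u' i)) \<le> (2 * 2 ^ l / 2 ^ j) ^ card V}" for D j u
    define Zs where "Zs = {- int (2 ^ jm * card V)..int (2 ^ jm * card V)}"
    define P2 where "P2 s \<longleftrightarrow> (\<exists>D\<in>Ds. \<exists>j\<in>{l<..jm}. \<exists>u\<in>Hv D j. \<exists>u'\<in>Us D j u. \<exists>z\<in>Zs. Q u' z s)" for s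
    have DsD: "finite D" "finite (V - D)" "D \<inter> (V - D) = {}" "D \<union> (V - D) = V" "card V = card D + card (V - D)"
      "real (card D) * 2 ^ 36 \<le> n" "1 / 2 ^ 36 / 2 * n \<le> real (card D)" if "D \<in> Ds" for D
    proof -
      show fD: "finite D" "finite (V - D)" "D \<inter> (V - D) = {}" "D \<union> (V - D) = V" using that fV finite_subset by (auto simp: Ds_def)
      show "card V = card D + card (V - D)" using card_Un_disjoint[OF fD(1-3)] fD(4) by simp
      have cD: "card D = card V div 2 ^ 36" using that by (simp add: Ds_def)
      have dm: "a div m * m \<le> a" "a \<le> (a div m + 1) * m" if "m > 0" for a m :: nat
        using div_mult_mod_eq[of a m] mod_less_divisor[OF that, of a] by (linarith, simp only: add_mult_distrib mult_1)
      have "card V div 2 ^ 36 * 2 ^ 36 \<le> card V" "card V \<le> (card V div 2 ^ 36 + 1) * 2 ^ 36" by (rule dm; simp)+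
      then have "real (card D * 2 ^ 36) \<le> n" "n \<le> real ((card D + 1) * 2 ^ 36)" unfolding n_def cD by (simp_all only: of_nat_le_iff)
      then show "real (card D) * 2 ^ 36 \<le> n" "1 / 2 ^ 36 / 2 * n \<le> real (card D)" using n37 by simp_all
    qed
    have imp: "P1 s \<or> P2 s" if s: "s \<in> symm V" and P: "P s" for s
    proof (rule disjCI)
      assume nP1: "\<not> P2 s"
      show "P1 s"
      proof (rule ccontr)
        assume nP: "\<not> P1 s"
        from P obtain v b where "\<exists>i\<in>V. v i \<noteq> 0" "\<And>i. i \<in> V ==> mv s V v i = w i"
          "\<gamma> \<le> Pr (signs J) (\<lambda>r. (\<Sum>j\<in>J. r j * v j) = b)" unfolding P_def structured_def by blast
        from normalise_solution[OF fV n_def s this(1) w this(2,3)]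
        obtain v \<sigma> b where v: "(\<Sum>i\<in>V. (v i)\<^sup>2) = n" "\<bar>\<sigma>\<bar> \<le> n" "\<And>i. i \<in> V ==> mv s V v i = \<sigma> * w i"
          "\<gamma> \<le> Pr (signs J) (\<lambda>r. (\<Sum>j\<in>J. r j * v j) = b)" by blast
        define M where "M = {i\<in>V. 1/20000 / 2 \<le> \<bar>v i\<bar> \<and> \<bar>v i\<bar> \<le> 4 / (1/20000)}"
        have "\<not> (\<Sum>i\<in>V. \<bar>v i\<bar>) \<le> n / 20000" using nP v(1-3) unfolding P1_def by blast
        then have "(1/20000)\<^sup>2 * n / 16 \<le> real (card M)" unfolding M_def using n37 by (intro middle_coordinates[OF fV n_def v(1)]) auto
        then have cM: "n / 6400000000 \<le> real (card M)" by (simp add: power2_eq_square)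
        have "card M \<le> card ((M \<inter> J) \<union> (V - J))" using fV by (intro card_mono) (auto simp: M_def)
        also have "... \<le> card (M \<inter> J) + card (V - J)" by (rule card_Un_le)
        finally have "real (card M) \<le> real (card (M \<inter> J)) + real (card (V - J))" by linarith
        moreover have "real (card (V - J)) * 12800000000 \<le> n" using of_nat_mono[OF J(2), where 'a = real] by (simp add: n_def)
        moreover have "real (card V div 2 ^ 36) * 2 ^ 36 \<le> n"
        proof -
          have "card V div 2 ^ 36 * 2 ^ 36 \<le> card V" by (rule div_times_less_eq_dividend)
          then have "real (card V div 2 ^ 36 * 2 ^ 36) \<le> n" unfolding n_def by (simp only: of_nat_le_iff)
          then show ?thesis by simp
        qed
        \<comment> \<open>6400000000 is 16 * 20000^2, from \<open>middle_coordinates\<close>.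
          Indices outside \<open>J\<close> use up at most half of this bound, and n / 12800000000
          still exceeds n / 2^36.\<close>
        ultimately have "card V div 2 ^ 36 \<le> card (M \<inter> J)" using cM n37 by simp
        then obtain D where D: "D \<subseteq> M \<inter> J" "card D = card V div 2 ^ 36" by (rule obtain_subset_with_card_n) auto
        have DD: "D \<in> Ds" "D \<subseteq> J" using D by (auto simp: Ds_def M_def)
        obtain b' where b': "\<gamma> \<le> Pr (signs D) (\<lambda>r. (\<Sum>j\<in>D. r j * v j) = b')"
          using concentration_restrict[OF finite_subset[OF J(1) fV] DD(2) v(4)] by blast
        have "\<exists>j\<in>{l<..jm}. \<exists>u\<in>heavy D (V - D) (1/80000) 80001 2 (2 ^ j) n T (2 ^ l). \<exists>u'\<in>halves V u.
          \<exists>z\<in>{- int (2 ^ jm * card V)..int (2 ^ jm * card V)}.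
          fM D (V - D) T (4 * sqrt n) (\<lambda>i. real_of_int (u' i)) \<le> (2 * 2 ^ l / 2 ^ j) ^ card V \<and>
          (\<Sum>i\<in>V. (mv s V (\<lambda>j. real_of_int (u' j)) i - real_of_int z * w i)\<^sup>2) \<le> n\<^sup>2"
        proof (rule critical_scale[OF DsD(1-3)[OF DD(1)] DsD(4)[OF DD(1), symmetric] n_def _ w2 s v(3,2,1) _ _ b' l(2) ljm])
          show "2 \<le> n" using n37 by simp
          show "0 < \<gamma>" by (simp add: \<gamma>_def)
          fix j assume "j \<in> D"
          then show "1 / 40000 \<le> \<bar>v j\<bar> \<and> \<bar>v j\<bar> \<le> 80000" using D(1) by (auto simp: M_def)
        next
          fix u b assume u: "(\<Sum>i\<in>V - D. \<bar>u i\<bar>) \<le> real (2 * 2 ^ jm * card V)"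
            "\<gamma> / 2 \<le> Pr (signs D) (\<lambda>r. \<bar>(\<Sum>j\<in>D. r j * u j) - b\<bar> \<le> 2 * sqrt n)"
          have "real (card D) * 16 \<le> n" using DsD(6)[OF DD(1)] by simp
          then have "(2 ^ l / 2 ^ jm) ^ card (D \<union> (V - D)) \<le> fM D (V - D) T (4 * sqrt n) u"
            by (intro last_scale[OF DsD(1-3)[OF DD(1)] _ _ T0 c(1,2) jm _ n7])
              (use n37 nl u DsD(4)[OF DD(1)] in \<open>simp_all add: n_def \<gamma>_def\<close>)
          then show "(2 ^ l / 2 ^ jm) ^ card V \<le> fM D (V - D) T (4 * sqrt n) u" by (simp only: DsD(4)[OF DD(1)])
        qed
        then have "P2 s" using DD(1) unfolding P2_def Hv_def Us_def Zs_def Q_def by blast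
        then show False using nP1 by simp
      qed
    qed
    have "Pr (symm V) P2 \<le> 2 ^ card V * (exp n * ((8 * C / 2 ^ l) ^ card V * (3 * n * exp n * exp (6 * n))))" unfolding P2_def
    proof (rule avg_union)
      show "finite Ds" unfolding Ds_def using fV by simp
      have "card Ds \<le> card (Pow V)" using fV by (intro card_mono) (auto simp: Ds_def)
      then show "real (card Ds) \<le> 2 ^ card V" using of_nat_mono[of "card Ds" "2 ^ card V", where 'a = real] by (simp add: card_Pow fV)
      show "0 \<le> exp n * ((8 * C / 2 ^ l) ^ card V * (3 * n * exp n * exp (6 * n)))" using C n37 by simp
      fix D assume D: "D \<in> Ds"
      show "Pr (symm V) (\<lambda>s. \<exists>j\<in>{l<..jm}. \<exists>u\<in>Hv D j. \<exists>u'\<in>Us D j u. \<exists>z\<in>Zs. Q u' z s)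
         \<le> exp n * ((8 * C / 2 ^ l) ^ card V * (3 * n * exp n * exp (6 * n)))"
      proof (rule avg_union)
        show "0 \<le> (8 * C / 2 ^ l) ^ card V * (3 * n * exp n * exp (6 * n))" using C n37 by simp
        have en: "2 ^ jm \<le> exp n"
        proof -
          have "exp (c * n) \<le> exp n" using c n37 by simp
          then show ?thesis using jm(1) by linarith
        qed
        have "card {l<..jm} \<le> jm" by simp
        then have "real (card {l<..jm}) \<le> real (2 ^ jm)" using less_exp[of jm] by (intro of_nat_mono) linarith
        also have "... \<le> exp n" using en by simp
        finally show "real (card {l<..jm}) \<le> exp n" .
        fix j assume j: "j \<in> {l<..jm}"
        define X where "X = 3 * n * exp n * (exp (6 * n) * (2 * 2 ^ l / 2 ^ j) ^ card V)"
        have X0: "0 \<le> X" using n37 by (simp add: X_def)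
        have "2 ^ j \<le> (2 ^ jm :: real)" using j by (intro power_increasing) auto
        then have jc: "2 ^ j \<le> exp (c * n)" "(2::nat) ^ j \<le> 2 ^ jm" using jm(1) j by (linarith, auto intro!: power_increasing)
        have jc0: "real (2 ^ j) \<le> exp (c0 * real (card V))"
        proof -
          have "exp (c * n) \<le> exp (c0 * n)" using c n37 by simp
          then have "2 ^ j \<le> exp (c0 * n)" using jc(1) by linarith
          then show ?thesis by (simp add: n_def)
        qed
        have "5 * 2 ^ j * card V \<le> T" unfolding T_def using jc(2) by simp
        then have tT: "(2 * 2 + 1) * real (2 ^ j) * real (card V) \<le> real T" using of_nat_mono[of "5 * 2 ^ j * card V" T, where 'a = real] by simp
        note hv = cnt[OF DsD(1-3)[OF D] DsD(5)[OF D] nn(1) DsD(7)[OF D, unfolded n_def] DsD(6)[OF D, unfolded n_def] _ jc0 tT]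
        have "Pr (symm V) (\<lambda>s. \<exists>u\<in>Hv D j. \<exists>u'\<in>Us D j u. \<exists>z\<in>Zs. Q u' z s) \<le> (C * real (2 ^ j) / (2 ^ l)\<^sup>2) ^ card V * (4 ^ card V * X)"
        proof (rule avg_union)
          show "finite (Hv D j)" "real (card (Hv D j)) \<le> (C * real (2 ^ j) / (2 ^ l)\<^sup>2) ^ card V" unfolding Hv_def n_def using hv by auto
          show "0 \<le> 4 ^ card V * X" using X0 by simp
          fix u
          show "Pr (symm V) (\<lambda>s. \<exists>u'\<in>Us D j u. \<exists>z\<in>Zs. Q u' z s) \<le> 4 ^ card V * X"
          proof (rule avg_union)
            show "finite (Us D j u)" using card_halves(1)[OF fV] by (simp add: Us_def)
            have "card (Us D j u) \<le> card (halves V u)" using card_halves(1)[OF fV] by (intro card_mono) (auto simp: Us_def)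
            then show "real (card (Us D j u)) \<le> 4 ^ card V" using of_nat_mono[of "card (Us D j u)" "4 ^ card V", where 'a = real] by (simp add: card_halves(2)[OF fV])
            show "0 \<le> X" by (rule X0)
            fix u' assume u': "u' \<in> Us D j u"
            show "Pr (symm V) (\<lambda>s. \<exists>z\<in>Zs. Q u' z s) \<le> X" unfolding X_def
            proof (rule avg_union)
              show "finite Zs" by (simp add: Zs_def)
              have "1 \<le> 2 ^ jm * n" using n37 mult_mono[of 1 "2 ^ jm" 1 n] by simp
              then have "real (card Zs) \<le> 3 * n * 2 ^ jm" unfolding Zs_def n_def by (simp add: mult_ac)
              also have "... \<le> 3 * n * exp n" using en n37 by (intro mult_left_mono) auto
              finally show "real (card Zs) \<le> 3 * n * exp n" .
              show "0 \<le> exp (6 * n) * (2 * 2 ^ l / 2 ^ j) ^ card V" by simp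
              fix z
              have "Pr (symm (D \<union> (V - D))) (\<lambda>s. (\<Sum>i\<in>D \<union> (V - D). (mv s (D \<union> (V - D)) (\<lambda>j. real_of_int (u' j)) i - real_of_int z * w i)\<^sup>2) \<le> 1\<^sup>2 * n\<^sup>2)
                \<le> exp ((1 + 5) * n) * fM D (V - D) T (4 * sqrt n) (\<lambda>j. real_of_int (u' j))"
                by (rule small_ball_le_fM[OF DsD(1-3)[OF D]]) (use n37 T0 DsD(4)[OF D] in \<open>auto simp: n_def\<close>)
              then have "Pr (symm V) (\<lambda>s. Q u' z s) \<le> exp (6 * n) * fM D (V - D) T (4 * sqrt n) (\<lambda>j. real_of_int (u' j))"
                unfolding DsD(4)[OF D] Q_def by simp
              also have "... \<le> exp (6 * n) * (2 * 2 ^ l / 2 ^ j) ^ card V" using u' by (intro mult_left_mono) (auto simp: Us_def)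
              finally show "Pr (symm V) (\<lambda>s. Q u' z s) \<le> exp (6 * n) * (2 * 2 ^ l / 2 ^ j) ^ card V" .
            qed
          qed
        qed
        also have "... = ((C * real (2 ^ j) / (2 ^ l)\<^sup>2) * 4 * (2 * 2 ^ l / 2 ^ j)) ^ card V * (3 * n * exp n * exp (6 * n))"
          unfolding X_def power_mult_distrib by (simp only: mult_ac)
        also have "(C * real (2 ^ j) / (2 ^ l)\<^sup>2) * 4 * (2 * 2 ^ l / 2 ^ j) = 8 * C / 2 ^ l" by (simp add: power2_eq_square)
        finally show "Pr (symm V) (\<lambda>s. \<exists>u\<in>Hv D j. \<exists>u'\<in>Us D j u. \<exists>z\<in>Zs. Q u' z s)
          \<le> (8 * C / 2 ^ l) ^ card V * (3 * n * exp n * exp (6 * n))" .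
      qed simp
    qed
    also have "... = (16 * C / 2 ^ l) ^ card V * (3 * n * exp (8 * n))"
    proof -
      have "exp (8 * n) = exp n * exp n * exp (6 * n)" unfolding exp_add[symmetric] by simp
      moreover have "(16 * C / 2 ^ l) ^ card V = 2 ^ card V * (8 * C / 2 ^ l) ^ card V" unfolding power_mult_distrib[symmetric] by simp
      ultimately show ?thesis by (simp only: mult_ac)
    qed
    also have "... \<le> exp (- 10) ^ card V * (3 * exp n * exp (8 * n))"
    proof (intro mult_mono power_mono)
      have "16 * C = 16 * C * exp 10 * exp (- 10)" by (simp add: mult.assoc exp_minus_inverse)
      also have "... \<le> 2 ^ l * exp (- 10)" using l(1) by (intro mult_right_mono) auto
      finally show "16 * C / 2 ^ l \<le> exp (- 10)" by (simp add: pos_divide_le_eq mult.commute)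
      show "n \<le> exp n" using exp_ge_add_one_self[of n] by linarith
    qed (use C n37 in auto)
    also have "... = 3 * exp (- n)" unfolding exp_of_nat_mult[symmetric] n_def[symmetric] by (simp add: exp_add[symmetric])
    also have "... \<le> 3 * exp (- n / 50)" using n37 by simp
    finally have b2: "Pr (symm V) P2 \<le> 3 * exp (- n / 50)" .
    have b1: "Pr (symm V) P1 \<le> exp (- n / 50)" unfolding P1_def by (rule compressible[OF fV n_def _ w2]) (use n37 in auto)
    have "Pr (symm V) P \<le> avg (symm V) (\<lambda>s. of_bool (P1 s) + of_bool (P2 s) :: real)"
      by (rule avg_mono) (use imp in \<open>auto simp: of_bool_def\<close>)
    also have "... \<le> 4 * exp (- n / 50)" unfolding avg_add using b1 b2 by linarith
    also have "... \<le> exp (n / 100) * exp (- n / 50)"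
    proof (rule mult_right_mono)
      have "300 \<le> n" using n37 by simp
      then show "4 \<le> exp (n / 100)" using exp_ge_add_one_self[of "n / 100"] by linarith
    qed simp
    also have "... = exp (- (n / 100))" unfolding exp_add[symmetric] by simp
    finally show ?thesis unfolding P_def n_def \<gamma>_def by simp
  qed
  show ?thesis by (rule exI[of _ "c / 8"], rule conjI, use c in simp, rule exI[of _ n0]) (use bound in blast)
qed

section \<open>Reduction to structured kernel vectors\<close>

definition joinf :: "'a set => 'a set => ('a => real) => ('a => real) => 'a => real" where
  "joinf I J y z = (\<lambda>x\<in>I \<union> J. if x \<in> I then y x else z x)"

lemma avg_signs_Un:
  assumes "I \<inter> J = {}"
  shows "avg (signs (I \<union> J)) F = avg (signs I) (\<lambda>y. avg (signs J) (\<lambda>z. F (joinf I J y z)))"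
proof -
  have b: "bij_betw (\<lambda>p. joinf I J (fst p) (snd p)) (signs I \<times> signs J) (signs (I \<union> J))"
  proof (rule bij_betwI[where g = "\<lambda>h. (restrict h I, restrict h J)"])
    show "(\<lambda>p. joinf I J (fst p) (snd p)) \<in> signs I \<times> signs J \<rightarrow> signs (I \<union> J)"
    proof
      fix p assume p: "p \<in> signs I \<times> signs J"
      have "(if x \<in> I then fst p x else snd p x) \<in> pm1" if "x \<in> I \<union> J" for x
        using p that PiE_mem[of "fst p" I "\<lambda>_. pm1" x] PiE_mem[of "snd p" J "\<lambda>_. pm1" x] by auto
      then show "joinf I J (fst p) (snd p) \<in> signs (I \<union> J)" unfolding joinf_def by (intro restrict_PiE_iff[THEN iffD2]) blast
    qed
    show "(\<lambda>h. (restrict h I, restrict h J)) \<in> signs (I \<union> J) \<rightarrow> signs I \<times> signs J" by (auto dest: PiE_mem)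
  next
    fix p assume p: "p \<in> signs I \<times> signs J"
    have "restrict (joinf I J (fst p) (snd p)) I = fst p" using p by (intro ext) (auto simp: joinf_def restrict_def PiE_def extensional_def)
    moreover have "restrict (joinf I J (fst p) (snd p)) J = snd p"
      using p assms by (intro ext) (auto simp: joinf_def restrict_def PiE_def extensional_def)
    ultimately show "(restrict (joinf I J (fst p) (snd p)) I, restrict (joinf I J (fst p) (snd p)) J) = p" by simp
  next
    fix h assume "h \<in> signs (I \<union> J)"
    then show "joinf I J (fst (restrict h I, restrict h J)) (snd (restrict h I, restrict h J)) = h"
      by (intro ext) (auto simp: joinf_def restrict_def PiE_def extensional_def)
  qed
  have "avg (signs (I \<union> J)) F = avg (signs I \<times> signs J) (\<lambda>p. F (joinf I J (fst p) (snd p)))" by (rule avg_reindex[OF b, symmetric])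
  then show ?thesis by (simp add: avg_def card_cartesian_product sum.cartesian_product' sum_divide_distrib[symmetric] mult.commute)
qed

lemma mv_ent_cong: "i \<in> W ==> (\<And>x. x \<in> prs W ==> s x = s' x) ==> mv s W v i = mv s' W v i"
  by (simp add: mv_def ent_def prs_mem)

lemma avg_symm_restrict:
  assumes "finite V" "W \<subseteq> V" "\<And>s s'. (\<And>x. x \<in> prs W ==> s x = s' x) ==> F s = F s'"
  shows "avg (symm V) F = avg (symm W) F"
proof -
  have V: "prs V = prs W \<union> (prs V - prs W)" using assms(2) by (auto simp: prs_def)
  have fin: "finite (prs V - prs W)" using finite_prs[OF assms(1)] by simp
  have "avg (symm V) F = avg (signs (prs W)) (\<lambda>y. avg (signs (prs V - prs W)) (\<lambda>z. F (joinf (prs W) (prs V - prs W) y z)))"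
    by (subst V, subst avg_signs_Un) auto
  also have "... = avg (signs (prs W)) (\<lambda>y. avg (signs (prs V - prs W)) (\<lambda>z. F y))" by (intro avg_cong refl assms(3)) (simp add: joinf_def)
  also have "... = avg (signs (prs W)) F" by (simp only: avg_const[OF finite_signs[OF fin] signs_nonempty])
  finally show ?thesis .
qed

definition rowev :: "nat set => nat set => real => (nat \<times> nat => real) => bool" where
  "rowev C I \<gamma> s \<longleftrightarrow> (\<exists>k. (\<forall>x. (\<forall>a\<in>C. mv s C x a = 0) --> (\<exists>t. \<forall>c\<in>C. x c = t * k c)) \<and>
     (\<forall>a\<in>C \<union> I. mv s C k a = 0) \<and> (\<forall>b. Pr (signs C) (\<lambda>r. (\<Sum>c\<in>C. r c * k c) = b) \<le> \<gamma>))"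

text \<open>The line \<open>\<real>k\<close> is determined by the block on \<open>C\<close>, hence independent of the rows in \<open>I\<close>.\<close>

lemma rowev_prob:
  assumes "finite C" "finite I" "C \<inter> I = {}" "0 \<le> \<gamma>"
  shows "Pr (symm (C \<union> I)) (\<lambda>s. rowev C I \<gamma> s) \<le> \<gamma> ^ card I"
proof (subst avg_twist[OF assms(1,2)], rule avg_le)
  show "finite (symm (C \<union> I))" "symm (C \<union> I) \<noteq> {}" using symm_fin[of "C \<union> I"] assms(1,2) by auto
  fix s assume s: "s \<in> symm (C \<union> I)"
  have blk: "mv (twist C I s H) C x a = mv s C x a" if "a \<in> C" for H x a
    unfolding mv_def using that assms(3) by (intro sum.cong refl) (subst ent_twist[OF assms(3)], auto)
  have row: "mv (twist C I s H) C x a = (\<Sum>c\<in>C. H a c * (ent s a c * x c))" if "a \<in> I" for H x a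
    unfolding mv_def using that assms(3) by (intro sum.cong refl) (subst ent_twist[OF assms(3)], auto simp: mult_ac)
  show "Pr (BM C I) (\<lambda>H. rowev C I \<gamma> (twist C I s H)) \<le> \<gamma> ^ card I"
  proof (cases "\<exists>H. rowev C I \<gamma> (twist C I s H)")
    case False
    then have "Pr (BM C I) (\<lambda>H. rowev C I \<gamma> (twist C I s H)) = avg (BM C I) (\<lambda>H. 0)" by simp
    also have "... = 0" by (simp add: avg_def)
    finally show ?thesis using assms(4) by simp
  next
    case True
    then obtain H0 k0 where k0: "\<forall>a\<in>C \<union> I. mv (twist C I s H0) C k0 a = 0"
      "\<And>b. Pr (signs C) (\<lambda>r. (\<Sum>c\<in>C. r c * k0 c) = b) \<le> \<gamma>" unfolding rowev_def by blast
    have k0C: "mv s C k0 a = 0" if "a \<in> C" for a using k0(1) that blk by (metis UnI1)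
    \<comment> \<open>\<open>k0\<close> comes from a reference matrix with the same block on
      \<open>C\<close>. For any other admissible matrix k spans the same line or a larger multiple
      set containing \<open>k0\<close>, so its rows in \<open>I\<close> annihilate
      \<open>k0\<close>, a vector that no longer depends on them.\<close>
    have "of_bool (rowev C I \<gamma> (twist C I s H)) \<le> (\<Prod>a\<in>I. of_bool ((\<Sum>c\<in>C. H a c * (ent s a c * k0 c)) = 0) :: real)" for H
    proof (cases "rowev C I \<gamma> (twist C I s H)")
      case True
      then obtain k where k: "\<And>x. (\<forall>a\<in>C. mv (twist C I s H) C x a = 0) ==> \<exists>t. \<forall>c\<in>C. x c = t * k c"
        "\<And>a. a \<in> C \<union> I ==> mv (twist C I s H) C k a = 0" unfolding rowev_def by blast
      have "\<exists>t. \<forall>c\<in>C. k0 c = t * k c" by (rule k(1)) (simp add: blk k0C)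
      then obtain t where t: "\<And>c. c \<in> C ==> k0 c = t * k c" by blast
      have "(\<Sum>c\<in>C. H a c * (ent s a c * k0 c)) = 0" if a: "a \<in> I" for a
      proof -
        have "(\<Sum>c\<in>C. H a c * (ent s a c * k0 c)) = mv (twist C I s H) C (\<lambda>c. t * k c) a"
          unfolding row[OF a, symmetric] by (rule mv_cong) (rule t)
        also have "... = 0" unfolding mv_scale using k(2)[of a] a by simp
        finally show ?thesis .
      qed
      then show ?thesis by simp
    qed (simp add: prod_nonneg)
    then have "Pr (BM C I) (\<lambda>H. rowev C I \<gamma> (twist C I s H))
      \<le> avg (BM C I) (\<lambda>H. \<Prod>a\<in>I. of_bool ((\<Sum>c\<in>C. H a c * (ent s a c * k0 c)) = 0) :: real)" by (rule avg_mono)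
    also have "... = (\<Prod>a\<in>I. Pr (signs C) (\<lambda>h. (\<Sum>c\<in>C. h c * (ent s a c * k0 c)) = 0))"
      by (rule avg_PiE_prod[OF assms(2) finite_signs[OF assms(1)]])
    also have "... \<le> (\<Prod>a\<in>I. \<gamma>)"
    proof (rule prod_mono, intro conjI)
      fix a assume a: "a \<in> I"
      show "0 \<le> Pr (signs C) (\<lambda>h. (\<Sum>c\<in>C. h c * (ent s a c * k0 c)) = 0)" by (rule avg_nonneg) simp
      have "Pr (signs C) (\<lambda>h. (\<Sum>c\<in>C. h c * (ent s a c * k0 c)) = 0)
        = Pr (signs C) (\<lambda>h. (\<Sum>c\<in>C. (\<lambda>x\<in>C. h x * ent s a x) c * k0 c) = 0)"
        by (intro avg_cong refl) (simp add: mult_ac)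
      also have "... = Pr (signs C) (\<lambda>h. (\<Sum>c\<in>C. h c * k0 c) = 0)"
        using ent_pm[OF s] a by (intro avg_sign_twist[where G = "\<lambda>h. of_bool ((\<Sum>c\<in>C. h c * k0 c) = 0)"]) blast
      also have "... \<le> \<gamma>" by (rule k0(2))
      finally show "Pr (signs C) (\<lambda>h. (\<Sum>c\<in>C. h c * (ent s a c * k0 c)) = 0) \<le> \<gamma>" .
    qed
    finally show ?thesis by simp
  qed
qed

text \<open>The minor on \<open>W\<close> is nonsingular and its Schur complement vanishes: with a
  the part of column i on \<open>W\<close>, the number a^T A^(-1) a equals the diagonal entry at
  i.\<close>

definition colev :: "nat set => nat => (nat \<times> nat => real) => bool" where
  "colev W i s \<longleftrightarrow> (\<forall>x. (\<forall>a\<in>W. mv s W x a = 0) --> (\<forall>a\<in>W. x a = 0)) \<and>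
     (\<exists>v. (\<forall>a\<in>W. mv s W v a = ent s i a) \<and> (\<Sum>a\<in>W. ent s i a * v a) = ent s i i)"

lemma mv_extend:
  assumes "finite V" "C \<subseteq> V" "\<And>a. a \<in> V - C ==> x a = 0"
  shows "mv s V x a = mv s C x a"
  unfolding mv_def using assms by (intro sum.mono_neutral_right) auto

text \<open>If the kernel has dimension at least two, split off all but one of the coordinates of a minimal
  set \<open>I\<close> that determines kernel vectors; if it has dimension one, split off that one coordinate.\<close>

lemma singular_cases:
  assumes fV: "finite V" and "\<exists>i\<in>V. v0 i \<noteq> 0" "\<And>i. i \<in> V ==> mv s V v0 i = 0"
    and uns: "\<And>v b. \<exists>i\<in>V. v i \<noteq> 0 ==> (\<And>i. i \<in> V ==> mv s V v i = 0) ==>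
      Pr (signs V) (\<lambda>r. (\<Sum>j\<in>V. r j * v j) = b) \<le> \<gamma>"
  shows "(\<exists>I\<in>Pow V - {{}}. rowev (V - I) I \<gamma> s) \<or> (\<exists>i\<in>V. colev (V - {i}) i s)"
proof -
  define K where "K v \<longleftrightarrow> (\<forall>i\<in>V. mv s V v i = 0)" for v
  \<comment> \<open>Sets of coordinates that determine kernel vectors; the least size of such a set
    is the corank.\<close>
  define Good where "Good I \<longleftrightarrow> I \<subseteq> V \<and> (\<forall>v. K v --> (\<forall>i\<in>I. v i = 0) --> (\<forall>i\<in>V. v i = 0))" for I
  have "Good V" by (simp add: Good_def)
  from ex_has_least_nat[of Good V card, OF this]
  obtain I where I: "Good I" "\<And>I'. Good I' ==> card I \<le> card I'" by blast
  have IV: "I \<subseteq> V" and fI: "finite I" using I(1) fV finite_subset by (auto simp: Good_def)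
  have Idet: "v i = 0" if "K v" "\<And>i. i \<in> I ==> v i = 0" "i \<in> V" for v i using I(1) that unfolding Good_def by blast
  have I0: "I \<noteq> {}" using Idet[of v0] assms(2,3) by (auto simp: K_def)
  \<comment> \<open>Minimality provides a dual basis of the kernel: for each i in \<open>I\<close> a
    kernel vector that vanishes on the rest of \<open>I\<close> but not at i.\<close>
  have "\<exists>k. K k \<and> (\<forall>j\<in>I - {i}. k j = 0) \<and> k i \<noteq> 0" if i: "i \<in> I" for i
  proof -
    have "card (I - {i}) < card I" using i fI by (intro psubset_card_mono) auto
    then have "\<not> Good (I - {i})" using I(2)[of "I - {i}"] by linarith
    then obtain k where k: "K k" "\<forall>j\<in>I - {i}. k j = 0" "\<exists>j\<in>V. k j \<noteq> 0" using IV unfolding Good_def by blast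
    have "k i \<noteq> 0" using Idet[of k] k by (metis Diff_iff singletonD)
    then show ?thesis using k by blast
  qed
  then obtain kk where kk: "\<And>i. i \<in> I ==> K (kk i)" "\<And>i j. i \<in> I ==> j \<in> I ==> j \<noteq> i ==> kk i j = 0" "\<And>i. i \<in> I ==> kk i i \<noteq> 0"
    by (metis Diff_iff singletonD)
  \<comment> \<open>The rows in \<open>X\<close> impose nothing new on vectors supported off
    \<open>X\<close>. By symmetry the kernel vector \<open>kk j\<close> pairs to zero with the image
    of such a vector, and only the term at j can survive in that pairing.\<close>
  have ext: "K (\<lambda>a. if a \<in> V - X then x a else 0)" if X: "X \<subseteq> I" and x: "\<And>a. a \<in> V - X ==> mv s (V - X) x a = 0" for X x
  proof -
    define x' where "x' a = (if a \<in> V - X then x a else 0)" for a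
    have e: "mv s V x' a = mv s (V - X) x a" for a
      using mv_extend[OF fV, of "V - X" x' s a] mv_cong[of "V - X" x' x s a] by (auto simp: x'_def)
    have "mv s V x' j = 0" if j: "j \<in> X" for j
    proof -
      have jI: "j \<in> I" "j \<in> V" using j X IV by auto
      have "(\<Sum>a\<in>V. kk j a * mv s V x' a) = (\<Sum>a\<in>V. x' a * mv s V (kk j) a)" by (rule mv_self_adjoint)
      also have "... = 0" using kk(1)[OF jI(1)] by (simp add: K_def)
      also have "(\<Sum>a\<in>V. kk j a * mv s V x' a) = (\<Sum>a\<in>{j}. kk j a * mv s V x' a)"
      proof (rule sum.mono_neutral_right[OF fV])
        show "\<forall>a\<in>V - {j}. kk j a * mv s V x' a = 0"
        proof
          fix a assume a: "a \<in> V - {j}"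
          show "kk j a * mv s V x' a = 0" using a x[of a] kk(2)[OF jI(1), of a] X by (cases "a \<in> X") (auto simp: e)
        qed
      qed (use jI in auto)
      finally show ?thesis using kk(3)[OF jI(1)] by simp
    qed
    moreover have "mv s V x' j = 0" if "j \<in> V - X" for j using x[OF that] e by simp
    ultimately show ?thesis unfolding K_def x'_def by blast
  qed
  obtain i where i: "i \<in> I" using I0 by blast
  have iV: "i \<in> V" using i IV by blast
  define X where "X = I - {i}"
  have XV: "X \<subseteq> V" "X \<subseteq> I" using IV by (auto simp: X_def)
  show ?thesis
  proof (cases "X = {}")
    case False
    define C where "C = V - X"
    have mk: "mv s C (kk i) a = mv s V (kk i) a" for a using mv_extend[OF fV, of C "kk i" s a] kk(2)[OF i] XV by (auto simp: C_def X_def)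
    have "rowev C X \<gamma> s" unfolding rowev_def
    proof (intro exI[of _ "kk i"] conjI allI impI ballI)
      fix x assume x: "\<forall>a\<in>C. mv s C x a = 0"
      define x' where "x' a = (if a \<in> V - X then x a else 0)" for a
      define t where "t = x i / kk i i"
      have "K x'" unfolding x'_def using x XV(2) by (intro ext) (auto simp: C_def)
      then have "K (\<lambda>a. x' a - t * kk i a)" using kk(1)[OF i] by (simp add: K_def mv_diff mv_scale)
      moreover have "x' a - t * kk i a = 0" if a: "a \<in> I" for a
        using kk(2)[OF i a] kk(3)[OF i] a iV by (cases "a = i") (auto simp: x'_def t_def X_def)
      ultimately have z: "x' a - t * kk i a = 0" if "a \<in> V" for a using Idet[of "\<lambda>a. x' a - t * kk i a" a] that by blast
      show "\<exists>t. \<forall>c\<in>C. x c = t * kk i c"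
      proof (intro exI[of _ t] ballI)
        fix c assume "c \<in> C"
        then show "x c = t * kk i c" using z[of c] by (simp add: x'_def C_def)
      qed
    next
      fix a assume "a \<in> C \<union> X"
      then show "mv s C (kk i) a = 0" unfolding mk using kk(1)[OF i] XV by (auto simp: K_def C_def)
    next
      fix b
      have V: "V = C \<union> X" "C \<inter> X = {}" using XV by (auto simp: C_def)
      have fX: "finite X" "finite C" using fI fV by (auto simp: X_def C_def)
      have "Pr (signs V) (\<lambda>r. (\<Sum>j\<in>V. r j * kk i j) = b)
        = avg (signs C) (\<lambda>y. Pr (signs X) (\<lambda>z. (\<Sum>j\<in>C \<union> X. joinf C X y z j * kk i j) = b))"
        unfolding V(1) by (rule avg_signs_Un[OF V(2)])
      also have "... = avg (signs C) (\<lambda>y. Pr (signs X) (\<lambda>z. (\<Sum>j\<in>C. y j * kk i j) = b))"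
      proof (intro avg_cong refl)
        fix y z
        have "(\<Sum>j\<in>C \<union> X. joinf C X y z j * kk i j) = (\<Sum>j\<in>C. joinf C X y z j * kk i j)"
          using fX kk(2)[OF i] by (intro sum.mono_neutral_right) (auto simp: X_def)
        also have "... = (\<Sum>j\<in>C. y j * kk i j)" by (intro sum.cong refl) (simp add: joinf_def)
        finally show "of_bool ((\<Sum>j\<in>C \<union> X. joinf C X y z j * kk i j) = b) = (of_bool ((\<Sum>j\<in>C. y j * kk i j) = b) :: real)" by simp
      qed
      also have "... = Pr (signs C) (\<lambda>y. (\<Sum>j\<in>C. y j * kk i j) = b)" by (simp only: avg_const[OF finite_signs[OF fX(1)] signs_nonempty])
      finally show "Pr (signs C) (\<lambda>r. (\<Sum>c\<in>C. r c * kk i c) = b) \<le> \<gamma>" using uns[of "kk i" b] kk(1,3)[OF i] iV by (auto simp: K_def)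
    qed
    then show ?thesis using False XV by (auto simp: C_def)
  next
    case True
    then have Ii: "I = {i}" using i by (auto simp: X_def)
    let ?W = "V - {i}"
    define k where "k = kk i"
    have k: "K k" "k i \<noteq> 0" using kk(1,3)[OF i] by (auto simp: k_def)
    have sp: "mv s V k a = ent s a i * k i + mv s ?W k a" for a unfolding mv_def by (rule sum.remove[OF fV iV])
    have "colev ?W i s" unfolding colev_def
    proof (intro conjI allI impI exI[of _ "\<lambda>a. (- 1 / k i) * k a"] ballI)
      fix x a assume x: "\<forall>a\<in>?W. mv s ?W x a = 0" and a: "a \<in> ?W"
      have "K (\<lambda>a. if a \<in> V - {i} then x a else 0)" using x Ii by (intro ext) auto
      then show "x a = 0" using Idet[of "\<lambda>a. if a \<in> V - {i} then x a else 0" a] a Ii by auto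
    next
      fix a assume a: "a \<in> ?W"
      have "ent s a i * k i + mv s ?W k a = 0" using k(1) a unfolding sp[symmetric] K_def by simp
      then show "mv s ?W (\<lambda>a. (- 1 / k i) * k a) a = ent s i a" unfolding mv_scale using k(2) by (simp add: ent_sym[of s i a] field_simps)
    next
      have "ent s i i * k i + mv s ?W k i = 0" using k(1) iV unfolding sp[symmetric] K_def by simp
      then have "mv s ?W (\<lambda>a. (- 1 / k i) * k a) i = ent s i i" unfolding mv_scale using k(2) by (simp add: field_simps)
      then show "(\<Sum>a\<in>?W. ent s i a * (- 1 / k i * k a)) = ent s i i" by (simp add: mv_def)
    qed
    then show ?thesis using iV by blast
  qed
qed

lemma avg_rotate:
  "avg S (\<lambda>s. avg Z (\<lambda>z. avg Y (\<lambda>y. f s z y))) = avg Y (\<lambda>y. avg S (\<lambda>s. avg Z (\<lambda>z. f s z y)))"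
proof -
  have "avg Z (\<lambda>z. avg Y (\<lambda>y. f s z y)) = avg Y (\<lambda>y. avg Z (\<lambda>z. f s z y))" for s by (rule avg_swap)
  then show ?thesis by (simp only:) (rule avg_swap)
qed

text \<open>Two solutions \<open>v\<^sub>1, v\<^sub>2\<close> for columns that agree on \<open>J\<close> differ by a solution \<open>v\<close> whose right-hand side lives
  off \<open>J\<close>; since the block is symmetric, \<open>\<langle>x\<^sub>1 + x\<^sub>2, v\<rangle> = 0\<close>, a linear condition on the common part of the columns.\<close>

lemma colev_prob:
  fixes V I0 :: "nat set" and \<gamma> p :: real
  assumes fV: "finite V" and iV: "i \<in> V" and W: "W = V - {i}" and I0: "I0 \<subseteq> W" and J0: "J0 = W - I0" and "0 \<le> \<gamma>" "0 \<le> p"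
    and str: "\<And>w. (\<And>a. a \<in> W ==> w a \<in> {-2, 0, 2}) ==>
      Pr (symm W) (\<lambda>s. structured \<gamma> W J0 w s) \<le> p"
  shows "(Pr (symm V) (\<lambda>s. colev W i s))\<^sup>2 \<le> (1/2) ^ card I0 + p + \<gamma>"
proof -
  have fW: "finite W" and VW: "V = W \<union> {i}" "W \<inter> {i} = {}" using fV iV W by auto
  have fIJ: "finite I0" "finite J0" "I0 \<inter> J0 = {}" "W = I0 \<union> J0" using fW I0 J0 finite_subset by auto
  define inj where "inj s \<longleftrightarrow> (\<forall>x. (\<forall>a\<in>W. mv s W x a = 0) --> (\<forall>a\<in>W. x a = 0))" for s
  define phi where "phi s x \<longleftrightarrow> inj s \<and> (\<exists>v. (\<forall>a\<in>W. mv s W v a = x a) \<and> (\<Sum>a\<in>W. x a * v a) = ent s i i)" for s x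
  define F where "F s h = (of_bool (phi s h) :: real)" for s h
  let ?F2 = "\<lambda>s y y' z. F s (joinf I0 J0 y z) * F s (joinf I0 J0 y' z)"
  have "Pr (symm V) (\<lambda>s. colev W i s) = avg (symm V) (\<lambda>s. Pr (BM W {i}) (\<lambda>H. colev W i (twist W {i} s H)) :: real)"
    unfolding VW(1) by (rule avg_twist[OF fW]) simp
  also have "... = avg (symm V) (\<lambda>s. avg (signs W) (F s))"
  proof (intro avg_cong refl)
    fix s assume s: "s \<in> symm V"
    have m: "mv (twist W {i} s H) W x a = mv s W x a" if "a \<in> W" for H x a
      unfolding mv_def using that VW(2) by (intro sum.cong refl) (subst ent_twist[OF VW(2)], auto)
    have c: "ent (twist W {i} s H) i a = ent s i a * H i a" if "a \<in> W" for H a using that VW(2) by (subst ent_twist[OF VW(2)]) auto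
    have d: "ent (twist W {i} s H) i i = ent s i i" for H using VW(2) by (subst ent_twist[OF VW(2)]) auto
    define G where "G h = (of_bool (phi s (\<lambda>a\<in>W. h a * ent s i a)) :: real)" for h
    have "of_bool (colev W i (twist W {i} s H)) = G (H i)" for H
    proof -
      have "colev W i (twist W {i} s H) = phi s (\<lambda>a\<in>W. H i a * ent s i a)"
        unfolding colev_def phi_def inj_def d using VW(2) by (simp add: m c mult_ac cong: ball_cong sum.cong)
      then show ?thesis by (simp add: G_def)
    qed
    then have "Pr (BM W {i}) (\<lambda>H. colev W i (twist W {i} s H)) = avg (BM W {i}) (\<lambda>H. \<Prod>j\<in>{i}. G (H j))" by simp
    also have "... = (\<Prod>j\<in>{i}. avg (signs W) G)" using finite_signs[OF fW] by (intro avg_PiE_prod) auto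
    also have "... = avg (signs W) G" by simp
    also have "... = avg (signs W) (F s)" unfolding G_def F_def
      using ent_pm[OF s iV] W by (intro avg_sign_twist[where G = "\<lambda>h. of_bool (phi s h)"]) blast
    finally show "Pr (BM W {i}) (\<lambda>H. colev W i (twist W {i} s H)) = avg (signs W) (F s)" .
  qed
  finally have e1: "Pr (symm V) (\<lambda>s. colev W i s) = avg (symm V) (\<lambda>s. avg (signs W) (F s))" .
  have e2: "avg (signs W) (F s) = avg (signs J0) (\<lambda>z. avg (signs I0) (\<lambda>y. F s (joinf I0 J0 y z)))" for s
    unfolding fIJ(4) avg_signs_Un[OF fIJ(3)] by (rule avg_swap)
  \<comment> \<open>Cauchy-Schwarz over the matrix and then over the part z of the column on
    \<open>J0\<close>; expanding the square yields two columns with independent parts y, y' on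
    \<open>I0\<close> and the same z.\<close>
  have "(avg (symm V) (\<lambda>s. avg (signs W) (F s)))\<^sup>2 \<le> avg (symm V) (\<lambda>s. (avg (signs W) (F s))\<^sup>2)" by (rule avg_square_le[OF symm_fin(1)[OF fV]])
  also have "... \<le> avg (symm V) (\<lambda>s. avg (signs J0) (\<lambda>z. (avg (signs I0) (\<lambda>y. F s (joinf I0 J0 y z)))\<^sup>2))"
    unfolding e2 by (rule avg_mono) (rule avg_square_le[OF finite_signs[OF fIJ(2)]])
  also have "... = avg (symm V) (\<lambda>s. avg (signs J0) (\<lambda>z. avg (signs I0) (\<lambda>y. avg (signs I0) (\<lambda>y'. ?F2 s y y' z))))"
    by (simp only: power2_eq_square avg_prod2)
  also have "... = avg (signs I0) (\<lambda>y. avg (symm V) (\<lambda>s. avg (signs J0) (\<lambda>z. avg (signs I0) (\<lambda>y'. ?F2 s y y' z))))" by (rule avg_rotate)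
  also have "... = avg (signs I0) (\<lambda>y. avg (signs I0) (\<lambda>y'. avg (symm V) (\<lambda>s. avg (signs J0) (\<lambda>z. ?F2 s y y' z))))"
    by (intro avg_cong refl avg_rotate)
  also have "... \<le> avg (signs I0) (\<lambda>y. avg (signs I0) (\<lambda>y'. of_bool (y = y') + (p + \<gamma>)))"
  proof (rule avg_mono, rule avg_mono)
    fix y y' assume y: "y \<in> signs I0" "y' \<in> signs I0"
    show "avg (symm V) (\<lambda>s. avg (signs J0) (\<lambda>z. ?F2 s y y' z)) \<le> of_bool (y = y') + (p + \<gamma>)"
    proof (cases "y = y'")
      case True
      have "avg (symm V) (\<lambda>s. avg (signs J0) (\<lambda>z. ?F2 s y y' z)) \<le> 1" by (rule avg_le0, rule avg_le0) (auto simp: F_def)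
      then show ?thesis using True assms(6,7) by simp
    next
      case False
      define w where "w a = (if a \<in> I0 then y a - y' a else 0)" for a
      have wv: "w a \<in> {-2, 0, 2}" for a using PiE_mem[OF y(1), of a] PiE_mem[OF y(2), of a] by (auto simp: w_def)
      have w0: "\<exists>a\<in>W. w a \<noteq> 0"
      proof (rule ccontr)
        assume "\<not> ?thesis"
        then have "w a = 0" if "a \<in> I0" for a using that I0 by blast
        then have "y a = y' a" if "a \<in> I0" for a using that by (fastforce simp: w_def)
        then have "y = y'" using y by (intro PiE_ext[OF y])
        then show False using False by simp
      qed
      have "avg (signs J0) (\<lambda>z. ?F2 s y y' z) \<le> of_bool (structured \<gamma> W J0 w s) + \<gamma>" for s
      proof (cases "structured \<gamma> W J0 w s")
        case True
        have "avg (signs J0) (\<lambda>z. ?F2 s y y' z) \<le> 1" by (rule avg_le0) (auto simp: F_def)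
        then show ?thesis using True assms(6) by simp
      next
        case nstr: False
        define two where "two z \<longleftrightarrow> phi s (joinf I0 J0 y z) \<and> phi s (joinf I0 J0 y' z)" for z
        have FF: "?F2 s y y' z = of_bool (two z)" for z by (simp add: F_def two_def)
        have sol: "\<exists>v. (\<forall>a\<in>W. mv s W v a = w a) \<and> (\<Sum>j\<in>J0. z j * v j) = - (\<Sum>a\<in>I0. (y a + y' a) * v a) / 2" if z: "two z" for z
        proof -
          let ?x1 = "joinf I0 J0 y z" and ?x2 = "joinf I0 J0 y' z"
          obtain v1 v2 where v: "\<And>a. a \<in> W ==> mv s W v1 a = ?x1 a" "(\<Sum>a\<in>W. ?x1 a * v1 a) = ent s i i"
            "\<And>a. a \<in> W ==> mv s W v2 a = ?x2 a" "(\<Sum>a\<in>W. ?x2 a * v2 a) = ent s i i"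
            using z unfolding two_def phi_def by blast
          define v where "v a = v1 a - v2 a" for a
          have 1: "mv s W v a = w a" if "a \<in> W" for a
            unfolding v_def mv_diff using v(1,3)[OF that] that fIJ(4) by (auto simp: w_def joinf_def)
          have "(\<Sum>a\<in>W. ?x2 a * v1 a) = (\<Sum>a\<in>W. v1 a * mv s W v2 a)" using v(3) by (intro sum.cong refl) simp
          also have "... = (\<Sum>a\<in>W. v2 a * mv s W v1 a)" by (rule mv_self_adjoint)
          also have "... = (\<Sum>a\<in>W. ?x1 a * v2 a)" using v(1) by (intro sum.cong refl) simp
          finally have "(\<Sum>a\<in>W. (?x1 a + ?x2 a) * v a) = 0" using v(2,4) by (simp add: v_def algebra_simps sum.distrib sum_subtractf)
          moreover have "(\<Sum>a\<in>W. (?x1 a + ?x2 a) * v a) = (\<Sum>a\<in>I0. (?x1 a + ?x2 a) * v a) + (\<Sum>a\<in>J0. (?x1 a + ?x2 a) * v a)"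
            unfolding fIJ(4) by (rule sum.union_disjoint[OF fIJ(1-3)])
          moreover have "(\<Sum>a\<in>I0. (?x1 a + ?x2 a) * v a) = (\<Sum>a\<in>I0. (y a + y' a) * v a)" by (intro sum.cong refl) (simp add: joinf_def)
          moreover have "(\<Sum>a\<in>J0. (?x1 a + ?x2 a) * v a) = 2 * (\<Sum>a\<in>J0. z a * v a)"
            unfolding sum_distrib_left using fIJ(3) by (intro sum.cong refl) (auto simp: joinf_def)
          ultimately have "(\<Sum>j\<in>J0. z j * v j) = - (\<Sum>a\<in>I0. (y a + y' a) * v a) / 2" by linarith
          then show ?thesis using 1 by blast
        qed
        show ?thesis
        proof (cases "\<exists>z. two z")
          case False
          then show ?thesis using assms(6) nstr unfolding FF by (simp add: avg_def)
        next
          case True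
          then obtain z0 v0 where z0: "two z0" "\<And>a. a \<in> W ==> mv s W v0 a = w a" using sol by blast
          define b where "b = - (\<Sum>a\<in>I0. (y a + y' a) * v0 a) / 2"
          have "inj s" using z0(1) by (simp add: two_def phi_def)
          \<comment> \<open>As the minor is nonsingular, the solution for w is unique. All
            admissible z hence satisfy one and the same linear equation with coefficients
            \<open>v0\<close>, whose probability is below \<gamma> for an unstructured
            \<open>v0\<close>.\<close>
          have imp: "(\<Sum>j\<in>J0. z j * v0 j) = b" if z: "two z" for z
          proof -
            from sol[OF z] obtain v where v: "\<And>a. a \<in> W ==> mv s W v a = w a"
              "(\<Sum>j\<in>J0. z j * v j) = - (\<Sum>a\<in>I0. (y a + y' a) * v a) / 2" by blast
            have "\<forall>a\<in>W. mv s W (\<lambda>a. v a - v0 a) a = 0" unfolding mv_diff using v(1) z0(2) by simp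
            then have "\<forall>a\<in>W. v a - v0 a = 0" using \<open>inj s\<close> unfolding inj_def by (elim allE impE)
            then have e: "v a = v0 a" if "a \<in> W" for a using that by simp
            have "(\<Sum>j\<in>J0. z j * v j) = (\<Sum>j\<in>J0. z j * v0 j)" "(\<Sum>a\<in>I0. (y a + y' a) * v a) = (\<Sum>a\<in>I0. (y a + y' a) * v0 a)"
              using e fIJ(4) by (auto intro!: sum.cong)
            then show ?thesis using v(2) by (simp add: b_def)
          qed
          have "\<exists>a\<in>W. v0 a \<noteq> 0"
          proof (rule ccontr)
            assume "\<not> ?thesis"
            then have "mv s W v0 a = 0" for a unfolding mv_def by (intro sum.neutral) auto
            then show False using w0 z0(2) by force
          qed
          then have "\<not> \<gamma> \<le> Pr (signs J0) (\<lambda>r. (\<Sum>j\<in>J0. r j * v0 j) = b)" using nstr z0(2) unfolding structured_def by blast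
          moreover have "Pr (signs J0) two \<le> (Pr (signs J0) (\<lambda>r. (\<Sum>j\<in>J0. r j * v0 j) = b) :: real)" by (rule avg_imp) (rule imp)
          ultimately show ?thesis unfolding FF by simp
        qed
      qed
      then have "avg (symm V) (\<lambda>s. avg (signs J0) (\<lambda>z. ?F2 s y y' z)) \<le> avg (symm V) (\<lambda>s. of_bool (structured \<gamma> W J0 w s) + \<gamma>)"
        by (rule avg_mono)
      also have "... = Pr (symm V) (\<lambda>s. structured \<gamma> W J0 w s) + \<gamma>" by (simp only: avg_add avg_const[OF symm_fin(1)[OF fV] symm_fin(2)])
      also have "Pr (symm V) (\<lambda>s. structured \<gamma> W J0 w s) = Pr (symm W) (\<lambda>s. structured \<gamma> W J0 w s)"
      proof (rule avg_symm_restrict[OF fV])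
        show "W \<subseteq> V" using W by blast
        fix s s' :: "nat \<times> nat => real" assume "\<And>x. x \<in> prs W ==> s x = s' x"
        then have "mv s W v a = mv s' W v a" if "a \<in> W" for v a using mv_ent_cong[OF that] by blast
        then show "of_bool (structured \<gamma> W J0 w s) = (of_bool (structured \<gamma> W J0 w s') :: real)" by (simp add: structured_def cong: ball_cong)
      qed
      also have "... \<le> p" by (rule str) (rule wv)
      finally show ?thesis using False by simp
    qed
  qed
  also have "... = avg (signs I0) (\<lambda>y. (1/2) ^ card I0 + (p + \<gamma>))"
  proof (intro avg_cong refl)
    fix y :: "nat => real" assume y: "y \<in> signs I0"
    have "{x \<in> signs I0. y = x} = {y}" using y by auto
    then have "Pr (signs I0) (\<lambda>y'. y = y') = (1/2) ^ card I0"
      by (simp add: avg_of_bool[OF finite_signs[OF fIJ(1)]] card_signs[OF fIJ(1)] power_divide)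
    then show "avg (signs I0) (\<lambda>y'. of_bool (y = y') + (p + \<gamma>)) = (1/2) ^ card I0 + (p + \<gamma>)"
      by (simp only: avg_add[of _ "\<lambda>y'. of_bool (y = y')" "\<lambda>_. p + \<gamma>"] avg_const[OF finite_signs[OF fIJ(1)] signs_nonempty])
  qed
  also have "... = (1/2) ^ card I0 + p + \<gamma>" by (simp add: finite_signs[OF fIJ(1)] signs_nonempty)
  finally show ?thesis unfolding e1 .
qed

section \<open>Combining the cases in large dimension\<close>

definition sing :: "nat set => (nat \<times> nat => real) => bool" where
  "sing V s \<longleftrightarrow> (\<exists>v. (\<exists>i\<in>V. v i \<noteq> 0) \<and> (\<forall>i\<in>V. mv s V v i = 0))"

lemma sum_Pow_power:
  assumes "finite V"
  shows "(\<Sum>I\<in>Pow V - {{}}. (\<gamma>::real) ^ card I) = (1 + \<gamma>) ^ card V - 1"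
proof -
  have "(\<Sum>I\<in>Pow V. \<gamma> ^ card I) = (1 + \<gamma>) ^ card V" using assms
  proof (induction V rule: finite_induct)
    case (insert x V)
    have "(\<Sum>I\<in>insert x ` Pow V. \<gamma> ^ card I) = (\<Sum>I\<in>Pow V. \<gamma> * \<gamma> ^ card I)"
    proof (rule sum.reindex_cong[of "insert x"])
      show "inj_on (insert x) (Pow V)" using insert.hyps by (auto simp: inj_on_def)
      fix I assume "I \<in> Pow V"
      then have "finite I" "x \<notin> I" using insert.hyps finite_subset by auto
      then show "\<gamma> ^ card (insert x I) = \<gamma> * \<gamma> ^ card I" by simp
    qed simp
    moreover have "(\<Sum>I\<in>Pow (insert x V). \<gamma> ^ card I) = (\<Sum>I\<in>Pow V. \<gamma> ^ card I) + (\<Sum>I\<in>insert x ` Pow V. \<gamma> ^ card I)"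
      unfolding Pow_insert using insert.hyps by (intro sum.union_disjoint) auto
    ultimately show ?case using insert by (simp add: sum_distrib_left[symmetric] distrib_right)
  qed simp
  then show ?thesis using assms by (simp add: sum_diff1)
qed

text \<open>For corank at least two the 2^n choices of \<open>I\<close> are harmless, since
  \<gamma>^|I| summed over nonempty sets is (1 + \<gamma>)^n - 1 \<le> 2 n \<gamma>. For corank one
  the set \<open>I0\<close> must be proportional to n, so that 2^(-|I0|) is exponentially small, yet
  not exceed the share 1/12800000000 that \<open>structured_solution_rare\<close> tolerates outside
  \<open>J\<close>.\<close>

lemma singular_rare:
  "\<exists>\<theta>>0. \<exists>n0. \<forall>V. finite V --> n0 \<le> card V --> Pr (symm V) (\<lambda>s. sing V s) \<le> exp (- \<theta> * real (card V))"
proof -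
  obtain c1 n1 where c1: "c1 > 0" and S0: "\<forall>V (w :: nat => real) J. finite V --> n1 \<le> card V --> (\<forall>i\<in>V. w i \<in> {-2, 0, 2}) --> J \<subseteq> V -->
     card (V - J) * 12800000000 \<le> card V -->
     Pr (symm V) (\<lambda>s. structured (exp (- c1 * real (card V))) V J w s) \<le> exp (- (real (card V) / 100))"
    using structured_solution_rare by (elim exE conjE) (rule that)
  note S = S0[rule_format]
  \<comment> \<open>Half of the density of \<open>I0\<close>, because (1/2)^m is estimated by
    e^(-m/2).\<close>
  define \<theta> where "\<theta> = min c1 (1 / 25600000000)"
  have \<theta>: "0 < \<theta>" "\<theta> \<le> c1" "\<theta> \<le> 1 / 25600000000" using c1 by (auto simp: \<theta>_def)
  \<comment> \<open>224 is 7 * 32, which gives 7 n \<le> (\<theta> n / 4)^2 / 2; the 1 added to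
    \<open>n1\<close> allows for minors of size n - 1.\<close>
  define n0 where "n0 = max (n1 + 1) (nat \<lceil>224 / \<theta>\<^sup>2\<rceil>)"
  have "Pr (symm V) (\<lambda>s. sing V s) \<le> exp (- (\<theta> / 4) * real (card V))" if fV: "finite V" and big: "n0 \<le> card V" for V
  proof -
    define n where "n = real (card V)"
    have nn: "n1 + 1 \<le> card V" "nat \<lceil>224 / \<theta>\<^sup>2\<rceil> \<le> card V" using big by (auto simp: n0_def)
    have n1: "1 \<le> n" using nn(1) by (simp add: n_def)
    have n7: "7 * n \<le> exp (\<theta> / 4 * n)"
    proof -
      have "224 / \<theta>\<^sup>2 \<le> n" unfolding n_def using nn(2) by linarith
      then have "224 * n \<le> n * \<theta>\<^sup>2 * n" using \<theta> n1 by (intro mult_right_mono) (auto simp: pos_divide_le_eq)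
      then have "7 * n \<le> (\<theta> / 4 * n)\<^sup>2 / 2" by (simp add: power2_eq_square mult_ac)
      also have "... \<le> 1 + \<theta> / 4 * n + (\<theta> / 4 * n)\<^sup>2 / 2" using \<theta> n1 by simp
      also have "... \<le> exp (\<theta> / 4 * n)" using \<theta> n1 by (intro exp_lower_Taylor_quadratic) simp
      finally show ?thesis .
    qed
    define \<gamma> where "\<gamma> = exp (- c1 * n)"
    define str where "str s \<longleftrightarrow> structured \<gamma> V V (\<lambda>_. 0) s" for s
    define rows where "rows s \<longleftrightarrow> (\<exists>I\<in>Pow V - {{}}. rowev (V - I) I \<gamma> s)" for s
    define cols where "cols s \<longleftrightarrow> (\<exists>i\<in>V. colev (V - {i}) i s)" for s
    have cover: "str s \<or> rows s \<or> cols s" if "sing V s" for s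
    proof (cases "str s")
      case False
      from that obtain v0 where v0: "\<exists>i\<in>V. v0 i \<noteq> 0" "\<And>i. i \<in> V ==> mv s V v0 i = 0" unfolding sing_def by blast
      have "Pr (signs V) (\<lambda>r. (\<Sum>j\<in>V. r j * v j) = b) \<le> \<gamma>" if "\<exists>i\<in>V. v i \<noteq> 0" "\<And>i. i \<in> V ==> mv s V v i = 0" for v b
        using False that unfolding str_def structured_def by (meson linear)
      from singular_cases[OF fV v0 this] show ?thesis unfolding rows_def cols_def by blast
    qed simp
    have "Pr (symm V) (\<lambda>s. sing V s) \<le> avg (symm V) (\<lambda>s. of_bool (str s) + of_bool (rows s) + of_bool (cols s))"
      by (rule avg_mono) (use cover in \<open>auto simp: of_bool_def\<close>)
    also have "... = Pr (symm V) str + Pr (symm V) rows + Pr (symm V) cols" by (simp only: avg_add)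
    also have "... \<le> exp (- (n / 100)) + ((1 + \<gamma>) ^ card V - 1) + n * (4 * exp (- \<theta> / 2 * n))"
    proof (intro add_mono)
      show "Pr (symm V) str \<le> exp (- (n / 100))" unfolding str_def \<gamma>_def n_def by (rule S[OF fV, of "\<lambda>_. 0" V]) (use nn in auto)
      have "Pr (symm V) rows \<le> (\<Sum>I\<in>Pow V - {{}}. Pr (symm V) (\<lambda>s. rowev (V - I) I \<gamma> s) :: real)"
        unfolding rows_def by (rule avg_union_sum) (use fV in simp)
      also have "... \<le> (\<Sum>I\<in>Pow V - {{}}. \<gamma> ^ card I)"
      proof (rule sum_mono)
        fix I assume "I \<in> Pow V - {{}}"
        then have I: "finite (V - I)" "finite I" "(V - I) \<inter> I = {}" "(V - I) \<union> I = V" using fV finite_subset by auto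
        show "Pr (symm V) (\<lambda>s. rowev (V - I) I \<gamma> s) \<le> \<gamma> ^ card I" using rowev_prob[OF I(1-3), of \<gamma>] unfolding I(4) by (simp add: \<gamma>_def)
      qed
      also have "... = (1 + \<gamma>) ^ card V - 1" by (rule sum_Pow_power[OF fV])
      finally show "Pr (symm V) rows \<le> (1 + \<gamma>) ^ card V - 1" .
      show "Pr (symm V) cols \<le> n * (4 * exp (- \<theta> / 2 * n))" unfolding cols_def
      proof (rule avg_union[OF fV])
        show "real (card V) \<le> n" by (simp add: n_def)
        fix i assume i: "i \<in> V"
        define W where "W = V - {i}"
        define m where "m = card W div 12800000000"
        have fW: "finite W" and cW: "real (card W) = n - 1" "n1 \<le> card W" using fV i nn(1) by (auto simp: W_def n_def card_Diff_singleton of_nat_diff)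
        have "m \<le> card W" by (simp add: m_def)
        then obtain I0 where I0: "I0 \<subseteq> W" "card I0 = m" by (rule obtain_subset_with_card_n)
        define J0 where "J0 = W - I0"
        define N where "N = n - 1"
        have N0: "0 \<le> N" using n1 by (simp add: N_def)
        have WJ: "W - J0 = I0" using I0 by (auto simp: J0_def)
        have cm: "m * 12800000000 \<le> card W" "card W < (m + 1) * 12800000000" unfolding m_def by simp_all
        have "(Pr (symm V) (\<lambda>s. colev W i s))\<^sup>2 \<le> (1/2) ^ card I0 + exp (- (N / 100)) + exp (- c1 * N)"
        proof (rule colev_prob[OF fV i W_def I0(1) J0_def])
          fix w :: "nat => real" assume "\<And>a. a \<in> W ==> w a \<in> {-2, 0, 2}"
          then show "Pr (symm W) (\<lambda>s. structured (exp (- c1 * N)) W J0 w s) \<le> exp (- (N / 100))"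
            unfolding N_def cW(1)[symmetric] by (rule S[OF fW cW(2)]) (use WJ I0(2) cm in \<open>auto simp: J0_def\<close>)
        qed auto
        also have "... \<le> 2 * exp (- \<theta> * N) + exp (- \<theta> * N) + exp (- \<theta> * N)"
        proof (intro add_mono)
          \<comment> \<open>One more factor 1/2 compensates for rounding down in \<open>m\<close>;
            it reappears as the 2 in front of the exponential.\<close>
          have "(1/2 :: real) ^ Suc m \<le> exp (- (1/2)) ^ Suc m" using exp_ge_add_one_self[of "- (1/2)::real"] by (intro power_mono) auto
          also have "... = exp (real (Suc m) * (- (1/2)))" by (simp only: exp_of_nat_mult)
          also have "... \<le> exp (- \<theta> * N)"
          proof -
            have "real (card W) \<le> (real m + 1) * 12800000000" using of_nat_mono[OF less_imp_le[OF cm(2)], where 'a = real] by simp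
            then have "N \<le> (real m + 1) * 12800000000" by (simp add: cW N_def)
            moreover have "\<theta> * N \<le> 1 / 25600000000 * N" using \<theta>(3) N0 by (rule mult_right_mono)
            ultimately show ?thesis by simp
          qed
          finally show "(1/2) ^ card I0 \<le> 2 * exp (- \<theta> * N)" using I0(2) by simp
          have "\<theta> * N \<le> 1 / 100 * N" using \<theta>(3) N0 by (intro mult_right_mono) auto
          then show "exp (- (N / 100)) \<le> exp (- \<theta> * N)" by simp
          show "exp (- c1 * N) \<le> exp (- \<theta> * N)" using mult_right_mono[OF \<theta>(2) N0] by simp
        qed
        also have "... = (2 * exp (- \<theta> / 2 * N))\<^sup>2" by (simp add: power2_eq_square exp_add[symmetric])
        finally have "Pr (symm V) (\<lambda>s. colev W i s) \<le> 2 * exp (- \<theta> / 2 * N)" by (rule power2_le_imp_le) simp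
        also have "exp (- \<theta> / 2 * N) = exp (\<theta> / 2) * exp (- \<theta> / 2 * n)" unfolding exp_add[symmetric] N_def by (simp add: field_simps)
        also have "2 * (exp (\<theta> / 2) * exp (- \<theta> / 2 * n)) \<le> 2 * (2 * exp (- \<theta> / 2 * n))"
        proof (intro mult_left_mono mult_right_mono)
          have "exp (\<theta> / 2) \<le> exp (1/2)" using \<theta>(3) by simp
          also have "exp (1/2) \<le> (2::real)"
          proof -
            have "exp (1/2) * (1/2) \<le> exp (1/2) * exp (- (1/2) :: real)" using exp_ge_add_one_self[of "- (1/2)::real"] by (intro mult_left_mono) auto
            then show ?thesis unfolding exp_minus_inverse by simp
          qed
          finally show "exp (\<theta> / 2) \<le> 2" .
        qed auto
        finally show "Pr (symm V) (\<lambda>s. colev (V - {i}) i s) \<le> 4 * exp (- \<theta> / 2 * n)" by (simp add: W_def)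
      qed simp
    qed
    also have "... \<le> n * exp (- \<theta> / 2 * n) + 2 * n * exp (- \<theta> / 2 * n) + n * (4 * exp (- \<theta> / 2 * n))"
    proof (intro add_mono order_refl)
      have "\<theta> / 2 * n \<le> 1 / 100 * n" using \<theta>(3) n1 by (intro mult_right_mono) auto
      then have "exp (- (n / 100)) \<le> 1 * exp (- \<theta> / 2 * n)" by simp
      also have "... \<le> n * exp (- \<theta> / 2 * n)" using n1 by (intro mult_right_mono) auto
      finally show "exp (- (n / 100)) \<le> n * exp (- \<theta> / 2 * n)" .
      define x where "x = n * \<gamma>"
      have g: "\<gamma> \<le> exp (- \<theta> / 2 * n)"
      proof -
        have "\<theta> / 2 * n \<le> c1 * n" using \<theta> n1 by (intro mult_right_mono) auto
        then show ?thesis by (simp add: \<gamma>_def)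
      qed
      have "exp (- \<theta> / 2 * n) \<le> exp (- (\<theta> / 4 * n))" using \<theta> n1 by simp
      then have "\<gamma> \<le> exp (- (\<theta> / 4 * n))" using g by linarith
      then have "x \<le> n * exp (- (\<theta> / 4 * n))" using n1 unfolding x_def by (intro mult_left_mono) auto
      moreover have "7 * n * exp (- (\<theta> / 4 * n)) \<le> exp (\<theta> / 4 * n) * exp (- (\<theta> / 4 * n))" using n7 by (rule mult_right_mono) simp
      ultimately have x12: "x \<le> 1/2" unfolding exp_minus_inverse mult.assoc by linarith
      have "0 \<le> x" using n1 by (simp add: x_def \<gamma>_def)
      note x = this x12
      have "(1 + \<gamma>) ^ card V \<le> exp \<gamma> ^ card V" using exp_ge_add_one_self[of \<gamma>] by (intro power_mono) (auto simp: \<gamma>_def)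
      also have "... = exp x" by (simp only: exp_of_nat_mult[symmetric] n_def[symmetric] x_def)
      also have "exp x \<le> 1 + 2 * x"
      proof -
        have "exp x * (1 - x) \<le> exp x * exp (- x)" using exp_ge_add_one_self[of "- x"] by (intro mult_left_mono) auto
        also have "... = 1" by (rule exp_minus_inverse)
        also have "1 \<le> (1 + 2 * x) * (1 - x)" using mult_left_mono[OF x(2,1)] by (simp add: algebra_simps)
        finally show ?thesis by (rule mult_right_le_imp_le) (use x in simp)
      qed
      finally have "(1 + \<gamma>) ^ card V - 1 \<le> 2 * n * \<gamma>" by (simp add: x_def)
      also have "... \<le> 2 * n * exp (- \<theta> / 2 * n)" using g n1 by (intro mult_left_mono) auto
      finally show "(1 + \<gamma>) ^ card V - 1 \<le> 2 * n * exp (- \<theta> / 2 * n)" .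
    qed
    also have "... = 7 * n * exp (- \<theta> / 2 * n)" by (simp add: algebra_simps)
    also have "... \<le> exp (\<theta> / 4 * n) * exp (- \<theta> / 2 * n)" using n7 by (rule mult_right_mono) simp
    also have "... = exp (- (\<theta> / 4) * n)" unfolding exp_add[symmetric] by (simp add: algebra_simps)
    finally show ?thesis by (simp add: n_def)
  qed
  then show ?thesis using \<theta>(1) by (intro exI[of _ "\<theta> / 4"] conjI exI[of _ n0]) auto
qed

section \<open>Transfer to integer determinants, and small dimensions\<close>

definition sign_mat :: "nat => (nat \<times> nat => real) => int mat" where
  "sign_mat n s = mat n n (\<lambda>(i, j). if ent s i j = 1 then 1 else - 1)"

lemma sign_mat_bij: "bij_betw (sign_mat n) (symm {..<n}) (sym_sign_mats n)"
proof (rule bij_betwI[where g = "\<lambda>A. \<lambda>x\<in>prs {..<n}. real_of_int (A $$ x)"])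
  show "sign_mat n \<in> symm {..<n} \<rightarrow> sym_sign_mats n" by (auto simp: sym_sign_mats_def sign_mat_def ent_sym intro!: eq_matI)
  show "(\<lambda>A. \<lambda>x\<in>prs {..<n}. real_of_int (A $$ x)) \<in> sym_sign_mats n \<rightarrow> symm {..<n}" by (force simp: sym_sign_mats_def prs_def)
next
  fix s assume s: "s \<in> symm {..<n}"
  show "(\<lambda>x\<in>prs {..<n}. real_of_int (sign_mat n s $$ x)) = s"
  proof (rule PiE_ext[OF _ s])
    show "(\<lambda>x\<in>prs {..<n}. real_of_int (sign_mat n s $$ x)) \<in> symm {..<n}" by (auto simp: sign_mat_def prs_def split: if_splits)
    fix x assume x: "x \<in> prs {..<n}"
    then have "s x \<in> pm1" using s by (rule PiE_mem[rotated])
    then show "(\<lambda>x\<in>prs {..<n}. real_of_int (sign_mat n s $$ x)) x = s x" using x by (auto simp: prs_def sign_mat_def ent_def)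
  qed
next
  fix A assume A: "A \<in> sym_sign_mats n"
  then have c: "A \<in> carrier_mat n n" and e: "\<And>i j. i < n ==> j < n ==> A $$ (i, j) \<in> {-1, 1}" and t: "transpose_mat A = A"
    by (auto simp: sym_sign_mats_def)
  show "sign_mat n (\<lambda>x\<in>prs {..<n}. real_of_int (A $$ x)) = A"
  proof (rule eq_matI)
    fix i j assume "i < dim_row A" "j < dim_col A"
    then have ij: "i < n" "j < n" using c by auto
    have "A $$ (min i j, max i j) = A $$ (i, j)"
    proof (cases "i \<le> j")
      case False
      have "A $$ (j, i) = transpose_mat A $$ (i, j)" using ij c by (subst index_transpose_mat) auto
      then show ?thesis using False t by (simp add: min_def max_def)
    qed (simp add: min_def max_def)
    then have "ent (\<lambda>x\<in>prs {..<n}. real_of_int (A $$ x)) i j = real_of_int (A $$ (i, j))"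
      using prs_mem[of i "{..<n}" j] ij by (simp add: ent_def)
    then show "sign_mat n (\<lambda>x\<in>prs {..<n}. real_of_int (A $$ x)) $$ (i, j) = A $$ (i, j)" using ij e[OF ij] by (auto simp: sign_mat_def)
  qed (use c in \<open>auto simp: sign_mat_def\<close>)
qed

lemma det_sign_mat:
  assumes s: "s \<in> symm {..<n}"
  shows "det (sign_mat n s) = 0 \<longleftrightarrow> sing {..<n} s"
proof -
  define A where "A = mat n n (\<lambda>(i, j). ent s i j)"
  have A: "A \<in> carrier_mat n n" by (simp add: A_def)
  have "map_mat real_of_int (sign_mat n s) = A"
  proof (rule eq_matI)
    fix i j assume "i < dim_row A" "j < dim_col A"
    then have "i < n" "j < n" by (auto simp: A_def)
    then show "map_mat real_of_int (sign_mat n s) $$ (i, j) = A $$ (i, j)" using ent_pm[OF s, of i j] by (auto simp: sign_mat_def A_def)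
  qed (auto simp: A_def sign_mat_def)
  then have "det A = real_of_int (det (sign_mat n s))" using of_int_hom.hom_det[of "sign_mat n s", where 'a = real] by simp
  then have "det (sign_mat n s) = 0 \<longleftrightarrow> det A = 0" by simp
  also have "... \<longleftrightarrow> (\<exists>v. v \<in> carrier_vec n \<and> v \<noteq> 0\<^sub>v n \<and> A *\<^sub>v v = 0\<^sub>v n)" by (rule det_0_iff_vec_prod_zero[OF A])
  also have "... \<longleftrightarrow> sing {..<n} s"
  proof
    assume "\<exists>v. v \<in> carrier_vec n \<and> v \<noteq> 0\<^sub>v n \<and> A *\<^sub>v v = 0\<^sub>v n"
    then obtain v where v: "v \<in> carrier_vec n" "v \<noteq> 0\<^sub>v n" "A *\<^sub>v v = 0\<^sub>v n" by blast
    have "\<exists>i\<in>{..<n}. v $ i \<noteq> 0"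
    proof (rule ccontr)
      assume "\<not> ?thesis"
      then have "v = 0\<^sub>v n" using v(1) by (intro eq_vecI) auto
      then show False using v(2) by simp
    qed
    moreover have "mv s {..<n} (\<lambda>i. v $ i) i = 0" if "i \<in> {..<n}" for i
    proof -
      have "(A *\<^sub>v v) $ i = mv s {..<n} (\<lambda>i. v $ i) i"
        using that v(1) by (auto simp: A_def mv_def scalar_prod_def lessThan_atLeast0 intro!: sum.cong)
      then show ?thesis using v(3) that by simp
    qed
    ultimately show "sing {..<n} s" unfolding sing_def by blast
  next
    assume "sing {..<n} s"
    then obtain u where u: "\<exists>i\<in>{..<n}. u i \<noteq> 0" "\<And>i. i \<in> {..<n} ==> mv s {..<n} u i = 0" unfolding sing_def by blast
    define v where "v = vec n u"
    have "(A *\<^sub>v v) $ i = mv s {..<n} u i" if "i < n" for i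
      using that by (auto simp: A_def v_def mv_def scalar_prod_def lessThan_atLeast0 intro!: sum.cong)
    then have "A *\<^sub>v v = 0\<^sub>v n" using u(2) A by (intro eq_vecI) auto
    moreover have "v \<noteq> 0\<^sub>v n" using u(1) by (auto simp: v_def vec_eq_iff)
    moreover have "v \<in> carrier_vec n" by (simp add: v_def)
    ultimately show "\<exists>v. v \<in> carrier_vec n \<and> v \<noteq> 0\<^sub>v n \<and> A *\<^sub>v v = 0\<^sub>v n" by blast
  qed
  finally show ?thesis .
qed

lemma prob_singular_eq: "prob_singular n = Pr (symm {..<n}) (\<lambda>s. sing {..<n} s)"
proof -
  have "finite (sym_sign_mats n)" using bij_betw_finite[OF sign_mat_bij] symm_fin(1)[of "{..<n}"] by simp
  then have "prob_singular n = Pr (sym_sign_mats n) (\<lambda>A. det A = 0)" by (simp add: prob_singular_def avg_of_bool)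
  also have "... = Pr (symm {..<n}) (\<lambda>s. det (sign_mat n s) = 0)" by (rule avg_reindex[OF sign_mat_bij, symmetric])
  also have "... = Pr (symm {..<n}) (\<lambda>s. sing {..<n} s)" by (intro avg_cong refl) (simp add: det_sign_mat)
  finally show ?thesis .
qed

text \<open>One nonsingular matrix is enough: all entries 1 except for -1 on the diagonal after the
  first place. Comparing each row with the first makes every later coordinate of a kernel vector
  vanish, and then the first one too. This serves the finitely many dimensions below the asymptotic
  range.\<close>

lemma prob_singular_less_1: "prob_singular n \<le> 1 - 1 / 2 ^ (n * n)"
proof -
  let ?V = "{..<n}"
  have fin: "finite (symm ?V)" using symm_fin(1)[of ?V] by simp
  define s where "s = (\<lambda>x\<in>prs ?V. if fst x = snd x \<and> fst x \<noteq> 0 then - 1 else 1 :: real)"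
  have sS: "s \<in> symm ?V" by (auto simp: s_def)
  have "\<not> sing ?V s"
  proof
    assume "sing ?V s"
    then obtain v where v: "\<exists>i\<in>?V. v i \<noteq> 0" "\<And>i. i \<in> ?V ==> mv s ?V v i = 0" unfolding sing_def by blast
    define S where "S = (\<Sum>j\<in>?V. v j)"
    have e: "mv s ?V v i = S - (if i \<noteq> 0 then 2 * v i else 0)" if i: "i \<in> ?V" for i
    proof -
      have "mv s ?V v i = (\<Sum>j\<in>?V. v j - (if j = i then (if i \<noteq> 0 then 2 * v i else 0) else 0))" unfolding mv_def
      proof (rule sum.cong[OF refl])
        fix j assume "j \<in> ?V"
        then show "ent s i j * v j = v j - (if j = i then (if i \<noteq> 0 then 2 * v i else 0) else 0)"
          using i prs_mem[of i ?V j] by (auto simp: ent_def s_def min_def max_def)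
      qed
      also have "... = S - (if i \<noteq> 0 then 2 * v i else 0)" using i by (simp add: sum_subtractf S_def)
      finally show ?thesis .
    qed
    from v(1) have "0 \<in> ?V" by auto
    then have S0: "S = 0" using e[of 0] v(2)[of 0] by simp
    then have z: "v i = 0" if "i \<in> ?V" "i \<noteq> 0" for i using e[of i] v(2)[of i] that by simp
    have "S = v 0 + (\<Sum>j\<in>?V - {0}. v j)" unfolding S_def by (rule sum.remove) (use \<open>0 \<in> ?V\<close> in auto)
    also have "(\<Sum>j\<in>?V - {0}. v j) = 0" using z by (intro sum.neutral) auto
    finally have "v 0 = 0" using S0 by simp
    then show False using v(1) z by metis
  qed
  then have "{s \<in> symm ?V. sing ?V s} \<subset> symm ?V" using sS by blast
  then have "card {s \<in> symm ?V. sing ?V s} < card (symm ?V)" using fin by (intro psubset_card_mono)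
  then have "real (card {s \<in> symm ?V. sing ?V s}) \<le> real (card (symm ?V)) - 1" by linarith
  moreover have c0: "0 < real (card (symm ?V))" using fin symm_fin(2)[of ?V] by (simp add: card_gt_0_iff)
  ultimately have "prob_singular n \<le> (real (card (symm ?V)) - 1) / real (card (symm ?V))"
    unfolding prob_singular_eq avg_of_bool[OF fin] by (intro divide_right_mono) auto
  also have "... = 1 - 1 / real (card (symm ?V))" using c0 by (simp add: diff_divide_distrib)
  also have "... \<le> 1 - 1 / 2 ^ (n * n)"
  proof -
    have "card (prs ?V) \<le> card (?V \<times> ?V)" by (intro card_mono) (auto simp: prs_def)
    then have "(2::real) ^ card (prs ?V) \<le> 2 ^ (n * n)" by (intro power_increasing) (auto simp: card_cartesian_product)
    moreover have "real (card (symm ?V)) = 2 ^ card (prs ?V)" using card_signs[OF finite_prs[of ?V]] by simp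
    ultimately have "real (card (symm ?V)) \<le> 2 ^ (n * n)" by simp
    then show ?thesis using c0 by (simp add: frac_le)
  qed
  finally show ?thesis .
qed

theorem theorem1p1:
  shows "\<exists>c::real. c > 0 \<and> (\<forall>n::nat. prob_singular n \<le> exp (- c * real n))"
proof -
  obtain \<theta> n0 where \<theta>: "\<theta> > 0" and big: "\<And>V. finite V ==> n0 \<le> card V ==> Pr (symm V) (\<lambda>s. sing V s) \<le> exp (- \<theta> * real (card V))"
    using singular_rare by blast
  \<comment> \<open>For n below \<open>n0\<close> this gives c n \<le> 2^(-n n), so 1 - c n lies
    above the bound of \<open>prob_singular_less_1\<close> and below e^(-c n).\<close>
  define \<delta> where "\<delta> = 1 / ((real n0 + 1) * 2 ^ (n0 * n0))"
  define c where "c = min \<theta> \<delta>"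
  have c: "c > 0" "c \<le> \<theta>" "c \<le> \<delta>" using \<theta> by (auto simp: c_def \<delta>_def)
  have "prob_singular n \<le> exp (- c * real n)" for n
  proof (cases "n0 \<le> n")
    case True
    have "prob_singular n \<le> exp (- \<theta> * real n)" using big[of "{..<n}"] True by (simp add: prob_singular_eq)
    also have "... \<le> exp (- c * real n)" using c(2) by (simp add: mult_right_mono)
    finally show ?thesis .
  next
    case False
    have "c * real n \<le> \<delta> * (real n0 + 1)" using c False by (intro mult_mono) auto
    also have "... = 1 / 2 ^ (n0 * n0)" by (simp add: \<delta>_def)
    also have "... \<le> 1 / 2 ^ (n * n)" using False by (intro divide_left_mono power_increasing mult_le_mono) auto
    finally have "prob_singular n \<le> 1 + (- c * real n)" using prob_singular_less_1[of n] by simp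
    also have "... \<le> exp (- c * real n)" by (rule exp_ge_add_one_self)
    finally show ?thesis .
  qed
  then show ?thesis using c(1) by blast
qed

end
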